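(* Let $d\in\mathbb{N}$ and let $(K,K')$ be a pair of bunched holomorphic Cantor sets in $\mathbb{C}^d\cong\mathbb{R}^{2d}$, with corresponding family $\mathcal{R}^*$ of renormalization operators acting on $\mathcal{Q}^{\mathrm{Hol}}_{\mathrm{Aff}}$. Assume that there exists a bounded (i.e. relatively compact) open set $\mathcal{U}\subset\mathcal{Q}^{\mathrm{Hol}}_{\mathrm{Aff}}$ satisfying the covering condition $$\overline{\mathcal{U}}\subset\bigcup_{\Psi\in\mathcal{R}^*}\Psi^{-1}(\mathcal{U}).$$ Then for every relative configuration $[h,h']\in\Phi_q(\mathcal{U})$ the Cantor sets $h(K)$ and $h'(K')$ have stable intersection, i.e. $[h,h']$ is stably intersecting in the holomorphic sense. In particular, if $[\mathrm{Id}|_{G(a)},\mathrm{Id}|_{G'(a')}]\in\Phi_q(\mathcal{U})$ for some letters $a\in\mathfrak{A}$, $a'\in\mathfrak{A}'$, then $K$ and $K'$ have stable intersection in the space of bunched holomorphic Cantor sets.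
   Context: Fix $\alpha\in(0,1)$. For a linear map $A$, $\|A\|_{op}=\sup_{|v|=1}|Av|$, $m(A)=\inf_{|v|=1}|Av|$. $\mathrm{GL}(d,\mathbb{C})\subset\mathrm{GL}(2d,\mathbb{R})$, and $\mathrm{Aff}(d,\mathbb{C})\subset\mathrm{Aff}(2d,\mathbb{R})$ is the group of invertible complex affine maps of $\mathbb{C}^d$. Regular Cantor sets. A ($\mathcal{C}^{1+\alpha}$) regular Cantor set $K$ in $\mathbb{R}^{2d}$ is given by: a finite alphabet $\mathfrak{A}$ and a set $\mathfrak{B}\subset\mathfrak{A}\times\mathfrak{A}$ of admissible pairs; pairwise disjoint compact connected sets $G(a)\subset\mathbb{R}^{2d}$, $a\in\mathfrak{A}$; a $\mathcal{C}^{1+\alpha}$ map $g:V\to\mathbb{R}^{2d}$ on an open neighborhood $V$ of $\bigsqcup_a G(a)$ such that $(a,b)\in\mathfrak{B}$ implies $G(b)\subset g(G(a))$ and otherwise $G(b)\cap g(G(a))=\emptyset$; each $g|_{G(a)}$ extends to a $\mathcal{C}^{1+\alpha}$ embedding (with $\mathcal{C}^{1+\alpha}$ inverse) of an open neighborhood of $G(a)$; there is $\mu\in(0,1)$ with $m(Dg(x))>\mu^{-1}$ on $V$; the one-sided subshift $\Sigma$ of admissible sequences $(a_0,a_1,\dots)$, $(a_i,a_{i+1})\in\mathfrak{B}$, is topologically mixing under the shift. Then $K=\bigcap_{n\ge0}g^{-n}(\bigsqcup_aG(a))$ and $K(a)=K\cap G(a)$. $K$ is bunched if for some $N\in\mathbb{N}$,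 $\|Dg^N(x)\|_{op}\,m(Dg^N(x))^{-1}\mu^{\alpha N}<1$ for all $x\in K$; it is holomorphic if $Dg(x)\in\mathrm{GL}(d,\mathbb{C})$ for all $x\in K$. Let $G^*(a)$ be the open neighborhood of $G(a)$ of a fixed small radius, to which $g$ extends with the same properties. Objects of $K'$ carry primes. Words and inverse branches. $\Sigma^{\mathrm{fin}}$ is the set of finite admissible words $\underline a=(a_0,\dots,a_n)$; $\Sigma^-$ is the set of admissible left-infinite sequences $\underline\theta=(\dots,\theta_{-1},\theta_0)$, with its product topology; $\underline\theta_n=(\theta_{-n},\dots,\theta_0)$; if $\theta_0=a_0$, $\underline{\theta a}=(\dots,\theta_{-1},a_0,\dots,a_n)$. For $(a,b)\in\mathfrak{B}$, $f_{(a,b)}=(g|_{G^*(a)})^{-1}$ restricted to $G^*(b)$, and $f_{\underline a}=f_{(a_0,a_1)}\circ\cdots\circ f_{(a_{n-1},a_n)}$, defined on $G^*(a_n)$. Limit geometries. Fix base points $c(a)\in K(a)$. Let $A_{\underline\theta_n}$ be the affine map with $A_{\underline\theta_n}(c(\theta_0))=f_{\underline\theta_n}(c(\theta_0))$ and linear part $Df_{\underline\theta_n}(c(\theta_0))$; it is in $\mathrm{Aff}(d,\mathbb{C})$. The maps $k_n^{\underline\theta}=A_{\underline\theta_n}^{-1}\circ f_{\underline\theta_n}:G^*(\theta_0)\to\mathbb{R}^{2d}$ converge in $\mathcal{C}^{1+\alpha}$ to an embedding $k^{\underline\theta}$ (limit geometry), and for $\theta_0=a_0$ the map $F^{\underline{\theta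 a}}=k^{\underline\theta}\circ f_{\underline a}\circ(k^{\underline{\theta a}})^{-1}$ is (the restriction of) an element of $\mathrm{Aff}(d,\mathbb{C})$. Configurations. $\mathcal{P}^{\mathrm{Hol}}(a)$ is the space of $\mathcal{C}^{1+\alpha}$ diffeomorphisms $h:G(a)\to h(G(a))\subset\mathbb{R}^{2d}$ with $Dh(x)\in\mathrm{GL}(d,\mathbb{C})$ for all $x\in K(a)$, with the $\mathcal{C}^{1+\alpha}$ topology; $\mathcal{P}^{\mathrm{Hol}}=\bigcup_a\mathcal{P}^{\mathrm{Hol}}(a)$. $\mathcal{Q}^{\mathrm{Hol}}$ is the quotient of $\mathcal{P}^{\mathrm{Hol}}\times\mathcal{P}'^{\mathrm{Hol}}$ by the action $(h,h')\mapsto(A\circ h,A\circ h')$ of $\mathrm{Aff}(d,\mathbb{C})$; the class of $(h,h')$ is $[h,h']$ (a relative configuration). $\mathcal{Q}^{\mathrm{Hol}}_{\mathrm{Aff}}=\mathrm{Aff}(d,\mathbb{C})\times\Sigma^-\times\Sigma'^-$ and $\Phi_q:\mathcal{Q}^{\mathrm{Hol}}_{\mathrm{Aff}}\to\mathcal{Q}^{\mathrm{Hol}}$, $\Phi_q(B,\underline\theta,\underline\theta')=[k^{\underline\theta},B\circ k'^{\underline\theta'}]$. Renormalization operators. $\mathcal{R}^*$ is the family of operators $T^*_{\underline a,\underline a'}$, where $\underline a\in\Sigma^{\mathrm{fin}}\cup\{\emptyset\}$, $\underline a'\in\Sigma'^{\mathrm{fin}}\cup\{\emptyset\}$, not both void,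 acting on those $(B,\underline\theta,\underline\theta')$ with $\theta_0=a_0$, $\theta'_0=a'_0$ (no condition for a void word) by $$T^*_{\underline a,\underline a'}(B,\underline\theta,\underline\theta')=\big((F^{\underline{\theta a}})^{-1}\circ B\circ F'^{\underline{\theta}'\underline{a}'},\ \underline{\theta a},\ \underline{\theta}'\underline{a}'\big),$$ where for a void word the corresponding $F$ is the identity and the sequence is unchanged. $\Psi^{-1}$ denotes preimage. Topology and stability. Two $\mathcal{C}^r$ diffeomorphisms $f_1,f_2$ between open subsets of $\mathbb{R}^{2d}$ are $\mathcal{C}^r$-close if there is a diffeomorphism $\phi:\mathrm{Dom}(f_1)\to\mathrm{Dom}(f_2)$ $\mathcal{C}^r$-close to the identity with $f_2\circ\phi$ $\mathcal{C}^r$-close to $f_1$. A bunched holomorphic Cantor set $\tilde K$ with the same symbolic type is close to $K$ if $\tilde g|_{\tilde G^*(a)}$ is $\mathcal{C}^{1+\alpha}$-close to $g|_{G^*(a)}$ for every $a$. A pair $(h,h')\in\mathcal{P}^{\mathrm{Hol}}(a)\times\mathcal{P}'^{\mathrm{Hol}}(a')$ (or its class) is stably intersecting in the holomorphic sense if $\tilde h(\tilde K(a))\cap\tilde h'(\tilde K'(a'))\neq\emptyset$ for all pairs $(\tilde K,\tilde K')$ of bunched holomorphic Cantor sets sufficiently close to $(K,K')$ and all $\tilde h\in\tilde{\mathcal{P}}^{\mathrm{Hol}}(a)$, $\tilde h'\in\tilde{\mathcal{P}}'^{\mathrm{Hol}}(a')$ sufficiently $\mathcal{C}^{1+\alpha}$-close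 to $h,h'$ on the common domains. $K,K'$ have stable intersection in the space of bunched holomorphic Cantor sets if $\tilde K\cap\tilde K'\ne\emptyset$ for all such $(\tilde K,\tilde K')$ sufficiently close to $(K,K')$. *)

theory Defs
  imports "HOL-Analysis.Analysis"
begin

section \<open>Derivatives, conorm and maps of class C\<open>\<^sup>1\<^sup>+\<^sup>\<alpha>\<close>\<close>

text \<open>
  The ambient space is \<open>complex ^ 'd\<close>; as a real normed space it is Euclidean
  space of dimension \<open>2 * CARD('d)\<close>.  All derivatives are real Frechet derivatives; as bounded
  linear functions their norm is the operator norm.
\<close>

definition Der :: "('v::euclidean_space \<Rightarrow> 'v) \<Rightarrow> 'v \<Rightarrow> ('v \<Rightarrow>\<^sub>L 'v)" where
  "Der f x = Blinfun (frechet_derivative f (at x))"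

definition conorm :: "('v::euclidean_space \<Rightarrow>\<^sub>L 'v) \<Rightarrow> real" where
  "conorm A = (INF v\<in>{v. norm v = 1}. norm (blinfun_apply A v))"

definition GLC :: "((complex ^ 'd::finite) \<Rightarrow>\<^sub>L (complex ^ 'd)) set" where
  "GLC = {A. \<exists>M :: complex ^ 'd ^ 'd. invertible M \<and> (\<forall>v. blinfun_apply A v = M *v v)}"

definition C1a :: "real \<Rightarrow> ('v::euclidean_space \<Rightarrow> 'v) \<Rightarrow> 'v set \<Rightarrow> bool" where
  "C1a \<alpha> f U \<longleftrightarrow> open U \<and> (\<forall>x\<in>U. f differentiable (at x)) \<and>
     (\<exists>C. \<forall>x\<in>U. \<forall>y\<in>U. norm (Der f x - Der f y) \<le> C * dist x y powr \<alpha>)"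

definition C1a_diffeo :: "real \<Rightarrow> ('v::euclidean_space \<Rightarrow> 'v) \<Rightarrow> 'v set \<Rightarrow> bool" where
  "C1a_diffeo \<alpha> f U \<longleftrightarrow> C1a \<alpha> f U \<and> inj_on f U \<and> C1a \<alpha> (inv_into U f) (f ` U)"

definition C1a_near ::
    "real \<Rightarrow> real \<Rightarrow> 'v set \<Rightarrow> ('v::euclidean_space \<Rightarrow> 'v) \<Rightarrow> ('v \<Rightarrow> 'v) \<Rightarrow> bool" where
  "C1a_near \<alpha> \<epsilon> U f h \<longleftrightarrow>
     (\<forall>x\<in>U. norm (f x - h x) \<le> \<epsilon> \<and> norm (Der f x - Der h x) \<le> \<epsilon>) \<and>
     (\<forall>x\<in>U. \<forall>y\<in>U. norm ((Der f x - Der h x) - (Der f y - Der h y)) \<le> \<epsilon> * dist x y powr \<alpha>)"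

text \<open>Closeness of diffeomorphisms \<open>f1\<close> and \<open>f2\<close> whose open domains \<open>U1\<close> and \<open>U2\<close> may differ.\<close>

definition C1a_close :: "real \<Rightarrow> real \<Rightarrow> ('v::euclidean_space \<Rightarrow> 'v) \<Rightarrow> 'v set
    \<Rightarrow> ('v \<Rightarrow> 'v) \<Rightarrow> 'v set \<Rightarrow> bool" where
  "C1a_close \<alpha> \<epsilon> f1 U1 f2 U2 \<longleftrightarrow> C1a_diffeo \<alpha> f1 U1 \<and> C1a_diffeo \<alpha> f2 U2 \<and>
     (\<exists>\<phi>. C1a_diffeo \<alpha> \<phi> U1 \<and> \<phi> ` U1 = U2 \<and>
          C1a_near \<alpha> \<epsilon> U1 \<phi> (\<lambda>x. x) \<and> C1a_near \<alpha> \<epsilon> U1 (f2 \<circ> \<phi>) f1)"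


section \<open>Regular Cantor sets\<close>

text \<open>
  The alphabet is the finite type \<open>'a\<close>.  The map \<open>expmap\<close> is relevant only on \<open>nbhd\<close>; \<open>rad\<close> is
  the radius of the neighbourhoods \<open>G\<^sup>*(a)\<close>.
\<close>

record ('a, 'd) cantor =
  adm :: "('a \<times> 'a) set"
  piece :: "'a \<Rightarrow> (complex ^ 'd) set"
  nbhd :: "(complex ^ 'd) set"
  expmap :: "complex ^ 'd \<Rightarrow> complex ^ 'd"
  contr :: real
  rad :: real

definition topologically_mixing :: "'x topology \<Rightarrow> ('x \<Rightarrow> 'x) \<Rightarrow> bool" where
  "topologically_mixing X T \<longleftrightarrow>
     (\<forall>U V. openin X U \<and> openin X V \<and> U \<noteq> {} \<and> V \<noteq> {} \<longrightarrow>
        (\<exists>N. \<forall>n\<ge>N. (T ^^ n) ` U \<inter> V \<noteq> {}))"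

definition Sigma_top :: "('a::finite, 'd::finite) cantor \<Rightarrow> (nat \<Rightarrow> 'a) topology" where
  "Sigma_top K = subtopology (product_topology (\<lambda>_. discrete_topology UNIV) UNIV)
     {s. \<forall>i. (s i, s (Suc i)) \<in> adm K}"

definition cantor_set :: "('a::finite, 'd::finite) cantor \<Rightarrow> (complex ^ 'd) set" where
  "cantor_set K = (\<Inter>n. (expmap K ^^ n) -` (\<Union>a. piece K a))"

definition cantor_piece :: "('a::finite, 'd::finite) cantor \<Rightarrow> 'a \<Rightarrow> (complex ^ 'd) set" where
  "cantor_piece K a = cantor_set K \<inter> piece K a"

definition regular_cantor :: "real \<Rightarrow> ('a::finite, 'd::finite) cantor \<Rightarrow> bool" where
  "regular_cantor \<alpha> K \<longleftrightarrow>
     (\<forall>a. compact (piece K a) \<and> connected (piece K a)) \<and>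
     (\<forall>a b. a \<noteq> b \<longrightarrow> piece K a \<inter> piece K b = {}) \<and>
     open (nbhd K) \<and> (\<forall>a. piece K a \<subseteq> nbhd K) \<and>
     C1a \<alpha> (expmap K) (nbhd K) \<and>
     (\<forall>a b. if (a, b) \<in> adm K then piece K b \<subseteq> expmap K ` piece K a
            else piece K b \<inter> expmap K ` piece K a = {}) \<and>
     (\<forall>a. \<exists>W h. open W \<and> piece K a \<subseteq> W \<and> C1a_diffeo \<alpha> h W \<and>
            (\<forall>x\<in>piece K a. h x = expmap K x)) \<and>
     0 < contr K \<and> contr K < 1 \<and>
     (\<forall>x\<in>nbhd K. conorm (Der (expmap K) x) > inverse (contr K)) \<and>
     topologically_mixing (Sigma_top K) (\<lambda>s i. s (Suc i))"

definition Gstar :: "('a::finite, 'd::finite) cantor \<Rightarrow> 'a \<Rightarrow> (complex ^ 'd) set" where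
  "Gstar K a = (\<Union>x\<in>piece K a. ball x (rad K))"

text \<open>The radius is small enough for the pieces \<open>G\<^sup>*(a)\<close> to inherit the properties of the \<open>G(a)\<close>.\<close>

definition admissible_radius :: "real \<Rightarrow> ('a::finite, 'd::finite) cantor \<Rightarrow> bool" where
  "admissible_radius \<alpha> K \<longleftrightarrow> 0 < rad K \<and>
     (\<forall>a. Gstar K a \<subseteq> nbhd K \<and> C1a_diffeo \<alpha> (expmap K) (Gstar K a)) \<and>
     (\<forall>a b. a \<noteq> b \<longrightarrow> Gstar K a \<inter> Gstar K b = {}) \<and>
     (\<forall>a b. if (a, b) \<in> adm K then Gstar K b \<subseteq> expmap K ` Gstar K a
            else Gstar K b \<inter> expmap K ` Gstar K a = {})"

definition bunched :: "real \<Rightarrow> ('a::finite, 'd::finite) cantor \<Rightarrow> bool" where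
  "bunched \<alpha> K \<longleftrightarrow> (\<exists>N::nat. \<forall>x\<in>cantor_set K.
     norm (Der (expmap K ^^ N) x) * inverse (conorm (Der (expmap K ^^ N) x))
       * contr K powr (\<alpha> * real N) < 1)"

definition holomorphic_cantor :: "('a::finite, 'd::finite) cantor \<Rightarrow> bool" where
  "holomorphic_cantor K \<longleftrightarrow> (\<forall>x\<in>cantor_set K. Der (expmap K) x \<in> GLC)"

definition bunched_holomorphic_cantor :: "real \<Rightarrow> ('a::finite, 'd::finite) cantor \<Rightarrow> bool" where
  "bunched_holomorphic_cantor \<alpha> K \<longleftrightarrow>
     regular_cantor \<alpha> K \<and> admissible_radius \<alpha> K \<and> bunched \<alpha> K \<and> holomorphic_cantor K"


section \<open>Words and inverse branches\<close>

text \<open>A word is a list of letters; the empty list is the void word.\<close>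

definition admissible_word :: "('a::finite, 'd::finite) cantor \<Rightarrow> 'a list \<Rightarrow> bool" where
  "admissible_word K w \<longleftrightarrow> successively (\<lambda>a b. (a, b) \<in> adm K) w"

text \<open>A left-infinite sequence is stored as \<open>\<theta> :: nat \<Rightarrow> 'a\<close>, where \<open>\<theta> i\<close> is the letter at position \<open>-i\<close>.\<close>

definition SigmaM_top :: "('a::finite, 'd::finite) cantor \<Rightarrow> (nat \<Rightarrow> 'a) topology" where
  "SigmaM_top K = subtopology (product_topology (\<lambda>_. discrete_topology UNIV) UNIV)
     {\<theta>. \<forall>i. (\<theta> (Suc i), \<theta> i) \<in> adm K}"

definition trunc :: "(nat \<Rightarrow> 'a) \<Rightarrow> nat \<Rightarrow> 'a list" where
  "trunc \<theta> n = map \<theta> (rev [0..<Suc n])"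

text \<open>
  The concatenation of \<open>\<theta>\<close> with a word whose first letter is \<open>\<theta> 0\<close>: that letter is shared and
  not repeated.  Concatenation with the void word is \<open>\<theta>\<close>.
\<close>

definition extend :: "(nat \<Rightarrow> 'a) \<Rightarrow> 'a list \<Rightarrow> nat \<Rightarrow> 'a" where
  "extend \<theta> w i = (if i < length w then rev w ! i else \<theta> (i - (length w - 1)))"

fun inv_branch :: "('a::finite, 'd::finite) cantor \<Rightarrow> 'a list \<Rightarrow> complex ^ 'd \<Rightarrow> complex ^ 'd" where
  "inv_branch K (a # b # w) = inv_into (Gstar K a) (expmap K) \<circ> inv_branch K (b # w)"
| "inv_branch K [a] = (\<lambda>x. x)"
| "inv_branch K [] = (\<lambda>x. x)"


section \<open>The complex affine group\<close>

text \<open>The pair \<open>(M, t)\<close> encodes the map sending \<open>x\<close> to \<open>M *v x + t\<close>.\<close>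

type_synonym 'd aff = "(complex ^ 'd ^ 'd) \<times> (complex ^ 'd)"

definition aff_app :: "'d::finite aff \<Rightarrow> complex ^ 'd \<Rightarrow> complex ^ 'd" where
  "aff_app A x = fst A *v x + snd A"

definition Aff :: "'d::finite aff set" where
  "Aff = {A. invertible (fst A)}"

definition aff_comp :: "'d::finite aff \<Rightarrow> 'd aff \<Rightarrow> 'd aff" where
  "aff_comp A B = (fst A ** fst B, fst A *v snd B + snd A)"

definition aff_inv :: "'d::finite aff \<Rightarrow> 'd aff" where
  "aff_inv A = (matrix_inv (fst A), - (matrix_inv (fst A) *v snd A))"

lemma aff_app_comp: "aff_app (aff_comp A B) = aff_app A \<circ> aff_app B"
  by (rule ext) (simp add: aff_app_def aff_comp_def matrix_vector_mul_assoc
      matrix_vector_right_distrib add.assoc)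

lemma matrix_inv_both:
  fixes M :: "'k::semiring_1 ^ 'n::finite ^ 'n"
  assumes "invertible M"
  shows "M ** matrix_inv M = mat 1" and "matrix_inv M ** M = mat 1"
  using someI_ex[OF assms[unfolded invertible_def]] unfolding matrix_inv_def by auto

lemma aff_app_inv_right: "A \<in> Aff \<Longrightarrow> aff_app A (aff_app (aff_inv A) x) = x"
  by (simp add: aff_app_def aff_inv_def Aff_def matrix_vector_mul_assoc
      matrix_vector_mult_diff_distrib matrix_inv_both)

lemma aff_app_inv_left: "A \<in> Aff \<Longrightarrow> aff_app (aff_inv A) (aff_app A x) = x"
  by (simp add: aff_app_def aff_inv_def Aff_def matrix_vector_mul_assoc
      matrix_vector_right_distrib matrix_inv_both)


section \<open>Limit geometries\<close>

definition base_affine :: "('a::finite, 'd::finite) cantor \<Rightarrow> ('a \<Rightarrow> complex ^ 'd)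
    \<Rightarrow> (nat \<Rightarrow> 'a) \<Rightarrow> nat \<Rightarrow> complex ^ 'd \<Rightarrow> complex ^ 'd" where
  "base_affine K c \<theta> n x =
     inv_branch K (trunc \<theta> n) (c (\<theta> 0))
       + blinfun_apply (Der (inv_branch K (trunc \<theta> n)) (c (\<theta> 0))) (x - c (\<theta> 0))"

definition approx_geometry :: "('a::finite, 'd::finite) cantor \<Rightarrow> ('a \<Rightarrow> complex ^ 'd)
    \<Rightarrow> (nat \<Rightarrow> 'a) \<Rightarrow> nat \<Rightarrow> complex ^ 'd \<Rightarrow> complex ^ 'd" where
  "approx_geometry K c \<theta> n = inv (base_affine K c \<theta> n) \<circ> inv_branch K (trunc \<theta> n)"

text \<open>
  On \<open>G\<^sup>*(\<theta>\<^sub>0)\<close> the approximations converge in the C\<open>\<^sup>1\<^sup>+\<^sup>\<alpha>\<close> topology when \<open>K\<close> is bunched, so that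
  the limit is given by its values.
\<close>

definition limit_geometry :: "('a::finite, 'd::finite) cantor \<Rightarrow> ('a \<Rightarrow> complex ^ 'd)
    \<Rightarrow> (nat \<Rightarrow> 'a) \<Rightarrow> complex ^ 'd \<Rightarrow> complex ^ 'd" where
  "limit_geometry K c \<theta> x = lim (\<lambda>n. approx_geometry K c \<theta> n x)"

text \<open>
  The affine map extending \<open>k\<^sup>\<theta> \<circ> f\<^sub>w \<circ> (k\<^sup>\<theta>\<^sup>w)\<^sup>-\<^sup>1\<close>, for a word \<open>w\<close> starting with \<open>\<theta> 0\<close>.  It is unique
  because the limit geometry has open image.  For the void word it is the identity.
\<close>

definition Faff :: "('a::finite, 'd::finite) cantor \<Rightarrow> ('a \<Rightarrow> complex ^ 'd)
    \<Rightarrow> (nat \<Rightarrow> 'a) \<Rightarrow> 'a list \<Rightarrow> 'd aff" where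
  "Faff K c \<theta> w = (if w = [] then (mat 1, 0) else
     (THE A. A \<in> Aff \<and> (\<forall>x\<in>Gstar K (last w).
        aff_app A (limit_geometry K c (extend \<theta> w) x) = limit_geometry K c \<theta> (inv_branch K w x))))"


section \<open>Configurations\<close>

text \<open>
  A C\<open>\<^sup>1\<^sup>+\<^sup>\<alpha>\<close> diffeomorphism on the compact set \<open>G(a)\<close> is one defined on some open neighbourhood
  of it.  As elements of \<open>P(a)\<close>, two such maps are the same if their values and
  derivatives agree on \<open>G(a)\<close>; agreement of values suffices when \<open>G(a)\<close> is the closure of its interior,
  but \<open>G(a)\<close> may have empty interior.
\<close>

definition PHol :: "real \<Rightarrow> ('a::finite, 'd::finite) cantor \<Rightarrow> 'a \<Rightarrow> (complex ^ 'd \<Rightarrow> complex ^ 'd) set" where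
  "PHol \<alpha> K a = {h. (\<exists>W. open W \<and> piece K a \<subseteq> W \<and> C1a_diffeo \<alpha> h W) \<and>
                     (\<forall>x\<in>cantor_piece K a. Der h x \<in> GLC)}"

definition agree_on :: "'v set \<Rightarrow> ('v::euclidean_space \<Rightarrow> 'v) \<Rightarrow> ('v \<Rightarrow> 'v) \<Rightarrow> bool" where
  "agree_on S f h \<longleftrightarrow> (\<forall>x\<in>S. f x = h x \<and> Der f x = Der h x)"

text \<open>Elements of \<open>P\<close> are tagged by the letter that determines their domain.\<close>

type_synonym ('a, 'd) config = "'a \<times> (complex ^ 'd \<Rightarrow> complex ^ 'd)"

definition orbit_rel :: "real \<Rightarrow> ('a::finite, 'd::finite) cantor \<Rightarrow> ('b::finite, 'd) cantor \<Rightarrow>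
    ((('a, 'd) config \<times> ('b, 'd) config) \<times> (('a, 'd) config \<times> ('b, 'd) config)) set" where
  "orbit_rel \<alpha> K K' = {(((a, h), (a', h')), ((b, k), (b', k'))).
     a = b \<and> a' = b' \<and> {h, k} \<subseteq> PHol \<alpha> K a \<and> {h', k'} \<subseteq> PHol \<alpha> K' a' \<and>
     (\<exists>A\<in>Aff. agree_on (piece K a) k (aff_app A \<circ> h) \<and> agree_on (piece K' a') k' (aff_app A \<circ> h'))}"

definition rel_config :: "real \<Rightarrow> ('a::finite, 'd::finite) cantor \<Rightarrow> ('b::finite, 'd) cantor \<Rightarrow>
    ('a, 'd) config \<Rightarrow> ('b, 'd) config \<Rightarrow> (('a, 'd) config \<times> ('b, 'd) config) set" where
  "rel_config \<alpha> K K' p p' = orbit_rel \<alpha> K K' `` {(p, p')}"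

type_synonym ('a, 'b, 'd) affconf = "'d aff \<times> (nat \<Rightarrow> 'a) \<times> (nat \<Rightarrow> 'b)"

definition QAff_top :: "('a::finite, 'd::finite) cantor \<Rightarrow> ('b::finite, 'd) cantor
    \<Rightarrow> ('a, 'b, 'd) affconf topology" where
  "QAff_top K K' = prod_topology (subtopology euclidean Aff)
     (prod_topology (SigmaM_top K) (SigmaM_top K'))"

definition Phi_q :: "real \<Rightarrow> ('a::finite, 'd::finite) cantor \<Rightarrow> ('a \<Rightarrow> complex ^ 'd) \<Rightarrow>
    ('b::finite, 'd) cantor \<Rightarrow> ('b \<Rightarrow> complex ^ 'd) \<Rightarrow>
    ('a, 'b, 'd) affconf \<Rightarrow> (('a, 'd) config \<times> ('b, 'd) config) set" where
  "Phi_q \<alpha> K c K' c' = (\<lambda>(B, \<theta>, \<theta>').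
     rel_config \<alpha> K K' (\<theta> 0, limit_geometry K c \<theta>)
                        (\<theta>' 0, aff_app B \<circ> limit_geometry K' c' \<theta>'))"


section \<open>Renormalization operators\<close>

text \<open>
  A nonvoid word contains at least one transition: a one-letter word has the identity as its
  inverse branch, and two such words would make the identity a renormalization operator.
\<close>

definition renorm_words :: "('a::finite, 'd::finite) cantor \<Rightarrow> 'a list set" where
  "renorm_words K = insert [] {w. 2 \<le> length w \<and> admissible_word K w}"

definition renorm :: "('a::finite, 'd::finite) cantor \<Rightarrow> ('a \<Rightarrow> complex ^ 'd) \<Rightarrow>
    ('b::finite, 'd) cantor \<Rightarrow> ('b \<Rightarrow> complex ^ 'd) \<Rightarrow> 'a list \<Rightarrow> 'b list \<Rightarrow>
    ('a, 'b, 'd) affconf \<Rightarrow> ('a, 'b, 'd) affconf" where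
  "renorm K c K' c' w w' = (\<lambda>(B, \<theta>, \<theta>').
     (aff_comp (aff_inv (Faff K c \<theta> w)) (aff_comp B (Faff K' c' \<theta>' w')),
      extend \<theta> w, extend \<theta>' w'))"

definition renorm_dom :: "('a::finite, 'd::finite) cantor \<Rightarrow> ('b::finite, 'd) cantor \<Rightarrow>
    'a list \<Rightarrow> 'b list \<Rightarrow> ('a, 'b, 'd) affconf set" where
  "renorm_dom K K' w w' = {(B, \<theta>, \<theta>'). (B, \<theta>, \<theta>') \<in> topspace (QAff_top K K') \<and>
     (w \<noteq> [] \<longrightarrow> \<theta> 0 = hd w) \<and> (w' \<noteq> [] \<longrightarrow> \<theta>' 0 = hd w')}"

text \<open>The family of renormalization operators, each a partial map given with its domain.\<close>

definition renorm_ops :: "('a::finite, 'd::finite) cantor \<Rightarrow> ('a \<Rightarrow> complex ^ 'd) \<Rightarrow>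
    ('b::finite, 'd) cantor \<Rightarrow> ('b \<Rightarrow> complex ^ 'd) \<Rightarrow>
    (('a, 'b, 'd) affconf set \<times> (('a, 'b, 'd) affconf \<Rightarrow> ('a, 'b, 'd) affconf)) set" where
  "renorm_ops K c K' c' = {(renorm_dom K K' w w', renorm K c K' c' w w') | w w'.
     w \<in> renorm_words K \<and> w' \<in> renorm_words K' \<and> \<not> (w = [] \<and> w' = [])}"

definition partial_preimage :: "'x set \<times> ('x \<Rightarrow> 'y) \<Rightarrow> 'y set \<Rightarrow> 'x set" where
  "partial_preimage \<Psi> U = {x \<in> fst \<Psi>. snd \<Psi> x \<in> U}"


section \<open>Stable intersection\<close>

definition cantor_close :: "real \<Rightarrow> real \<Rightarrow> ('a::finite, 'd::finite) cantor \<Rightarrow> ('a, 'd) cantor \<Rightarrow> bool" where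
  "cantor_close \<alpha> \<epsilon> K L \<longleftrightarrow> adm L = adm K \<and>
     (\<forall>a. C1a_close \<alpha> \<epsilon> (expmap K) (Gstar K a) (expmap L) (Gstar L a))"

text \<open>
  Configurations are compared on arbitrary fixed open neighbourhoods \<open>W\<close>, \<open>W'\<close> of the pieces
  \<open>G(a)\<close>, \<open>G'(a')\<close> on which \<open>h\<close>, \<open>h'\<close> are diffeomorphisms.  Comparing only on the
  intersection of the pieces of the two Cantor sets would not control the perturbed configuration
  on the perturbed Cantor set, which need not lie in that intersection.
\<close>

definition stably_intersecting :: "real \<Rightarrow> ('a::finite, 'd::finite) cantor \<Rightarrow> ('b::finite, 'd) cantor \<Rightarrow>
    ('a, 'd) config \<Rightarrow> ('b, 'd) config \<Rightarrow> bool" where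
  "stably_intersecting \<alpha> K K' = (\<lambda>(a, h) (a', h'). \<forall>W W'.
     piece K a \<subseteq> W \<and> C1a_diffeo \<alpha> h W \<and> piece K' a' \<subseteq> W' \<and> C1a_diffeo \<alpha> h' W' \<longrightarrow>
     (\<exists>\<epsilon>>0. \<forall>L L' k k' Z Z'.
        bunched_holomorphic_cantor \<alpha> L \<and> bunched_holomorphic_cantor \<alpha> L' \<and>
        cantor_close \<alpha> \<epsilon> K L \<and> cantor_close \<alpha> \<epsilon> K' L' \<and>
        k \<in> PHol \<alpha> L a \<and> k' \<in> PHol \<alpha> L' a' \<and>
        C1a_close \<alpha> \<epsilon> h W k Z \<and> C1a_close \<alpha> \<epsilon> h' W' k' Z' \<longrightarrow>
        k ` cantor_piece L a \<inter> k' ` cantor_piece L' a' \<noteq> {}))"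

definition stable_intersection :: "real \<Rightarrow> ('a::finite, 'd::finite) cantor \<Rightarrow> ('b::finite, 'd) cantor \<Rightarrow> bool" where
  "stable_intersection \<alpha> K K' \<longleftrightarrow> (\<exists>\<epsilon>>0. \<forall>L L'.
     bunched_holomorphic_cantor \<alpha> L \<and> bunched_holomorphic_cantor \<alpha> L' \<and>
     cantor_close \<alpha> \<epsilon> K L \<and> cantor_close \<alpha> \<epsilon> K' L' \<longrightarrow>
     cantor_set L \<inter> cantor_set L' \<noteq> {})"

end

theory Submission
  imports Defs
begin

text \<open>
  The covering condition is open.  Since the closure of \<open>U\<close> is compact, finitely many operators
  suffice to send every configuration of \<open>U\<close> back into \<open>U\<close>, and there is a tolerance \<open>\<eta>\<close> such that
  they still do so after the affine maps \<open>F\<close> in their definition are replaced by maps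
  \<open>\<eta>\<close>-close to them (\<open>uniform_robust_steps\<close>).

  Let \<open>k\<close> be an observable close to \<open>h\<close> on a Cantor set \<open>L\<close> close to \<open>K\<close>, where \<open>h\<close> agrees with
  \<open>A \<circ> k\<^sup>\<theta>\<close>.  The place of limit geometries of \<open>L\<close> is taken by the affine one-jets
  \<open>J\<close> of \<open>k \<circ> f\<^sub>w\<close>, where \<open>f\<^sub>w\<close> runs through the inverse branches of \<open>L\<close>, at points of \<open>L\<close> shadowing the
  base points of \<open>K\<close>.  They have to be taken at points of the Cantor set because only there the
  derivatives are complex linear.  The initial jet is close to \<open>A\<close>, and when the branch is lengthened
  by a word \<open>w\<close> the jet changes from \<open>J\<close> to \<open>J\<^sub>1\<close> with \<open>J\<^sup>-\<^sup>1 J\<^sub>1\<close> close to the map \<open>F\<close> of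
  that word for \<open>K\<close>, \<^emph>\<open>uniformly over branches of all lengths\<close> (\<open>jet_system_exists\<close>).

  Hence, with \<open>J'\<close> denoting the jets of the second observable, \<open>J\<^sup>-\<^sup>1 J'\<close> starts in \<open>U\<close> and the
  operators can be applied forever without leaving \<open>U\<close> (\<open>jet_systems_meet\<close>).  The
  configurations \<open>J\<^sup>-\<^sup>1 J'\<close> stay bounded, while the linear part of \<open>J\<close> or of \<open>J'\<close> tends to \<open>0\<close> because
  at least one of the words grows at each step.  So the images of base points under \<open>J\<close> and \<open>J'\<close>,
  which belong to the images of the two perturbed Cantor sets under the observables, come arbitrarily close to each other, and two
  compact sets at distance \<open>0\<close> meet.

  It remains to see why jets follow the affine model uniformly.  Bunching says that the
  Hoelder gain of a long inverse branch beats its condition number, so that its derivative,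
  normalised at the base point, converges geometrically in the length of the branch (\<open>E_bounds\<close>),
  and a smooth observable composed with a long branch is invisible after normalisation
  (\<open>observable_tail\<close>).  Bunching holds with a margin on blocks of bounded length, so the constants
  are the same for all nearby Cantor sets (\<open>family_bunched\<close>).  Therefore long words are determined
  up to a small error by their last letters, and for boundedly many letters the perturbed data
  depend continuously on the perturbation (\<open>Ek_kn_lim\<close>).

  The statement about \<open>K\<close> and \<open>K'\<close> themselves is the case \<open>h = h' = id\<close>, with unperturbed observables.
\<close>

section \<open>Derivatives as bounded linear maps\<close>

lemma Der_works:
  "f differentiable (at x) \<Longrightarrow> (f has_derivative blinfun_apply (Der f x)) (at x)"
  using frechet_derivative_works has_derivative_bounded_linear
  by (fastforce simp: Der_def bounded_linear_Blinfun_apply)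

lemma Der_eq:
  assumes "(f has_derivative blinfun_apply A) (at x)" shows "Der f x = A"
  by (metis Der_def assms blinfun_apply_inverse frechet_derivative_at)

lemma Der_compose:
  assumes "f differentiable (at x)" "g differentiable (at (f x))"
  shows "Der (g \<circ> f) x = Der g (f x) o\<^sub>L Der f x"
  by (rule Der_eq) (use diff_chain_at[OF Der_works[OF assms(1)] Der_works[OF assms(2)]]
      in \<open>simp add: o_def blinfun_compose.rep_eq\<close>)

lemma has_derivative_cong_open:
  assumes "open S" "x \<in> S" "\<And>y. y \<in> S \<Longrightarrow> f y = g y"
    and "(f has_derivative f') (at x)"
  shows "(g has_derivative f') (at x)"
  using has_derivative_transform_within_open[OF assms(4,1,2)] assms(3) by auto

lemma Der_cong:
  assumes "open S" "x \<in> S" "\<And>y. y \<in> S \<Longrightarrow> f y = g y"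
  shows "Der f x = Der g x"
proof -
  have "(f has_derivative D) (at x) \<longleftrightarrow> (g has_derivative D) (at x)" for D
    using has_derivative_cong_open[OF assms(1,2)] assms(3) by metis
  then show ?thesis
    unfolding Der_def frechet_derivative_def by simp
qed

lemma Der_id [simp]: "Der (\<lambda>x. x) x = id_blinfun"
  by (rule Der_eq) (simp add: id_blinfun.rep_eq)

lemma blinfun_compose_assoc: "(A o\<^sub>L B) o\<^sub>L C = A o\<^sub>L (B o\<^sub>L C)"
  by (rule blinfun_eqI) simp

lemma blinfun_compose_id [simp]: "A o\<^sub>L id_blinfun = A" "id_blinfun o\<^sub>L A = A"
  by (auto intro: blinfun_eqI)

lemmas blinfun_compose_diff_left = bounded_bilinear.diff_left[OF bounded_bilinear_blinfun_compose]
lemmas blinfun_compose_diff_right = bounded_bilinear.diff_right[OF bounded_bilinear_blinfun_compose]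

lemma norm_compose_le:
  fixes A :: "'b::real_normed_vector \<Rightarrow>\<^sub>L 'c::real_normed_vector"
    and B :: "'a::real_normed_vector \<Rightarrow>\<^sub>L 'b"
  assumes "norm A \<le> a" "norm B \<le> b" shows "norm (A o\<^sub>L B) \<le> a * b"
  by (rule order_trans[OF norm_blinfun_compose mult_mono[OF assms]])
    (use assms(1) norm_ge_zero order_trans in blast)+

text \<open>
  A relation rather than an inverse operation: for the derivatives of an expanding map and of its
  inverse branches both members of a pair are known, and pairs compose.
\<close>

definition inverse_pair :: "('v::real_normed_vector \<Rightarrow>\<^sub>L 'v) \<Rightarrow> ('v \<Rightarrow>\<^sub>L 'v) \<Rightarrow> bool" where
  "inverse_pair A B \<longleftrightarrow> A o\<^sub>L B = id_blinfun \<and> B o\<^sub>L A = id_blinfun"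

lemma inverse_pair_sym: "inverse_pair A B \<Longrightarrow> inverse_pair B A"
  by (simp add: inverse_pair_def)

lemma inverse_pair_unique: "inverse_pair A B \<Longrightarrow> inverse_pair A C \<Longrightarrow> B = C"
  by (metis blinfun_compose_assoc blinfun_compose_id inverse_pair_def)

lemma inverse_pair_id [simp]: "inverse_pair id_blinfun id_blinfun"
  by (simp add: inverse_pair_def)

lemma inverse_pair_compose:
  assumes "inverse_pair A A'" "inverse_pair B B'"
  shows "inverse_pair (A o\<^sub>L B) (B' o\<^sub>L A')"
  using assms unfolding inverse_pair_def
  by (metis blinfun_compose_assoc blinfun_compose_id(1))

lemma inverse_pair_apply:
  "inverse_pair A B \<Longrightarrow> blinfun_apply A (blinfun_apply B v) = v"
  "inverse_pair A B \<Longrightarrow> blinfun_apply B (blinfun_apply A v) = v"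
  unfolding inverse_pair_def by (metis blinfun_apply_blinfun_compose blinfun_apply_id_blinfun)+

text \<open>The resolvent identity \<open>B - Y = B (X - A) Y\<close>, whose factor \<open>B\<close> is first bounded by absorption.\<close>

lemma inverse_pair_perturb:
  fixes A B X Y :: "'v::real_normed_vector \<Rightarrow>\<^sub>L 'v"
  assumes "inverse_pair A B" "inverse_pair X Y" "norm (A - X) * norm Y \<le> 1/2"
  shows "norm B \<le> 2 * norm Y" "norm (B - Y) \<le> 2 * (norm Y)\<^sup>2 * norm (A - X)"
proof -
  have "B - Y = B o\<^sub>L ((X - A) o\<^sub>L Y)"
    using assms(1,2) unfolding inverse_pair_def blinfun_compose_diff_left blinfun_compose_diff_right
    by (metis blinfun_compose_assoc blinfun_compose_id)
  then have *: "norm (B - Y) \<le> norm B * (norm (A - X) * norm Y)"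
    by (metis norm_compose_le norm_minus_commute order_refl)
  also have "\<dots> \<le> norm B * (1/2)"
    using assms(3) by (intro mult_left_mono) auto
  finally show B: "norm B \<le> 2 * norm Y"
    using norm_triangle_sub[of B Y] by simp
  have "norm B * (norm (A - X) * norm Y) \<le> 2 * norm Y * (norm (A - X) * norm Y)"
    using B by (intro mult_right_mono) auto
  then show "norm (B - Y) \<le> 2 * (norm Y)\<^sup>2 * norm (A - X)"
    using * by (simp add: power2_eq_square algebra_simps)
qed

lemma inverse_pair_tendsto:
  fixes A B X Y :: "'t \<Rightarrow> ('v::real_normed_vector \<Rightarrow>\<^sub>L 'v)"
  assumes "\<forall>\<^sub>F t in F. inverse_pair (A t) (B t)" "\<forall>\<^sub>F t in F. inverse_pair (X t) (Y t)"
    and "\<forall>\<^sub>F t in F. norm (Y t) \<le> C" and lim: "((\<lambda>t. A t - X t) \<longlongrightarrow> 0) F"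
  shows "((\<lambda>t. B t - Y t) \<longlongrightarrow> 0) F"
proof (rule Lim_null_comparison)
  have "((\<lambda>t. norm (A t - X t) * \<bar>C\<bar>) \<longlongrightarrow> 0) F"
    using tendsto_mult_left_zero[OF tendsto_norm_zero[OF lim]] by blast
  then have "\<forall>\<^sub>F t in F. norm (A t - X t) * \<bar>C\<bar> < 1/2"
    by (rule order_tendstoD) auto
  then show "\<forall>\<^sub>F t in F. norm (B t - Y t) \<le> 2 * \<bar>C\<bar>\<^sup>2 * norm (A t - X t)"
    using assms(1-3)
  proof eventually_elim
    case (elim t)
    have Y: "norm (Y t) \<le> \<bar>C\<bar>" using elim by simp
    have "norm (A t - X t) * norm (Y t) \<le> norm (A t - X t) * \<bar>C\<bar>"
      by (rule mult_left_mono[OF Y]) simp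
    then have "norm (B t - Y t) \<le> 2 * (norm (Y t))\<^sup>2 * norm (A t - X t)"
      using inverse_pair_perturb(2)[OF elim(2,3)] elim(1) by simp
    also have "\<dots> \<le> 2 * \<bar>C\<bar>\<^sup>2 * norm (A t - X t)"
      by (intro mult_right_mono mult_left_mono power_mono Y) auto
    finally show ?case .
  qed
  show "((\<lambda>t. 2 * \<bar>C\<bar>\<^sup>2 * norm (A t - X t)) \<longlongrightarrow> 0) F"
    using tendsto_mult_right_zero[OF tendsto_norm_zero[OF lim]] by blast
qed

lemma tendsto_compose_diff:
  fixes A X :: "'t \<Rightarrow> ('b::real_normed_vector \<Rightarrow>\<^sub>L 'c::real_normed_vector)"
    and B Y :: "'t \<Rightarrow> ('a::real_normed_vector \<Rightarrow>\<^sub>L 'b)"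
  assumes A: "((\<lambda>t. A t - X t) \<longlongrightarrow> 0) F" and B: "((\<lambda>t. B t - Y t) \<longlongrightarrow> 0) F"
    and "\<forall>\<^sub>F t in F. norm (X t) \<le> a" "\<forall>\<^sub>F t in F. norm (Y t) \<le> b"
  shows "((\<lambda>t. (A t o\<^sub>L B t) - (X t o\<^sub>L Y t)) \<longlongrightarrow> 0) F"
proof (rule Lim_null_comparison)
  show "\<forall>\<^sub>F t in F. norm ((A t o\<^sub>L B t) - (X t o\<^sub>L Y t)) \<le>
      norm (A t - X t) * norm (B t - Y t) + norm (A t - X t) * \<bar>b\<bar> + \<bar>a\<bar> * norm (B t - Y t)"
    using assms(3,4)
  proof eventually_elim
    case (elim t)
    have "(A t o\<^sub>L B t) - (X t o\<^sub>L Y t) =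
        ((A t - X t) o\<^sub>L (B t - Y t)) + ((A t - X t) o\<^sub>L Y t) + (X t o\<^sub>L (B t - Y t))"
      by (simp add: blinfun_compose_diff_left blinfun_compose_diff_right)
    also have "norm \<dots> \<le> norm (A t - X t) * norm (B t - Y t) + norm (A t - X t) * \<bar>b\<bar> + \<bar>a\<bar> * norm (B t - Y t)"
      by (intro order_trans[OF norm_triangle_ineq] add_mono norm_compose_le) (use elim in auto)
    finally show ?case .
  qed
  have "((\<lambda>t. norm (A t - X t) * norm (B t - Y t) + norm (A t - X t) * \<bar>b\<bar> + \<bar>a\<bar> * norm (B t - Y t))
      \<longlongrightarrow> 0 * 0 + 0 * \<bar>b\<bar> + \<bar>a\<bar> * 0) F"
    by (intro tendsto_intros tendsto_norm_zero A B)
  then show "((\<lambda>t. norm (A t - X t) * norm (B t - Y t) + norm (A t - X t) * \<bar>b\<bar> + \<bar>a\<bar> * norm (B t - Y t))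
      \<longlongrightarrow> 0) F" by simp
qed

lemma tendsto_apply_diff:
  fixes A X :: "'t \<Rightarrow> ('b::real_normed_vector \<Rightarrow>\<^sub>L 'c::real_normed_vector)"
    and u v :: "'t \<Rightarrow> 'b"
  assumes A: "((\<lambda>t. A t - X t) \<longlongrightarrow> 0) F" and B: "((\<lambda>t. u t - v t) \<longlongrightarrow> 0) F"
    and "\<forall>\<^sub>F t in F. norm (X t) \<le> a" "\<forall>\<^sub>F t in F. norm (v t) \<le> b"
  shows "((\<lambda>t. blinfun_apply (A t) (u t) - blinfun_apply (X t) (v t)) \<longlongrightarrow> 0) F"
proof (rule Lim_null_comparison)
  show "\<forall>\<^sub>F t in F. norm (blinfun_apply (A t) (u t) - blinfun_apply (X t) (v t)) \<le>
      norm (A t - X t) * norm (u t - v t) + norm (A t - X t) * \<bar>b\<bar> + \<bar>a\<bar> * norm (u t - v t)"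
    using assms(3,4)
  proof eventually_elim
    case (elim t)
    have *: "norm (blinfun_apply T w) \<le> p * q" if "norm T \<le> p" "norm w \<le> q"
      for T :: "'b \<Rightarrow>\<^sub>L 'c" and w p q
      by (rule order_trans[OF norm_blinfun mult_mono[OF that]])
        (use that(1) norm_ge_zero order_trans in blast)+
    have "blinfun_apply (A t) (u t) - blinfun_apply (X t) (v t) =
        blinfun_apply (A t - X t) (u t - v t) + blinfun_apply (A t - X t) (v t)
        + blinfun_apply (X t) (u t - v t)"
      by (simp add: blinfun.bilinear_simps)
    also have "norm \<dots> \<le> norm (A t - X t) * norm (u t - v t) + norm (A t - X t) * \<bar>b\<bar> + \<bar>a\<bar> * norm (u t - v t)"
      by (intro order_trans[OF norm_triangle_ineq] add_mono *) (use elim in auto)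
    finally show ?case .
  qed
  have "((\<lambda>t. norm (A t - X t) * norm (u t - v t) + norm (A t - X t) * \<bar>b\<bar> + \<bar>a\<bar> * norm (u t - v t))
      \<longlongrightarrow> 0 * 0 + 0 * \<bar>b\<bar> + \<bar>a\<bar> * 0) F"
    by (intro tendsto_intros tendsto_norm_zero A B)
  then show "((\<lambda>t. norm (A t - X t) * norm (u t - v t) + norm (A t - X t) * \<bar>b\<bar> + \<bar>a\<bar> * norm (u t - v t))
      \<longlongrightarrow> 0) F" by simp
qed

text \<open>
  Uniform statements over a parameter \<open>s\<close> follow from statements about arbitrary choices
  \<open>t \<mapsto> s t\<close> of the parameter, provided these are known along every finer filter.
\<close>

lemma eventually_ball_of_choices:
  assumes "\<And>F' s. F' \<le> F \<Longrightarrow> (\<forall>\<^sub>F t in F'. s t \<in> S t) \<Longrightarrow> (\<forall>\<^sub>F t in F'. R t (s t))"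
  shows "\<forall>\<^sub>F t in F. \<forall>s\<in>S t. R t s"
proof -
  define B where "B = {t. \<exists>s\<in>S t. \<not> R t s}"
  define F' where "F' = inf F (principal B)"
  define s where "s t = (SOME s. s \<in> S t \<and> \<not> R t s)" for t
  have s: "s t \<in> S t \<and> \<not> R t (s t)" if "t \<in> B" for t
    unfolding s_def by (rule someI_ex) (use that in \<open>auto simp: B_def\<close>)
  have "\<forall>\<^sub>F t in F'. t \<in> B"
    by (simp add: F'_def eventually_inf_principal)
  then have "\<forall>\<^sub>F t in F'. s t \<in> S t" and *: "\<forall>\<^sub>F t in F'. \<not> R t (s t)"
    using s by (auto elim: eventually_mono)
  then have "\<forall>\<^sub>F t in F'. R t (s t)"
    by (intro assms) (auto simp: F'_def)
  with * have "\<forall>\<^sub>F t in F'. False"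
    by eventually_elim auto
  then show ?thesis
    unfolding F'_def eventually_inf_principal by eventually_elim (auto simp: B_def)
qed

section \<open>Thickenings of compact connected sets\<close>

definition thicken :: "real \<Rightarrow> 'v::metric_space set \<Rightarrow> 'v set" where
  "thicken r S = (\<Union>x\<in>S. ball x r)"

lemma Gstar_thicken: "Gstar K a = thicken (rad K) (piece K a)"
  by (simp add: Gstar_def thicken_def)

lemma open_thicken [simp]: "open (thicken r S)"
  by (auto simp: thicken_def)

lemma thicken_mono: "r \<le> s \<Longrightarrow> thicken r S \<subseteq> thicken s S"
  by (force simp: thicken_def)

lemma subset_thicken: "0 < r \<Longrightarrow> S \<subseteq> thicken r S"
  by (auto simp: thicken_def)

lemma thicken_shift: "x \<in> thicken r S \<Longrightarrow> dist x y \<le> e \<Longrightarrow> y \<in> thicken (r + e) S"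
  unfolding thicken_def by (smt (verit) UN_iff dist_triangle mem_ball)

lemma bounded_thicken: "bounded S \<Longrightarrow> bounded (thicken r S)"
proof -
  assume "bounded S"
  then obtain x e where "S \<subseteq> cball x e" by (auto simp: bounded_subset_cball)
  then have "thicken r S \<subseteq> cball x (e + r)"
    unfolding thicken_def by (smt (verit, ccfv_threshold) UN_least dist_triangle mem_ball mem_cball subset_iff)
  then show ?thesis using bounded_cball bounded_subset by blast
qed

lemma compact_thicken_closed:
  fixes S :: "'v::euclidean_space set"
  assumes "compact S" "S \<noteq> {}"
  shows "compact {x. infdist x S \<le> r}" and "r < s \<Longrightarrow> {x. infdist x S \<le> r} \<subseteq> thicken s S"
    and "thicken r S \<subseteq> {x. infdist x S \<le> r}"
proof -
  show 1: "r < s \<Longrightarrow> {x. infdist x S \<le> r} \<subseteq> thicken s S" for s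
  proof
    fix x assume "r < s" "x \<in> {x. infdist x S \<le> r}"
    moreover obtain y where "y \<in> S" "infdist x S = dist x y"
      using infdist_attains_inf[OF compact_imp_closed[OF assms(1)] assms(2)] by blast
    ultimately show "x \<in> thicken s S"
      by (auto simp: thicken_def dist_commute intro!: bexI[of _ y])
  qed
  show "thicken r S \<subseteq> {x. infdist x S \<le> r}"
    unfolding thicken_def by (auto simp: dist_commute intro: infdist_le2)
  have "bounded {x. infdist x S \<le> r}"
    by (rule bounded_subset[OF bounded_thicken[OF compact_imp_bounded[OF assms(1)]] 1[of "r+1"]]) simp
  moreover have "closed {x. infdist x S \<le> r}"
    by (intro closed_Collect_le continuous_intros)
  ultimately show "compact {x. infdist x S \<le> r}"
    by (simp add: compact_eq_bounded_closed)
qed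

lemma norm_diff_le_on_ball:
  fixes f :: "'v::real_normed_vector \<Rightarrow> 'w::real_normed_vector"
  assumes "\<And>x. x \<in> ball p r \<Longrightarrow> (f has_derivative blinfun_apply (f' x)) (at x)"
    and "\<And>x. x \<in> ball p r \<Longrightarrow> norm (f' x) \<le> B"
    and "x \<in> ball p r" "y \<in> ball p r"
  shows "norm (f x - f y) \<le> B * norm (x - y)"
proof (rule differentiable_bound[where S = "ball p r" and f' = "\<lambda>x. blinfun_apply (f' x)"])
  show "(f has_derivative blinfun_apply (f' x)) (at x within ball p r)" if "x \<in> ball p r" for x
    using assms(1)[OF that] by (rule has_derivative_at_withinI)
  show "onorm (blinfun_apply (f' x)) \<le> B" if "x \<in> ball p r" for x
    using assms(2)[OF that] by (simp add: norm_blinfun.rep_eq)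
qed (use assms in auto)

text \<open>
  A thickened compact connected set has finite inner diameter.  The statement is phrased through
  functions with bounded derivative, so that no paths are needed: the points of \<open>S\<close> that satisfy
  the estimate relative to a fixed point, for some constant, form an open and closed subset of \<open>S\<close>.
\<close>

lemma inner_diameter:
  fixes S :: "'v::euclidean_space set"
  assumes "compact S" "connected S" "0 < r"
  obtains M where "0 < M"
    "\<And>(f::'v \<Rightarrow> 'v) f' B x y. (\<And>x. x \<in> thicken r S \<Longrightarrow> (f has_derivative blinfun_apply (f' x)) (at x)) \<Longrightarrow>
       (\<And>x. x \<in> thicken r S \<Longrightarrow> norm (f' x) \<le> B) \<Longrightarrow> x \<in> thicken r S \<Longrightarrow> y \<in> thicken r S \<Longrightarrow>
       norm (f x - f y) \<le> M * B"
proof (cases "S = {}")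
  case True
  then show thesis by (intro that[of 1]) (auto simp: thicken_def)
next
  case False
  then obtain p where p: "p \<in> S" by auto
  define good where "good f f' B \<longleftrightarrow> (\<forall>x\<in>thicken r S. (f has_derivative blinfun_apply (f' x)) (at x) \<and> norm (f' x) \<le> B)"
    for f :: "'v \<Rightarrow> 'v" and f' B
  define A where "A m = {x \<in> S. \<forall>f f' B. good f f' B \<longrightarrow> norm (f x - f p) \<le> m * B}" for m
  have B0: "0 \<le> B" if "good f f' B" for f f' B
    using that p subset_thicken[OF assms(3), of S] norm_ge_zero order_trans unfolding good_def by blast
  have near: "norm (f x - f y) \<le> r * B" if "good f f' B" "y \<in> S" "x \<in> ball y r" for f f' B x y
  proof -
    have "norm (f x - f y) \<le> B * norm (x - y)"
      by (rule norm_diff_le_on_ball[where p = y and r = r and f' = f'])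
        (use that assms(3) in \<open>auto simp: good_def thicken_def\<close>)
    also have "\<dots> \<le> B * r"
      using that(3) B0[OF that(1)] by (intro mult_left_mono) (auto simp: dist_norm norm_minus_commute)
    finally show ?thesis by (simp add: mult.commute)
  qed
  have step: "x \<in> A (m + r)" if "y \<in> A m" "x \<in> S" "dist x y < r" for x y m
    unfolding A_def
  proof (intro CollectI conjI allI impI)
    fix f f' B assume g: "good f f' B"
    have "norm (f x - f p) \<le> norm (f x - f y) + norm (f y - f p)"
      using norm_triangle_ineq[of "f x - f y" "f y - f p"] by simp
    also have "\<dots> \<le> r * B + m * B"
      using near[OF g, of y x] g that by (intro add_mono) (auto simp: A_def dist_commute)
    finally show "norm (f x - f p) \<le> (m + r) * B" by (simp add: algebra_simps)
  qed (use that in auto)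
  define V where "V = (\<Union>m. A m)"
  have "V = S"
  proof (rule ccontr)
    assume "V \<noteq> S"
    have "V \<subseteq> S" by (auto simp: V_def A_def)
    have "p \<in> V" using p by (auto simp: V_def A_def intro!: exI[of _ 0])
    have "openin (top_of_set S) V"
      unfolding openin_euclidean_subtopology_iff
    proof (intro conjI ballI)
      fix x assume "x \<in> V"
      then obtain m where "x \<in> A m" by (auto simp: V_def)
      then have "\<forall>y\<in>S. dist y x < r \<longrightarrow> y \<in> V" using step by (auto simp: V_def)
      then show "\<exists>e>0. \<forall>y\<in>S. dist y x < e \<longrightarrow> y \<in> V" using assms(3) by blast
    qed fact
    moreover have "openin (top_of_set S) (S - V)"
      unfolding openin_euclidean_subtopology_iff
    proof (intro conjI ballI)
      fix x assume x: "x \<in> S - V"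
      have "y \<notin> V" if "y \<in> S" "dist y x < r" for y
      proof
        assume "y \<in> V"
        then obtain m where "y \<in> A m" by (auto simp: V_def)
        then have "x \<in> V" using step[of y m x] that x by (auto simp: V_def dist_commute)
        with x show False by simp
      qed
      then show "\<exists>e>0. \<forall>y\<in>S. dist y x < e \<longrightarrow> y \<in> S - V" using assms(3) by blast
    qed auto
    ultimately have "closedin (top_of_set S) V"
      using \<open>V \<subseteq> S\<close> by (simp add: closedin_def)
    with \<open>openin (top_of_set S) V\<close> show False
      using assms(2) \<open>p \<in> V\<close> \<open>V \<noteq> S\<close> unfolding connected_clopen by blast
  qed
  then have "\<forall>x\<in>S. \<exists>m. x \<in> A m" by (auto simp: V_def)
  then obtain m where m: "\<And>x. x \<in> S \<Longrightarrow> x \<in> A (m x)" by metis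
  obtain C where C: "C \<subseteq> S" "finite C" "S \<subseteq> (\<Union>x\<in>C. ball x r)"
    using compactE_image[OF assms(1), of S "\<lambda>x. ball x r"] assms(3) by (metis UN_I centre_in_ball open_ball subsetI)
  define M0 where "M0 = Max (insert 0 (m ` C)) + 2 * r"
  have M0: "norm (f x - f p) \<le> M0 * B" if g: "good f f' B" and x: "x \<in> thicken r S" for f f' B x
  proof -
    obtain y where y: "y \<in> S" "x \<in> ball y r" using x by (auto simp: thicken_def)
    obtain z where z: "z \<in> C" "y \<in> ball z r" using C y by auto
    have "norm (f x - f p) \<le> norm (f x - f y) + (norm (f y - f z) + norm (f z - f p))"
      by (smt (verit) norm_diff_triangle_ineq diff_add_cancel norm_triangle_ineq4 norm_diff_triangle_le)
    also have "\<dots> \<le> r * B + (r * B + m z * B)"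
      using near[OF g y] near[OF g, of z y] z C m[of z] g
      by (intro add_mono) (auto simp: A_def)
    also have "\<dots> = (m z + 2 * r) * B" by (simp add: algebra_simps)
    also have "\<dots> \<le> M0 * B"
      unfolding M0_def using C z B0[OF g] by (intro mult_right_mono add_right_mono Max_ge) auto
    finally show ?thesis .
  qed
  show thesis
  proof (rule that[of "2 * M0"])
    have "0 \<le> Max (insert 0 (m ` C))" using C by (intro Max_ge) auto
    then show "0 < 2 * M0" using assms(3) by (simp add: M0_def)
    fix f :: "'v \<Rightarrow> 'v" and f' B x y
    assume "\<And>x. x \<in> thicken r S \<Longrightarrow> (f has_derivative blinfun_apply (f' x)) (at x)"
      "\<And>x. x \<in> thicken r S \<Longrightarrow> norm (f' x) \<le> B" "x \<in> thicken r S" "y \<in> thicken r S"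
    then have "norm (f x - f p) \<le> M0 * B" "norm (f y - f p) \<le> M0 * B"
      using M0[of f f' B] by (auto simp: good_def)
    then show "norm (f x - f y) \<le> 2 * M0 * B"
      using norm_triangle_ineq4[of "f x - f p" "f y - f p"] by simp
  qed
qed

section \<open>Compositions of inverse branches and their distortion\<close>

definition left_seq :: "('a \<times> 'a) set \<Rightarrow> (nat \<Rightarrow> 'a) \<Rightarrow> bool" where
  "left_seq R \<theta> \<longleftrightarrow> (\<forall>i. (\<theta> (Suc i), \<theta> i) \<in> R)"

definition shift :: "nat \<Rightarrow> (nat \<Rightarrow> 'a) \<Rightarrow> nat \<Rightarrow> 'a" where
  "shift i \<theta> = (\<lambda>j. \<theta> (j + i))"

text \<open>
  A left-infinite sequence is indexed from its right end, so the letter \<open>\<theta> 0\<close> gives the domain of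
  the branch and longer branches add letters with higher indices.  The derivative of the branch and
  the derivative of the iterate of \<open>g\<close> that inverts it are defined as products along the orbit; splitting
  a branch into two then needs no differentiability.
\<close>

primrec branch :: "('a \<Rightarrow> 'a \<Rightarrow> 'v \<Rightarrow> 'v) \<Rightarrow> (nat \<Rightarrow> 'a) \<Rightarrow> nat \<Rightarrow> 'v \<Rightarrow> 'v" where
  "branch f \<theta> 0 x = x"
| "branch f \<theta> (Suc n) x = f (\<theta> (Suc n)) (\<theta> n) (branch f \<theta> n x)"

primrec dbranch :: "('a \<Rightarrow> 'a \<Rightarrow> 'v \<Rightarrow> 'v) \<Rightarrow> (nat \<Rightarrow> 'a) \<Rightarrow> nat \<Rightarrow> 'v \<Rightarrow> ('v::euclidean_space \<Rightarrow>\<^sub>L 'v)" where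
  "dbranch f \<theta> 0 x = id_blinfun"
| "dbranch f \<theta> (Suc n) x = Der (f (\<theta> (Suc n)) (\<theta> n)) (branch f \<theta> n x) o\<^sub>L dbranch f \<theta> n x"

primrec ibranch :: "('a \<Rightarrow> 'a \<Rightarrow> 'v \<Rightarrow> 'v) \<Rightarrow> ('v \<Rightarrow> 'v) \<Rightarrow> (nat \<Rightarrow> 'a) \<Rightarrow> nat \<Rightarrow> 'v \<Rightarrow> ('v::euclidean_space \<Rightarrow>\<^sub>L 'v)" where
  "ibranch f g \<theta> 0 x = id_blinfun"
| "ibranch f g \<theta> (Suc n) x = ibranch f g \<theta> n x o\<^sub>L Der g (branch f \<theta> (Suc n) x)"

lemma left_seq_shift: "left_seq R \<theta> \<Longrightarrow> left_seq R (shift i \<theta>)"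
  by (simp add: left_seq_def shift_def)

lemma shift_0 [simp]: "shift 0 \<theta> = \<theta>" "shift i \<theta> 0 = \<theta> i"
  by (simp_all add: shift_def)

lemma branch_0 [simp]: "branch f \<theta> 0 = (\<lambda>x. x)"
  by auto

lemma branch_add: "branch f \<theta> (n + i) x = branch f (shift i \<theta>) n (branch f \<theta> i x)"
  by (induction n) (simp_all add: shift_def)

lemma dbranch_add:
  "dbranch f \<theta> (n + i) x = dbranch f (shift i \<theta>) n (branch f \<theta> i x) o\<^sub>L dbranch f \<theta> i x"
  by (induction n) (simp_all add: shift_def branch_add blinfun_compose_assoc)

lemma ibranch_add:
  "ibranch f g \<theta> (n + i) x = ibranch f g \<theta> i x o\<^sub>L ibranch f g (shift i \<theta>) n (branch f \<theta> i x)"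
proof (induction n)
  case (Suc n)
  show ?case
    using branch_add[of f \<theta> "Suc n" i x] by (simp add: Suc.IH shift_def blinfun_compose_assoc)
qed simp

lemma branch_cong:
  assumes "\<And>i. i \<le> n \<Longrightarrow> \<theta> i = \<theta>' i"
  shows "branch f \<theta> n = branch f \<theta>' n" "dbranch f \<theta> n = dbranch f \<theta>' n" "ibranch f g \<theta> n = ibranch f g \<theta>' n"
proof -
  have *: "branch f \<theta> k x = branch f \<theta>' k x" if "k \<le> n" for k x
    using that by (induction k) (simp_all add: assms)
  then show "branch f \<theta> n = branch f \<theta>' n" by auto
  have "dbranch f \<theta> k x = dbranch f \<theta>' k x" if "k \<le> n" for k x
    using that by (induction k) (simp_all add: assms *)
  then show "dbranch f \<theta> n = dbranch f \<theta>' n" by auto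
  have "ibranch f g \<theta> k x = ibranch f g \<theta>' k x" if "k \<le> n" for k x
    using that by (induction k) (simp_all add: assms *)
  then show "ibranch f g \<theta> n = ibranch f g \<theta>' n" by auto
qed

text \<open>
  A step multiplies the norm by at most \<open>1 + q \<kappa>\<^sup>n \<le> exp (q \<kappa>\<^sup>n)\<close>, and these factors have a bounded
  product.  With the norms bounded, the increments decay like \<open>\<kappa>\<^sup>n\<close>.
\<close>

lemma geometric_growth:
  fixes X :: "nat \<Rightarrow> 'b::real_normed_vector"
  assumes "norm (X 0) \<le> 1" and step: "\<And>n. norm (X (Suc n) - X n) \<le> q * \<kappa> ^ n * norm (X n)"
    and "0 < \<kappa>" "\<kappa> < 1" "0 \<le> q"
  shows "norm (X n) \<le> exp (q / (1 - \<kappa>))"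
    and "m \<le> n \<Longrightarrow> norm (X n - X m) \<le> q * exp (q / (1 - \<kappa>)) / (1 - \<kappa>) * \<kappa> ^ m"
proof -
  \<comment> \<open>The exponent is the partial sum of the geometric series.\<close>
  have "norm (X n) \<le> exp (q / (1 - \<kappa>) * (1 - \<kappa> ^ n))" for n
  proof (induction n)
    case (Suc n)
    have "norm (X (Suc n)) \<le> norm (X n) + norm (X (Suc n) - X n)"
      using norm_triangle_ineq[of "X n" "X (Suc n) - X n"] by simp
    also have "\<dots> \<le> (1 + q * \<kappa> ^ n) * norm (X n)" using step[of n] by (simp add: algebra_simps)
    also have "\<dots> \<le> exp (q * \<kappa> ^ n) * exp (q / (1 - \<kappa>) * (1 - \<kappa> ^ n))"
      using Suc.IH assms(3,5) by (intro mult_mono exp_ge_add_one_self) auto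
    also have "\<dots> = exp (q * \<kappa> ^ n + q / (1 - \<kappa>) * (1 - \<kappa> ^ n))" by (simp add: exp_add)
    also have "q * \<kappa> ^ n + q / (1 - \<kappa>) * (1 - \<kappa> ^ n) = q / (1 - \<kappa>) * (1 - \<kappa> ^ Suc n)"
      using assms(4) by (simp add: field_simps)
    finally show ?case .
  qed (use assms(1) in simp)
  also have "exp (q / (1 - \<kappa>) * (1 - \<kappa> ^ n)) \<le> exp (q / (1 - \<kappa>))" for n
    using assms(3-5) by (auto intro!: divide_right_mono mult_left_le)
  finally show bd: "norm (X n) \<le> exp (q / (1 - \<kappa>))" for n .
  let ?C = "q * exp (q / (1 - \<kappa>)) / (1 - \<kappa>)"
  assume "m \<le> n"
  then have "norm (X n - X m) \<le> ?C * (\<kappa> ^ m - \<kappa> ^ n)"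
  proof (induction rule: dec_induct)
    case (step n)
    have "norm (X (Suc n) - X m) \<le> norm (X n - X m) + norm (X (Suc n) - X n)"
      using norm_triangle_ineq[of "X n - X m" "X (Suc n) - X n"] by simp
    also have "norm (X (Suc n) - X n) \<le> q * \<kappa> ^ n * exp (q / (1 - \<kappa>))"
      using assms(3,5) bd by (intro order_trans[OF assms(2)] mult_left_mono) auto
    also have "norm (X n - X m) \<le> ?C * (\<kappa> ^ m - \<kappa> ^ n)" by (rule step.IH)
    also have "q * \<kappa> ^ n * exp (q / (1 - \<kappa>)) = ?C * (\<kappa> ^ n - \<kappa> ^ Suc n)"
      using assms(4) by (simp add: field_simps)
    also have "?C * (\<kappa> ^ m - \<kappa> ^ n) + ?C * (\<kappa> ^ n - \<kappa> ^ Suc n) = ?C * (\<kappa> ^ m - \<kappa> ^ Suc n)"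
      by (simp only: flip: distrib_left) simp
    finally show ?case by simp
  qed simp
  also have "\<dots> \<le> ?C * \<kappa> ^ m"
    using assms(3-5) by (intro mult_left_mono) auto
  finally show "norm (X n - X m) \<le> ?C * \<kappa> ^ m" .
qed

lemma geometric_growth_lim:
  fixes X :: "nat \<Rightarrow> 'b::banach"
  assumes "\<And>m n. m \<le> n \<Longrightarrow> norm (X n - X m) \<le> C * \<kappa> ^ m" "0 < \<kappa>" "\<kappa> < 1"
  shows "X \<longlonglongrightarrow> lim X" "norm (lim X - X m) \<le> C * \<kappa> ^ m"
proof -
  have C: "0 \<le> C" using assms(1)[of 0 0] by simp
  have "(\<lambda>n. C * \<kappa> ^ n) \<longlonglongrightarrow> C * 0"
    using assms(2,3) by (intro tendsto_intros LIMSEQ_realpow_zero) auto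
  then have *: "(\<lambda>n. C * \<kappa> ^ n) \<longlonglongrightarrow> 0" by simp
  have "Cauchy X"
  proof (rule CauchyI')
    fix e :: real assume "0 < e"
    then obtain M where M: "\<And>n. n \<ge> M \<Longrightarrow> C * \<kappa> ^ n < e"
      using order_tendstoD(2)[OF *] by (auto simp: eventually_sequentially)
    show "\<exists>M. \<forall>m\<ge>M. \<forall>n>m. dist (X m) (X n) < e"
      using M assms(1) by (intro exI[of _ M]) (metis dist_commute dist_norm le_less_trans less_imp_le)
  qed
  then show lim: "X \<longlonglongrightarrow> lim X" by (simp add: Cauchy_convergent_iff convergent_LIMSEQ_iff)
  show "norm (lim X - X m) \<le> C * \<kappa> ^ m"
  proof (rule tendsto_upperbound)
    show "(\<lambda>n. norm (X n - X m)) \<longlonglongrightarrow> norm (lim X - X m)"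
      by (intro tendsto_intros lim)
    show "\<forall>\<^sub>F n in sequentially. norm (X n - X m) \<le> C * \<kappa> ^ m"
      using assms(1) eventually_ge_at_top by (rule eventually_mono[rotated])
  qed simp
qed

locale branches =
  fixes R :: "('a \<times> 'a) set" and D :: "'a \<Rightarrow> 'v::euclidean_space set"
    and f :: "'a \<Rightarrow> 'a \<Rightarrow> 'v \<Rightarrow> 'v" and g :: "'v \<Rightarrow> 'v" and \<mu> \<Gamma> :: real
  assumes D_open: "open (D a)"
    and D_maps: "(a, b) \<in> R \<Longrightarrow> y \<in> D b \<Longrightarrow> f a b y \<in> D a"
    and f_der: "(a, b) \<in> R \<Longrightarrow> y \<in> D b \<Longrightarrow> (f a b has_derivative blinfun_apply (Der (f a b) y)) (at y)"
    and f_pair: "(a, b) \<in> R \<Longrightarrow> y \<in> D b \<Longrightarrow> inverse_pair (Der (f a b) y) (Der g (f a b y))"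
    and f_norm: "(a, b) \<in> R \<Longrightarrow> y \<in> D b \<Longrightarrow> norm (Der (f a b) y) \<le> \<mu>"
    and g_norm: "(a, b) \<in> R \<Longrightarrow> y \<in> D b \<Longrightarrow> norm (Der g (f a b y)) \<le> \<Gamma>"
    and \<mu>: "0 < \<mu>" "\<mu> < 1" and \<Gamma>: "1 \<le> \<Gamma>"
begin

lemma branch_in: "left_seq R \<theta> \<Longrightarrow> x \<in> D (\<theta> 0) \<Longrightarrow> branch f \<theta> n x \<in> D (\<theta> n)"
  by (induction n) (auto simp: left_seq_def D_maps)

lemma branch_has_derivative:
  "left_seq R \<theta> \<Longrightarrow> x \<in> D (\<theta> 0) \<Longrightarrow>
    (branch f \<theta> n has_derivative blinfun_apply (dbranch f \<theta> n x)) (at x)"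
proof (induction n)
  case (Suc n)
  have "(f (\<theta> (Suc n)) (\<theta> n) has_derivative
      blinfun_apply (Der (f (\<theta> (Suc n)) (\<theta> n)) (branch f \<theta> n x))) (at (branch f \<theta> n x))"
    using Suc.prems branch_in by (intro f_der) (auto simp: left_seq_def)
  from diff_chain_at[OF Suc.IH[OF Suc.prems] this]
  show ?case by (simp add: o_def blinfun_compose.rep_eq)
qed (simp add: id_blinfun.rep_eq)

lemma branch_inverse_pair:
  "left_seq R \<theta> \<Longrightarrow> x \<in> D (\<theta> 0) \<Longrightarrow> inverse_pair (dbranch f \<theta> n x) (ibranch f g \<theta> n x)"
proof (induction n)
  case (Suc n)
  then show ?case
    using branch_in by (auto intro!: inverse_pair_compose f_pair simp: left_seq_def)
qed simp

lemma norm_dbranch: "left_seq R \<theta> \<Longrightarrow> x \<in> D (\<theta> 0) \<Longrightarrow> norm (dbranch f \<theta> n x) \<le> \<mu> ^ n"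
proof (induction n)
  case (Suc n)
  then show ?case
    using branch_in by (auto intro!: norm_compose_le f_norm simp: left_seq_def)
qed (simp add: norm_blinfun_id_le)

lemma norm_ibranch: "left_seq R \<theta> \<Longrightarrow> x \<in> D (\<theta> 0) \<Longrightarrow> norm (ibranch f g \<theta> n x) \<le> \<Gamma> ^ n"
proof (induction n)
  case (Suc n)
  then show ?case
    using branch_in norm_compose_le[OF Suc.IH g_norm, of "\<theta> (Suc n)" "\<theta> n" "branch f \<theta> n x"]
    by (auto simp: left_seq_def mult.commute)
qed (simp add: norm_blinfun_id_le)

text \<open>
  Norms are submultiplicative, so a factor \<open>\<rho>\<close> gained on each block of length \<open>N\<close> gives exponential decay;
  an incomplete block costs at most \<open>\<Gamma>\<^sup>N\<close>.  Only branches of a fixed length have to be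
  inspected, which is what makes bunching stable under perturbation.
\<close>

lemma bunching_from_blocks:
  assumes "left_seq R \<theta>" "x \<in> D (\<theta> 0)" "0 < N" "0 < \<rho>" "\<rho> < 1" "0 < \<alpha>"
    and blocks: "\<And>i. norm (dbranch f (shift i \<theta>) N (branch f \<theta> i x))
       * norm (ibranch f g (shift i \<theta>) N (branch f \<theta> i x)) * (\<mu> ^ N) powr \<alpha> \<le> \<rho>"
  shows "norm (dbranch f \<theta> n x) * norm (ibranch f g \<theta> n x) * (\<mu> ^ n) powr \<alpha>
      \<le> \<Gamma> ^ N / \<rho> * (root N \<rho>) ^ n"
proof (induction n rule: less_induct)
  case (less n)
  have rt: "root N \<rho> ^ N = \<rho>" "0 < root N \<rho>" "root N \<rho> < 1" using assms(3-5) by simp_all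
  show ?case
  proof (cases "n < N")
    case True
    have "norm (dbranch f \<theta> n x) * norm (ibranch f g \<theta> n x) * (\<mu> ^ n) powr \<alpha> \<le> 1 * \<Gamma> ^ N * 1"
    proof (intro mult_mono)
      show "norm (dbranch f \<theta> n x) \<le> 1"
        using norm_dbranch[OF assms(1,2), of n] \<mu> power_le_one[of \<mu> n] by simp
      show "norm (ibranch f g \<theta> n x) \<le> \<Gamma> ^ N"
        using norm_ibranch[OF assms(1,2), of n] \<Gamma> True power_increasing[of n N \<Gamma>] by simp
      show "(\<mu> ^ n) powr \<alpha> \<le> 1"
        using \<mu> assms(6) by (intro powr_le1) (auto simp: power_le_one)
    qed (use \<Gamma> in auto)
    also have "\<dots> = \<Gamma> ^ N / \<rho> * root N \<rho> ^ N" using assms(4) rt by simp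
    also have "\<dots> \<le> \<Gamma> ^ N / \<rho> * root N \<rho> ^ n"
      using True rt \<Gamma> assms(4) by (intro mult_left_mono power_decreasing) auto
    finally show ?thesis .
  next
    case False
    then obtain i where i: "n = N + i" using le_Suc_ex[of N n] by auto
    let ?d = "dbranch f (shift i \<theta>) N (branch f \<theta> i x)"
    let ?q = "ibranch f g (shift i \<theta>) N (branch f \<theta> i x)"
    have "norm (dbranch f \<theta> n x) * norm (ibranch f g \<theta> n x) * (\<mu> ^ n) powr \<alpha> \<le>
       (norm ?d * norm (dbranch f \<theta> i x)) * (norm (ibranch f g \<theta> i x) * norm ?q) * ((\<mu> ^ N) powr \<alpha> * (\<mu> ^ i) powr \<alpha>)"
      unfolding i dbranch_add ibranch_add power_add
      using \<mu> by (intro mult_mono norm_blinfun_compose) (auto simp: powr_mult)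
    also have "\<dots> = (norm ?d * norm ?q * (\<mu> ^ N) powr \<alpha>)
       * (norm (dbranch f \<theta> i x) * norm (ibranch f g \<theta> i x) * (\<mu> ^ i) powr \<alpha>)"
      by (simp add: mult_ac)
    also have "\<dots> \<le> \<rho> * (\<Gamma> ^ N / \<rho> * root N \<rho> ^ i)"
      using less.IH[of i] i assms(3,4) \<mu> by (intro mult_mono[OF blocks]) auto
    also have "\<dots> = \<Gamma> ^ N / \<rho> * root N \<rho> ^ n"
      by (simp add: i power_add rt)
    finally show ?thesis .
  qed
qed

end

text \<open>
  The constant \<open>M\<close> bounds the inner diameter of the domains, so that their images under a branch of length
  \<open>n\<close> have diameter at most \<open>M \<mu>\<^sup>n\<close>.  Bunching is required along the orbits of the base points only,
  because it is a condition on the points of the Cantor set and not on a neighbourhood.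
\<close>

locale bunched_branches = branches R D f g \<mu> \<Gamma>
  for R :: "('a \<times> 'a) set" and D :: "'a \<Rightarrow> 'v::euclidean_space set" and f g \<mu> \<Gamma> +
  fixes c :: "'a \<Rightarrow> 'v" and \<alpha> H M Q \<kappa> :: real
  assumes g_holder: "(a, b) \<in> R \<Longrightarrow> y \<in> D b \<Longrightarrow> y' \<in> D b \<Longrightarrow>
      norm (Der g (f a b y) - Der g (f a b y')) \<le> H * dist (f a b y) (f a b y') powr \<alpha>"
    and D_inner: "(\<And>x. x \<in> D a \<Longrightarrow> (\<phi> has_derivative blinfun_apply (\<phi>' x)) (at x)) \<Longrightarrow>
       (\<And>x. x \<in> D a \<Longrightarrow> norm (\<phi>' x) \<le> B) \<Longrightarrow> x \<in> D a \<Longrightarrow> y \<in> D a \<Longrightarrow>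
       norm (\<phi> x - \<phi> y :: 'v) \<le> M * B"
    and base_in: "c a \<in> D a"
    and bunching: "left_seq R \<theta> \<Longrightarrow> norm (dbranch f \<theta> n (c (\<theta> 0)))
       * norm (ibranch f g \<theta> n (c (\<theta> 0))) * (M * \<mu> ^ n) powr \<alpha> \<le> Q * \<kappa> ^ n"
    and \<alpha>: "0 < \<alpha>" and H: "0 \<le> H" and M: "0 < M" and \<kappa>: "0 < \<kappa>" "\<kappa> < 1"
begin

definition dist_const :: real where "dist_const = exp (H * Q / (1 - \<kappa>))"
definition tail_const :: real where "tail_const = H * Q * exp (H * Q / (1 - \<kappa>)) / (1 - \<kappa>)"

text \<open>
  Normalisation at the base point removes the contraction of the branch and leaves its distortion.
  For the Cantor set itself the limit of \<open>E\<close> is the derivative of the limit geometry.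
\<close>

definition E :: "(nat \<Rightarrow> 'a) \<Rightarrow> nat \<Rightarrow> 'v \<Rightarrow> ('v \<Rightarrow>\<^sub>L 'v)" where
  "E \<theta> n x = ibranch f g \<theta> n (c (\<theta> 0)) o\<^sub>L dbranch f \<theta> n x"

text \<open>The inverse of \<open>E\<close> obeys the same recursive estimate as \<open>E\<close>, so the limit of \<open>E\<close> is invertible.\<close>

definition E_inv :: "(nat \<Rightarrow> 'a) \<Rightarrow> nat \<Rightarrow> 'v \<Rightarrow> ('v \<Rightarrow>\<^sub>L 'v)" where
  "E_inv \<theta> n x = ibranch f g \<theta> n x o\<^sub>L dbranch f \<theta> n (c (\<theta> 0))"

lemma diameter:
  assumes "left_seq R \<theta>" "x \<in> D (\<theta> 0)" "y \<in> D (\<theta> 0)"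
  shows "dist (branch f \<theta> n x) (branch f \<theta> n y) \<le> M * \<mu> ^ n"
  unfolding dist_norm
  by (rule D_inner[OF branch_has_derivative norm_dbranch assms(2,3)]) (use assms in auto)

lemma E_pair:
  assumes "left_seq R \<theta>" "x \<in> D (\<theta> 0)"
  shows "inverse_pair (E \<theta> n x) (E_inv \<theta> n x)"
  unfolding E_def E_inv_def
  by (intro inverse_pair_compose inverse_pair_sym[OF branch_inverse_pair] branch_inverse_pair)
    (use assms base_in in auto)

lemma dbranch_eq:
  assumes "left_seq R \<theta>"
  shows "dbranch f \<theta> n x = dbranch f \<theta> n (c (\<theta> 0)) o\<^sub>L E \<theta> n x"
  using branch_inverse_pair[OF assms base_in, of n]
  by (simp add: E_def inverse_pair_def flip: blinfun_compose_assoc)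

lemma holder_branch:
  assumes "left_seq R \<theta>" "x \<in> D (\<theta> 0)" "y \<in> D (\<theta> 0)"
  shows "dist (branch f \<theta> n x) (branch f \<theta> n y) powr \<alpha> \<le> (M * \<mu> ^ n) powr \<alpha>"
  using diameter[OF assms] \<alpha> by (intro powr_mono2) auto

text \<open>
  The estimate behind all that follows: conjugation by a branch costs its condition number, and
  bunching says that an operator with the Hoelder smallness \<open>(M \<mu>\<^sup>n)\<^sup>\<alpha>\<close> can afford this.
\<close>

lemma bunched_conjugation:
  assumes "left_seq R \<theta>" "norm T \<le> B * (M * \<mu> ^ n) powr \<alpha>" "0 \<le> B"
  shows "norm (ibranch f g \<theta> n (c (\<theta> 0)) o\<^sub>L (T o\<^sub>L dbranch f \<theta> n (c (\<theta> 0)))) \<le> B * Q * \<kappa> ^ n"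
proof -
  let ?i = "norm (ibranch f g \<theta> n (c (\<theta> 0)))" and ?d = "norm (dbranch f \<theta> n (c (\<theta> 0)))"
  have "norm (ibranch f g \<theta> n (c (\<theta> 0)) o\<^sub>L (T o\<^sub>L dbranch f \<theta> n (c (\<theta> 0))))
      \<le> ?i * (B * (M * \<mu> ^ n) powr \<alpha> * ?d)"
    by (rule norm_compose_le[OF order_refl norm_compose_le[OF assms(2) order_refl]])
  also have "\<dots> = B * (?d * ?i * (M * \<mu> ^ n) powr \<alpha>)" by (simp add: mult_ac)
  also have "\<dots> \<le> B * (Q * \<kappa> ^ n)" by (intro mult_left_mono bunching assms)
  finally show ?thesis by (simp add: mult_ac)
qed

lemma Q_nonneg: "left_seq R \<theta> \<Longrightarrow> 0 \<le> Q"
  using order_trans[OF _ bunching[of \<theta> 0]] by force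

text \<open>
  For \<open>x = y\<close> the two factors are inverse to each other; otherwise the Hoelder condition on the derivative of
  \<open>g\<close> measures the defect over a set of diameter \<open>M \<mu>\<^sup>n\<close>.
\<close>

lemma branch_step:
  assumes "left_seq R \<theta>" "x \<in> D (\<theta> 0)" "y \<in> D (\<theta> 0)"
  shows "norm ((Der g (branch f \<theta> (Suc n) x) o\<^sub>L Der (f (\<theta> (Suc n)) (\<theta> n)) (branch f \<theta> n y))
      - id_blinfun) \<le> H * (M * \<mu> ^ n) powr \<alpha>" (is "norm ?T \<le> _")
proof -
  let ?a = "\<theta> (Suc n)" let ?b = "\<theta> n"
  have R: "(?a, ?b) \<in> R" using assms(1) by (simp add: left_seq_def)
  note x = branch_in[OF assms(1,2), of n] and y = branch_in[OF assms(1,3), of n]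
  have "?T = (Der g (f ?a ?b (branch f \<theta> n x)) - Der g (f ?a ?b (branch f \<theta> n y)))
      o\<^sub>L Der (f ?a ?b) (branch f \<theta> n y)"
    using f_pair[OF R y] by (simp add: blinfun_compose_diff_left inverse_pair_def)
  also have "norm \<dots> \<le> (H * dist (branch f \<theta> (Suc n) x) (branch f \<theta> (Suc n) y) powr \<alpha>) * \<mu>"
    using g_holder[OF R x y] f_norm[OF R y] by (intro norm_compose_le) auto
  also have "\<dots> \<le> (H * (M * \<mu> ^ Suc n) powr \<alpha>) * 1"
    using \<mu> H by (intro mult_mono mult_left_mono holder_branch assms) auto
  also have "\<dots> \<le> H * (M * \<mu> ^ n) powr \<alpha>"
    using \<mu> H M \<alpha> by (auto intro!: mult_left_mono powr_mono2 mult_right_le_one_le)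
  finally show ?thesis .
qed

lemma E_step:
  assumes "left_seq R \<theta>" "x \<in> D (\<theta> 0)"
  shows "norm (E \<theta> (Suc n) x - E \<theta> n x) \<le> H * Q * \<kappa> ^ n * norm (E \<theta> n x)"
proof -
  let ?c = "c (\<theta> 0)"
  let ?T = "(Der g (branch f \<theta> (Suc n) ?c) o\<^sub>L Der (f (\<theta> (Suc n)) (\<theta> n)) (branch f \<theta> n x)) - id_blinfun"
  have d: "dbranch f \<theta> n x = dbranch f \<theta> n ?c o\<^sub>L E \<theta> n x" by (rule dbranch_eq[OF assms(1)])
  have "E \<theta> (Suc n) x - E \<theta> n x = ibranch f g \<theta> n ?c o\<^sub>L (?T o\<^sub>L dbranch f \<theta> n x)"
    by (simp add: E_def blinfun_compose_diff_left blinfun_compose_diff_right blinfun_compose_assoc)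
  then have eq: "E \<theta> (Suc n) x - E \<theta> n x = (ibranch f g \<theta> n ?c o\<^sub>L (?T o\<^sub>L dbranch f \<theta> n ?c)) o\<^sub>L E \<theta> n x"
    by (simp only: d blinfun_compose_assoc)
  show ?thesis
    unfolding eq
    by (rule norm_compose_le[OF bunched_conjugation[OF assms(1) branch_step[OF assms(1) base_in assms(2)] H]
          order_refl])
qed

lemma E_inv_step:
  assumes "left_seq R \<theta>" "x \<in> D (\<theta> 0)"
  shows "norm (E_inv \<theta> (Suc n) x - E_inv \<theta> n x) \<le> H * Q * \<kappa> ^ n * norm (E_inv \<theta> n x)"
proof -
  let ?c = "c (\<theta> 0)"
  let ?T = "(Der g (branch f \<theta> (Suc n) x) o\<^sub>L Der (f (\<theta> (Suc n)) (\<theta> n)) (branch f \<theta> n ?c)) - id_blinfun"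
  have i: "ibranch f g \<theta> n x = E_inv \<theta> n x o\<^sub>L ibranch f g \<theta> n ?c"
    using branch_inverse_pair[OF assms(1) base_in, of n]
    by (simp add: E_inv_def inverse_pair_def blinfun_compose_assoc)
  have "E_inv \<theta> (Suc n) x - E_inv \<theta> n x = ibranch f g \<theta> n x o\<^sub>L (?T o\<^sub>L dbranch f \<theta> n ?c)"
    by (simp add: E_inv_def blinfun_compose_diff_left blinfun_compose_diff_right blinfun_compose_assoc)
  then have eq: "E_inv \<theta> (Suc n) x - E_inv \<theta> n x = E_inv \<theta> n x o\<^sub>L (ibranch f g \<theta> n ?c o\<^sub>L (?T o\<^sub>L dbranch f \<theta> n ?c))"
    by (simp only: i blinfun_compose_assoc)
  have "norm (E_inv \<theta> (Suc n) x - E_inv \<theta> n x) \<le> norm (E_inv \<theta> n x) * (H * Q * \<kappa> ^ n)"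
    unfolding eq
    by (rule norm_compose_le[OF order_refl
          bunched_conjugation[OF assms(1) branch_step[OF assms base_in] H]])
  then show ?thesis by (simp add: mult_ac)
qed

lemma E_bounds:
  assumes "left_seq R \<theta>" "x \<in> D (\<theta> 0)"
  shows "norm (E \<theta> n x) \<le> dist_const"
    and "m \<le> n \<Longrightarrow> norm (E \<theta> n x - E \<theta> m x) \<le> tail_const * \<kappa> ^ m"
    and "norm (E_inv \<theta> n x) \<le> dist_const"
    and "m \<le> n \<Longrightarrow> norm (E_inv \<theta> n x - E_inv \<theta> m x) \<le> tail_const * \<kappa> ^ m"
proof -
  have 0: "0 \<le> H * Q" using Q_nonneg[OF assms(1)] H by simp
  have 1: "norm (E \<theta> 0 x) \<le> 1" "norm (E_inv \<theta> 0 x) \<le> 1"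
    by (simp_all add: E_def E_inv_def norm_blinfun_id_le)
  note A = geometric_growth[of "\<lambda>n. E \<theta> n x", OF 1(1) E_step[OF assms] \<kappa> 0, folded dist_const_def tail_const_def]
  note B = geometric_growth[of "\<lambda>n. E_inv \<theta> n x", OF 1(2) E_inv_step[OF assms] \<kappa> 0, folded dist_const_def tail_const_def]
  show "norm (E \<theta> n x) \<le> dist_const"
    "m \<le> n \<Longrightarrow> norm (E \<theta> n x - E \<theta> m x) \<le> tail_const * \<kappa> ^ m" by (fact A)+
  show "norm (E_inv \<theta> n x) \<le> dist_const"
    "m \<le> n \<Longrightarrow> norm (E_inv \<theta> n x - E_inv \<theta> m x) \<le> tail_const * \<kappa> ^ m" by (fact B)+
qed

definition E_lim :: "(nat \<Rightarrow> 'a) \<Rightarrow> 'v \<Rightarrow> ('v \<Rightarrow>\<^sub>L 'v)" where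
  "E_lim \<theta> x = lim (\<lambda>n. E \<theta> n x)"

lemma E_lim:
  assumes "left_seq R \<theta>" "x \<in> D (\<theta> 0)"
  shows "(\<lambda>n. E \<theta> n x) \<longlonglongrightarrow> E_lim \<theta> x" "norm (E_lim \<theta> x - E \<theta> m x) \<le> tail_const * \<kappa> ^ m"
  unfolding E_lim_def
  by (rule geometric_growth_lim[OF E_bounds(2)[OF assms] \<kappa>]; simp)+

lemma E_lim_pair:
  assumes "left_seq R \<theta>" "x \<in> D (\<theta> 0)"
  shows "\<exists>Y. inverse_pair (E_lim \<theta> x) Y"
proof -
  let ?Y = "lim (\<lambda>n. E_inv \<theta> n x)"
  have Y: "(\<lambda>n. E_inv \<theta> n x) \<longlonglongrightarrow> ?Y"
    by (rule geometric_growth_lim(1)[OF E_bounds(4)[OF assms] \<kappa>]) simp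
  note lim = bounded_bilinear.tendsto[OF bounded_bilinear_blinfun_compose]
  have "(\<lambda>n. E \<theta> n x o\<^sub>L E_inv \<theta> n x) \<longlonglongrightarrow> (E_lim \<theta> x o\<^sub>L ?Y)"
    "(\<lambda>n. E_inv \<theta> n x o\<^sub>L E \<theta> n x) \<longlonglongrightarrow> (?Y o\<^sub>L E_lim \<theta> x)"
    by (intro lim E_lim Y assms)+
  then have "inverse_pair (E_lim \<theta> x) ?Y"
    using E_pair[OF assms] unfolding inverse_pair_def
    by (simp add: LIMSEQ_const_iff)
  then show ?thesis ..
qed

text \<open>
  A smooth observable with derivative \<open>h'\<close> is nearly affine on the small image of a long branch, with a
  Hoelder error that bunching absorbs.  After normalisation at the base point only the branch remains,
  and it may be cut off at any length \<open>m\<close>.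
\<close>

lemma observable_tail:
  assumes "left_seq R \<theta>" "x \<in> D (\<theta> 0)"
    and holder: "\<And>y z. y \<in> D (\<theta> p) \<Longrightarrow> z \<in> D (\<theta> p) \<Longrightarrow> norm (h' y - h' z) \<le> B * dist y z powr \<alpha>"
    and inv: "inverse_pair (h' (branch f \<theta> p (c (\<theta> 0)))) Y" "norm Y \<le> Z" and "0 \<le> B" and "m \<le> p"
  shows "norm (((ibranch f g \<theta> p (c (\<theta> 0)) o\<^sub>L Y) o\<^sub>L (h' (branch f \<theta> p x) o\<^sub>L dbranch f \<theta> p x)) - E \<theta> m x)
     \<le> (Z * B * Q * dist_const + tail_const) * \<kappa> ^ m"
proof -
  let ?c = "c (\<theta> 0)" and ?X = "h' (branch f \<theta> p x)"
  let ?T = "(Y o\<^sub>L ?X) - id_blinfun"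
  have d: "dbranch f \<theta> p x = dbranch f \<theta> p ?c o\<^sub>L E \<theta> p x" by (rule dbranch_eq[OF assms(1)])
  have Z: "0 \<le> Z" using inv(2) norm_ge_zero order_trans by blast
  have "?T = Y o\<^sub>L (?X - h' (branch f \<theta> p ?c))"
    using inv(1) by (simp add: blinfun_compose_diff_right inverse_pair_def)
  also have "norm \<dots> \<le> Z * (B * dist (branch f \<theta> p x) (branch f \<theta> p ?c) powr \<alpha>)"
    by (rule norm_compose_le[OF inv(2) holder[OF branch_in[OF assms(1,2)] branch_in[OF assms(1) base_in]]])
  also have "\<dots> \<le> Z * (B * (M * \<mu> ^ p) powr \<alpha>)"
    using Z assms(6) by (intro mult_left_mono holder_branch assms base_in) auto
  finally have T: "norm ?T \<le> Z * B * (M * \<mu> ^ p) powr \<alpha>" by (simp add: mult_ac)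
  let ?L = "((ibranch f g \<theta> p ?c o\<^sub>L Y) o\<^sub>L (?X o\<^sub>L dbranch f \<theta> p x)) - E \<theta> p x"
  have "?L = ibranch f g \<theta> p ?c o\<^sub>L (?T o\<^sub>L dbranch f \<theta> p x)"
    by (simp add: E_def blinfun_compose_diff_left blinfun_compose_diff_right blinfun_compose_assoc)
  then have eq: "?L = (ibranch f g \<theta> p ?c o\<^sub>L (?T o\<^sub>L dbranch f \<theta> p ?c)) o\<^sub>L E \<theta> p x"
    by (simp only: d blinfun_compose_assoc)
  have "norm ?L \<le> (Z * B * Q * \<kappa> ^ p) * dist_const"
    unfolding eq
    by (rule norm_compose_le[OF bunched_conjugation[OF assms(1) T] E_bounds(1)[OF assms(1,2)]])
      (use Z assms(6) in auto)
  also have "\<dots> \<le> (Z * B * Q * \<kappa> ^ m) * dist_const"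
    using Z assms(6,7) \<kappa> Q_nonneg[OF assms(1)]
    by (intro mult_right_mono mult_left_mono power_decreasing) (auto simp: dist_const_def)
  finally have "norm ?L \<le> Z * B * Q * dist_const * \<kappa> ^ m" by (simp add: mult_ac)
  moreover have "norm (E \<theta> p x - E \<theta> m x) \<le> tail_const * \<kappa> ^ m"
    by (rule E_bounds) fact+
  ultimately show ?thesis
    using norm_triangle_ineq[of ?L "E \<theta> p x - E \<theta> m x"] by (simp add: algebra_simps)
qed

end

section \<open>Inverse branches of a holomorphic Cantor set\<close>

lemma all_le_Suc: "(\<forall>i\<le>Suc n. P i) \<longleftrightarrow> P 0 \<and> (\<forall>i\<le>n. P (Suc i))"
proof (intro iffI allI impI)
  fix i assume *: "P 0 \<and> (\<forall>i\<le>n. P (Suc i))" "i \<le> Suc n"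
  then show "P i" by (cases i) auto
qed auto

lemma GLC_compose: "A \<in> GLC \<Longrightarrow> B \<in> GLC \<Longrightarrow> (A o\<^sub>L B) \<in> GLC"
  unfolding GLC_def
  by clarsimp (metis invertible_mult matrix_vector_mul_assoc)

lemma GLC_id: "id_blinfun \<in> GLC"
  unfolding GLC_def by (auto intro!: exI[of _ "mat 1"] simp: invertible_def)

lemma GLC_inverse_pair:
  assumes "A \<in> GLC" "inverse_pair A B" shows "B \<in> GLC"
proof -
  obtain M where M: "invertible M" "\<And>v. blinfun_apply A v = M *v v"
    using assms(1) by (auto simp: GLC_def)
  have "blinfun_apply B v = matrix_inv M *v v" for v
  proof -
    have "matrix_inv M *v v = matrix_inv M *v (M *v blinfun_apply B v)"
      using inverse_pair_apply(1)[OF assms(2)] M by metis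
    then show ?thesis by (simp add: matrix_vector_mul_assoc matrix_inv_both[OF M(1)])
  qed
  moreover have "invertible (matrix_inv M)"
    using matrix_inv_both[OF M(1)] by (auto simp: invertible_def)
  ultimately show ?thesis by (auto simp: GLC_def)
qed

lemma GLC_inverse_exists:
  assumes "A \<in> GLC" shows "\<exists>B. inverse_pair A B"
proof -
  obtain M where M: "invertible M" "\<And>v. blinfun_apply A v = M *v v"
    using assms by (auto simp: GLC_def)
  have "linear (\<lambda>v. matrix_inv M *v v)"
    by (rule linearI) (simp_all add: vec_eq_iff matrix_vector_mult_def scaleR_sum_right
        distrib_left sum.distrib)
  then have "bounded_linear (\<lambda>v. matrix_inv M *v v)"
    by (simp add: linear_conv_bounded_linear)
  then have "inverse_pair A (Blinfun (\<lambda>v. matrix_inv M *v v))"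
    by (auto simp: inverse_pair_def bounded_linear_Blinfun_apply M matrix_vector_mul_assoc
        matrix_inv_both[OF M(1)] intro!: blinfun_eqI)
  then show ?thesis ..
qed

lemma unit_vectors_nonempty: "{v::'v::euclidean_space. norm v = 1} \<noteq> {}"
  using vector_choose_size[of 1] by auto

lemma conorm_le:
  fixes A :: "'v::euclidean_space \<Rightarrow>\<^sub>L 'v"
  shows "conorm A * norm v \<le> norm (blinfun_apply A v)"
proof (cases "v = 0")
  case False
  have "conorm A \<le> norm (blinfun_apply A (sgn v))"
    unfolding conorm_def by (rule cINF_lower) (auto intro!: bdd_belowI[of _ 0] simp: norm_sgn False)
  then show ?thesis
    using False by (simp add: sgn_div_norm blinfun.bilinear_simps field_simps)
qed simp

lemma conorm_greatest:
  fixes A :: "'v::euclidean_space \<Rightarrow>\<^sub>L 'v"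
  assumes "\<And>v. norm v = 1 \<Longrightarrow> m \<le> norm (blinfun_apply A v)" shows "m \<le> conorm A"
  unfolding conorm_def by (rule cINF_greatest) (use unit_vectors_nonempty assms in auto)

lemma conorm_lipschitz:
  fixes A B :: "'v::euclidean_space \<Rightarrow>\<^sub>L 'v"
  shows "conorm A - norm (A - B) \<le> conorm B"
proof (rule conorm_greatest)
  fix v :: 'v assume v: "norm v = 1"
  have "conorm A \<le> norm (blinfun_apply A v)" using conorm_le[of A v] v by simp
  also have "blinfun_apply A v = blinfun_apply B v + blinfun_apply (A - B) v"
    by (simp add: blinfun.bilinear_simps)
  also have "norm \<dots> \<le> norm (blinfun_apply B v) + norm (A - B)"
    using norm_blinfun[of "A - B" v] v by (intro order_trans[OF norm_triangle_ineq]) auto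
  finally show "conorm A - norm (A - B) \<le> norm (blinfun_apply B v)" by simp
qed

lemma continuous_on_conorm [continuous_intros]:
  fixes h :: "'b::topological_space \<Rightarrow> ('v::euclidean_space \<Rightarrow>\<^sub>L 'v)"
  assumes "continuous_on S h" shows "continuous_on S (\<lambda>x. conorm (h x))"
proof (rule continuous_on_compose2[OF _ assms])
  show "continuous_on (UNIV :: ('v \<Rightarrow>\<^sub>L 'v) set) conorm"
    unfolding continuous_on_iff
  proof (intro ballI allI impI)
    fix A :: "'v \<Rightarrow>\<^sub>L 'v" and e :: real assume "0 < e"
    have "dist (conorm B) (conorm A) \<le> dist B A" for B
      using conorm_lipschitz[of A B] conorm_lipschitz[of B A] by (simp add: dist_norm norm_minus_commute)
    then show "\<exists>d>0. \<forall>B\<in>UNIV. dist B A < d \<longrightarrow> dist (conorm B) (conorm A) < e"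
      using \<open>0 < e\<close> le_less_trans by blast
  qed
qed auto

lemma norm_le_of_conorm:
  fixes A B :: "'v::euclidean_space \<Rightarrow>\<^sub>L 'v"
  assumes "inverse_pair A B" "s \<le> conorm A" "0 < s"
  shows "norm B \<le> inverse s"
proof (rule norm_blinfun_bound)
  fix v
  have "s * norm (blinfun_apply B v) \<le> conorm A * norm (blinfun_apply B v)"
    using assms(2) by (intro mult_right_mono) auto
  also have "\<dots> \<le> norm v"
    using conorm_le[of A "blinfun_apply B v"] inverse_pair_apply(1)[OF assms(1)] by simp
  finally show "norm (blinfun_apply B v) \<le> inverse s * norm v"
    using assms(3) by (simp add: field_simps)
qed (use assms in simp)

lemma conorm_pos:
  fixes A B :: "'v::euclidean_space \<Rightarrow>\<^sub>L 'v"
  assumes "inverse_pair A B" shows "0 < conorm A"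
proof -
  have "B \<noteq> 0"
  proof
    assume "B = 0"
    moreover obtain v :: 'v where "norm v = 1" using unit_vectors_nonempty by auto
    ultimately show False using inverse_pair_apply(1)[OF assms, of v] by simp
  qed
  then have B: "0 < norm B" by simp
  have "inverse (norm B) \<le> conorm A"
  proof (rule conorm_greatest)
    fix v :: 'v assume "norm v = 1"
    then have "1 \<le> norm B * norm (blinfun_apply A v)"
      using norm_blinfun[of B "blinfun_apply A v"] inverse_pair_apply(2)[OF assms] by simp
    then show "inverse (norm B) \<le> norm (blinfun_apply A v)"
      using B by (simp add: field_simps)
  qed
  then show ?thesis using B by (meson less_le_trans positive_imp_inverse_positive)
qed

lemma C1aE:
  assumes "C1a \<alpha> f U"
  obtains C where "0 \<le> C" "\<And>x y. x \<in> U \<Longrightarrow> y \<in> U \<Longrightarrow> norm (Der f x - Der f y) \<le> C * dist x y powr \<alpha>"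
proof -
  obtain C where C: "\<And>x y. x \<in> U \<Longrightarrow> y \<in> U \<Longrightarrow> norm (Der f x - Der f y) \<le> C * dist x y powr \<alpha>"
    using assms by (auto simp: C1a_def)
  show thesis
  proof (rule that[of "\<bar>C\<bar>"])
    fix x y assume "x \<in> U" "y \<in> U"
    then have "norm (Der f x - Der f y) \<le> C * dist x y powr \<alpha>" by (rule C)
    also have "\<dots> \<le> \<bar>C\<bar> * dist x y powr \<alpha>" by (intro mult_right_mono) auto
    finally show "norm (Der f x - Der f y) \<le> \<bar>C\<bar> * dist x y powr \<alpha>" .
  qed simp
qed

lemma C1a_open: "C1a \<alpha> f U \<Longrightarrow> open U"
  by (simp add: C1a_def)

lemma C1a_differentiable: "C1a \<alpha> f U \<Longrightarrow> x \<in> U \<Longrightarrow> f differentiable (at x)"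
  by (simp add: C1a_def)

lemma C1a_continuous_on: "C1a \<alpha> f U \<Longrightarrow> continuous_on U f"
  by (simp add: C1a_def continuous_at_imp_continuous_on differentiable_imp_continuous_within)

lemma holder_continuous_on:
  fixes h :: "'v::metric_space \<Rightarrow> 'w::real_normed_vector"
  assumes "\<And>x y. x \<in> U \<Longrightarrow> y \<in> U \<Longrightarrow> norm (h x - h y) \<le> C * dist x y powr \<alpha>" "0 < \<alpha>"
  shows "continuous_on U h"
  unfolding continuous_on_def
proof
  fix x assume x: "x \<in> U"
  have "((\<lambda>y. C * dist y x powr \<alpha>) \<longlongrightarrow> C * dist x x powr \<alpha>) (at x within U)"
    by (intro tendsto_intros) (use assms(2) in auto)
  then have "((\<lambda>y. C * dist y x powr \<alpha>) \<longlongrightarrow> 0) (at x within U)" by simp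
  moreover have "\<forall>\<^sub>F y in at x within U. norm (h y - h x) \<le> C * dist y x powr \<alpha>"
    using assms(1) x by (auto simp: eventually_at_filter)
  ultimately have "((\<lambda>y. h y - h x) \<longlongrightarrow> 0) (at x within U)"
    by (rule Lim_null_comparison[rotated])
  then show "(h \<longlongrightarrow> h x) (at x within U)" by (rule LIM_zero_cancel)
qed

lemma C1a_Der_continuous_on: "C1a \<alpha> f U \<Longrightarrow> 0 < \<alpha> \<Longrightarrow> continuous_on U (Der f)"
  unfolding C1a_def by (blast intro: holder_continuous_on)

lemma Der_bounded:
  assumes "C1a \<alpha> f U" "V \<subseteq> U" "bounded V" "0 < \<alpha>"
  obtains B where "0 \<le> B" "\<And>x. x \<in> V \<Longrightarrow> norm (Der f x) \<le> B"
proof (cases "V = {}")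
  case True
  then show thesis by (intro that[of 0]) auto
next
  case False
  then obtain p where p: "p \<in> V" by auto
  obtain C where C: "0 \<le> C" "\<And>x y. x \<in> U \<Longrightarrow> y \<in> U \<Longrightarrow> norm (Der f x - Der f y) \<le> C * dist x y powr \<alpha>"
    using C1aE[OF assms(1)] by blast
  obtain d where d: "\<And>x. x \<in> V \<Longrightarrow> dist x p \<le> d"
    using assms(3) bounded_any_center[of V p] by (auto simp: dist_commute)
  show thesis
  proof (rule that[of "norm (Der f p) + C * d powr \<alpha>"])
    fix x assume x: "x \<in> V"
    have "norm (Der f x) \<le> norm (Der f p) + norm (Der f x - Der f p)"
      using norm_triangle_ineq[of "Der f p" "Der f x - Der f p"] by simp
    also have "norm (Der f x - Der f p) \<le> C * dist x p powr \<alpha>"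
      using x p assms(2) by (intro C) auto
    also have "\<dots> \<le> C * d powr \<alpha>"
      using d[OF x] C(1) assms(4) by (intro mult_left_mono powr_mono2) auto
    finally show "norm (Der f x) \<le> norm (Der f p) + C * d powr \<alpha>" by simp
  qed (use C in auto)
qed

lemma C1a_diffeo_inverse_pair:
  assumes "C1a_diffeo \<alpha> f U" "x \<in> U"
  shows "inverse_pair (Der (inv_into U f) (f x)) (Der f x)"
proof -
  have d1: "f differentiable (at x)" and d2: "inv_into U f differentiable (at (f x))"
    using assms by (auto simp: C1a_diffeo_def C1a_def)
  have inv: "inv_into U f (f x) = x"
    using assms by (simp add: C1a_diffeo_def)
  have "Der (inv_into U f \<circ> f) x = Der (\<lambda>x. x) x"
    by (rule Der_cong[of U]) (use assms in \<open>auto simp: C1a_diffeo_def C1a_def\<close>)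
  then have 1: "(Der (inv_into U f) (f x) o\<^sub>L Der f x) = id_blinfun"
    using Der_compose[OF d1 d2] by simp
  have "Der (f \<circ> inv_into U f) (f x) = Der (\<lambda>x. x) (f x)"
    by (rule Der_cong[of "f ` U"])
      (use assms in \<open>auto simp: C1a_diffeo_def C1a_def f_inv_into_f\<close>)
  then have "(Der f x o\<^sub>L Der (inv_into U f) (f x)) = id_blinfun"
    using Der_compose[of "inv_into U f" "f x" f] d1 d2 inv by simp
  with 1 show ?thesis by (simp add: inverse_pair_def)
qed

definition ib :: "('a::finite, 'd::finite) cantor \<Rightarrow> 'a \<Rightarrow> 'a \<Rightarrow> complex ^ 'd \<Rightarrow> complex ^ 'd" where
  "ib K a b = inv_into (Gstar K a) (expmap K)"

lemma trunc_simps [simp]: "trunc \<theta> 0 = [\<theta> 0]" "trunc \<theta> (Suc n) = \<theta> (Suc n) # trunc \<theta> n"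
  by (simp_all add: trunc_def)

lemma inv_branch_trunc: "inv_branch K (trunc \<theta> n) = branch (ib K) \<theta> n"
proof (induction n)
  case (Suc n)
  have "\<exists>w. trunc \<theta> n = \<theta> n # w" by (cases n) auto
  then obtain w where w: "trunc \<theta> n = \<theta> n # w" by blast
  show ?case
    using Suc.IH by (auto simp: w ib_def)
qed auto

text \<open>Base points make the pieces nonempty, and nearby Cantor sets inherit this.\<close>

locale hcantor =
  fixes \<alpha> :: real and K :: "('a::finite, 'd::finite) cantor"
  assumes \<alpha>_pos: "0 < \<alpha>" and bhc: "bunched_holomorphic_cantor \<alpha> K"
    and piece_ne: "piece K a \<noteq> {}"
begin

abbreviation g where "g \<equiv> expmap K"
abbreviation f where "f \<equiv> ib K"
abbreviation \<mu> where "\<mu> \<equiv> contr K"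

lemma regular: "regular_cantor \<alpha> K" and admissible: "admissible_radius \<alpha> K"
  and bunched: "bunched \<alpha> K" and holomorphic: "holomorphic_cantor K"
  using bhc by (auto simp: bunched_holomorphic_cantor_def)

lemma \<mu>: "0 < \<mu>" "\<mu> < 1"
  using regular by (auto simp: regular_cantor_def)

lemma rad_pos: "0 < rad K"
  using admissible by (simp add: admissible_radius_def)

lemma compact_piece: "compact (piece K a)" and connected_piece: "connected (piece K a)"
  using regular by (auto simp: regular_cantor_def)

lemma piece_Gstar: "piece K a \<subseteq> Gstar K a"
  by (simp add: Gstar_thicken subset_thicken rad_pos)

lemma open_Gstar [simp]: "open (Gstar K a)"
  by (simp add: Gstar_thicken)

lemma bounded_Gstar: "bounded (Gstar K a)"
  by (simp add: Gstar_thicken bounded_thicken compact_imp_bounded compact_piece)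

lemma Gstar_nbhd: "Gstar K a \<subseteq> nbhd K" and g_diffeo: "C1a_diffeo \<alpha> g (Gstar K a)"
  using admissible by (auto simp: admissible_radius_def)

lemma g_C1a: "C1a \<alpha> g (nbhd K)"
  using regular by (simp add: regular_cantor_def)

lemma g_differentiable: "x \<in> Gstar K a \<Longrightarrow> g differentiable (at x)"
  using g_C1a Gstar_nbhd C1a_differentiable by blast

lemma Gstar_disjoint: "x \<in> Gstar K a \<Longrightarrow> x \<in> Gstar K b \<Longrightarrow> a = b"
  using admissible unfolding admissible_radius_def by (metis IntI empty_iff)

lemma Gstar_cover: "(a, b) \<in> adm K \<Longrightarrow> Gstar K b \<subseteq> g ` Gstar K a"
  using admissible unfolding admissible_radius_def by metis

lemma adm_iff: "x \<in> Gstar K a \<Longrightarrow> g x \<in> Gstar K b \<Longrightarrow> (a, b) \<in> adm K"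
  using admissible unfolding admissible_radius_def by (metis IntI empty_iff imageI)

lemma piece_cover: "(a, b) \<in> adm K \<Longrightarrow> piece K b \<subseteq> g ` piece K a"
  using regular unfolding regular_cantor_def by metis

lemma f_g: "x \<in> Gstar K a \<Longrightarrow> f a b (g x) = x"
  using g_diffeo[of a] by (simp add: ib_def C1a_diffeo_def)

lemma f_in: "(a, b) \<in> adm K \<Longrightarrow> y \<in> Gstar K b \<Longrightarrow> f a b y \<in> Gstar K a"
  and g_f: "(a, b) \<in> adm K \<Longrightarrow> y \<in> Gstar K b \<Longrightarrow> g (f a b y) = y"
  using Gstar_cover[of a b] f_g by fastforce+

lemma f_piece: "(a, b) \<in> adm K \<Longrightarrow> y \<in> piece K b \<Longrightarrow> f a b y \<in> piece K a"
  using piece_cover[of a b] f_g piece_Gstar by fastforce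

lemma f_differentiable: "y \<in> g ` Gstar K a \<Longrightarrow> f a b differentiable (at y)"
  using g_diffeo[of a] by (auto simp: ib_def C1a_diffeo_def C1a_def)

lemma f_pair: "x \<in> Gstar K a \<Longrightarrow> inverse_pair (Der (f a b) (g x)) (Der g x)"
  unfolding ib_def by (rule C1a_diffeo_inverse_pair[OF g_diffeo])

lemma f_norm:
  assumes "x \<in> Gstar K a" shows "norm (Der (f a b) (g x)) \<le> \<mu>"
proof -
  have "inverse \<mu> \<le> conorm (Der g x)"
    using regular assms Gstar_nbhd[of a] unfolding regular_cantor_def by (meson less_imp_le subsetD)
  then show ?thesis
    using norm_le_of_conorm[OF inverse_pair_sym[OF f_pair[OF assms]], of "inverse \<mu>"] \<mu> by simp
qed

text \<open>
  Inverse branches contract by \<open>\<mu>\<close>, so they map a thickened piece well inside the thickening of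
  another piece.  The remaining room \<open>(1 - \<mu>) r\<close> is what a perturbation may use up.
\<close>

lemma f_thicken:
  assumes "(a, b) \<in> adm K" "r \<le> rad K" "y \<in> thicken r (piece K b)"
  shows "f a b y \<in> thicken (\<mu> * r) (piece K a)"
proof -
  obtain p where p: "p \<in> piece K b" "y \<in> ball p r" using assms(3) by (auto simp: thicken_def)
  have sub: "ball p r \<subseteq> g ` Gstar K a"
    using Gstar_cover[OF assms(1)] p assms(2) by (fastforce simp: Gstar_def)
  have r: "0 < r" using p(2) by (metis ball_empty empty_iff not_le_imp_less)
  have "norm (f a b p - f a b y) \<le> \<mu> * norm (p - y)"
  proof (rule norm_diff_le_on_ball[where f' = "Der (f a b)" and p = p and r = r])
    fix x assume "x \<in> ball p r"
    then obtain z where z: "z \<in> Gstar K a" "x = g z" using sub by auto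
    show "norm (Der (f a b) x) \<le> \<mu>" unfolding z(2) by (rule f_norm[OF z(1)])
    show "(f a b has_derivative blinfun_apply (Der (f a b) x)) (at x)"
      using z by (intro Der_works f_differentiable) auto
  qed (use p r in auto)
  also have "\<dots> < \<mu> * r"
    using p \<mu> by (simp add: dist_norm)
  finally show ?thesis
    using f_piece[OF assms(1) p(1)] by (auto simp: thicken_def dist_norm)
qed

lemma cantor_set_orbit: "x \<in> cantor_set K \<Longrightarrow> (g ^^ n) x \<in> cantor_set K"
  by (auto simp: cantor_set_def) (metis comp_apply funpow_add)

lemma cantor_set_letter: "x \<in> cantor_set K \<Longrightarrow> \<exists>a. x \<in> piece K a"
  unfolding cantor_set_def using funpow_0 by (metis INT_iff UNIV_I UN_iff vimage_eq)

lemma cantor_setI: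
  assumes "\<And>n. (g ^^ n) x \<in> piece K (s n)" shows "x \<in> cantor_set K"
  using assms by (auto simp: cantor_set_def)

lemma cantor_set_itinerary:
  assumes "x \<in> cantor_set K"
  obtains s where "\<And>n. (g ^^ n) x \<in> piece K (s n)" "\<And>n. (s n, s (Suc n)) \<in> adm K"
proof -
  have "\<forall>n. \<exists>a. (g ^^ n) x \<in> piece K a"
    using cantor_set_orbit[OF assms] cantor_set_letter by blast
  then obtain s where s: "\<And>n. (g ^^ n) x \<in> piece K (s n)" by metis
  moreover have "(s n, s (Suc n)) \<in> adm K" for n
    using s[of n] s[of "Suc n"] piece_Gstar by (intro adm_iff[of "(g ^^ n) x"]) auto
  ultimately show thesis using that by blast
qed

lemma f_cantor:
  assumes "(a, b) \<in> adm K" "y \<in> cantor_piece K b"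
  shows "f a b y \<in> cantor_piece K a"
proof -
  have y: "y \<in> piece K b" "y \<in> cantor_set K" using assms(2) by (auto simp: cantor_piece_def)
  have *: "(g ^^ Suc n) (f a b y) = (g ^^ n) y" for n
    using g_f[OF assms(1), of y] y piece_Gstar[of b] by (simp add: funpow_Suc_right subset_iff del: funpow.simps)
  have "(g ^^ n) (f a b y) \<in> (\<Union>a. piece K a)" for n
  proof (cases n)
    case 0
    then show ?thesis using f_piece[OF assms(1) y(1)] by auto
  next
    case (Suc m)
    then show ?thesis using y(2) * by (auto simp: cantor_set_def)
  qed
  then show ?thesis
    using f_piece[OF assms(1) y(1)] by (auto simp: cantor_piece_def cantor_set_def)
qed

lemma branch_cantor:
  assumes "left_seq (adm K) \<theta>" "y \<in> cantor_piece K (\<theta> 0)"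
  shows "branch f \<theta> n y \<in> cantor_piece K (\<theta> n)"
proof (induction n)
  case (Suc n)
  then show ?case using f_cantor[of "\<theta> (Suc n)" "\<theta> n"] assms(1) by (auto simp: left_seq_def)
qed (use assms in simp)

lemma Der_g_GLC: "x \<in> cantor_set K \<Longrightarrow> Der g x \<in> GLC"
  using holomorphic by (simp add: holomorphic_cantor_def)

lemma dbranch_GLC:
  assumes "left_seq (adm K) \<theta>" "y \<in> cantor_piece K (\<theta> 0)"
  shows "dbranch f \<theta> n y \<in> GLC"
proof (induction n)
  case (Suc n)
  have R: "(\<theta> (Suc n), \<theta> n) \<in> adm K" using assms by (simp add: left_seq_def)
  have x: "branch f \<theta> (Suc n) y \<in> cantor_piece K (\<theta> (Suc n))"
    and x': "branch f \<theta> n y \<in> cantor_piece K (\<theta> n)"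
    using branch_cantor[OF assms] by blast+
  have "g (branch f \<theta> (Suc n) y) = branch f \<theta> n y"
    using g_f[OF R, of "branch f \<theta> n y"] x' piece_Gstar by (auto simp: cantor_piece_def)
  then have "inverse_pair (Der g (branch f \<theta> (Suc n) y)) (Der (f (\<theta> (Suc n)) (\<theta> n)) (branch f \<theta> n y))"
    using f_pair[of "branch f \<theta> (Suc n) y" "\<theta> (Suc n)" "\<theta> n"] x piece_Gstar
    by (auto simp: cantor_piece_def intro: inverse_pair_sym simp del: branch.simps)
  then have "Der (f (\<theta> (Suc n)) (\<theta> n)) (branch f \<theta> n y) \<in> GLC"
    using Der_g_GLC x by (auto simp: cantor_piece_def intro: GLC_inverse_pair simp del: branch.simps)
  then show ?case using Suc.IH by (simp add: GLC_compose)
qed (simp add: GLC_id)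

lemma g_continuous_pieces: "continuous_on (\<Union>a. piece K a) g"
proof -
  have "(\<Union>a. piece K a) \<subseteq> nbhd K" using piece_Gstar Gstar_nbhd by blast
  then show ?thesis using C1a_continuous_on[OF g_C1a] continuous_on_subset by blast
qed

lemma compact_cantor_set: "compact (cantor_set K)"
proof -
  let ?P = "\<Union>a. piece K a"
  have P: "compact ?P" by (intro compact_UN) (auto simp: compact_piece)
  define C where "C n = (\<Inter>i\<le>n. (g ^^ i) -` ?P)" for n
  have "closed (C n)" for n
  proof (induction n)
    case 0
    then show ?case using compact_imp_closed[OF P] by (simp add: C_def)
  next
    case (Suc n)
    have "C (Suc n) = ?P \<inter> g -` C n"
    proof -
      have "x \<in> C m \<longleftrightarrow> (\<forall>i\<le>m. (g ^^ i) x \<in> ?P)" for x m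
        unfolding C_def by auto
      then show ?thesis by (intro set_eqI) (simp add: all_le_Suc funpow_Suc_right del: funpow.simps(2))
    qed
    then show ?case
      using continuous_closed_preimage[OF g_continuous_pieces compact_imp_closed[OF P] Suc.IH] by simp
  qed
  then have "closed (\<Inter>n. C n)" by blast
  moreover have "(\<Inter>n. C n) = cantor_set K" by (auto simp: C_def cantor_set_def)
  ultimately have "closed (cantor_set K)" by simp
  moreover have "cantor_set K \<subseteq> ?P" using cantor_set_letter by blast
  ultimately show ?thesis using P by (metis compact_Int_closed inf.absorb_iff2)
qed

lemma compact_cantor_piece: "compact (cantor_piece K a)"
  unfolding cantor_piece_def by (intro compact_Int compact_cantor_set compact_piece)

text \<open>
  The points that follow the itinerary for \<open>n\<close> steps form a decreasing sequence of compact sets; they are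
  nonempty because the image of each piece covers the next one.
\<close>

lemma itinerary_point:
  assumes "\<And>n. (s n, s (Suc n)) \<in> adm K"
  obtains x where "\<And>n. (g ^^ n) x \<in> piece K (s n)"
proof -
  define C where "C n s = {x. \<forall>i\<le>n. (g ^^ i) x \<in> piece K (s i)}" for n and s :: "nat \<Rightarrow> 'a"
  have C_Suc: "C (Suc n) s = piece K (s 0) \<inter> g -` C n (\<lambda>i. s (Suc i))" for n s
  proof -
    show ?thesis
      unfolding C_def by (intro set_eqI) (simp add: all_le_Suc funpow_Suc_right del: funpow.simps(2))
  qed
  have cl: "closed (C n s)" for n s
  proof (induction n arbitrary: s)
    case 0
    then show ?case using compact_imp_closed[OF compact_piece] by (simp add: C_def)
  next
    case (Suc n)
    have "continuous_on (piece K (s 0)) g"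
      using g_continuous_pieces by (rule continuous_on_subset) auto
    then show ?case
      unfolding C_Suc by (rule continuous_closed_preimage[OF _ compact_imp_closed[OF compact_piece] Suc.IH])
  qed
  have ne: "C n s \<noteq> {}" if "\<And>n. (s n, s (Suc n)) \<in> adm K" for n s
    using that
  proof (induction n arbitrary: s)
    case 0
    then show ?case using piece_ne by (auto simp: C_def)
  next
    case (Suc n)
    obtain y where y: "y \<in> C n (\<lambda>i. s (Suc i))" using Suc.IH[of "\<lambda>i. s (Suc i)"] Suc.prems by auto
    then have "y \<in> piece K (s (Suc 0))" by (auto simp: C_def dest: spec[of _ 0])
    then obtain x where "x \<in> piece K (s 0)" "g x = y" using piece_cover[OF Suc.prems[of 0]] by auto
    then have "x \<in> C (Suc n) s" using y by (auto simp: C_Suc)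
    then show ?case by auto
  qed
  have "(\<Inter>n. C n s) \<noteq> {}"
  proof (rule compact_nest)
    fix n
    have "C n s \<subseteq> piece K (s 0)" by (auto simp: C_def dest: spec[of _ 0])
    then show "compact (C n s)" using compact_piece cl by (metis compact_Int_closed inf.absorb_iff2)
    show "C n s \<noteq> {}" by (rule ne) (rule assms)
  next
    fix m n :: nat assume "m \<le> n" then show "C n s \<subseteq> C m s" by (auto simp: C_def)
  qed
  then obtain x where "\<And>n. x \<in> C n s" by auto
  then have "(g ^^ n) x \<in> piece K (s n)" for n by (auto simp: C_def)
  then show thesis by (rule that)
qed

end

section \<open>Bunching with a margin\<close>

context hcantor begin

lemma Der_g_bound: obtains \<Gamma> where "1 \<le> \<Gamma>" "\<And>a x. x \<in> Gstar K a \<Longrightarrow> norm (Der g x) \<le> \<Gamma>"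
proof -
  have "bounded (\<Union>a. Gstar K a)" by (auto simp: bounded_Gstar)
  moreover have "(\<Union>a. Gstar K a) \<subseteq> nbhd K" using Gstar_nbhd by blast
  ultimately obtain B where "\<And>x. x \<in> (\<Union>a. Gstar K a) \<Longrightarrow> norm (Der g x) \<le> B"
    using Der_bounded[OF g_C1a _ _ \<alpha>_pos] by metis
  then show thesis by (intro that[of "max 1 B"]) (auto simp: le_max_iff_disj)
qed

lemma Der_g_holder:
  obtains H where "0 \<le> H"
    "\<And>a b x y. x \<in> Gstar K a \<Longrightarrow> y \<in> Gstar K b \<Longrightarrow> norm (Der g x - Der g y) \<le> H * dist x y powr \<alpha>"
  using C1aE[OF g_C1a] Gstar_nbhd by (metis subsetD)

lemma inner_diameter_pieces:
  assumes "0 < r"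
  obtains M where "0 < M"
    "\<And>a (\<phi> :: complex ^ 'd \<Rightarrow> complex ^ 'd) \<phi>' B x y.
       (\<And>x. x \<in> thicken r (piece K a) \<Longrightarrow> (\<phi> has_derivative blinfun_apply (\<phi>' x)) (at x)) \<Longrightarrow>
       (\<And>x. x \<in> thicken r (piece K a) \<Longrightarrow> norm (\<phi>' x) \<le> B) \<Longrightarrow>
       x \<in> thicken r (piece K a) \<Longrightarrow> y \<in> thicken r (piece K a) \<Longrightarrow> norm (\<phi> x - \<phi> y) \<le> M * B"
proof -
  have "\<forall>a. \<exists>M. 0 < M \<and> (\<forall>(\<phi> :: complex ^ 'd \<Rightarrow> complex ^ 'd) \<phi>' B x y.
       (\<forall>x\<in>thicken r (piece K a). (\<phi> has_derivative blinfun_apply (\<phi>' x)) (at x)) \<longrightarrow>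
       (\<forall>x\<in>thicken r (piece K a). norm (\<phi>' x) \<le> B) \<longrightarrow>
       x \<in> thicken r (piece K a) \<longrightarrow> y \<in> thicken r (piece K a) \<longrightarrow> norm (\<phi> x - \<phi> y) \<le> M * B)"
  proof
    fix a
    obtain M where M: "0 < M" "\<And>(f::complex ^ 'd \<Rightarrow> complex ^ 'd) f' B x y.
       (\<And>x. x \<in> thicken r (piece K a) \<Longrightarrow> (f has_derivative blinfun_apply (f' x)) (at x)) \<Longrightarrow>
       (\<And>x. x \<in> thicken r (piece K a) \<Longrightarrow> norm (f' x) \<le> B) \<Longrightarrow> x \<in> thicken r (piece K a) \<Longrightarrow>
       y \<in> thicken r (piece K a) \<Longrightarrow> norm (f x - f y) \<le> M * B"
      using inner_diameter[OF compact_piece connected_piece assms] by blast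
    show "\<exists>M. 0 < M \<and> (\<forall>(\<phi> :: complex ^ 'd \<Rightarrow> complex ^ 'd) \<phi>' B x y.
       (\<forall>x\<in>thicken r (piece K a). (\<phi> has_derivative blinfun_apply (\<phi>' x)) (at x)) \<longrightarrow>
       (\<forall>x\<in>thicken r (piece K a). norm (\<phi>' x) \<le> B) \<longrightarrow>
       x \<in> thicken r (piece K a) \<longrightarrow> y \<in> thicken r (piece K a) \<longrightarrow> norm (\<phi> x - \<phi> y) \<le> M * B)"
      by (intro exI[of _ M] conjI allI impI M(1), rule M(2)) blast+
  qed
  then obtain M where M: "\<And>a. 0 < M a"
    "\<And>a (\<phi> :: complex ^ 'd \<Rightarrow> complex ^ 'd) \<phi>' B x y.
       (\<forall>x\<in>thicken r (piece K a). (\<phi> has_derivative blinfun_apply (\<phi>' x)) (at x)) \<Longrightarrow>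
       (\<forall>x\<in>thicken r (piece K a). norm (\<phi>' x) \<le> B) \<Longrightarrow>
       x \<in> thicken r (piece K a) \<Longrightarrow> y \<in> thicken r (piece K a) \<Longrightarrow> norm (\<phi> x - \<phi> y) \<le> M a * B"
    by metis
  show thesis
  proof (rule that[of "Max (range M)"])
    have le: "M a \<le> Max (range M)" for a by (intro Max_ge) auto
    show "0 < Max (range M)" using M(1) le by (meson less_le_trans)
    fix a and \<phi> :: "complex ^ 'd \<Rightarrow> complex ^ 'd" and \<phi>' B x y
    assume *: "\<And>x. x \<in> thicken r (piece K a) \<Longrightarrow> (\<phi> has_derivative blinfun_apply (\<phi>' x)) (at x)"
      "\<And>x. x \<in> thicken r (piece K a) \<Longrightarrow> norm (\<phi>' x) \<le> B"
      "x \<in> thicken r (piece K a)" "y \<in> thicken r (piece K a)"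
    then have "norm (\<phi> x - \<phi> y) \<le> M a * B" using M(2)[of a \<phi> \<phi>' B x y] by blast
    also have "\<dots> \<le> Max (range M) * B"
      by (rule mult_right_mono[OF le order_trans[OF norm_ge_zero *(2)[OF *(3)]]])
    finally show "norm (\<phi> x - \<phi> y) \<le> Max (range M) * B" .
  qed
qed

lemma funpow_g_differentiable:
  assumes "z \<in> cantor_set K"
  shows "(g ^^ n) differentiable (at z)"
    and "Der (g ^^ Suc n) z = (Der (g ^^ n) (g z) o\<^sub>L Der g z)"
proof -
  have g: "g differentiable (at z)" if "z \<in> cantor_set K" for z
    using cantor_set_letter[OF that] piece_Gstar g_differentiable by blast
  have *: "(g ^^ n) differentiable (at z)" if "z \<in> cantor_set K" for n z
    using that
  proof (induction n arbitrary: z)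
    case (Suc n)
    have "((g ^^ n) \<circ> g) differentiable (at z)"
      by (intro differentiable_chain_at g Suc) (use cantor_set_orbit[OF Suc.prems, of 1] in simp)
    then show ?case by (simp only: funpow_Suc_right)
  qed (simp add: id_def)
  show "(g ^^ n) differentiable (at z)" by (rule *[OF assms])
  have "g z \<in> cantor_set K" using cantor_set_orbit[OF assms, of 1] by simp
  from Der_compose[OF g[OF assms] *[OF this, of n]]
  show "Der (g ^^ Suc n) z = (Der (g ^^ n) (g z) o\<^sub>L Der g z)"
    by (simp only: funpow_Suc_right)
qed

lemma continuous_on_Der_funpow: "continuous_on (cantor_set K) (Der (g ^^ n))"
proof (induction n)
  case 0
  then show ?case by (simp add: id_def)
next
  case (Suc n)
  have sub: "cantor_set K \<subseteq> (\<Union>a. piece K a)"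
    using cantor_set_letter by blast
  have nb: "cantor_set K \<subseteq> nbhd K"
    using cantor_set_letter subsetD[OF piece_Gstar] subsetD[OF Gstar_nbhd] by blast
  have "continuous_on (cantor_set K) (\<lambda>z. Der (g ^^ n) (g z) o\<^sub>L Der g z)"
  proof (intro bounded_bilinear.continuous_on[OF bounded_bilinear_blinfun_compose])
    show "continuous_on (cantor_set K) (\<lambda>z. Der (g ^^ n) (g z))"
      by (rule continuous_on_compose2[OF Suc.IH continuous_on_subset[OF g_continuous_pieces sub]])
        (use cantor_set_orbit[of _ 1] in auto)
    show "continuous_on (cantor_set K) (Der g)"
      using C1a_Der_continuous_on[OF g_C1a \<alpha>_pos] nb by (rule continuous_on_subset)
  qed
  then show ?case
    by (rule continuous_on_eq) (simp only: funpow_g_differentiable)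
qed

lemma branches_Gstar:
  assumes "1 \<le> \<Gamma>" "\<And>a x. x \<in> Gstar K a \<Longrightarrow> norm (Der g x) \<le> \<Gamma>"
  shows "branches (adm K) (Gstar K) f g \<mu> \<Gamma>"
proof
  fix a b y assume R: "(a, b) \<in> adm K" and y: "y \<in> Gstar K b"
  show "f a b y \<in> Gstar K a" by (rule f_in[OF R y])
  then show "norm (Der g (f a b y)) \<le> \<Gamma>" by (rule assms)
  note x = f_in[OF R y] g_f[OF R y]
  show "(f a b has_derivative blinfun_apply (Der (f a b) y)) (at y)"
    by (intro Der_works f_differentiable) (use x in force)
  show "inverse_pair (Der (f a b) y) (Der g (f a b y))"
    using f_pair[OF x(1), of b] x(2) by simp
  show "norm (Der (f a b) y) \<le> \<mu>"
    using f_norm[OF x(1), of b] x(2) by simp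
qed (use \<mu> assms(1) in auto)

lemma branch_inverse_pair:
  assumes "left_seq (adm K) \<theta>" "x \<in> Gstar K (\<theta> 0)"
  shows "inverse_pair (dbranch f \<theta> n x) (ibranch f g \<theta> n x)"
proof -
  obtain \<Gamma> where "1 \<le> \<Gamma>" "\<And>a x. x \<in> Gstar K a \<Longrightarrow> norm (Der g x) \<le> \<Gamma>"
    using Der_g_bound by blast
  then interpret branches "adm K" "Gstar K" f g \<mu> \<Gamma> by (rule branches_Gstar)
  show ?thesis by (rule branch_inverse_pair[OF assms])
qed

text \<open>The bunching condition speaks of the derivative of \<open>g\<^sup>N\<close>, the distortion estimates of the product of derivatives.\<close>

lemma ibranch_eq_Der_funpow:
  assumes "left_seq (adm K) \<theta>" "y \<in> cantor_piece K (\<theta> 0)"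
  shows "ibranch f g \<theta> n y = Der (g ^^ n) (branch f \<theta> n y)"
proof (induction n)
  case 0
  then show ?case by (simp add: id_def)
next
  case (Suc n)
  have "branch f \<theta> (Suc n) y \<in> cantor_set K"
    using branch_cantor[OF assms, of "Suc n"] unfolding cantor_piece_def by blast
  moreover have "g (branch f \<theta> (Suc n) y) = branch f \<theta> n y"
    using g_f[of "\<theta> (Suc n)" "\<theta> n" "branch f \<theta> n y"] branch_cantor[OF assms, of n] piece_Gstar assms(1)
    unfolding cantor_piece_def left_seq_def by auto
  ultimately show ?case
    using Suc.IH funpow_g_differentiable(2)[of "branch f \<theta> (Suc n) y" n]
    by (simp del: funpow.simps branch.simps)
qed

text \<open>
  Bunching is a strict inequality between continuous functions on a compact set, so it holds with a
  margin.  The length \<open>N\<close> is positive since for \<open>N = 0\<close> the left-hand side of the inequality is \<open>1\<close>.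
\<close>

lemma bunched_blocks:
  assumes "cantor_set K \<noteq> {}"
  obtains N \<rho> where "0 < N" "0 < \<rho>" "\<rho> < 1"
    "\<And>\<theta> y. left_seq (adm K) \<theta> \<Longrightarrow> y \<in> cantor_piece K (\<theta> 0) \<Longrightarrow>
      norm (dbranch f \<theta> N y) * norm (ibranch f g \<theta> N y) * (\<mu> ^ N) powr \<alpha> \<le> \<rho>"
proof -
  obtain N where N: "\<And>z. z \<in> cantor_set K \<Longrightarrow>
      norm (Der (g ^^ N) z) * inverse (conorm (Der (g ^^ N) z)) * \<mu> powr (\<alpha> * real N) < 1"
    using bunched unfolding bunched_def by blast
  define q where "q z = norm (Der (g ^^ N) z) * inverse (conorm (Der (g ^^ N) z)) * (\<mu> ^ N) powr \<alpha>" for z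
  have pw: "\<mu> powr (\<alpha> * real N) = (\<mu> ^ N) powr \<alpha>"
    using \<mu> by (simp add: powr_powr mult.commute flip: powr_realpow)
  have q: "q z < 1" if "z \<in> cantor_set K" for z
    using N[OF that] by (simp add: q_def pw)
  have pair: "\<exists>B. inverse_pair (Der (g ^^ n) z) B" if "z \<in> cantor_set K" for n z
    using that
  proof (induction n arbitrary: z)
    case (Suc n)
    obtain A where "inverse_pair (Der (g ^^ n) (g z)) A"
      using Suc.IH[of "g z"] cantor_set_orbit[OF Suc.prems, of 1] by auto
    moreover obtain B where "inverse_pair (Der g z) B"
      using GLC_inverse_exists[OF Der_g_GLC[OF Suc.prems]] by blast
    ultimately show ?case
      unfolding funpow_g_differentiable(2)[OF Suc.prems] by (blast intro: inverse_pair_compose)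
  qed (auto simp: id_def intro: inverse_pair_id)
  have "conorm (Der (g ^^ N) z) \<noteq> 0" if "z \<in> cantor_set K" for z
    using pair[OF that, of N] conorm_pos by (metis less_irrefl)
  then have "continuous_on (cantor_set K) q"
    unfolding q_def by (intro continuous_intros continuous_on_Der_funpow ballI)
  then have qc: "continuous_on (cantor_set K) q" .
  obtain \<rho>0 where \<rho>0: "\<rho>0 < 1" "\<And>z. z \<in> cantor_set K \<Longrightarrow> q z \<le> \<rho>0"
  proof (cases "cantor_set K = {}")
    case False
    then obtain z0 where "z0 \<in> cantor_set K" "\<forall>z\<in>cantor_set K. q z \<le> q z0"
      using continuous_attains_sup[OF compact_cantor_set False qc] by blast
    then show thesis using that[of "q z0"] q by blast
  qed (use assms in auto)
  show thesis
  proof (rule that[of N "max \<rho>0 (1/2)"])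
    show "0 < N"
    proof (rule ccontr)
      assume "\<not> 0 < N"
      have False if z: "z \<in> cantor_set K" for z
      proof -
        let ?I = "id_blinfun :: (complex ^ 'd) \<Rightarrow>\<^sub>L (complex ^ 'd)"
        obtain v :: "complex ^ 'd" where "norm v = 1" using unit_vectors_nonempty by auto
        then have "conorm ?I \<le> 1" using conorm_le[of ?I v] by simp
        moreover have "1 \<le> conorm ?I" by (rule conorm_greatest) simp
        ultimately show False using q[OF z] \<open>\<not> 0 < N\<close> \<mu> by (simp add: q_def id_def)
      qed
      then show False using assms by blast
    qed
    fix \<theta> y assume *: "left_seq (adm K) \<theta>" "y \<in> cantor_piece K (\<theta> 0)"
    define z where "z = branch f \<theta> N y"
    have z: "z \<in> cantor_set K" using branch_cantor[OF *, of N] by (simp add: z_def cantor_piece_def)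
    have i: "ibranch f g \<theta> N y = Der (g ^^ N) z" using ibranch_eq_Der_funpow[OF *] by (simp add: z_def)
    have "inverse_pair (dbranch f \<theta> N y) (Der (g ^^ N) z)"
      using branch_inverse_pair[OF *(1), of y N] *(2) piece_Gstar by (auto simp: i cantor_piece_def)
    then have p: "inverse_pair (Der (g ^^ N) z) (dbranch f \<theta> N y)" by (rule inverse_pair_sym)
    have "norm (dbranch f \<theta> N y) \<le> inverse (conorm (Der (g ^^ N) z))"
      by (rule norm_le_of_conorm[OF p order_refl conorm_pos[OF p]])
    then have "norm (dbranch f \<theta> N y) * norm (ibranch f g \<theta> N y) * (\<mu> ^ N) powr \<alpha> \<le> q z"
      unfolding i q_def by (subst mult.commute[of "norm (dbranch f \<theta> N y)"]) (intro mult_right_mono mult_left_mono; simp)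
    also have "\<dots> \<le> max \<rho>0 (1/2)" using \<rho>0(2)[OF z] by simp
    finally show "norm (dbranch f \<theta> N y) * norm (ibranch f g \<theta> N y) * (\<mu> ^ N) powr \<alpha> \<le> max \<rho>0 (1/2)" .
  qed (use \<rho>0(1) in auto)
qed

end

section \<open>Complex affine maps\<close>

definition mat_of :: "((complex ^ 'd::finite) \<Rightarrow>\<^sub>L (complex ^ 'd)) \<Rightarrow> complex ^ 'd ^ 'd" where
  "mat_of A = (\<chi> i j. blinfun_apply A (axis j 1) $ i)"

lemma norm_axis_complex: "norm (axis j (1::complex) :: complex ^ 'd::finite) = 1"
proof -
  have "(\<Sum>i\<in>UNIV. (norm ((axis j (1::complex) :: complex ^ 'd) $ i))\<^sup>2) = (\<Sum>i\<in>UNIV. if i = j then 1 else 0)"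
    by (intro sum.cong) (auto simp: axis_def)
  then show ?thesis by (simp add: norm_vec_def L2_set_def)
qed

lemma norm_mat_of:
  fixes A :: "(complex ^ 'd::finite) \<Rightarrow>\<^sub>L (complex ^ 'd)"
  shows "norm (mat_of A) \<le> (real CARD('d))^2 * norm A"
proof -
  have l1: "norm x \<le> (\<Sum>i\<in>UNIV. norm (x $ i))" for x :: "'w::real_normed_vector ^ 'd"
    by (simp add: norm_vec_def L2_set_le_sum)
  have e: "norm (blinfun_apply A (axis j 1) $ i) \<le> norm A" for i j
  proof -
    have "norm (blinfun_apply A (axis j 1) $ i) \<le> norm (blinfun_apply A (axis j 1))"
      by (rule Finite_Cartesian_Product.norm_nth_le)
    also have "\<dots> \<le> norm A" using norm_blinfun[of A "axis j 1"] by (simp add: norm_axis_complex)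
    finally show ?thesis .
  qed
  have "norm (mat_of A) \<le> (\<Sum>i\<in>UNIV. norm (mat_of A $ i))" by (rule l1)
  also have "\<dots> \<le> (\<Sum>i\<in>(UNIV::'d set). \<Sum>j\<in>(UNIV::'d set). norm A)"
    by (intro sum_mono order_trans[OF l1]) (simp add: mat_of_def e)
  finally show ?thesis by (simp add: power2_eq_square mult_ac)
qed

lemma mat_of_diff: "mat_of (A - B) = mat_of A - mat_of B"
  by (simp add: mat_of_def vec_eq_iff blinfun.bilinear_simps)

lemma matrix_vector_axis: "(M *v axis j 1) $ i = M $ i $ j" for M :: "complex ^ 'd::finite ^ 'd"
  by (simp add: matrix_vector_mult_def axis_def if_distrib[of "(*) _"] cong: if_cong)

lemma mat_of_eqI: "(\<And>v. blinfun_apply A v = M *v v) \<Longrightarrow> mat_of A = M"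
  by (simp add: mat_of_def vec_eq_iff matrix_vector_axis)

lemma mat_of_apply: "A \<in> GLC \<Longrightarrow> mat_of A *v v = blinfun_apply A v"
  using mat_of_eqI by (fastforce simp: GLC_def)

lemma invertible_mat_of: "A \<in> GLC \<Longrightarrow> invertible (mat_of A)"
  using mat_of_eqI by (fastforce simp: GLC_def)

lemma matrix_eq_iff_vec: "(\<And>v. M *v v = N *v v) \<Longrightarrow> M = N" for M N :: "complex ^ 'd::finite ^ 'd"
  by (metis matrix_vector_axis vec_eq_iff)

lemma mat_of_compose: "A \<in> GLC \<Longrightarrow> B \<in> GLC \<Longrightarrow> mat_of (A o\<^sub>L B) = mat_of A ** mat_of B"
  by (rule mat_of_eqI) (simp add: mat_of_apply flip: matrix_vector_mul_assoc)

lemma mat_of_inverse: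
  assumes "A \<in> GLC" "inverse_pair A B"
  shows "matrix_inv (mat_of A) = mat_of B"
proof -
  have B: "B \<in> GLC" by (rule GLC_inverse_pair[OF assms])
  have "mat_of id_blinfun = (mat 1 :: complex ^ 'a ^ 'a)" by (rule mat_of_eqI) simp
  then have "mat_of A ** mat_of B = mat 1" "mat_of B ** mat_of A = mat 1"
    using assms B by (simp_all add: inverse_pair_def flip: mat_of_compose)
  then show ?thesis
    by (metis matrix_inv_both(2)[OF invertible_mat_of[OF assms(1)]] matrix_mul_assoc matrix_mul_lid matrix_mul_rid)
qed

lemma bounded_linear_mv: "bounded_linear (\<lambda>v. M *v v)" for M :: "complex ^ 'd::finite ^ 'd"
proof -
  have "linear (\<lambda>v. M *v v)"
    by (rule linearI) (simp_all add: vec_eq_iff matrix_vector_mult_def scaleR_sum_right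
        distrib_left sum.distrib)
  then show ?thesis by (simp add: linear_conv_bounded_linear)
qed

definition blin_of :: "complex ^ 'd::finite ^ 'd \<Rightarrow> ((complex ^ 'd) \<Rightarrow>\<^sub>L (complex ^ 'd))" where
  "blin_of M = Blinfun (\<lambda>v. M *v v)"

lemma blin_of_apply [simp]: "blinfun_apply (blin_of M) v = M *v v"
  by (simp add: blin_of_def bounded_linear_Blinfun_apply bounded_linear_mv)

lemma mat_of_blin_of [simp]: "mat_of (blin_of M) = M"
  by (rule mat_of_eqI) simp

lemma mat_of_tendsto:
  fixes A :: "'t \<Rightarrow> ((complex ^ 'd::finite) \<Rightarrow>\<^sub>L (complex ^ 'd))"
  shows "((\<lambda>t. A t - X t) \<longlongrightarrow> 0) F \<Longrightarrow> ((\<lambda>t. mat_of (A t) - mat_of (X t)) \<longlongrightarrow> 0) F"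
proof -
  assume "((\<lambda>t. A t - X t) \<longlongrightarrow> 0) F"
  then have "((\<lambda>t. (real CARD('d))^2 * norm (A t - X t)) \<longlongrightarrow> 0) F"
    using tendsto_mult_right_zero tendsto_norm_zero by blast
  then show ?thesis
    by (rule Lim_null_comparison[rotated]) (simp add: norm_mat_of flip: mat_of_diff)
qed

text \<open>
  Complex linearity is a closed condition; invertibility of the limit is not automatic and enters
  through \<open>B\<close>.
\<close>

lemma GLC_limit:
  assumes "\<And>n. A n \<in> GLC" "A \<longlonglongrightarrow> L" "inverse_pair L B"
  shows "L \<in> GLC"
proof -
  have L: "blinfun_apply L v = mat_of L *v v" for v
  proof (rule vec_eq_iff[THEN iffD2], rule allI)
    fix i
    have ap: "(\<lambda>n. blinfun_apply (A n) w $ j) \<longlonglongrightarrow> blinfun_apply L w $ j" for w j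
      by (intro tendsto_intros assms(2))
    have "(\<lambda>n. \<Sum>j\<in>UNIV. blinfun_apply (A n) (axis j 1) $ i * v $ j)
        \<longlonglongrightarrow> (\<Sum>j\<in>UNIV. blinfun_apply L (axis j 1) $ i * v $ j)"
      by (intro tendsto_intros assms(2))
    then have "(\<lambda>n. (mat_of (A n) *v v) $ i) \<longlonglongrightarrow> (mat_of L *v v) $ i"
      by (simp add: matrix_vector_mult_def mat_of_def)
    then have "(\<lambda>n. blinfun_apply (A n) v $ i) \<longlonglongrightarrow> (mat_of L *v v) $ i"
      by (simp add: mat_of_apply[OF assms(1)])
    with ap show "blinfun_apply L v $ i = (mat_of L *v v) $ i"
      by (blast intro: LIMSEQ_unique)
  qed
  have "inj ((*v) (mat_of L))"
    by (rule injI) (metis L assms(3) inverse_pair_apply(2))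
  then have "invertible (mat_of L)"
    by (simp add: invertible_left_inverse matrix_left_invertible_injective)
  then show ?thesis using L by (auto simp: GLC_def)
qed

text \<open>A one-jet \<open>(p, q, X)\<close> as an affine map, meaningful only if the real linear map \<open>X\<close> is complex linear.\<close>

definition aff_of :: "((complex ^ 'd::finite) \<Rightarrow>\<^sub>L (complex ^ 'd)) \<Rightarrow> complex ^ 'd \<Rightarrow> complex ^ 'd \<Rightarrow> 'd aff" where
  "aff_of X p q = (mat_of X, q - blinfun_apply X p)"

lemma aff_of_Aff: "X \<in> GLC \<Longrightarrow> aff_of X p q \<in> Aff"
  by (simp add: aff_of_def Aff_def invertible_mat_of)

lemma aff_of_app: "X \<in> GLC \<Longrightarrow> aff_app (aff_of X p q) x = q + blinfun_apply X (x - p)"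
  by (simp add: aff_of_def aff_app_def mat_of_apply blinfun.bilinear_simps)

lemma aff_of_inv_comp:
  assumes "X \<in> GLC" "Y \<in> GLC" "inverse_pair X Xi"
  shows "aff_comp (aff_inv (aff_of X p q)) (aff_of Y p' q')
    = aff_of (Xi o\<^sub>L Y) p' (p + blinfun_apply Xi (q' - q))"
proof -
  have Xi: "Xi \<in> GLC" by (rule GLC_inverse_pair[OF assms(1,3)])
  show ?thesis
    using inverse_pair_apply(2)[OF assms(3)]
    by (simp add: aff_of_def aff_comp_def aff_inv_def mat_of_inverse[OF assms(1,3)] mat_of_compose Xi assms(2)
        mat_of_apply blinfun.bilinear_simps algebra_simps)
qed

lemma aff_of_tendsto:
  assumes "((\<lambda>t. X t - Y t) \<longlongrightarrow> 0) F" "((\<lambda>t. q t - r t) \<longlongrightarrow> 0) F" "\<forall>\<^sub>F t in F. norm (p t) \<le> C"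
    and "\<forall>\<^sub>F t in F. norm (Y t) \<le> C'"
  shows "((\<lambda>t. aff_of (X t) (p t) (q t) - aff_of (Y t) (p t) (r t)) \<longlongrightarrow> 0) F"
proof -
  have "((\<lambda>t. blinfun_apply (X t) (p t) - blinfun_apply (Y t) (p t)) \<longlongrightarrow> 0) F"
    by (rule tendsto_apply_diff[OF assms(1) _ assms(4,3)]) simp
  from tendsto_diff[OF assms(2) this]
  have "((\<lambda>t. (q t - blinfun_apply (X t) (p t)) - (r t - blinfun_apply (Y t) (p t))) \<longlongrightarrow> 0) F"
    by (simp add: algebra_simps)
  from tendsto_Pair[OF mat_of_tendsto[OF assms(1)] this]
  show ?thesis by (simp add: aff_of_def zero_prod_def)
qed

lemma aff_app_has_derivative: "(aff_app A has_derivative (\<lambda>v. fst A *v v)) (at x)"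
  unfolding aff_app_def
  by (rule has_derivative_add_const) (rule bounded_linear_imp_has_derivative[OF bounded_linear_mv])

section \<open>Limit geometries\<close>

text \<open>
  Appending a word \<open>w\<close> adds \<open>length w - 1\<close> transitions, since the first letter of \<open>w\<close> is shared; the old
  letters move up by that amount.
\<close>

lemma extend_left_seq:
  assumes "left_seq R \<theta>" "successively (\<lambda>a b. (a, b) \<in> R) w" "w \<noteq> []" "hd w = \<theta> 0"
  shows "left_seq R (extend \<theta> w)"
  unfolding left_seq_def
proof
  fix i
  have last: "rev w ! (length w - 1) = \<theta> 0"
    using assms(3,4) by (simp add: rev_nth hd_conv_nth)
  show "(extend \<theta> w (Suc i), extend \<theta> w i) \<in> R"
  proof (cases "Suc i < length w")
    case True
    have "successively (\<lambda>a b. (b, a) \<in> R) (rev w)"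
      using assms(2) by (simp add: successively_rev)
    then show ?thesis using True by (simp add: extend_def successively_conv_nth)
  next
    case False
    then have "Suc i - (length w - 1) = Suc (i - (length w - 1))" using assms(3) by (cases w) auto
    moreover have "extend \<theta> w i = \<theta> (i - (length w - 1))"
    proof (cases "i < length w")
      case True
      then have "i = length w - 1" using False by simp
      then show ?thesis using True last by (simp add: extend_def)
    qed (simp add: extend_def)
    ultimately show ?thesis
      using False assms(1) by (simp add: extend_def left_seq_def)
  qed
qed

lemma extend_shift:
  assumes "w \<noteq> []" "hd w = \<theta> 0"
  shows "shift (length w - 1) (extend \<theta> w) = \<theta>"
proof
  fix i
  show "shift (length w - 1) (extend \<theta> w) i = \<theta> i"
  proof (cases "i = 0")
    case True
    then show ?thesis using assms by (simp add: shift_def extend_def rev_nth hd_conv_nth)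
  next
    case False
    then have "\<not> i + (length w - 1) < length w" using assms(1) by (cases w) auto
    then show ?thesis by (simp add: shift_def extend_def)
  qed
qed

lemma extend_trunc: "w \<noteq> [] \<Longrightarrow> trunc (extend \<theta> w) (length w - 1) = w"
proof -
  assume "w \<noteq> []"
  then have "[0..<Suc (length w - 1)] = [0..<length w]" by simp
  moreover have "map (extend \<theta> w) [0..<length w] = rev w"
    by (rule nth_equalityI) (auto simp: extend_def)
  ultimately show ?thesis unfolding trunc_def rev_map[symmetric] by simp
qed

lemma extend_0: "w \<noteq> [] \<Longrightarrow> extend \<theta> w 0 = last w"
  by (simp add: extend_def rev_nth last_conv_nth)

lemma extend_cong:
  assumes "\<And>i. i \<le> m \<Longrightarrow> \<theta> i = \<theta>' i" "i \<le> m + (length w - 1)"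
  shows "extend \<theta> w i = extend \<theta>' w i"
  using assms by (auto simp: extend_def)

locale limit_geometries =
  hcantor \<alpha> K +
  B: bunched_branches "adm K" "Gstar K" "ib K" "expmap K" "contr K" \<Gamma> c \<alpha> H M Q \<kappa>
  for \<alpha> :: real and K :: "('a::finite, 'd::finite) cantor" and c :: "'a \<Rightarrow> complex ^ 'd"
    and \<Gamma> H M Q \<kappa> :: real +
  assumes c_cantor: "c a \<in> cantor_piece K a"
begin

abbreviation k where "k \<equiv> limit_geometry K c"

lemma c_Gstar: "c a \<in> Gstar K a"
  using c_cantor piece_Gstar by (auto simp: cantor_piece_def)

lemma base_affine_inverse:
  assumes "left_seq (adm K) \<theta>"
  shows "inv (base_affine K c \<theta> n) =
    (\<lambda>y. c (\<theta> 0) + blinfun_apply (ibranch f g \<theta> n (c (\<theta> 0))) (y - branch f \<theta> n (c (\<theta> 0))))"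
proof (rule inv_equality)
  note p = branch_inverse_pair[OF assms c_Gstar, of n]
  have D: "Der (branch f \<theta> n) (c (\<theta> 0)) = dbranch f \<theta> n (c (\<theta> 0))"
    by (rule Der_eq[OF B.branch_has_derivative[OF assms c_Gstar]])
  show "c (\<theta> 0) + blinfun_apply (ibranch f g \<theta> n (c (\<theta> 0)))
      (base_affine K c \<theta> n x - branch f \<theta> n (c (\<theta> 0))) = x" for x
    by (simp add: base_affine_def inv_branch_trunc D inverse_pair_apply(2)[OF p])
  show "base_affine K c \<theta> n (c (\<theta> 0) + blinfun_apply (ibranch f g \<theta> n (c (\<theta> 0)))
      (y - branch f \<theta> n (c (\<theta> 0)))) = y" for y
    by (simp add: base_affine_def inv_branch_trunc D inverse_pair_apply(1)[OF p])
qed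

lemma approx_geometry_eq:
  assumes "left_seq (adm K) \<theta>"
  shows "approx_geometry K c \<theta> n x =
    c (\<theta> 0) + blinfun_apply (ibranch f g \<theta> n (c (\<theta> 0))) (branch f \<theta> n x - branch f \<theta> n (c (\<theta> 0)))"
  by (simp add: approx_geometry_def base_affine_inverse[OF assms] inv_branch_trunc)

lemma approx_geometry_has_derivative:
  assumes "left_seq (adm K) \<theta>" "x \<in> Gstar K (\<theta> 0)"
  shows "(approx_geometry K c \<theta> n has_derivative blinfun_apply (B.E \<theta> n x)) (at x)"
proof -
  have "((\<lambda>x. c (\<theta> 0) + blinfun_apply (ibranch f g \<theta> n (c (\<theta> 0))) (branch f \<theta> n x - branch f \<theta> n (c (\<theta> 0))))
      has_derivative (\<lambda>v. blinfun_apply (ibranch f g \<theta> n (c (\<theta> 0))) (blinfun_apply (dbranch f \<theta> n x) v))) (at x)"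
    by (auto intro!: derivative_eq_intros B.branch_has_derivative assms)
  then show ?thesis
    by (simp add: approx_geometry_eq[OF assms(1), abs_def] B.E_def blinfun_compose.rep_eq o_def)
qed

lemma approx_geometry_base: "left_seq (adm K) \<theta> \<Longrightarrow> approx_geometry K c \<theta> n (c (\<theta> 0)) = c (\<theta> 0)"
  by (simp add: approx_geometry_eq blinfun.bilinear_simps)

text \<open>
  The derivatives are close by \<open>E_bounds\<close> and the values agree at the base point; a bound for the inner
  diameter passes from the former to the latter.
\<close>

lemma approx_geometry_tail:
  assumes "left_seq (adm K) \<theta>" "x \<in> Gstar K (\<theta> 0)" "m \<le> n"
  shows "norm (approx_geometry K c \<theta> n x - approx_geometry K c \<theta> m x) \<le> M * B.tail_const * \<kappa> ^ m"
proof -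
  let ?\<phi> = "\<lambda>x. approx_geometry K c \<theta> n x - approx_geometry K c \<theta> m x"
  have "norm (?\<phi> x - ?\<phi> (c (\<theta> 0))) \<le> M * (B.tail_const * \<kappa> ^ m)"
  proof (rule B.D_inner[where \<phi>' = "\<lambda>x. B.E \<theta> n x - B.E \<theta> m x", OF _ _ assms(2) c_Gstar])
    fix y assume y: "y \<in> Gstar K (\<theta> 0)"
    show "(?\<phi> has_derivative blinfun_apply (B.E \<theta> n y - B.E \<theta> m y)) (at y)"
      using has_derivative_diff[OF approx_geometry_has_derivative approx_geometry_has_derivative,
          OF assms(1) y assms(1) y, of n m]
      by (simp add: minus_blinfun.rep_eq)
    show "norm (B.E \<theta> n y - B.E \<theta> m y) \<le> B.tail_const * \<kappa> ^ m"
      by (rule B.E_bounds) (use y assms in auto)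
  qed
  then show ?thesis by (simp add: approx_geometry_base[OF assms(1)] mult_ac)
qed

lemma limit_geometry_tail:
  assumes "left_seq (adm K) \<theta>" "x \<in> Gstar K (\<theta> 0)"
  shows "(\<lambda>n. approx_geometry K c \<theta> n x) \<longlonglongrightarrow> k \<theta> x"
    and "norm (k \<theta> x - approx_geometry K c \<theta> m x) \<le> M * B.tail_const * \<kappa> ^ m"
  unfolding limit_geometry_def
  by (rule geometric_growth_lim[OF approx_geometry_tail[OF assms] B.\<kappa>]; simp)+

lemma limit_geometry_base: "left_seq (adm K) \<theta> \<Longrightarrow> k \<theta> (c (\<theta> 0)) = c (\<theta> 0)"
  using limit_geometry_tail(1)[OF _ c_Gstar, of \<theta>] by (simp add: approx_geometry_base LIMSEQ_const_iff)

lemma E_base: "left_seq (adm K) \<theta> \<Longrightarrow> B.E \<theta> n (c (\<theta> 0)) = id_blinfun"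
  using branch_inverse_pair[OF _ c_Gstar] by (simp add: B.E_def inverse_pair_def)

lemma E_lim_base: "left_seq (adm K) \<theta> \<Longrightarrow> B.E_lim \<theta> (c (\<theta> 0)) = id_blinfun"
  by (simp add: B.E_lim_def E_base)

lemma limit_geometry_has_derivative:
  assumes "left_seq (adm K) \<theta>" "x \<in> Gstar K (\<theta> 0)"
  shows "(k \<theta> has_derivative blinfun_apply (B.E_lim \<theta> x)) (at x)"
proof -
  obtain r where r: "0 < r" "ball x r \<subseteq> Gstar K (\<theta> 0)"
    using open_Gstar assms(2) openE by blast
  have "\<exists>h. \<forall>y\<in>ball x r. (\<lambda>n. approx_geometry K c \<theta> n y) \<longlonglongrightarrow> h y \<and>
      (h has_derivative blinfun_apply (B.E_lim \<theta> y)) (at y within ball x r)"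
  proof (rule has_derivative_sequence)
    show "(approx_geometry K c \<theta> n has_derivative blinfun_apply (B.E \<theta> n y)) (at y within ball x r)"
      if "y \<in> ball x r" for n y
      using approx_geometry_has_derivative[OF assms(1)] that r by (blast intro: has_derivative_at_withinI)
    show "(\<lambda>n. approx_geometry K c \<theta> n x) \<longlonglongrightarrow> k \<theta> x" by (rule limit_geometry_tail[OF assms])
    fix e :: real assume e: "0 < e"
    have "(\<lambda>n. B.tail_const * \<kappa> ^ n) \<longlonglongrightarrow> B.tail_const * 0"
      using B.\<kappa> by (intro tendsto_intros LIMSEQ_realpow_zero) auto
    then have "\<forall>\<^sub>F n in sequentially. B.tail_const * \<kappa> ^ n < e"
      using e by (intro order_tendstoD(2)) auto
    then show "\<forall>\<^sub>F n in sequentially. \<forall>y\<in>ball x r. \<forall>h.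
        norm (blinfun_apply (B.E \<theta> n y) h - blinfun_apply (B.E_lim \<theta> y) h) \<le> e * norm h"
    proof eventually_elim
      case (elim n)
      show ?case
      proof (intro ballI allI)
        fix y h assume "y \<in> ball x r"
        then have "norm (B.E_lim \<theta> y - B.E \<theta> n y) \<le> e"
          using B.E_lim(2)[OF assms(1), of y n] r elim by force
        then have "norm (blinfun_apply (B.E_lim \<theta> y - B.E \<theta> n y) h) \<le> e * norm h"
          using norm_blinfun order_trans mult_right_mono norm_ge_zero by metis
        then show "norm (blinfun_apply (B.E \<theta> n y) h - blinfun_apply (B.E_lim \<theta> y) h) \<le> e * norm h"
          by (simp add: blinfun.bilinear_simps norm_minus_commute)
      qed
    qed
  qed (use r in auto)
  then obtain h where h: "\<And>y. y \<in> ball x r \<Longrightarrow> (\<lambda>n. approx_geometry K c \<theta> n y) \<longlonglongrightarrow> h y"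
    "\<And>y. y \<in> ball x r \<Longrightarrow> (h has_derivative blinfun_apply (B.E_lim \<theta> y)) (at y within ball x r)" by metis
  have "h y = k \<theta> y" if "y \<in> ball x r" for y
    using h(1)[OF that] limit_geometry_tail(1)[OF assms(1), of y] that r(2) LIMSEQ_unique by blast
  moreover have "(h has_derivative blinfun_apply (B.E_lim \<theta> x)) (at x)"
    using h(2)[of x] r(1) by (simp add: at_within_open[of x "ball x r"])
  ultimately show ?thesis
    using has_derivative_cong_open[of "ball x r" x h "k \<theta>"] r(1) by simp
qed

lemma E_lim_GLC:
  assumes "left_seq (adm K) \<theta>" "x \<in> cantor_piece K (\<theta> 0)"
  shows "B.E_lim \<theta> x \<in> GLC"
proof -
  have x: "x \<in> Gstar K (\<theta> 0)" using assms(2) piece_Gstar by (auto simp: cantor_piece_def)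
  have "B.E \<theta> n x \<in> GLC" for n
    unfolding B.E_def
    by (intro GLC_compose dbranch_GLC assms GLC_inverse_pair[OF dbranch_GLC branch_inverse_pair] c_cantor c_Gstar)
  then show ?thesis
    using GLC_limit[OF _ B.E_lim(1)[OF assms(1) x]] B.E_lim_pair[OF assms(1) x] by blast
qed

text \<open>
  The linear part of \<open>F\<close>: the derivative of \<open>k \<circ> f\<^sub>w\<close> at the base point, where the derivative of
  the limit geometry belonging to the longer sequence is the identity.
\<close>

definition Flin :: "(nat \<Rightarrow> 'a) \<Rightarrow> nat \<Rightarrow> ((complex ^ 'd) \<Rightarrow>\<^sub>L (complex ^ 'd))" where
  "Flin \<theta> q = (B.E_lim (shift q \<theta>) (branch f \<theta> q (c (\<theta> 0))) o\<^sub>L dbranch f \<theta> q (c (\<theta> 0)))"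

lemma Flin_GLC: "left_seq (adm K) \<theta> \<Longrightarrow> Flin \<theta> q \<in> GLC"
  unfolding Flin_def
  by (intro GLC_compose E_lim_GLC dbranch_GLC) (auto intro: left_seq_shift branch_cantor c_cantor)

text \<open>
  A branch of length \<open>n + q\<close> can be normalised at once or after its first \<open>q\<close> steps.  The two
  normalisations differ by an affine map, and so do their limits as \<open>n\<close> grows.
\<close>

lemma limit_geometry_branch:
  assumes "left_seq (adm K) \<theta>" "x \<in> Gstar K (\<theta> 0)"
  shows "k (shift q \<theta>) (branch f \<theta> q x) =
    k (shift q \<theta>) (branch f \<theta> q (c (\<theta> 0))) + blinfun_apply (Flin \<theta> q) (k \<theta> x - c (\<theta> 0))"
proof -
  let ?s = "shift q \<theta>" and ?c = "c (\<theta> 0)"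
  let ?A = "\<lambda>n x. approx_geometry K c ?s n x"
  note s = left_seq_shift[OF assms(1), of q]
  have br: "branch f \<theta> q y \<in> Gstar K (?s 0)" if "y \<in> Gstar K (\<theta> 0)" for y
    using B.branch_in[OF assms(1) that, of q] by simp
  have eq: "?A n (branch f \<theta> q x) - ?A n (branch f \<theta> q ?c) =
      blinfun_apply (B.E ?s n (branch f \<theta> q ?c)) (blinfun_apply (dbranch f \<theta> q ?c) (approx_geometry K c \<theta> (n + q) x - ?c))" for n
    using inverse_pair_apply(1)[OF branch_inverse_pair[OF assms(1) c_Gstar, of "n + q"]]
    by (simp add: approx_geometry_eq[OF s] approx_geometry_eq[OF assms(1)] B.E_def dbranch_add branch_add
        flip: blinfun.diff_right)
  have "(\<lambda>n. ?A n (branch f \<theta> q x) - ?A n (branch f \<theta> q ?c)) \<longlonglongrightarrow> k ?s (branch f \<theta> q x) - k ?s (branch f \<theta> q ?c)"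
    by (intro tendsto_diff limit_geometry_tail s br assms c_Gstar)
  moreover have "(\<lambda>n. blinfun_apply (B.E ?s n (branch f \<theta> q ?c)) (blinfun_apply (dbranch f \<theta> q ?c) (approx_geometry K c \<theta> (n + q) x - ?c)))
     \<longlonglongrightarrow> blinfun_apply (B.E_lim ?s (branch f \<theta> q ?c)) (blinfun_apply (dbranch f \<theta> q ?c) (k \<theta> x - ?c))"
    by (intro tendsto_intros B.E_lim(1) s br c_Gstar LIMSEQ_ignore_initial_segment limit_geometry_tail assms)
  ultimately have "k ?s (branch f \<theta> q x) - k ?s (branch f \<theta> q ?c) =
      blinfun_apply (B.E_lim ?s (branch f \<theta> q ?c)) (blinfun_apply (dbranch f \<theta> q ?c) (k \<theta> x - ?c))"
    unfolding eq by (rule LIMSEQ_unique)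
  then show ?thesis by (simp add: Flin_def algebra_simps)
qed

lemma E_lim_branch:
  assumes "left_seq (adm K) \<theta>" "x \<in> Gstar K (\<theta> 0)"
  shows "(B.E_lim (shift q \<theta>) (branch f \<theta> q x) o\<^sub>L dbranch f \<theta> q x) = (Flin \<theta> q o\<^sub>L B.E_lim \<theta> x)"
proof -
  have br: "branch f \<theta> q x \<in> Gstar K (shift q \<theta> 0)"
    using B.branch_in[OF assms, of q] by simp
  have "(k (shift q \<theta>) \<circ> branch f \<theta> q has_derivative
      blinfun_apply (B.E_lim (shift q \<theta>) (branch f \<theta> q x)) \<circ> blinfun_apply (dbranch f \<theta> q x)) (at x)"
    by (intro diff_chain_at B.branch_has_derivative limit_geometry_has_derivative left_seq_shift br assms)
  then have 1: "Der (k (shift q \<theta>) \<circ> branch f \<theta> q) x = (B.E_lim (shift q \<theta>) (branch f \<theta> q x) o\<^sub>L dbranch f \<theta> q x)"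
    by (intro Der_eq) (simp add: blinfun_compose.rep_eq)
  have "((\<lambda>y. k (shift q \<theta>) (branch f \<theta> q (c (\<theta> 0))) + blinfun_apply (Flin \<theta> q) (k \<theta> y - c (\<theta> 0)))
     has_derivative (\<lambda>v. blinfun_apply (Flin \<theta> q) (blinfun_apply (B.E_lim \<theta> x) v))) (at x)"
    by (auto intro!: derivative_eq_intros limit_geometry_has_derivative assms)
  then have "Der (\<lambda>y. k (shift q \<theta>) (branch f \<theta> q (c (\<theta> 0))) + blinfun_apply (Flin \<theta> q) (k \<theta> y - c (\<theta> 0))) x
     = (Flin \<theta> q o\<^sub>L B.E_lim \<theta> x)"
    by (intro Der_eq) (simp add: blinfun_compose.rep_eq o_def)
  moreover have "Der (k (shift q \<theta>) \<circ> branch f \<theta> q) x =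
     Der (\<lambda>y. k (shift q \<theta>) (branch f \<theta> q (c (\<theta> 0))) + blinfun_apply (Flin \<theta> q) (k \<theta> y - c (\<theta> 0))) x"
    by (rule Der_cong[OF open_Gstar assms(2)]) (simp add: limit_geometry_branch[OF assms(1)])
  ultimately show ?thesis using 1 by simp
qed

text \<open>
  The defining property of \<open>F\<close> determines the one-jet of \<open>F\<close> at the base point, where the limit geometry
  is tangent to the identity.
\<close>

lemma Faff_eq:
  assumes "left_seq (adm K) \<theta>" "admissible_word K w" "w \<noteq> []" "hd w = \<theta> 0"
  defines "\<theta>' \<equiv> extend \<theta> w" and "q \<equiv> length w - 1"
  shows "Faff K c \<theta> w = aff_of (Flin \<theta>' q) (c (\<theta>' 0)) (k \<theta> (branch f \<theta>' q (c (\<theta>' 0))))"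
    (is "_ = ?A")
proof -
  have \<theta>': "left_seq (adm K) \<theta>'"
    unfolding \<theta>'_def using assms by (intro extend_left_seq) (auto simp: admissible_word_def)
  have sh: "shift q \<theta>' = \<theta>" unfolding \<theta>'_def q_def by (rule extend_shift) (use assms in auto)
  have br: "inv_branch K w = branch f \<theta>' q"
    using extend_trunc[OF assms(3), of \<theta>] inv_branch_trunc[of K \<theta>' q] by (simp add: \<theta>'_def q_def)
  have last: "last w = \<theta>' 0" using extend_0[OF assms(3)] by (simp add: \<theta>'_def)
  have A: "aff_app ?A (k \<theta>' x) = k \<theta> (branch f \<theta>' q x)" if "x \<in> Gstar K (\<theta>' 0)" for x
    using limit_geometry_branch[OF \<theta>' that, of q] by (simp add: aff_of_app Flin_GLC \<theta>' sh)
  have "Faff K c \<theta> w = (THE A. A \<in> Aff \<and> (\<forall>x\<in>Gstar K (\<theta>' 0).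
        aff_app A (k \<theta>' x) = k \<theta> (branch f \<theta>' q x)))"
    using assms(3) unfolding Faff_def br last by (simp add: \<theta>'_def)
  also have "\<dots> = ?A"
  proof (rule the_equality)
    show "?A \<in> Aff \<and> (\<forall>x\<in>Gstar K (\<theta>' 0). aff_app ?A (k \<theta>' x) = k \<theta> (branch f \<theta>' q x))"
      using A by (auto intro: aff_of_Aff Flin_GLC \<theta>')
    fix B assume B: "B \<in> Aff \<and> (\<forall>x\<in>Gstar K (\<theta>' 0). aff_app B (k \<theta>' x) = k \<theta> (branch f \<theta>' q x))"
    have d: "((\<lambda>x. aff_app C (k \<theta>' x)) has_derivative (\<lambda>v. fst C *v v)) (at (c (\<theta>' 0)))" for C
      using diff_chain_at[OF limit_geometry_has_derivative[OF \<theta>' c_Gstar] aff_app_has_derivative, of C]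
      by (simp add: E_lim_base[OF \<theta>'] o_def)
    have "((\<lambda>x. aff_app ?A (k \<theta>' x)) has_derivative (\<lambda>v. fst B *v v)) (at (c (\<theta>' 0)))"
      by (rule has_derivative_cong_open[OF open_Gstar c_Gstar _ d[of B]]) (use A B in simp)
    then have "(\<lambda>v. fst B *v v) = (\<lambda>v. fst ?A *v v)"
      using d[of ?A] has_derivative_unique by blast
    then have 1: "fst B = fst ?A" by (metis matrix_eq_iff_vec)
    have "aff_app B (k \<theta>' (c (\<theta>' 0))) = aff_app ?A (k \<theta>' (c (\<theta>' 0)))"
      using A B c_Gstar by auto
    then have "snd B = snd ?A" using 1 by (simp add: aff_app_def)
    then show "B = ?A" using 1 by (simp add: prod_eq_iff)
  qed
  finally show ?thesis .
qed

end

section \<open>Observables close up to a near-identity change of domain\<close>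

text \<open>
  The map \<open>k\<close> is close to \<open>h\<close> after the change of domain \<open>\<phi>\<close>.  This is applied both to expanding maps
  and to observables.  Conclusions are drawn on the thickening by \<open>r1 \<le> \<rho> / 2\<close>, whose points are
  reached by \<open>\<phi>\<close> with room to spare.
\<close>

locale near_pair =
  fixes \<alpha> \<epsilon> \<rho> r1 \<Gamma> H :: real and S :: "'v::euclidean_space set" and \<phi> k h :: "'v \<Rightarrow> 'v"
  assumes \<alpha>_pos: "0 < \<alpha>" and \<phi>_C1a: "C1a \<alpha> \<phi> (thicken \<rho> S)"
    and \<phi>_near: "C1a_near \<alpha> \<epsilon> (thicken \<rho> S) \<phi> (\<lambda>x. x)"
    and k_near: "C1a_near \<alpha> \<epsilon> (thicken \<rho> S) (k \<circ> \<phi>) h"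
    and k_differentiable: "u \<in> thicken \<rho> S \<Longrightarrow> k differentiable (at (\<phi> u))"
    and h_differentiable: "u \<in> thicken \<rho> S \<Longrightarrow> h differentiable (at u)"
    and \<Gamma>: "1 \<le> \<Gamma>" "x \<in> thicken \<rho> S \<Longrightarrow> norm (Der h x) \<le> \<Gamma>"
    and H: "0 \<le> H" "x \<in> thicken \<rho> S \<Longrightarrow> y \<in> thicken \<rho> S \<Longrightarrow>
       norm (Der h x - Der h y) \<le> H * dist x y powr \<alpha>"
    and r1: "0 < r1" "2 * r1 \<le> \<rho>"
    and \<epsilon>_pos: "0 < \<epsilon>" and small: "4 * \<epsilon> \<le> 1" "8 * \<epsilon> \<le> r1"
begin

abbreviation N where "N \<equiv> thicken \<rho> S"

lemma \<phi>_dist: "u \<in> N \<Longrightarrow> dist (\<phi> u) u \<le> \<epsilon>"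
  and D\<phi>_near: "u \<in> N \<Longrightarrow> norm (Der \<phi> u - id_blinfun) \<le> \<epsilon>"
  and D\<phi>_holder: "u \<in> N \<Longrightarrow> u' \<in> N \<Longrightarrow>
      norm (Der \<phi> u - Der \<phi> u') \<le> \<epsilon> * dist u u' powr \<alpha>"
  using \<phi>_near by (auto simp: C1a_near_def dist_norm)

lemma k\<phi>_dist: "u \<in> N \<Longrightarrow> dist (k (\<phi> u)) (h u) \<le> \<epsilon>"
  using k_near by (auto simp: C1a_near_def dist_norm)

text \<open>Brouwer's fixed point theorem for \<open>x \<mapsto> x - \<phi> x + y\<close> on the ball of radius \<open>\<epsilon>\<close> around \<open>y\<close>.\<close>

lemma \<phi>_hits:
  assumes "y \<in> thicken r S" "r + \<epsilon> \<le> \<rho>"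
  obtains v where "v \<in> N" "\<phi> v = y" "dist y v \<le> \<epsilon>" "v \<in> thicken (r + \<epsilon>) S"
proof -
  have sub: "cball y \<epsilon> \<subseteq> thicken (r + \<epsilon>) S"
    using thicken_shift[OF assms(1)] by auto
  have sub': "cball y \<epsilon> \<subseteq> N"
    using sub thicken_mono[OF assms(2)] by blast
  have "\<exists>x\<in>cball y \<epsilon>. x - \<phi> x + y = x"
  proof (rule brouwer[OF compact_cball convex_cball])
    show "continuous_on (cball y \<epsilon>) (\<lambda>x. x - \<phi> x + y)"
      using \<phi>_C1a sub'
      by (intro continuous_intros continuous_on_subset[OF C1a_continuous_on[of \<alpha> "\<phi>"]])
        auto
    show "(\<lambda>x. x - \<phi> x + y) \<in> cball y \<epsilon> \<rightarrow> cball y \<epsilon>"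
      using \<phi>_dist sub' by (force simp: dist_norm norm_minus_commute)
  qed (use \<epsilon>_pos in auto)
  then obtain v where "v \<in> cball y \<epsilon>" "\<phi> v = y" by (auto simp: algebra_simps)
  then show thesis using sub sub' by (intro that[of v]) auto
qed

lemma chain_rule:
  assumes "u \<in> N"
  shows "(Der k (\<phi> u) o\<^sub>L Der \<phi> u) = Der (k \<circ> \<phi>) u"
  using \<phi>_C1a assms k_differentiable[OF assms]
  by (intro Der_compose[symmetric]) (auto simp: C1a_def)

lemma Dk_bound:
  assumes "u \<in> N"
  shows "norm (Der k (\<phi> u)) \<le> 2 * (\<Gamma> + 1)"
    and "norm (Der k (\<phi> u) - Der h u) \<le> \<epsilon> + 2 * (\<Gamma> + 1) * \<epsilon>"
proof -
  let ?X = "Der k (\<phi> u)" and ?P = "Der \<phi> u" and ?Y = "Der (k \<circ> \<phi>) u"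
  have Y: "norm (?Y - Der h u) \<le> \<epsilon>" using k_near assms by (auto simp: C1a_near_def)
  then have "norm ?Y \<le> \<Gamma> + 1"
    using \<Gamma>(2)[OF assms] norm_triangle_sub[of ?Y "Der h u"] small \<epsilon>_pos by simp
  have X: "?X - ?Y = - (?X o\<^sub>L (?P - id_blinfun))"
    using chain_rule[OF assms] by (simp add: blinfun_compose_diff_right)
  then have le: "norm (?X - ?Y) \<le> norm ?X * \<epsilon>"
    using norm_compose_le[OF order_refl D\<phi>_near[OF assms], of ?X] by simp
  also have "\<dots> \<le> norm ?X * (1/4)" using small \<epsilon>_pos by (intro mult_left_mono) auto
  finally have "norm ?X \<le> norm ?Y + norm ?X / 4" using norm_triangle_sub[of ?X ?Y] by simp
  then show 1: "norm ?X \<le> 2 * (\<Gamma> + 1)" using \<open>norm ?Y \<le> \<Gamma> + 1\<close> \<Gamma>(1) by simp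
  have "norm (?X - ?Y) \<le> 2 * (\<Gamma> + 1) * \<epsilon>"
    by (rule order_trans[OF le mult_right_mono[OF 1]]) (use \<epsilon>_pos in simp)
  then show "norm (?X - Der h u) \<le> \<epsilon> + 2 * (\<Gamma> + 1) * \<epsilon>"
    using Y norm_triangle_ineq[of "?X - ?Y" "?Y - Der h u"] by simp
qed

text \<open>
  For nearby points the derivative of \<open>\<phi>\<close> decides, on a ball inside the domain; distant points stay distant
  because \<open>\<phi>\<close> moves them by at most \<open>\<epsilon>\<close>.  The domain need not be convex, so neither argument works alone.
\<close>

lemma \<phi>_expands:
  assumes "u \<in> thicken (r1 + \<epsilon>) S" "u' \<in> N"
  shows "dist u u' \<le> 2 * dist (\<phi> u) (\<phi> u')"
proof -
  define s where "s = \<rho> - r1 - \<epsilon>"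
  have s: "4 * \<epsilon> \<le> s" using r1 small(2) \<epsilon>_pos unfolding s_def by linarith
  have sub: "ball u s \<subseteq> N"
  proof
    fix x assume "x \<in> ball u s"
    then have "x \<in> thicken (r1 + \<epsilon> + s) S" by (intro thicken_shift[OF assms(1)]) auto
    then show "x \<in> N" by (simp add: s_def)
  qed
  have u: "u \<in> N" using sub s \<epsilon>_pos by auto
  show ?thesis
  proof (cases "dist u u' < s")
    case True
    have "norm ((\<phi> u - u) - (\<phi> u' - u')) \<le> \<epsilon> * norm (u - u')"
    proof (rule norm_diff_le_on_ball[where p = u and r = s and f' = "\<lambda>x. Der \<phi> x - id_blinfun"])
      fix x assume "x \<in> ball u s"
      then have x: "x \<in> N" using sub by blast
      show "norm (Der \<phi> x - id_blinfun) \<le> \<epsilon>" by (rule D\<phi>_near[OF x])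
      have "(\<phi> has_derivative blinfun_apply (Der \<phi> x)) (at x)"
        using \<phi>_C1a x by (intro Der_works) (auto simp: C1a_def)
      from has_derivative_diff[OF this has_derivative_ident]
      show "((\<lambda>x. \<phi> x - x) has_derivative blinfun_apply (Der \<phi> x - id_blinfun)) (at x)"
        by (simp add: minus_blinfun.rep_eq id_blinfun.rep_eq)
    qed (use True s \<epsilon>_pos in auto)
    also have "\<dots> \<le> 1/4 * norm (u - u')" using small by (intro mult_right_mono) auto
    finally have "norm ((\<phi> u - \<phi> u') - (u - u')) \<le> norm (u - u') / 4" by (simp add: algebra_simps)
    then have "norm ((u - u') - (\<phi> u - \<phi> u')) \<le> norm (u - u') / 4"
      by (simp only: norm_minus_commute)
    then show ?thesis
      using norm_triangle_sub[of "u - u'" "\<phi> u - \<phi> u'"] norm_ge_zero[of "\<phi> u - \<phi> u'"]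
      unfolding dist_norm by linarith
  next
    case False
    have "dist u u' \<le> dist u (\<phi> u) + (dist (\<phi> u) (\<phi> u') + dist (\<phi> u') u')"
      using dist_triangle[of u u' "\<phi> u"] dist_triangle[of "\<phi> u" u' "\<phi> u'"] by simp
    then show ?thesis
      using \<phi>_dist[OF u] \<phi>_dist[OF assms(2)] False s by (simp add: dist_commute)
  qed
qed

text \<open>
  The chain rule \<open>D(k \<circ> \<phi>) = Dk D\<phi>\<close> is solved for \<open>Dk\<close>: as \<open>D\<phi>\<close> is close to the identity, half of the
  unknown difference can be absorbed into the left-hand side.  The resulting constant does not depend
  on \<open>k\<close>.
\<close>

lemma Dk_holder:
  assumes "z \<in> thicken r1 S" "z' \<in> thicken r1 S"
  shows "norm (Der k z - Der k z')
      \<le> 2 * (H + 1 + 2 * (\<Gamma> + 1)) * 2 powr \<alpha> * dist z z' powr \<alpha>"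
proof -
  have "r1 + \<epsilon> \<le> \<rho>" using r1 small(2) \<epsilon>_pos by linarith
  then obtain u u' where u: "u \<in> N" "\<phi> u = z" "u \<in> thicken (r1 + \<epsilon>) S"
    and u': "u' \<in> N" "\<phi> u' = z'"
    using \<phi>_hits[OF assms(1)] \<phi>_hits[OF assms(2)] by metis
  let ?X = "Der k z" and ?X' = "Der k z'"
  let ?P = "Der \<phi> u" and ?P' = "Der \<phi> u'"
  let ?Y = "Der (k \<circ> \<phi>) u" and ?Y' = "Der (k \<circ> \<phi>) u'"
  let ?d = "dist u u' powr \<alpha>"
  have Y: "norm (?Y - ?Y') \<le> (H + 1) * ?d"
  proof -
    have "norm ((?Y - Der h u) - (?Y' - Der h u')) \<le> \<epsilon> * ?d"
      using k_near u u' unfolding C1a_near_def by blast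
    also have "\<dots> \<le> 1 * ?d" using small \<epsilon>_pos by (intro mult_right_mono) auto
    finally have "norm ((?Y - Der h u) - (?Y' - Der h u')) \<le> ?d" by simp
    moreover have "norm (Der h u - Der h u') \<le> H * ?d" by (rule H) fact+
    moreover have "?Y - ?Y' = ((?Y - Der h u) - (?Y' - Der h u')) + (Der h u - Der h u')"
      by simp
    ultimately show ?thesis
      using norm_triangle_ineq[of "(?Y - Der h u) - (?Y' - Der h u')"
          "Der h u - Der h u'"] by (simp add: algebra_simps)
  qed
  have P: "norm (?P - ?P') \<le> 1 * ?d"
    using D\<phi>_holder[OF u(1) u'(1)] mult_right_mono[of \<epsilon> 1 ?d] small \<epsilon>_pos by simp
  have eq: "?X - ?X' = (?Y - ?Y') - (?X' o\<^sub>L (?P - ?P')) - ((?X - ?X') o\<^sub>L (?P - id_blinfun))"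
    using chain_rule[OF u(1)] chain_rule[OF u'(1)] u(2) u'(2)
    by (simp add: blinfun_compose_diff_left blinfun_compose_diff_right)
  have "norm (?X' o\<^sub>L (?P - ?P')) \<le> 2 * (\<Gamma> + 1) * (1 * ?d)"
    using Dk_bound(1)[OF u'(1)] u'(2) P by (intro norm_compose_le) auto
  moreover have "norm ((?X - ?X') o\<^sub>L (?P - id_blinfun)) \<le> norm (?X - ?X') * (1/2)"
    using D\<phi>_near[OF u(1)] small \<epsilon>_pos by (intro norm_compose_le) auto
  ultimately have "norm (?X - ?X') \<le> (H + 1) * ?d + 2 * (\<Gamma> + 1) * ?d + norm (?X - ?X') / 2"
    using Y norm_triangle_ineq4[of "(?Y - ?Y') - (?X' o\<^sub>L (?P - ?P'))" "(?X - ?X') o\<^sub>L (?P - id_blinfun)"]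
      norm_triangle_ineq4[of "?Y - ?Y'" "?X' o\<^sub>L (?P - ?P')"] unfolding eq[symmetric] by simp
  then have "norm (?X - ?X') \<le> 2 * (H + 1 + 2 * (\<Gamma> + 1)) * ?d" by (simp add: algebra_simps)
  also have "?d \<le> (2 * dist z z') powr \<alpha>"
    using \<phi>_expands[OF u(3) u'(1)] u(2) u'(2) \<alpha>_pos by (intro powr_mono2) auto
  also have "(2 * dist z z') powr \<alpha> = 2 powr \<alpha> * dist z z' powr \<alpha>" by (simp add: powr_mult)
  finally show ?thesis using H(1) \<Gamma>(1) by (simp add: mult_left_mono mult.assoc)
qed

lemma near_at:
  assumes "z \<in> thicken r1 S"
  shows "dist (k z) (h z) \<le> (1 + \<Gamma>) * \<epsilon>"
    and "norm (Der k z - Der h z) \<le> \<epsilon> + 2 * (\<Gamma> + 1) * \<epsilon> + H * \<epsilon> powr \<alpha>"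
    and "norm (Der k z) \<le> 2 * (\<Gamma> + 1)" and "k differentiable (at z)"
proof -
  have "r1 + \<epsilon> \<le> \<rho>" using r1 small(2) \<epsilon>_pos by linarith
  then obtain u where u: "u \<in> N" "\<phi> u = z" "dist z u \<le> \<epsilon>"
    using \<phi>_hits[OF assms] by metis
  obtain p where p: "p \<in> S" "z \<in> ball p r1" using assms by (auto simp: thicken_def)
  have z: "z \<in> N" using assms thicken_mono[of r1 \<rho> S] r1 by auto
  have "norm (h u - h z) \<le> \<Gamma> * norm (u - z)"
  proof (rule norm_diff_le_on_ball[where p = p and r = \<rho> and f' = "Der h"])
    show "u \<in> ball p \<rho>" "z \<in> ball p \<rho>"
      using p u(3) r1 small(2) \<epsilon>_pos dist_triangle[of p u z] by auto
    fix x assume "x \<in> ball p \<rho>"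
    then have x: "x \<in> N" using p by (auto simp: thicken_def)
    show "(h has_derivative blinfun_apply (Der h x)) (at x)" by (rule Der_works[OF h_differentiable[OF x]])
    show "norm (Der h x) \<le> \<Gamma>" by (rule \<Gamma>(2)[OF x])
  qed
  also have "\<dots> \<le> \<Gamma> * \<epsilon>"
    using \<Gamma>(1) u(3) by (intro mult_left_mono) (auto simp: dist_norm norm_minus_commute)
  finally show "dist (k z) (h z) \<le> (1 + \<Gamma>) * \<epsilon>"
    using k\<phi>_dist[OF u(1)] u(2) dist_triangle[of "k z" "h z" "h u"]
    by (simp add: dist_norm algebra_simps)
  have "norm (Der h u - Der h z) \<le> H * dist u z powr \<alpha>" by (rule H(2)[OF u(1) z])
  also have "\<dots> \<le> H * \<epsilon> powr \<alpha>"
    using u(3) \<alpha>_pos by (intro mult_left_mono powr_mono2 H) (auto simp: dist_commute)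
  finally show "norm (Der k z - Der h z) \<le> \<epsilon> + 2 * (\<Gamma> + 1) * \<epsilon> + H * \<epsilon> powr \<alpha>"
    using Dk_bound(2)[OF u(1)] u(2) norm_triangle_ineq[of "Der k z - Der h u" "Der h u - Der h z"] by simp
  show "norm (Der k z) \<le> 2 * (\<Gamma> + 1)" using Dk_bound(1)[OF u(1)] u(2) by simp
  show "k differentiable (at z)" using k_differentiable[OF u(1)] u(2) by simp
qed

end

section \<open>Perturbed Cantor sets\<close>

text \<open>
  Both systems are compared on the same domains, the pieces of \<open>K\<close> thickened by \<open>r1\<close>: they are mapped
  into each other by the inverse branches of \<open>K\<close> and of \<open>L\<close>, and they contain the Cantor set of \<open>L\<close>,
  whose own pieces are not controlled.  Errors of size \<open>4 \<epsilon>\<close> per step add up to \<open>4 \<epsilon> / (1 - \<mu>)\<close>,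
  and this has to fit twice into the room \<open>(1 - \<mu>) r1\<close> left by the contraction, whence the square in the
  smallness condition.
\<close>

locale perturbed = K: hcantor \<alpha> K + L: hcantor \<alpha> L
  for \<alpha> :: real and K L :: "('a::finite, 'd::finite) cantor" +
  fixes \<epsilon> r0 r1 \<Gamma> H :: real and \<phi> :: "'a \<Rightarrow> complex ^ 'd \<Rightarrow> complex ^ 'd"
  assumes adm_eq: "adm L = adm K"
    and \<phi>_diffeo: "C1a_diffeo \<alpha> (\<phi> a) (Gstar K a)" and \<phi>_image: "\<phi> a ` Gstar K a = Gstar L a"
    and \<phi>_near: "C1a_near \<alpha> \<epsilon> (Gstar K a) (\<phi> a) (\<lambda>x. x)"
    and g_near: "C1a_near \<alpha> \<epsilon> (Gstar K a) (expmap L \<circ> \<phi> a) (expmap K)"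
    and room: "(a, b) \<in> adm K \<Longrightarrow> v \<in> Gstar K b \<Longrightarrow> ball v r0 \<subseteq> expmap K ` Gstar K a"
    and \<Gamma>: "1 \<le> \<Gamma>" "x \<in> Gstar K a \<Longrightarrow> norm (Der (expmap K) x) \<le> \<Gamma>"
    and H: "0 \<le> H" "x \<in> Gstar K a \<Longrightarrow> y \<in> Gstar K a \<Longrightarrow>
       norm (Der (expmap K) x - Der (expmap K) y) \<le> H * dist x y powr \<alpha>"
    and r1: "0 < r1" "2 * r1 \<le> rad K"
    and \<epsilon>_pos: "0 < \<epsilon>"
    and small: "2 * \<epsilon> < r0" "4 * \<epsilon> \<le> 1" "8 * \<epsilon> \<le> (1 - contr K)\<^sup>2 * r1"
begin

abbreviation D where "D a \<equiv> thicken r1 (piece K a)"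
abbreviation \<mu> where "\<mu> \<equiv> contr K"
text \<open>The fixed point of the error recursion \<open>e = 4 \<epsilon> + \<mu> e\<close>.\<close>

definition e where "e = 4 * \<epsilon> / (1 - \<mu>)"

lemma small':
  shows "2 * e \<le> (1 - \<mu>) * r1" "4 * \<epsilon> \<le> e" "0 < e" "8 * \<epsilon> \<le> r1" "2 * e \<le> r1" "4 * \<epsilon> + \<mu> * e = e"
    and "\<mu> * r1 + 4 * \<epsilon> \<le> r1"
proof -
  have m: "0 < 1 - \<mu>" "1 - \<mu> < 1" using K.\<mu> by auto
  show e: "4 * \<epsilon> + \<mu> * e = e" using m by (simp add: e_def field_simps)
  show "0 < e" using m \<epsilon>_pos by (simp add: e_def)
  show "4 * \<epsilon> \<le> e" using e \<open>0 < e\<close> K.\<mu> by (smt (verit) mult_pos_pos)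
  have "(1 - \<mu>) * e = 4 * \<epsilon>" using m by (simp add: e_def)
  then have "(1 - \<mu>) * (2 * e) \<le> (1 - \<mu>) * ((1 - \<mu>) * r1)"
    using small(3) by (simp add: power2_eq_square mult.assoc)
  then show 1: "2 * e \<le> (1 - \<mu>) * r1" using m by simp
  also have "\<dots> \<le> 1 * r1" using m r1 by (intro mult_right_mono) auto
  finally show 2: "2 * e \<le> r1" by simp
  then show "8 * \<epsilon> \<le> r1" using \<open>4 * \<epsilon> \<le> e\<close> by simp
  show "\<mu> * r1 + 4 * \<epsilon> \<le> r1" using 1 \<open>4 * \<epsilon> \<le> e\<close> \<open>0 < e\<close> by (simp add: algebra_simps)
qed

lemma near: "near_pair \<alpha> \<epsilon> (rad K) r1 \<Gamma> H (piece K a) (\<phi> a) (expmap L) (expmap K)"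
  unfolding near_pair_def Gstar_thicken[symmetric]
proof (intro conjI allI impI)
  show "C1a \<alpha> (\<phi> a) (Gstar K a)" using \<phi>_diffeo[of a] by (simp add: C1a_diffeo_def)
  show "expmap L differentiable (at (\<phi> a u))" if "u \<in> Gstar K a" for u
    using L.g_differentiable \<phi>_image that by blast
  show "expmap K differentiable (at u)" if "u \<in> Gstar K a" for u
    using K.g_differentiable that by blast
qed (use K.\<alpha>_pos \<phi>_near g_near \<Gamma> H r1 \<epsilon>_pos small small' in auto)

lemmas \<phi>_dist = near_pair.\<phi>_dist[OF near, folded Gstar_thicken]
  and g\<phi>_dist = near_pair.k\<phi>_dist[OF near, folded Gstar_thicken]
  and \<phi>_hits = near_pair.\<phi>_hits[OF near, folded Gstar_thicken]
  and DgL_bound = near_pair.Dk_bound[OF near, folded Gstar_thicken]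
  and DgL_holder = near_pair.Dk_holder[OF near]

lemma \<phi>_in: "u \<in> Gstar K a \<Longrightarrow> \<phi> a u \<in> Gstar L a"
  using \<phi>_image by blast

lemma \<phi>_surj: "y \<in> Gstar L a \<Longrightarrow> \<exists>v\<in>Gstar K a. y = \<phi> a v"
  using \<phi>_image by blast

lemma fK_lipschitz:
  assumes "(a, b) \<in> adm K" "ball p r \<subseteq> expmap K ` Gstar K a" "x \<in> ball p r" "y \<in> ball p r"
  shows "dist (ib K a b x) (ib K a b y) \<le> \<mu> * dist x y"
  unfolding dist_norm
proof (rule norm_diff_le_on_ball[where f' = "Der (ib K a b)" and p = p and r = r])
  fix x assume "x \<in> ball p r"
  then obtain z where z: "z \<in> Gstar K a" "x = expmap K z" using assms(2) by auto
  show "norm (Der (ib K a b) x) \<le> \<mu>" unfolding z(2) by (rule K.f_norm[OF z(1)])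
  show "(ib K a b has_derivative blinfun_apply (Der (ib K a b) x)) (at x)"
    using z by (intro Der_works K.f_differentiable) auto
qed (use assms in auto)

lemma ball_in_image:
  "(a, b) \<in> adm K \<Longrightarrow> p \<in> piece K b \<Longrightarrow> ball p (rad K) \<subseteq> expmap K ` Gstar K a"
  using K.Gstar_cover[of a b] by (auto simp: Gstar_def)

lemma fL_near_Gstar:
  assumes "(a, b) \<in> adm K" "v \<in> Gstar K b"
  obtains u where "u \<in> Gstar K a" "ib L a b (\<phi> b v) = \<phi> a u"
    "dist u (ib K a b v) \<le> 2 * \<epsilon>" "dist (ib L a b (\<phi> b v)) (ib K a b v) \<le> 3 * \<epsilon>"
proof -
  have R: "(a, b) \<in> adm L" using assms(1) adm_eq by simp
  note y = \<phi>_in[OF assms(2)]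
  obtain u where u: "u \<in> Gstar K a" "ib L a b (\<phi> b v) = \<phi> a u"
    using \<phi>_surj[OF L.f_in[OF R y]] by blast
  have "expmap L (\<phi> a u) = \<phi> b v" using L.g_f[OF R y] u(2) by simp
  then have "dist (expmap K u) v \<le> 2 * \<epsilon>"
    using g\<phi>_dist[OF u(1)] \<phi>_dist[OF assms(2)] dist_triangle[of "expmap K u" v "\<phi> b v"]
    by (simp add: dist_commute)
  then have "dist (ib K a b (expmap K u)) (ib K a b v) \<le> \<mu> * (2 * \<epsilon>)"
    using K.\<mu> small(1) \<epsilon>_pos
    by (intro order_trans[OF fK_lipschitz[OF assms(1) room[OF assms]]] mult_left_mono)
      (auto simp: dist_commute)
  also have "\<dots> \<le> 1 * (2 * \<epsilon>)" using K.\<mu> \<epsilon>_pos by (intro mult_right_mono) auto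
  finally have d: "dist u (ib K a b v) \<le> 2 * \<epsilon>" using K.f_g[OF u(1)] by simp
  then have "dist (\<phi> a u) (ib K a b v) \<le> 3 * \<epsilon>"
    using \<phi>_dist[OF u(1)] dist_triangle[of "\<phi> a u" "ib K a b v" u] by simp
  with u d show thesis using that by simp
qed

lemma D_Gstar: "D a \<subseteq> Gstar K a"
  unfolding Gstar_thicken by (rule thicken_mono) (use r1 in auto)

lemma D_GstarL: "D a \<subseteq> Gstar L a"
proof
  fix y assume "y \<in> D a"
  then obtain v where "v \<in> Gstar K a" "\<phi> a v = y" using \<phi>_hits small' r1 by (smt (verit))
  then show "y \<in> Gstar L a" using \<phi>_in by blast
qed

lemma fL_near:
  assumes R: "(a, b) \<in> adm K" and y: "y \<in> D b"
  obtains u where "u \<in> Gstar K a" "ib L a b y = \<phi> a u" "dist u (ib K a b y) \<le> 3 * \<epsilon>"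
    "dist (ib L a b y) (ib K a b y) \<le> 4 * \<epsilon>"
proof -
  obtain v where v: "v \<in> Gstar K b" "\<phi> b v = y" "dist y v \<le> \<epsilon>"
    using \<phi>_hits[OF y] small' r1 \<epsilon>_pos by (smt (verit))
  obtain p where p: "p \<in> piece K b" "y \<in> ball p r1" using y by (auto simp: thicken_def)
  obtain u where u: "u \<in> Gstar K a" "ib L a b y = \<phi> a u" "dist u (ib K a b v) \<le> 2 * \<epsilon>"
      "dist (ib L a b y) (ib K a b v) \<le> 3 * \<epsilon>"
    using fL_near_Gstar[OF R v(1)] v(2) by metis
  have "dist (ib K a b v) (ib K a b y) \<le> \<mu> * dist v y"
  proof (rule fK_lipschitz[OF R ball_in_image[OF R p(1)]])
    show "v \<in> ball p (rad K)" "y \<in> ball p (rad K)"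
      using p v(3) r1 small' \<epsilon>_pos dist_triangle[of p v y] by (auto simp: dist_commute)
  qed
  also have "\<dots> \<le> 1 * \<epsilon>" using v(3) K.\<mu> by (intro mult_mono) (auto simp: dist_commute)
  finally have "dist (ib K a b v) (ib K a b y) \<le> \<epsilon>" by simp
  then show thesis
    using u dist_triangle[of u "ib K a b y" "ib K a b v"]
      dist_triangle[of "ib L a b y" "ib K a b y" "ib K a b v"] by (intro that[of u]) auto
qed

lemma fL_D: "(a, b) \<in> adm K \<Longrightarrow> y \<in> D b \<Longrightarrow> ib L a b y \<in> D a"
proof -
  assume R: "(a, b) \<in> adm K" and y: "y \<in> D b"
  have "ib K a b y \<in> thicken (\<mu> * r1) (piece K a)"
    using r1 by (intro K.f_thicken[OF R _ y]) auto
  moreover have "dist (ib K a b y) (ib L a b y) \<le> 4 * \<epsilon>"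
    using fL_near[OF R y] by (metis dist_commute)
  ultimately have "ib L a b y \<in> thicken (\<mu> * r1 + 4 * \<epsilon>) (piece K a)" by (rule thicken_shift)
  then show ?thesis using thicken_mono[OF small'(7)] by blast
qed

lemma fK_D: "(a, b) \<in> adm K \<Longrightarrow> y \<in> D b \<Longrightarrow> ib K a b y \<in> D a"
  using K.f_thicken[of a b r1 y] r1 K.\<mu> thicken_mono[of "\<mu> * r1" r1 "piece K a"] by auto

text \<open>
  Every point of an orbit in the Cantor set of \<open>L\<close> lies in \<open>\<phi> (G\<^sup>*)\<close>, hence near some \<open>G\<^sup>*\<close> of \<open>K\<close>.
  If its image lies \<open>r\<close>-close to a piece of \<open>K\<close>, pulling back along an inverse branch shows that
  the point itself is \<open>(\<mu> r + 4 \<epsilon>)\<close>-close to one; iterating this along the orbit brings the radius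
  down to about \<open>e\<close>, which is less than \<open>r1\<close>.
\<close>

lemma cantor_piece_D: "cantor_piece L a \<subseteq> D a"
proof
  fix z assume z: "z \<in> cantor_piece L a"
  then have "z \<in> cantor_set L" by (simp add: cantor_piece_def)
  then obtain s where s: "\<And>n. (expmap L ^^ n) z \<in> piece L (s n)" "\<And>n. (s n, s (Suc n)) \<in> adm L"
    using L.cantor_set_itinerary by blast
  have a: "s 0 = a"
    using s(1)[of 0] z L.piece_Gstar L.Gstar_disjoint unfolding cantor_piece_def
    by (metis IntD2 funpow_0 subsetD)
  define x where "x n = (expmap L ^^ n) z" for n
  have xL: "x n \<in> Gstar L (s n)" for n using s(1) L.piece_Gstar by (auto simp: x_def)
  have R: "(s n, s (Suc n)) \<in> adm K" for n using s(2) adm_eq by simp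
  have pull: "x n = ib L (s n) (s (Suc n)) (x (Suc n))" for n
    using L.f_g[OF xL[of n]] by (simp add: x_def)
  have step: "x n \<in> thicken (\<mu> * r + 3 * \<epsilon>) (piece K (s n))"
    if "v \<in> thicken r (piece K (s (Suc n)))" "v \<in> Gstar K (s (Suc n))" "x (Suc n) = \<phi> (s (Suc n)) v" "r \<le> rad K" for n v r
  proof -
    have "dist (x n) (ib K (s n) (s (Suc n)) v) \<le> 3 * \<epsilon>"
      using fL_near_Gstar[OF R that(2)] that(3) pull[of n] by metis
    then show ?thesis
      using thicken_shift[OF K.f_thicken[OF R that(4,1)], of "x n"] by (simp add: dist_commute)
  qed
  have *: "x n \<in> thicken (\<mu> ^ Suc m * rad K + e) (piece K (s n))" for m n
  proof (induction m arbitrary: n)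
    case 0
    obtain v where v: "v \<in> Gstar K (s (Suc n))" "x (Suc n) = \<phi> (s (Suc n)) v"
      using \<phi>_surj[OF xL] by blast
    then have "x n \<in> thicken (\<mu> * rad K + 3 * \<epsilon>) (piece K (s n))"
      by (intro step) (auto simp: Gstar_thicken)
    moreover have "\<mu> * rad K + 3 * \<epsilon> \<le> \<mu> ^ Suc 0 * rad K + e" using small'(2) \<epsilon>_pos by simp
    ultimately show ?case using thicken_mono by blast
  next
    case (Suc m)
    let ?r = "\<mu> ^ Suc m * rad K + e + \<epsilon>"
    obtain v where v: "v \<in> Gstar K (s (Suc n))" "x (Suc n) = \<phi> (s (Suc n)) v"
      using \<phi>_surj[OF xL] by blast
    have "v \<in> thicken ?r (piece K (s (Suc n)))"
      by (rule thicken_shift[OF Suc.IH]) (use \<phi>_dist[OF v(1)] v(2) in simp)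
    moreover have "?r \<le> rad K"
    proof -
      have "\<mu> ^ Suc m \<le> \<mu>" using K.\<mu> power_decreasing[of 1 "Suc m" \<mu>] by simp
      then have "\<mu> ^ Suc m * rad K \<le> \<mu> * rad K" using K.rad_pos by (intro mult_right_mono) auto
      moreover have "e + \<epsilon> \<le> (1 - \<mu>) * r1" using small'(1,2,3) \<epsilon>_pos by linarith
      moreover have "(1 - \<mu>) * r1 \<le> (1 - \<mu>) * rad K" using K.\<mu> r1 by (intro mult_left_mono) auto
      ultimately show ?thesis by (simp add: algebra_simps)
    qed
    ultimately have "x n \<in> thicken (\<mu> * ?r + 3 * \<epsilon>) (piece K (s n))"
      using v by (intro step)
    moreover have "\<mu> * ?r + 3 * \<epsilon> \<le> \<mu> ^ Suc (Suc m) * rad K + e"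
    proof -
      have "\<mu> * ?r + 3 * \<epsilon> = \<mu> ^ Suc (Suc m) * rad K + (\<mu> * e + 4 * \<epsilon>) - (1 - \<mu>) * \<epsilon>"
        by (simp add: algebra_simps)
      moreover have "0 \<le> (1 - \<mu>) * \<epsilon>" using K.\<mu> \<epsilon>_pos by simp
      ultimately show ?thesis using small'(6) by linarith
    qed
    ultimately show ?case using thicken_mono by blast
  qed
  have "(\<lambda>m. \<mu> ^ Suc m * rad K + e) \<longlonglongrightarrow> 0 * rad K + e"
    using K.\<mu> by (intro tendsto_intros LIMSEQ_Suc[OF LIMSEQ_realpow_zero]) auto
  then have "\<forall>\<^sub>F m in sequentially. \<mu> ^ Suc m * rad K + e < r1"
    using small'(3,5) by (intro order_tendstoD(2)) auto
  then obtain m where "\<mu> ^ Suc m * rad K + e < r1" by (auto simp: eventually_sequentially)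
  then show "z \<in> D a"
    using *[of 0 m] thicken_mono[of "\<mu> ^ Suc m * rad K + e" r1 "piece K a"] a by (auto simp: x_def)
qed

text \<open>
  Along inverse branches the distance is contracted before a new error of size \<open>4 \<epsilon>\<close> is added, so the
  estimate does not depend on the number of steps.
\<close>

lemma shadowing:
  assumes \<theta>: "left_seq (adm K) \<theta>" and "y \<in> D (\<theta> 0)" "x \<in> D (\<theta> 0)" "dist y x \<le> e"
  shows "branch (ib L) \<theta> n y \<in> D (\<theta> n)" "branch (ib K) \<theta> n x \<in> D (\<theta> n)"
    and "dist (branch (ib L) \<theta> n y) (branch (ib K) \<theta> n x) \<le> e + dist y x"
proof -
  have R: "(\<theta> (Suc n), \<theta> n) \<in> adm K" for n using \<theta> by (simp add: left_seq_def)
  show y: "branch (ib L) \<theta> n y \<in> D (\<theta> n)" for n by (induction n) (auto simp: assms fL_D R)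
  show x: "branch (ib K) \<theta> n x \<in> D (\<theta> n)" for n by (induction n) (auto simp: assms fK_D R)
  show "dist (branch (ib L) \<theta> n y) (branch (ib K) \<theta> n x) \<le> e + dist y x" for n
  proof (induction n)
    case 0
    then show ?case using small' by simp
  next
    case (Suc n)
    let ?y = "branch (ib L) \<theta> n y" and ?x = "branch (ib K) \<theta> n x"
    let ?a = "\<theta> (Suc n)" and ?b = "\<theta> n"
    obtain p where p: "p \<in> piece K ?b" "?x \<in> ball p r1" using x[of n] by (auto simp: thicken_def)
    have "dist (ib K ?a ?b ?y) (ib K ?a ?b ?x) \<le> \<mu> * dist ?y ?x"
    proof (rule fK_lipschitz[OF R ball_in_image[OF R p(1)]])
      have "dist p ?y < r1 + (e + dist y x)"
        using p(2) Suc.IH dist_triangle[of p ?y ?x] by (simp add: dist_commute)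
      then show "?y \<in> ball p (rad K)" using small'(5) assms(4) r1 by simp
      show "?x \<in> ball p (rad K)" using p(2) r1 by simp
    qed
    also have "\<dots> \<le> \<mu> * (e + dist y x)" using Suc.IH K.\<mu> by (intro mult_left_mono) auto
    also have "\<dots> \<le> \<mu> * e + dist y x" using K.\<mu> by (simp add: algebra_simps mult_left_le_one_le)
    finally have "dist (ib K ?a ?b ?y) (ib K ?a ?b ?x) \<le> \<mu> * e + dist y x" .
    moreover have "dist (ib L ?a ?b ?y) (ib K ?a ?b ?y) \<le> 4 * \<epsilon>"
      using fL_near[OF R y[of n]] by metis
    ultimately show ?case
      using dist_triangle[of "ib L ?a ?b ?y" "ib K ?a ?b ?x" "ib K ?a ?b ?y"] small'(6) by simp
  qed
qed

text \<open>
  Bounds the distance between the derivatives of the two expanding maps at the images of one point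
  under corresponding inverse branches.
\<close>

definition \<omega> where "\<omega> = \<epsilon> + 2 * (\<Gamma> + 1) * \<epsilon> + H * (3 * \<epsilon>) powr \<alpha>"

lemma DgL_near:
  assumes R: "(a, b) \<in> adm K" and y: "y \<in> D b"
  shows "norm (Der (expmap L) (ib L a b y) - Der (expmap K) (ib K a b y)) \<le> \<omega>"
    and "norm (Der (expmap L) (ib L a b y)) \<le> 2 * (\<Gamma> + 1)"
proof -
  obtain u where u: "u \<in> Gstar K a" "ib L a b y = \<phi> a u" "dist u (ib K a b y) \<le> 3 * \<epsilon>"
    using fL_near[OF R y] by metis
  have "norm (Der (expmap K) u - Der (expmap K) (ib K a b y)) \<le> H * dist u (ib K a b y) powr \<alpha>"
    using y D_Gstar R by (intro H(2)[OF u(1)] K.f_in) auto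
  also have "\<dots> \<le> H * (3 * \<epsilon>) powr \<alpha>"
    using u(3) K.\<alpha>_pos by (intro mult_left_mono powr_mono2 H) auto
  finally show "norm (Der (expmap L) (ib L a b y) - Der (expmap K) (ib K a b y)) \<le> \<omega>"
    using DgL_bound(2)[OF u(1)] norm_triangle_ineq[of "Der (expmap L) (ib L a b y) - Der (expmap K) u"
        "Der (expmap K) u - Der (expmap K) (ib K a b y)"] u(2) by (simp add: \<omega>_def)
  show "norm (Der (expmap L) (ib L a b y)) \<le> 2 * (\<Gamma> + 1)"
    using DgL_bound(1)[OF u(1)] u(2) by simp
qed

lemma fL_pair:
  assumes R: "(a, b) \<in> adm K" and y: "y \<in> D b"
  shows "inverse_pair (Der (ib L a b) y) (Der (expmap L) (ib L a b y))"
    and "(ib L a b has_derivative blinfun_apply (Der (ib L a b) y)) (at y)"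
proof -
  have y: "y \<in> Gstar L b" and R: "(a, b) \<in> adm L" using y D_GstarL R adm_eq by auto
  show "inverse_pair (Der (ib L a b) y) (Der (expmap L) (ib L a b y))"
    using L.f_pair[OF L.f_in[OF R y], of b] L.g_f[OF R y] by simp
  show "(ib L a b has_derivative blinfun_apply (Der (ib L a b) y)) (at y)"
    using L.f_in[OF R y] L.g_f[OF R y] by (intro Der_works L.f_differentiable) (metis imageI)
qed

lemma fL_norm:
  assumes R: "(a, b) \<in> adm K" and y: "y \<in> D b" and "0 < \<mu>1" "\<omega> \<le> inverse \<mu> - inverse \<mu>1"
  shows "norm (Der (ib L a b) y) \<le> \<mu>1"
proof -
  have yG: "y \<in> Gstar K b" using y D_Gstar by blast
  have "inverse \<mu> \<le> conorm (Der (expmap K) (ib K a b y))"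
    using K.regular K.f_in[OF R yG] K.Gstar_nbhd[of a] unfolding regular_cantor_def
    by (meson less_imp_le subsetD)
  also have "\<dots> \<le> conorm (Der (expmap L) (ib L a b y)) + \<omega>"
    using conorm_lipschitz[of "Der (expmap K) (ib K a b y)" "Der (expmap L) (ib L a b y)"]
      DgL_near(1)[OF R y] by (simp add: norm_minus_commute)
  finally have "inverse \<mu>1 \<le> conorm (Der (expmap L) (ib L a b y))" using assms(4) by simp
  then show ?thesis
    using norm_le_of_conorm[OF inverse_pair_sym[OF fL_pair(1)[OF R y]], of "inverse \<mu>1"] assms(3) by simp
qed

lemma branch_D:
  assumes \<theta>: "left_seq (adm K) \<theta>"
  shows "y \<in> D (\<theta> 0) \<Longrightarrow> branch (ib L) \<theta> n y \<in> D (\<theta> n)" "y \<in> D (\<theta> 0) \<Longrightarrow> branch (ib K) \<theta> n y \<in> D (\<theta> n)"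
proof -
  have R: "(\<theta> (Suc n), \<theta> n) \<in> adm K" for n using \<theta> by (simp add: left_seq_def)
  show "y \<in> D (\<theta> 0) \<Longrightarrow> branch (ib L) \<theta> n y \<in> D (\<theta> n)" by (induction n) (auto simp: fL_D R)
  show "y \<in> D (\<theta> 0) \<Longrightarrow> branch (ib K) \<theta> n y \<in> D (\<theta> n)" by (induction n) (auto simp: fK_D R)
qed

lemma fK_near:
  assumes R: "(a, b) \<in> adm K" and "y \<in> D b" "x \<in> D b" "dist y x < r1"
  shows "dist (ib K a b y) (ib K a b x) \<le> dist y x"
proof -
  obtain p where p: "p \<in> piece K b" "x \<in> ball p r1" using assms(3) by (auto simp: thicken_def)
  have "dist (ib K a b y) (ib K a b x) \<le> \<mu> * dist y x"
  proof (rule fK_lipschitz[OF R ball_in_image[OF R p(1)]])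
    show "y \<in> ball p (rad K)" "x \<in> ball p (rad K)"
      using p r1 assms(4) dist_triangle[of p y x] by (auto simp: dist_commute)
  qed
  also have "\<dots> \<le> 1 * dist y x" using K.\<mu> by (intro mult_right_mono) auto
  finally show ?thesis by simp
qed

lemma one_step:
  assumes R: "(a, b) \<in> adm K" and "y \<in> D b" "x \<in> D b" "dist y x < r1"
  shows "norm (ib L a b y - ib K a b x) \<le> 4 * \<epsilon> + norm (y - x)"
    and "norm (Der (expmap L) (ib L a b y) - Der (expmap K) (ib K a b x)) \<le> \<omega> + H * norm (y - x) powr \<alpha>"
proof -
  note n = fK_near[OF assms]
  have "dist (ib L a b y) (ib K a b y) \<le> 4 * \<epsilon>" using fL_near[OF R assms(2)] by metis
  then show "norm (ib L a b y - ib K a b x) \<le> 4 * \<epsilon> + norm (y - x)"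
    using n dist_triangle[of "ib L a b y" "ib K a b x" "ib K a b y"] by (simp add: dist_norm)
  have "norm (Der (expmap K) (ib K a b y) - Der (expmap K) (ib K a b x)) \<le>
      H * dist (ib K a b y) (ib K a b x) powr \<alpha>"
    using assms(2,3) D_Gstar by (intro H(2)[where a = a] K.f_in[OF R]) auto
  also have "\<dots> \<le> H * norm (y - x) powr \<alpha>"
    using n K.\<alpha>_pos by (intro mult_left_mono powr_mono2 H) (auto simp: dist_norm)
  finally show "norm (Der (expmap L) (ib L a b y) - Der (expmap K) (ib K a b x)) \<le> \<omega> + H * norm (y - x) powr \<alpha>"
    using DgL_near(1)[OF R assms(2)]
      norm_triangle_ineq[of "Der (expmap L) (ib L a b y) - Der (expmap K) (ib K a b y)"
        "Der (expmap K) (ib K a b y) - Der (expmap K) (ib K a b x)"] by simp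
qed

lemma branches_L:
  assumes "\<mu> < \<mu>1" "\<mu>1 < 1" "\<omega> \<le> inverse \<mu> - inverse \<mu>1"
  shows "branches (adm K) D (ib L) (expmap L) \<mu>1 (2 * (\<Gamma> + 1))"
proof
  fix a b y assume R: "(a, b) \<in> adm K" and y: "y \<in> D b"
  show "norm (Der (ib L a b) y) \<le> \<mu>1"
    using K.\<mu> assms by (intro fL_norm[OF R y]) auto
qed (use fL_D fL_pair DgL_near(2) K.\<mu> assms \<Gamma>(1) in auto)

end

section \<open>Families of perturbations\<close>

context limit_geometries begin

text \<open>Mixing, applied to the sequences starting with \<open>b\<close>, gives a path from \<open>b\<close> to \<open>b\<close>; so \<open>b\<close> has a predecessor.\<close>

lemma left_extension: "\<exists>\<tau>. left_seq (adm K) \<tau> \<and> \<tau> 0 = b"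
proof -
  have "\<exists>a. (a, b) \<in> adm K" for b
  proof -
    let ?X = "Sigma_top K" and ?T = "\<lambda>s i. s (Suc i) :: 'a"
    define U where "U = {s. (\<forall>i. (s i, s (Suc i)) \<in> adm K) \<and> s 0 = b}"
    have "openin (product_topology (\<lambda>_. discrete_topology UNIV) UNIV) {s :: nat \<Rightarrow> 'a. s 0 = b}"
      using openin_continuous_map_preimage[OF continuous_map_product_projection[of 0 UNIV "\<lambda>_::nat. discrete_topology (UNIV :: 'a set)"],
        of "{b}"] by simp
    then have "openin ?X ({s. s 0 = b} \<inter> {s. \<forall>i. (s i, s (Suc i)) \<in> adm K})"
      unfolding Sigma_top_def openin_subtopology by blast
    moreover have "{s. s 0 = b} \<inter> {s. \<forall>i. (s i, s (Suc i)) \<in> adm K} = U" by (auto simp: U_def)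
    ultimately have "openin ?X U" by simp
    moreover have "U \<noteq> {}"
    proof -
      have "c b \<in> cantor_set K" using c_cantor by (auto simp: cantor_piece_def)
      then obtain s where s: "\<And>n. (g ^^ n) (c b) \<in> piece K (s n)" "\<And>n. (s n, s (Suc n)) \<in> adm K"
        using cantor_set_itinerary by blast
      have "c b \<in> piece K (s 0)" using s(1)[of 0] by simp
      then have "s 0 = b"
        using c_Gstar[of b] piece_Gstar[of "s 0"] Gstar_disjoint by blast
      then show ?thesis using s(2) by (auto simp: U_def)
    qed
    moreover have "topologically_mixing ?X ?T"
      using regular by (simp only: regular_cantor_def)
    ultimately obtain N where N: "\<And>n. N \<le> n \<Longrightarrow> (?T ^^ n) ` U \<inter> U \<noteq> {}"
      unfolding topologically_mixing_def by meson
    have "(?T ^^ Suc N) ` U \<inter> U \<noteq> {}" by (rule N) simp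
    then obtain s where s: "s \<in> U" "(?T ^^ Suc N) s \<in> U" by (auto simp del: funpow.simps)
    have "(?T ^^ n) s i = s (i + n)" for n and s :: "nat \<Rightarrow> 'a" and i
      by (induction n arbitrary: i) auto
    then have "s (Suc N) = b" using s(2) by (auto simp: U_def simp del: funpow.simps)
    then show ?thesis using s(1) by (auto simp: U_def)
  qed
  then obtain p where p: "\<And>b. (p b, b) \<in> adm K" by metis
  have "left_seq (adm K) (\<lambda>n. (p ^^ n) b)" using p by (simp add: left_seq_def)
  then show ?thesis by (intro exI[of _ "\<lambda>n. (p ^^ n) b"]) simp
qed

text \<open>
  The point of \<open>L\<close> with the itinerary of \<open>c b\<close> is the wanted one.  The two orbits are compared backwards
  from time \<open>n\<close>: pulling back \<open>n\<close> steps by shadowing costs \<open>e\<close>, and the initial distance is contracted away.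
\<close>

lemma perturbed_base_point:
  assumes "perturbed \<alpha> K L \<epsilon> r0 r1 \<Gamma> H' \<phi>"
  shows "\<exists>x\<in>cantor_piece L b. dist x (c b) \<le> 4 * \<epsilon> / (1 - contr K)"
proof -
  interpret P: perturbed \<alpha> K L \<epsilon> r0 r1 \<Gamma> H' \<phi> by fact
  have "c b \<in> cantor_set K" using c_cantor by (auto simp: cantor_piece_def)
  then obtain s where s: "\<And>n. (g ^^ n) (c b) \<in> piece K (s n)" "\<And>n. (s n, s (Suc n)) \<in> adm K"
    using cantor_set_itinerary by blast
  have "c b \<in> piece K (s 0)" using s(1)[of 0] by simp
  then have s0: "s 0 = b"
    using c_Gstar[of b] piece_Gstar[of "s 0"] Gstar_disjoint by blast
  obtain x where x: "\<And>n. (expmap L ^^ n) x \<in> piece L (s n)"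
    using P.L.itinerary_point[of s] s(2) P.adm_eq by auto
  have xL: "(expmap L ^^ n) x \<in> cantor_piece L (s n)" for n
    using P.L.cantor_set_orbit[OF P.L.cantor_setI[OF x]] x by (auto simp: cantor_piece_def)
  obtain \<tau> where \<tau>: "left_seq (adm K) \<tau>" "\<tau> 0 = b" using left_extension by blast
  have le: "dist x (c b) \<le> P.e + M * contr K ^ n" for n
  proof -
    \<comment> \<open>Branches want a left-infinite sequence; left of the itinerary any admissible continuation will do.\<close>
    define \<theta> where "\<theta> i = (if i \<le> n then s (n - i) else \<tau> (i - n))" for i
    have \<theta>: "left_seq (adm K) \<theta>"
      unfolding left_seq_def
    proof
      fix i
      consider "i < n" | "i = n" | "n < i" by linarith
      then show "(\<theta> (Suc i), \<theta> i) \<in> adm K"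
      proof cases
        case 1
        then show ?thesis using s(2)[of "n - Suc i"] by (simp add: \<theta>_def Suc_diff_Suc)
      next
        case 2
        then show ?thesis using \<tau> s0 by (auto simp: \<theta>_def left_seq_def)
      next
        case 3
        then show ?thesis using \<tau>(1) by (simp add: \<theta>_def left_seq_def Suc_diff_le)
      qed
    qed
    have R: "(\<theta> (Suc i), \<theta> i) \<in> adm K" for i using \<theta> by (simp add: left_seq_def)
    have \<theta>_s: "\<theta> i = s (n - i)" if "i \<le> n" for i using that by (simp add: \<theta>_def)
    have brL: "branch (ib L) \<theta> i ((expmap L ^^ n) x) = (expmap L ^^ (n - i)) x" if "i \<le> n" for i
      using that
    proof (induction i)
      case (Suc i)
      have "(expmap L ^^ (n - Suc i)) x \<in> Gstar L (\<theta> (Suc i))"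
        using xL[of "n - Suc i"] P.L.piece_Gstar \<theta>_s[of "Suc i"] Suc.prems by (auto simp: cantor_piece_def)
      moreover have "(expmap L ^^ (n - i)) x = expmap L ((expmap L ^^ (n - Suc i)) x)"
        using Suc.prems by (metis Suc_diff_Suc Suc_le_lessD comp_apply funpow.simps(2))
      ultimately show ?case
        using Suc P.L.f_g[of "(expmap L ^^ (n - Suc i)) x" "\<theta> (Suc i)" "\<theta> i"] by simp
    qed simp
    have brK: "branch f \<theta> i ((g ^^ n) (c b)) = (g ^^ (n - i)) (c b)" if "i \<le> n" for i
      using that
    proof (induction i)
      case (Suc i)
      have "(g ^^ (n - Suc i)) (c b) \<in> Gstar K (\<theta> (Suc i))"
        using s(1)[of "n - Suc i"] piece_Gstar \<theta>_s[of "Suc i"] Suc.prems by auto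
      moreover have "(g ^^ (n - i)) (c b) = g ((g ^^ (n - Suc i)) (c b))"
        using Suc.prems by (metis Suc_diff_Suc Suc_le_lessD comp_apply funpow.simps(2))
      ultimately show ?case
        using Suc f_g[of "(g ^^ (n - Suc i)) (c b)" "\<theta> (Suc i)" "\<theta> i"] by simp
    qed simp
    let ?y = "(expmap L ^^ n) x" and ?z = "(g ^^ n) (c b)"
    have y: "?y \<in> P.D (\<theta> 0)" using P.cantor_piece_D xL[of n] \<theta>_s[of 0] by auto
    have z: "?z \<in> Gstar K (\<theta> 0)" using s(1)[of n] piece_Gstar \<theta>_s[of 0] by auto
    have "dist (branch (ib L) \<theta> n ?y) (branch f \<theta> n ?y) \<le> P.e"
      using P.shadowing(3)[OF \<theta> y y] P.small' by simp
    moreover have "dist (branch f \<theta> n ?y) (branch f \<theta> n ?z) \<le> M * contr K ^ n"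
      using y P.D_Gstar by (intro B.diameter[OF \<theta> _ z]) auto
    ultimately show ?thesis
      using brL[of n] brK[of n] dist_triangle[of x "c b" "branch f \<theta> n ?y"] by simp
  qed
  have "(\<lambda>n. P.e + M * contr K ^ n) \<longlonglongrightarrow> P.e + M * 0"
    using \<mu> by (intro tendsto_intros LIMSEQ_realpow_zero) auto
  then have "dist x (c b) \<le> P.e + M * 0" by (rule tendsto_lowerbound) (use le in auto)
  then show ?thesis
    using xL[of 0] s0 by (intro bexI[of _ x]) (auto simp: P.e_def)
qed

end

context bunched_branches begin

text \<open>The estimate of \<open>observable_tail\<close>, passed from derivatives to values by the inner diameter.\<close>

lemma observable_tail_value:
  assumes "left_seq R \<theta>" "x \<in> D (\<theta> 0)"
    and holder: "\<And>y z. y \<in> D (\<theta> p) \<Longrightarrow> z \<in> D (\<theta> p) \<Longrightarrow> norm (h' y - h' z) \<le> B * dist y z powr \<alpha>"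
    and der: "\<And>y. y \<in> D (\<theta> p) \<Longrightarrow> (h has_derivative blinfun_apply (h' y)) (at y)"
    and inv: "inverse_pair (h' (branch f \<theta> p (c (\<theta> 0)))) Y" "norm Y \<le> Z" and "0 \<le> B" and "m \<le> p"
  shows "norm (blinfun_apply (ibranch f g \<theta> p (c (\<theta> 0)) o\<^sub>L Y) (h (branch f \<theta> p x) - h (branch f \<theta> p (c (\<theta> 0))))
      - blinfun_apply (ibranch f g \<theta> m (c (\<theta> 0))) (branch f \<theta> m x - branch f \<theta> m (c (\<theta> 0))))
     \<le> M * ((Z * B * Q * dist_const + tail_const) * \<kappa> ^ m)"
proof -
  let ?c = "c (\<theta> 0)"
  let ?\<phi> = "\<lambda>x. blinfun_apply (ibranch f g \<theta> p ?c o\<^sub>L Y) (h (branch f \<theta> p x))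
      - blinfun_apply (ibranch f g \<theta> m ?c) (branch f \<theta> m x)"
  let ?\<phi>' = "\<lambda>x. ((ibranch f g \<theta> p ?c o\<^sub>L Y) o\<^sub>L (h' (branch f \<theta> p x) o\<^sub>L dbranch f \<theta> p x)) - E \<theta> m x"
  have "norm (?\<phi> x - ?\<phi> ?c) \<le> M * ((Z * B * Q * dist_const + tail_const) * \<kappa> ^ m)"
  proof (rule D_inner[where \<phi>' = ?\<phi>', OF _ _ assms(2) base_in])
    fix y assume y: "y \<in> D (\<theta> 0)"
    show "norm (?\<phi>' y) \<le> (Z * B * Q * dist_const + tail_const) * \<kappa> ^ m"
      by (rule observable_tail[OF assms(1) y holder inv assms(7,8)])
    have hb: "((\<lambda>x. h (branch f \<theta> p x)) has_derivative
        (\<lambda>v. blinfun_apply (h' (branch f \<theta> p y)) (blinfun_apply (dbranch f \<theta> p y) v))) (at y)"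
      using diff_chain_at[OF branch_has_derivative[OF assms(1) y] der[OF branch_in[OF assms(1) y]]]
      by (simp add: o_def)
    have "(?\<phi> has_derivative (\<lambda>v. blinfun_apply (ibranch f g \<theta> p ?c o\<^sub>L Y)
        (blinfun_apply (h' (branch f \<theta> p y)) (blinfun_apply (dbranch f \<theta> p y) v))
       - blinfun_apply (ibranch f g \<theta> m ?c) (blinfun_apply (dbranch f \<theta> m y) v))) (at y)"
      by (intro has_derivative_diff bounded_linear.has_derivative[OF blinfun.bounded_linear_right]
          hb branch_has_derivative assms(1) y)
    then show "(?\<phi> has_derivative blinfun_apply (?\<phi>' y)) (at y)"
      by (rule has_derivative_eq_rhs) (simp add: fun_eq_iff blinfun.diff_left E_def)
  qed
  then show ?thesis by (simp add: blinfun.diff_right algebra_simps)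
qed

end

text \<open>
  Perturbations form a family indexed by \<open>t\<close>, with \<open>\<epsilon> t\<close> tending to \<open>0\<close> along a filter \<open>F\<close>.  Letters, words and
  points may depend on \<open>t\<close> too, and limits are established along all finer filters \<open>F'\<close>; by
  \<open>eventually_ball_of_choices\<close> this amounts to uniformity in the words and points.
\<close>

locale perturbed_family = limit_geometries \<alpha> K c \<Gamma> H M Q \<kappa>
  for \<alpha> :: real and K :: "('a::finite, 'd::finite) cantor" and c :: "'a \<Rightarrow> complex ^ 'd"
    and \<Gamma> H M Q \<kappa> :: real +
  fixes r0 r1 :: real and F :: "'t filter" and L :: "'t \<Rightarrow> ('a, 'd) cantor" and \<epsilon> :: "'t \<Rightarrow> real"
    and \<phi> :: "'t \<Rightarrow> 'a \<Rightarrow> complex ^ 'd \<Rightarrow> complex ^ 'd"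
  assumes \<epsilon>_lim: "(\<epsilon> \<longlongrightarrow> 0) F"
    and perturbed: "\<forall>\<^sub>F t in F. perturbed \<alpha> K (L t) (\<epsilon> t) r0 r1 \<Gamma> H (\<phi> t)"
    and r1_pos: "0 < r1"
begin

abbreviation D where "D a \<equiv> thicken r1 (piece K a)"

lemma c_D: "c a \<in> D a"
  using c_cantor subset_thicken[OF r1_pos] by (auto simp: cantor_piece_def)

lemma cantor_D: "cantor_piece K a \<subseteq> D a"
  using subset_thicken[OF r1_pos] by (auto simp: cantor_piece_def)

lemma ev: "F' \<le> F \<Longrightarrow> \<forall>\<^sub>F t in F'. perturbed \<alpha> K (L t) (\<epsilon> t) r0 r1 \<Gamma> H (\<phi> t)"
  using perturbed filter_leD by blast

lemma \<epsilon>_lim': "F' \<le> F \<Longrightarrow> (\<epsilon> \<longlongrightarrow> 0) F'"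
  using \<epsilon>_lim tendsto_mono by blast

lemma tendsto_powr_zero:
  assumes "(u \<longlongrightarrow> 0) F'"
  shows "((\<lambda>t. \<bar>u t\<bar> powr \<alpha>) \<longlongrightarrow> 0) F'"
proof -
  have "((\<lambda>t. \<bar>u t\<bar>) \<longlongrightarrow> 0) F'" using tendsto_rabs_zero[OF assms] .
  then have "((\<lambda>t. \<bar>u t\<bar> powr \<alpha>) \<longlongrightarrow> 0 powr \<alpha>) F'"
    by (rule tendsto_powr2[OF _ tendsto_const]) (use \<alpha>_pos in auto)
  then show ?thesis by simp
qed

lemma \<omega>_lim:
  assumes "F' \<le> F"
  shows "((\<lambda>t. \<epsilon> t + 2 * (\<Gamma> + 1) * \<epsilon> t + H * (3 * \<bar>\<epsilon> t\<bar>) powr \<alpha>) \<longlongrightarrow> 0) F'"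
proof -
  have "((\<lambda>t. \<bar>3 * \<epsilon> t\<bar> powr \<alpha>) \<longlongrightarrow> 0) F'"
    by (rule tendsto_powr_zero) (use tendsto_mult_right_zero[OF \<epsilon>_lim'[OF assms]] in auto)
  then have "((\<lambda>t. \<epsilon> t + 2 * (\<Gamma> + 1) * \<epsilon> t + H * \<bar>3 * \<epsilon> t\<bar> powr \<alpha>) \<longlongrightarrow> 0 + 2 * (\<Gamma> + 1) * 0 + H * 0) F'"
    by (intro tendsto_intros \<epsilon>_lim' assms)
  then show ?thesis by (simp add: abs_mult)
qed

lemma step_lim:
  assumes F': "F' \<le> F" and e: "\<forall>\<^sub>F t in F'. (a t, b t) \<in> adm K \<and> y t \<in> D (b t) \<and> x t \<in> D (b t)"
    and lim: "((\<lambda>t. y t - x t) \<longlongrightarrow> 0) F'"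
  shows "((\<lambda>t. ib (L t) (a t) (b t) (y t) - ib K (a t) (b t) (x t)) \<longlongrightarrow> 0) F'"
    and "((\<lambda>t. Der (expmap (L t)) (ib (L t) (a t) (b t) (y t)) - Der (expmap K) (ib K (a t) (b t) (x t))) \<longlongrightarrow> 0) F'"
    and "((\<lambda>t. Der (ib (L t) (a t) (b t)) (y t) - Der (ib K (a t) (b t)) (x t)) \<longlongrightarrow> 0) F'"
proof -
  have "((\<lambda>t. norm (y t - x t)) \<longlongrightarrow> 0) F'" using lim by (rule tendsto_norm_zero)
  then have n: "\<forall>\<^sub>F t in F'. norm (y t - x t) < r1" using r1_pos by (rule order_tendstoD)
  have "((\<lambda>t. 4 * \<epsilon> t + norm (y t - x t)) \<longlongrightarrow> 4 * 0 + 0) F'"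
    by (intro tendsto_intros \<epsilon>_lim' F' tendsto_norm_zero lim)
  then have l1: "((\<lambda>t. 4 * \<epsilon> t + norm (y t - x t)) \<longlongrightarrow> 0) F'" by simp
  have "\<forall>\<^sub>F t in F'. norm (ib (L t) (a t) (b t) (y t) - ib K (a t) (b t) (x t)) \<le> 4 * \<epsilon> t + norm (y t - x t)"
    using ev[OF F'] e n
  proof eventually_elim
    case (elim t)
    then show ?case using perturbed.one_step(1)[OF elim(1), of "a t" "b t" "y t" "x t"] by (simp add: dist_norm)
  qed
  then show "((\<lambda>t. ib (L t) (a t) (b t) (y t) - ib K (a t) (b t) (x t)) \<longlongrightarrow> 0) F'"
    by (rule Lim_null_comparison[OF _ l1])
  have "((\<lambda>t. \<bar>norm (y t - x t)\<bar> powr \<alpha>) \<longlongrightarrow> 0) F'"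
    by (rule tendsto_powr_zero[OF tendsto_norm_zero[OF lim]])
  then have "((\<lambda>t. (\<epsilon> t + 2 * (\<Gamma> + 1) * \<epsilon> t + H * (3 * \<bar>\<epsilon> t\<bar>) powr \<alpha>) + H * norm (y t - x t) powr \<alpha>) \<longlongrightarrow> 0 + H * 0) F'"
    using \<omega>_lim[OF F'] by (intro tendsto_add tendsto_mult tendsto_const) simp_all
  then have l2: "((\<lambda>t. (\<epsilon> t + 2 * (\<Gamma> + 1) * \<epsilon> t + H * (3 * \<bar>\<epsilon> t\<bar>) powr \<alpha>) + H * norm (y t - x t) powr \<alpha>) \<longlongrightarrow> 0) F'"
    by simp
  have "\<forall>\<^sub>F t in F'. norm (Der (expmap (L t)) (ib (L t) (a t) (b t) (y t)) - Der (expmap K) (ib K (a t) (b t) (x t)))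
     \<le> (\<epsilon> t + 2 * (\<Gamma> + 1) * \<epsilon> t + H * (3 * \<bar>\<epsilon> t\<bar>) powr \<alpha>) + H * norm (y t - x t) powr \<alpha>"
    using ev[OF F'] e n
  proof eventually_elim
    case (elim t)
    interpret P: perturbed \<alpha> K "L t" "\<epsilon> t" r0 r1 \<Gamma> H "\<phi> t" by fact
    show ?case using P.one_step(2)[of "a t" "b t" "y t" "x t"] elim P.\<epsilon>_pos by (simp add: P.\<omega>_def dist_norm)
  qed
  then show G: "((\<lambda>t. Der (expmap (L t)) (ib (L t) (a t) (b t) (y t)) - Der (expmap K) (ib K (a t) (b t) (x t))) \<longlongrightarrow> 0) F'"
    by (rule Lim_null_comparison[OF _ l2])
  show "((\<lambda>t. Der (ib (L t) (a t) (b t)) (y t) - Der (ib K (a t) (b t)) (x t)) \<longlongrightarrow> 0) F'"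
  proof (rule inverse_pair_tendsto[OF _ _ _ G])
    show "\<forall>\<^sub>F t in F'. inverse_pair (Der (expmap (L t)) (ib (L t) (a t) (b t) (y t))) (Der (ib (L t) (a t) (b t)) (y t))"
      using ev[OF F'] e
    proof eventually_elim
      case (elim t)
      then show ?case using perturbed.fL_pair(1)[OF elim(1), of "a t" "b t" "y t"] by (simp add: inverse_pair_sym)
    qed
    show "\<forall>\<^sub>F t in F'. inverse_pair (Der (expmap K) (ib K (a t) (b t) (x t))) (Der (ib K (a t) (b t)) (x t))"
      using ev[OF F'] e
    proof eventually_elim
      case (elim t)
      then show ?case
        using perturbed.D_Gstar[OF elim(1), of "b t"] B.f_pair[of "a t" "b t" "x t"] inverse_pair_sym by blast
    qed
    show "\<forall>\<^sub>F t in F'. norm (Der (ib K (a t) (b t)) (x t)) \<le> contr K"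
      using ev[OF F'] e
    proof eventually_elim
      case (elim t)
      then show ?case
        using perturbed.D_Gstar[OF elim(1), of "b t"] B.f_norm[of "a t" "b t" "x t"] by blast
    qed
  qed
qed

text \<open>
  For a fixed number of steps the perturbed branch and its derivatives follow the unperturbed ones,
  however \<open>\<theta>\<close> depends on \<open>t\<close>.
\<close>

lemma branch_lim:
  assumes F': "F' \<le> F" and e: "\<forall>\<^sub>F t in F'. left_seq (adm K) (\<theta> t) \<and> y t \<in> D (\<theta> t 0) \<and> x t \<in> D (\<theta> t 0)"
    and lim: "((\<lambda>t. y t - x t) \<longlongrightarrow> 0) F'"
  shows "((\<lambda>t. branch (ib (L t)) (\<theta> t) n (y t) - branch (ib K) (\<theta> t) n (x t)) \<longlongrightarrow> 0) F'"
    and "((\<lambda>t. dbranch (ib (L t)) (\<theta> t) n (y t) - dbranch (ib K) (\<theta> t) n (x t)) \<longlongrightarrow> 0) F'"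
    and "((\<lambda>t. ibranch (ib (L t)) (expmap (L t)) (\<theta> t) n (y t) - ibranch (ib K) (expmap K) (\<theta> t) n (x t)) \<longlongrightarrow> 0) F'"
proof -
  have adm: "\<forall>\<^sub>F t in F'. (\<theta> t (Suc n), \<theta> t n) \<in> adm K \<and> branch (ib (L t)) (\<theta> t) n (y t) \<in> D (\<theta> t n)
      \<and> branch (ib K) (\<theta> t) n (x t) \<in> D (\<theta> t n)" for n
    using ev[OF F'] e
  proof eventually_elim
    case (elim t)
    then show ?case using perturbed.branch_D[OF elim(1), of "\<theta> t" _ n] by (simp add: left_seq_def)
  qed
  have G: "\<forall>\<^sub>F t in F'. left_seq (adm K) (\<theta> t) \<and> x t \<in> Gstar K (\<theta> t 0)"
    using ev[OF F'] e
  proof eventually_elim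
    case (elim t)
    then show ?case using perturbed.D_Gstar[OF elim(1), of "\<theta> t 0"] by auto
  qed
  show br: "((\<lambda>t. branch (ib (L t)) (\<theta> t) n (y t) - branch (ib K) (\<theta> t) n (x t)) \<longlongrightarrow> 0) F'" for n
  proof (induction n)
    case (Suc n)
    then show ?case using step_lim(1)[OF F' adm Suc] by simp
  qed (use lim in simp)
  show "((\<lambda>t. dbranch (ib (L t)) (\<theta> t) n (y t) - dbranch (ib K) (\<theta> t) n (x t)) \<longlongrightarrow> 0) F'" for n
  proof (induction n)
    case (Suc n)
    have "\<forall>\<^sub>F t in F'. norm (Der (f (\<theta> t (Suc n)) (\<theta> t n)) (branch f (\<theta> t) n (x t))) \<le> contr K"
      using G
    proof eventually_elim
      case (elim t)
      then show ?case
        using B.f_norm[of "\<theta> t (Suc n)" "\<theta> t n"] B.branch_in[of "\<theta> t" "x t" n] by (simp add: left_seq_def)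
    qed
    moreover have "\<forall>\<^sub>F t in F'. norm (dbranch f (\<theta> t) n (x t)) \<le> contr K ^ n"
      using G by eventually_elim (rule B.norm_dbranch; simp)
    ultimately show ?case
      using tendsto_compose_diff[OF step_lim(3)[OF F' adm br] Suc.IH] by simp
  qed simp
  show "((\<lambda>t. ibranch (ib (L t)) (expmap (L t)) (\<theta> t) n (y t) - ibranch (ib K) (expmap K) (\<theta> t) n (x t)) \<longlongrightarrow> 0) F'" for n
  proof (induction n)
    case (Suc n)
    have "\<forall>\<^sub>F t in F'. norm (Der g (f (\<theta> t (Suc n)) (\<theta> t n) (branch f (\<theta> t) n (x t)))) \<le> \<Gamma>"
      using G
    proof eventually_elim
      case (elim t)
      then show ?case
        using B.g_norm[of "\<theta> t (Suc n)" "\<theta> t n"] B.branch_in[of "\<theta> t" "x t" n] by (simp add: left_seq_def)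
    qed
    moreover have "\<forall>\<^sub>F t in F'. norm (ibranch f g (\<theta> t) n (x t)) \<le> \<Gamma> ^ n"
      using G by eventually_elim (rule B.norm_ibranch; simp)
    ultimately show ?case
      using tendsto_compose_diff[OF Suc.IH step_lim(2)[OF F' adm br]] by simp
  qed simp
qed

text \<open>
  The base points of \<open>K\<close> are replaced by nearby points of the perturbed Cantor set, because the
  derivatives of the perturbed map are complex linear only there.
\<close>

definition base :: "'t \<Rightarrow> 'a \<Rightarrow> complex ^ 'd" where
  "base t b = (SOME x. x \<in> cantor_piece (L t) b \<and> dist x (c b) \<le> 4 * \<epsilon> t / (1 - contr K))"

lemma base:
  assumes "perturbed \<alpha> K (L t) (\<epsilon> t) r0 r1 \<Gamma> H (\<phi> t)"
  shows "base t b \<in> cantor_piece (L t) b" "dist (base t b) (c b) \<le> 4 * \<epsilon> t / (1 - contr K)" "base t b \<in> D b"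
proof -
  show *: "base t b \<in> cantor_piece (L t) b" "dist (base t b) (c b) \<le> 4 * \<epsilon> t / (1 - contr K)"
    using someI_ex[OF perturbed_base_point[OF assms, of b, unfolded Bex_def]] by (simp_all add: base_def)
  show "base t b \<in> D b" using perturbed.cantor_piece_D[OF assms] * by blast
qed

text \<open>In contrast to \<open>branch_lim\<close> the number \<open>i t\<close> of steps is unrestricted, thanks to shadowing.\<close>

lemma base_orbit_lim:
  assumes F': "F' \<le> F" and e: "\<forall>\<^sub>F t in F'. left_seq (adm K) (\<theta> t)"
  shows "((\<lambda>t. branch (ib (L t)) (\<theta> t) (i t) (base t (\<theta> t 0)) - branch (ib K) (\<theta> t) (i t) (c (\<theta> t 0))) \<longlongrightarrow> 0) F'"
proof (rule Lim_null_comparison)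
  have "((\<lambda>t. 2 * (4 * \<epsilon> t / (1 - contr K))) \<longlongrightarrow> 2 * (4 * 0 / (1 - contr K))) F'"
    using \<mu> by (intro tendsto_intros \<epsilon>_lim' F') auto
  then show "((\<lambda>t. 2 * (4 * \<epsilon> t / (1 - contr K))) \<longlongrightarrow> 0) F'" by simp
  show "\<forall>\<^sub>F t in F'. norm (branch (ib (L t)) (\<theta> t) (i t) (base t (\<theta> t 0)) - branch (ib K) (\<theta> t) (i t) (c (\<theta> t 0)))
      \<le> 2 * (4 * \<epsilon> t / (1 - contr K))"
    using ev[OF F'] e
  proof eventually_elim
    case (elim t)
    interpret P: perturbed \<alpha> K "L t" "\<epsilon> t" r0 r1 \<Gamma> H "\<phi> t" by fact
    show ?case
      using P.shadowing(3)[OF elim(2) base(3)[OF elim(1)] c_D, of "i t"] base(2)[OF elim(1), of "\<theta> t 0"]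
      by (simp add: P.e_def dist_norm)
  qed
qed

lemma base_lim: "F' \<le> F \<Longrightarrow> ((\<lambda>t. base t (b t) - c (b t)) \<longlongrightarrow> 0) F'"
proof (rule Lim_null_comparison)
  assume F': "F' \<le> F"
  have "((\<lambda>t. 4 * \<epsilon> t / (1 - contr K)) \<longlongrightarrow> 4 * 0 / (1 - contr K)) F'"
    using \<mu> by (intro tendsto_intros \<epsilon>_lim' F') auto
  then show "((\<lambda>t. 4 * \<epsilon> t / (1 - contr K)) \<longlongrightarrow> 0) F'" by simp
  show "\<forall>\<^sub>F t in F'. norm (base t (b t) - c (b t)) \<le> 4 * \<epsilon> t / (1 - contr K)"
    using ev[OF F'] by eventually_elim (use base(2) in \<open>simp add: dist_norm\<close>)
qed

text \<open>
  The perturbed branches satisfy the bunching estimates with constants that do not depend on the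
  perturbation: bunching only has to be checked on blocks of a fixed length along base orbits.
\<close>

lemma family_bunched:
  obtains \<mu>1 \<Gamma>1 H1 M1 Q1 \<kappa>1 where
    "\<forall>\<^sub>F t in F. bunched_branches (adm K) D (ib (L t)) (expmap (L t)) \<mu>1 \<Gamma>1 (base t) \<alpha> H1 M1 Q1 \<kappa>1"
proof -
  have "cantor_set K \<noteq> {}" using c_cantor by (auto simp: cantor_piece_def)
  then obtain N \<rho> where N: "0 < N" "0 < \<rho>" "\<rho> < 1"
    and blocks: "\<And>\<theta> y. left_seq (adm K) \<theta> \<Longrightarrow> y \<in> cantor_piece K (\<theta> 0) \<Longrightarrow>
      norm (dbranch f \<theta> N y) * norm (ibranch f g \<theta> N y) * (\<mu> ^ N) powr \<alpha> \<le> \<rho>"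
    using bunched_blocks by blast
  \<comment> \<open>Both the contraction rate and the block estimate may deteriorate slightly.\<close>
  define \<rho>1 where "\<rho>1 = (1 + \<rho>) / 2"
  have \<rho>1: "\<rho> < \<rho>1" "0 < \<rho>1" "\<rho>1 < 1" using N by (auto simp: \<rho>1_def)
  have "((\<lambda>m. \<rho> * ((m / \<mu>) ^ N) powr \<alpha>) \<longlongrightarrow> \<rho> * ((\<mu> / \<mu>) ^ N) powr \<alpha>) (at_right \<mu>)"
    using \<mu> by (intro tendsto_intros) auto
  then have "\<forall>\<^sub>F m in at_right \<mu>. \<rho> * ((m / \<mu>) ^ N) powr \<alpha> < \<rho>1"
    using \<mu> \<rho>1 by (intro order_tendstoD(2)) auto
  moreover have "\<forall>\<^sub>F m in at_right \<mu>. m \<in> {\<mu><..<1}"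
    using \<mu> by (intro eventually_at_right_real) auto
  ultimately have "\<exists>m. \<rho> * ((m / \<mu>) ^ N) powr \<alpha> < \<rho>1 \<and> m \<in> {\<mu><..<1}"
    using eventually_happens[OF eventually_conj] trivial_limit_at_right_real by blast
  then obtain \<mu>1 where \<mu>1: "\<rho> * ((\<mu>1 / \<mu>) ^ N) powr \<alpha> < \<rho>1" "\<mu> < \<mu>1" "\<mu>1 < 1" by auto
  obtain M1 where M1: "0 < M1"
    "\<And>a (\<phi> :: complex ^ 'd \<Rightarrow> complex ^ 'd) \<phi>' B x y.
       (\<And>x. x \<in> D a \<Longrightarrow> (\<phi> has_derivative blinfun_apply (\<phi>' x)) (at x)) \<Longrightarrow>
       (\<And>x. x \<in> D a \<Longrightarrow> norm (\<phi>' x) \<le> B) \<Longrightarrow>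
       x \<in> D a \<Longrightarrow> y \<in> D a \<Longrightarrow> norm (\<phi> x - \<phi> y) \<le> M1 * B"
    using inner_diameter_pieces[OF r1_pos] by blast
  have "((\<lambda>t. \<epsilon> t + 2 * (\<Gamma> + 1) * \<epsilon> t + H * (3 * \<bar>\<epsilon> t\<bar>) powr \<alpha>) \<longlongrightarrow> 0) F" by (rule \<omega>_lim) simp
  then have \<omega>: "\<forall>\<^sub>F t in F. \<epsilon> t + 2 * (\<Gamma> + 1) * \<epsilon> t + H * (3 * \<bar>\<epsilon> t\<bar>) powr \<alpha> < inverse \<mu> - inverse \<mu>1"
    using \<mu> \<mu>1 by (intro order_tendstoD(2)) auto
  define bl where "bl t s = (case s of (\<theta>, i) \<Rightarrow>
     norm (dbranch (ib (L t)) (shift i \<theta>) N (branch (ib (L t)) \<theta> i (base t (\<theta> 0))))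
     * norm (ibranch (ib (L t)) (expmap (L t)) (shift i \<theta>) N (branch (ib (L t)) \<theta> i (base t (\<theta> 0))))
     * (\<mu>1 ^ N) powr \<alpha>)" for t s
  have bl: "\<forall>\<^sub>F t in F. \<forall>s\<in>{(\<theta>, i). left_seq (adm K) \<theta>}. bl t s < \<rho>1"
  proof (rule eventually_ball_of_choices)
    fix F' and s :: "'t \<Rightarrow> (nat \<Rightarrow> 'a) \<times> nat" assume F': "F' \<le> F" and s: "\<forall>\<^sub>F t in F'. s t \<in> {(\<theta>, i). left_seq (adm K) \<theta>}"
    define \<theta> where "\<theta> t = fst (s t)" for t
    define i where "i t = snd (s t)" for t
    have \<theta>: "\<forall>\<^sub>F t in F'. left_seq (adm K) (\<theta> t)" using s by eventually_elim (auto simp: \<theta>_def)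
    let ?y = "\<lambda>t. branch (ib (L t)) (\<theta> t) (i t) (base t (\<theta> t 0))"
    let ?x = "\<lambda>t. branch f (\<theta> t) (i t) (c (\<theta> t 0))"
    have e: "\<forall>\<^sub>F t in F'. left_seq (adm K) (shift (i t) (\<theta> t)) \<and> ?y t \<in> D (shift (i t) (\<theta> t) 0)
        \<and> ?x t \<in> D (shift (i t) (\<theta> t) 0)"
      using ev[OF F'] \<theta>
    proof eventually_elim
      case (elim t)
      then show ?case
        using left_seq_shift[OF elim(2), of "i t"] perturbed.branch_D[OF elim, of _ "i t"]
          base(3)[OF elim(1)] c_D by simp
    qed
    have c: "\<forall>\<^sub>F t in F'. ?x t \<in> cantor_piece K (shift (i t) (\<theta> t) 0)"
      using \<theta> by eventually_elim (auto intro!: branch_cantor c_cantor)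
    let ?A = "\<lambda>t. dbranch (ib (L t)) (shift (i t) (\<theta> t)) N (?y t)"
    let ?X = "\<lambda>t. dbranch f (shift (i t) (\<theta> t)) N (?x t)"
    let ?B = "\<lambda>t. ibranch (ib (L t)) (expmap (L t)) (shift (i t) (\<theta> t)) N (?y t)"
    let ?Z = "\<lambda>t. ibranch f g (shift (i t) (\<theta> t)) N (?x t)"
    note lim = branch_lim[OF F' e base_orbit_lim[OF F' \<theta>], of N]
    have "((\<lambda>t. norm (?A t - ?X t) * \<Gamma> ^ N + norm (?B t - ?Z t) + norm (?A t - ?X t) * norm (?B t - ?Z t))
        \<longlongrightarrow> 0 * \<Gamma> ^ N + 0 + 0 * 0) F'"
      by (intro tendsto_intros tendsto_norm_zero lim)
    then have "\<forall>\<^sub>F t in F'. norm (?A t - ?X t) * \<Gamma> ^ N + norm (?B t - ?Z t) + norm (?A t - ?X t) * norm (?B t - ?Z t)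
        < \<rho>1 - \<rho> * ((\<mu>1 / \<mu>) ^ N) powr \<alpha>"
      using \<mu>1 by (intro order_tendstoD(2)) auto
    then show "\<forall>\<^sub>F t in F'. bl t (s t) < \<rho>1"
      using c e ev[OF F']
    proof eventually_elim
      case (elim t)
      have xG: "?x t \<in> Gstar K (shift (i t) (\<theta> t) 0)" using elim(3) perturbed.D_Gstar[OF elim(4)] by blast
      have ls: "left_seq (adm K) (shift (i t) (\<theta> t))" using elim by simp
      have X: "norm (?X t) \<le> 1"
        using B.norm_dbranch[OF ls xG, of N] \<mu> power_le_one[of \<mu> N] by simp
      have Z: "norm (?Z t) \<le> \<Gamma> ^ N" by (rule B.norm_ibranch[OF ls xG])
      have "norm (?A t) * norm (?B t) \<le> (norm (?X t) + norm (?A t - ?X t)) * (norm (?Z t) + norm (?B t - ?Z t))"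
        by (intro mult_mono norm_triangle_sub) auto
      also have "\<dots> \<le> norm (?X t) * norm (?Z t) + (norm (?A t - ?X t) * \<Gamma> ^ N + 1 * norm (?B t - ?Z t)
          + norm (?A t - ?X t) * norm (?B t - ?Z t))"
        using mult_left_mono[OF Z norm_ge_zero[of "?A t - ?X t"]] mult_right_mono[OF X norm_ge_zero[of "?B t - ?Z t"]]
        by (simp add: algebra_simps)
      finally have "norm (?A t) * norm (?B t) \<le> norm (?X t) * norm (?Z t) + (\<rho>1 - \<rho> * ((\<mu>1 / \<mu>) ^ N) powr \<alpha>)"
        using elim(1) by simp
      then have "norm (?A t) * norm (?B t) * (\<mu>1 ^ N) powr \<alpha> \<le>
          (norm (?X t) * norm (?Z t) + (\<rho>1 - \<rho> * ((\<mu>1 / \<mu>) ^ N) powr \<alpha>)) * (\<mu>1 ^ N) powr \<alpha>"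
        by (rule mult_right_mono) simp
      also have "\<dots> = norm (?X t) * norm (?Z t) * (\<mu> ^ N) powr \<alpha> * ((\<mu>1 / \<mu>) ^ N) powr \<alpha>
         + (\<rho>1 - \<rho> * ((\<mu>1 / \<mu>) ^ N) powr \<alpha>) * (\<mu>1 ^ N) powr \<alpha>"
        using \<mu> \<mu>1 by (simp add: algebra_simps power_divide powr_divide)
      also have "\<dots> \<le> \<rho> * ((\<mu>1 / \<mu>) ^ N) powr \<alpha> + (\<rho>1 - \<rho> * ((\<mu>1 / \<mu>) ^ N) powr \<alpha>) * (\<mu>1 ^ N) powr \<alpha>"
        using blocks[OF ls elim(2)] by (intro add_right_mono mult_right_mono) auto
      also have "\<dots> < \<rho> * ((\<mu>1 / \<mu>) ^ N) powr \<alpha> + (\<rho>1 - \<rho> * ((\<mu>1 / \<mu>) ^ N) powr \<alpha>) * 1"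
      proof (intro add_strict_left_mono mult_strict_left_mono)
        have "\<mu>1 ^ N < 1" using \<mu> \<mu>1 N by (simp add: power_less_one_iff)
        then show "(\<mu>1 ^ N) powr \<alpha> < 1"
          using \<mu> \<mu>1 \<alpha>_pos powr_less_mono2[of \<alpha> "\<mu>1 ^ N" 1] by simp
      qed (use \<mu>1 in simp)
      finally show ?case by (simp add: bl_def \<theta>_def i_def case_prod_beta)
    qed
  qed
  have "\<forall>\<^sub>F t in F. bunched_branches (adm K) D (ib (L t)) (expmap (L t)) \<mu>1 (2 * (\<Gamma> + 1)) (base t) \<alpha>
      (2 * (H + 1 + 2 * (\<Gamma> + 1)) * 2 powr \<alpha>) M1 (M1 powr \<alpha> * ((2 * (\<Gamma> + 1)) ^ N / \<rho>1)) (root N \<rho>1)"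
    using perturbed \<omega> bl
  proof eventually_elim
    case (elim t)
    interpret P: perturbed \<alpha> K "L t" "\<epsilon> t" r0 r1 \<Gamma> H "\<phi> t" by fact
    have "P.\<omega> \<le> inverse \<mu> - inverse \<mu>1" using elim(2) P.\<epsilon>_pos by (simp add: P.\<omega>_def)
    then interpret PB: branches "adm K" D "ib (L t)" "expmap (L t)" \<mu>1 "2 * (\<Gamma> + 1)"
      by (rule P.branches_L[OF \<mu>1(2,3)])
    show ?case
    proof unfold_locales
      fix a b y y' assume "(a, b) \<in> adm K" "y \<in> D b" "y' \<in> D b"
      then show "norm (Der (expmap (L t)) (ib (L t) a b y) - Der (expmap (L t)) (ib (L t) a b y'))
        \<le> 2 * (H + 1 + 2 * (\<Gamma> + 1)) * 2 powr \<alpha> * dist (ib (L t) a b y) (ib (L t) a b y') powr \<alpha>"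
        by (intro P.DgL_holder[of _ a] P.fL_D)
    next
      fix \<theta> n assume \<theta>: "left_seq (adm K) \<theta>"
      have b: "norm (dbranch (ib (L t)) \<theta> n (base t (\<theta> 0))) * norm (ibranch (ib (L t)) (expmap (L t)) \<theta> n (base t (\<theta> 0)))
          * (\<mu>1 ^ n) powr \<alpha> \<le> (2 * (\<Gamma> + 1)) ^ N / \<rho>1 * root N \<rho>1 ^ n"
      proof (rule PB.bunching_from_blocks[OF \<theta> base(3)[OF elim(1)] N(1) \<rho>1(2,3) \<alpha>_pos])
        fix i
        have "bl t (\<theta>, i) < \<rho>1" using elim(3) \<theta> by blast
        then show "norm (dbranch (ib (L t)) (shift i \<theta>) N (branch (ib (L t)) \<theta> i (base t (\<theta> 0))))
          * norm (ibranch (ib (L t)) (expmap (L t)) (shift i \<theta>) N (branch (ib (L t)) \<theta> i (base t (\<theta> 0))))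
          * (\<mu>1 ^ N) powr \<alpha> \<le> \<rho>1" by (simp add: bl_def)
      qed
      have "(M1 * \<mu>1 ^ n) powr \<alpha> = M1 powr \<alpha> * (\<mu>1 ^ n) powr \<alpha>"
        using M1(1) \<mu> \<mu>1 by (simp add: powr_mult)
      then show "norm (dbranch (ib (L t)) \<theta> n (base t (\<theta> 0))) * norm (ibranch (ib (L t)) (expmap (L t)) \<theta> n (base t (\<theta> 0)))
          * (M1 * \<mu>1 ^ n) powr \<alpha> \<le> M1 powr \<alpha> * ((2 * (\<Gamma> + 1)) ^ N / \<rho>1) * root N \<rho>1 ^ n"
        using mult_left_mono[OF b, of "M1 powr \<alpha>"] by (simp add: mult_ac)
    next
      show "base t a \<in> D a" for a by (rule base(3)[OF elim(1)])
      show "norm (\<phi> x - \<phi> y) \<le> M1 * B" if "\<And>x. x \<in> D a \<Longrightarrow> (\<phi> has_derivative blinfun_apply (\<phi>' x)) (at x)"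
        "\<And>x. x \<in> D a \<Longrightarrow> norm (\<phi>' x) \<le> B" "x \<in> D a" "y \<in> D a"
        for a x y B and \<phi> :: "complex ^ 'd \<Rightarrow> complex ^ 'd" and \<phi>'
        by (rule M1(2)[OF that])
    qed (use \<alpha>_pos P.H(1) P.\<Gamma>(1) M1(1) N \<rho>1 in auto)
  qed
  then show thesis by (rule that)
qed

end

section \<open>One-jets of perturbed observables\<close>

context near_pair begin

lemma near_at_pair:
  assumes "z \<in> thicken r1 S" "x \<in> thicken r1 S" "dist z x < r1"
  shows "norm (k z - h x) \<le> (1 + \<Gamma>) * \<epsilon> + \<Gamma> * norm (z - x)"
    and "norm (Der k z - Der h x) \<le> \<epsilon> + 2 * (\<Gamma> + 1) * \<epsilon> + H * \<epsilon> powr \<alpha> + H * norm (z - x) powr \<alpha>"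
proof -
  obtain p where p: "p \<in> S" "x \<in> ball p r1" using assms(2) by (auto simp: thicken_def)
  have z: "z \<in> N" and x: "x \<in> N" using assms thicken_mono[of r1 \<rho> S] r1 by auto
  have "norm (h z - h x) \<le> \<Gamma> * norm (z - x)"
  proof (rule norm_diff_le_on_ball[where p = p and r = \<rho> and f' = "Der h"])
    show "z \<in> ball p \<rho>" "x \<in> ball p \<rho>"
      using p assms(3) r1 dist_triangle[of p z x] by (auto simp: dist_commute)
    fix y assume "y \<in> ball p \<rho>"
    then have y: "y \<in> N" using p by (auto simp: thicken_def)
    show "(h has_derivative blinfun_apply (Der h y)) (at y)" by (rule Der_works[OF h_differentiable[OF y]])
    show "norm (Der h y) \<le> \<Gamma>" by (rule \<Gamma>(2)[OF y])
  qed
  then show "norm (k z - h x) \<le> (1 + \<Gamma>) * \<epsilon> + \<Gamma> * norm (z - x)"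
    using near_at(1)[OF assms(1)] norm_triangle_ineq[of "k z - h z" "h z - h x"] by (simp add: dist_norm)
  show "norm (Der k z - Der h x) \<le> \<epsilon> + 2 * (\<Gamma> + 1) * \<epsilon> + H * \<epsilon> powr \<alpha> + H * norm (z - x) powr \<alpha>"
    using near_at(2)[OF assms(1)] H(2)[OF z x]
      norm_triangle_ineq[of "Der k z - Der h z" "Der h z - Der h x"] by (simp add: dist_norm)
qed

end

text \<open>Either the lengths \<open>p t\<close> are large, or they take finitely many values and each of these can be treated separately.\<close>

lemma tendsto_zero_by_cases:
  fixes d :: "'t \<Rightarrow> 'b::real_normed_vector" and p :: "'t \<Rightarrow> nat"
  assumes long: "\<And>\<eta>. 0 < \<eta> \<Longrightarrow> \<exists>m. \<forall>\<^sub>F t in F. m \<le> p t \<longrightarrow> norm (d t) < \<eta>"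
    and short: "\<And>j. (d \<longlongrightarrow> 0) (inf F (principal {t. p t = j}))"
  shows "(d \<longlongrightarrow> 0) F"
proof (rule tendstoI)
  fix \<eta> :: real assume \<eta>: "0 < \<eta>"
  obtain m where m: "\<forall>\<^sub>F t in F. m \<le> p t \<longrightarrow> norm (d t) < \<eta>" using long[OF \<eta>] by blast
  have "\<forall>\<^sub>F t in F. p t = j \<longrightarrow> norm (d t) < \<eta>" for j
    using tendstoD[OF short \<eta>, of j] by (simp add: eventually_inf_principal)
  then have "\<forall>\<^sub>F t in F. \<forall>j\<in>{..<m}. p t = j \<longrightarrow> norm (d t) < \<eta>"
    by (intro eventually_ball_finite) auto
  with m show "\<forall>\<^sub>F t in F. dist (d t) 0 < \<eta>"
    by eventually_elim (auto simp: not_le)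
qed

text \<open>
  An observable \<open>h\<close> on the piece of \<open>a0\<close> that represents the affine copy \<open>A \<circ> k\<close> of the limit geometry
  of \<open>\<theta>0\<close>, together with perturbed observables \<open>ko t\<close> on the perturbed Cantor sets.
\<close>

locale observed_family = perturbed_family \<alpha> K c \<Gamma> H M Q \<kappa> r0 r1 F L \<epsilon> \<phi>
  for \<alpha> :: real and K :: "('a::finite, 'd::finite) cantor" and c :: "'a \<Rightarrow> complex ^ 'd"
    and \<Gamma> H M Q \<kappa> :: real and r0 r1 :: real and F :: "'t filter" and L :: "'t \<Rightarrow> ('a, 'd) cantor"
    and \<epsilon> :: "'t \<Rightarrow> real" and \<phi> :: "'t \<Rightarrow> 'a \<Rightarrow> complex ^ 'd \<Rightarrow> complex ^ 'd" +
  fixes a0 :: 'a and h :: "complex ^ 'd \<Rightarrow> complex ^ 'd" and ko :: "'t \<Rightarrow> complex ^ 'd \<Rightarrow> complex ^ 'd"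
    and \<psi> :: "'t \<Rightarrow> complex ^ 'd \<Rightarrow> complex ^ 'd" and \<Gamma>h Hh Zh :: real
    and A :: "'d aff" and \<theta>0 :: "nat \<Rightarrow> 'a"
  assumes obs: "\<forall>\<^sub>F t in F. near_pair \<alpha> (\<epsilon> t) (2 * r1) r1 \<Gamma>h Hh (piece K a0) (\<psi> t) (ko t) h"
    and ko_GLC: "\<forall>\<^sub>F t in F. \<forall>x\<in>cantor_piece (L t) a0. Der (ko t) x \<in> GLC"
    and h_inv: "x \<in> piece K a0 \<Longrightarrow> \<exists>Y. inverse_pair (Der h x) Y \<and> norm Y \<le> Zh"
    and h_bound: "x \<in> piece K a0 \<Longrightarrow> norm (Der h x) \<le> \<Gamma>h"
    and \<theta>0: "left_seq (adm K) \<theta>0" "\<theta>0 0 = a0" and A: "A \<in> Aff"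
    and agree: "agree_on (piece K a0) h (aff_app A \<circ> limit_geometry K c \<theta>0)"
begin

abbreviation AL where "AL \<equiv> blin_of (fst A)"

text \<open>The sequences that arise from \<open>\<theta>0\<close> by appending a word with \<open>p\<close> transitions.\<close>

definition chain :: "(nat \<Rightarrow> 'a) \<Rightarrow> nat \<Rightarrow> bool" where
  "chain \<theta> p \<longleftrightarrow> left_seq (adm K) \<theta> \<and> shift p \<theta> = \<theta>0"

lemma chain_end: "chain \<theta> p \<Longrightarrow> \<theta> p = a0"
  using \<theta>0(2) by (metis chain_def shift_0(2))

lemma obs': "F' \<le> F \<Longrightarrow> \<forall>\<^sub>F t in F'. near_pair \<alpha> (\<epsilon> t) (2 * r1) r1 \<Gamma>h Hh (piece K a0) (\<psi> t) (ko t) h"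
  using obs filter_leD by blast

lemma obs_lim:
  assumes F': "F' \<le> F" and e: "\<forall>\<^sub>F t in F'. z t \<in> D a0 \<and> x t \<in> D a0" and lim: "((\<lambda>t. z t - x t) \<longlongrightarrow> 0) F'"
  shows "((\<lambda>t. ko t (z t) - h (x t)) \<longlongrightarrow> 0) F'"
    and "((\<lambda>t. Der (ko t) (z t) - Der h (x t)) \<longlongrightarrow> 0) F'"
proof -
  have n: "\<forall>\<^sub>F t in F'. norm (z t - x t) < r1"
    using tendsto_norm_zero[OF lim] r1_pos by (rule order_tendstoD)
  have "((\<lambda>t. (1 + \<Gamma>h) * \<epsilon> t + \<Gamma>h * norm (z t - x t)) \<longlongrightarrow> (1 + \<Gamma>h) * 0 + \<Gamma>h * 0) F'"
    by (intro tendsto_intros \<epsilon>_lim' F' tendsto_norm_zero lim)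
  then have l1: "((\<lambda>t. (1 + \<Gamma>h) * \<epsilon> t + \<Gamma>h * norm (z t - x t)) \<longlongrightarrow> 0) F'" by simp
  have "\<forall>\<^sub>F t in F'. norm (ko t (z t) - h (x t)) \<le> (1 + \<Gamma>h) * \<epsilon> t + \<Gamma>h * norm (z t - x t)"
    using obs'[OF F'] e n
  proof eventually_elim
    case (elim t)
    then show ?case using near_pair.near_at_pair(1)[OF elim(1), of "z t" "x t"] by (simp add: dist_norm)
  qed
  then show "((\<lambda>t. ko t (z t) - h (x t)) \<longlongrightarrow> 0) F'" by (rule Lim_null_comparison[OF _ l1])
  have a: "((\<lambda>t. \<bar>norm (z t - x t)\<bar> powr \<alpha>) \<longlongrightarrow> 0) F'" "((\<lambda>t. \<bar>\<epsilon> t\<bar> powr \<alpha>) \<longlongrightarrow> 0) F'"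
    by (rule tendsto_powr_zero[OF tendsto_norm_zero[OF lim]] tendsto_powr_zero[OF \<epsilon>_lim'[OF F']])+
  have "((\<lambda>t. \<epsilon> t + 2 * (\<Gamma>h + 1) * \<epsilon> t + Hh * \<bar>\<epsilon> t\<bar> powr \<alpha> + Hh * \<bar>norm (z t - x t)\<bar> powr \<alpha>)
      \<longlongrightarrow> 0 + 2 * (\<Gamma>h + 1) * 0 + Hh * 0 + Hh * 0) F'"
    by (intro tendsto_add tendsto_mult tendsto_const a \<epsilon>_lim' F')
  then have l2: "((\<lambda>t. \<epsilon> t + 2 * (\<Gamma>h + 1) * \<epsilon> t + Hh * \<bar>\<epsilon> t\<bar> powr \<alpha> + Hh * \<bar>norm (z t - x t)\<bar> powr \<alpha>) \<longlongrightarrow> 0) F'"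
    by simp
  have "\<forall>\<^sub>F t in F'. norm (Der (ko t) (z t) - Der h (x t))
      \<le> \<epsilon> t + 2 * (\<Gamma>h + 1) * \<epsilon> t + Hh * \<bar>\<epsilon> t\<bar> powr \<alpha> + Hh * \<bar>norm (z t - x t)\<bar> powr \<alpha>"
    using obs'[OF F'] e n
  proof eventually_elim
    case (elim t)
    then show ?case
      using near_pair.near_at_pair(2)[OF elim(1), of "z t" "x t"] near_pair.\<epsilon>_pos[OF elim(1)] by (simp add: dist_norm)
  qed
  then show "((\<lambda>t. Der (ko t) (z t) - Der h (x t)) \<longlongrightarrow> 0) F'" by (rule Lim_null_comparison[OF _ l2])
qed

text \<open>On its piece \<open>h\<close> has the one-jets of \<open>A \<circ> k\<close>, so the intertwining property of limit geometries applies to it.\<close>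

lemma h_branch:
  assumes ch: "chain \<theta> p" and x: "x \<in> cantor_piece K (\<theta> 0)"
  shows "(Der h (branch f \<theta> p x) o\<^sub>L dbranch f \<theta> p x) = ((AL o\<^sub>L Flin \<theta> p) o\<^sub>L B.E_lim \<theta> x)"
    and "h (branch f \<theta> p x) = aff_app A (k \<theta>0 (branch f \<theta> p x))"
    and "h (branch f \<theta> p x) - h (branch f \<theta> p (c (\<theta> 0))) = blinfun_apply (AL o\<^sub>L Flin \<theta> p) (k \<theta> x - c (\<theta> 0))"
proof -
  have \<theta>: "left_seq (adm K) \<theta>" "shift p \<theta> = \<theta>0" using ch by (auto simp: chain_def)
  have xG: "x \<in> Gstar K (\<theta> 0)" using x piece_Gstar by (auto simp: cantor_piece_def)
  have mem: "branch f \<theta> p y \<in> piece K a0 \<and> branch f \<theta> p y \<in> Gstar K (\<theta>0 0)" if "y \<in> cantor_piece K (\<theta> 0)" for y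
    using branch_cantor[OF \<theta>(1) that, of p] chain_end[OF ch] piece_Gstar[of a0] \<theta>0(2) by (auto simp: cantor_piece_def)
  have hv: "h z = aff_app A (k \<theta>0 z)" "Der h z = Der (aff_app A \<circ> k \<theta>0) z" if "z \<in> piece K a0" for z
    using agree that by (auto simp: agree_on_def)
  show "h (branch f \<theta> p x) = aff_app A (k \<theta>0 (branch f \<theta> p x))" using hv mem[OF x] by blast
  let ?z = "branch f \<theta> p x"
  have "(aff_app A \<circ> k \<theta>0 has_derivative (\<lambda>v. fst A *v v) \<circ> blinfun_apply (B.E_lim \<theta>0 ?z)) (at ?z)"
    using mem[OF x] by (intro diff_chain_at aff_app_has_derivative limit_geometry_has_derivative \<theta>0(1)) auto
  then have "Der h ?z = (AL o\<^sub>L B.E_lim \<theta>0 ?z)"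
    using hv(2) mem[OF x] by (auto intro!: Der_eq simp: blinfun_compose.rep_eq o_def)
  then show "(Der h ?z o\<^sub>L dbranch f \<theta> p x) = ((AL o\<^sub>L Flin \<theta> p) o\<^sub>L B.E_lim \<theta> x)"
    using E_lim_branch[OF \<theta>(1) xG, of p] by (simp add: \<theta>(2) blinfun_compose_assoc)
  have "h ?z - h (branch f \<theta> p (c (\<theta> 0))) = blinfun_apply AL (k \<theta>0 ?z - k \<theta>0 (branch f \<theta> p (c (\<theta> 0))))"
    using hv(1) mem[OF x] mem[OF c_cantor] by (simp add: aff_app_def matrix_vector_mult_diff_distrib)
  then show "h ?z - h (branch f \<theta> p (c (\<theta> 0))) = blinfun_apply (AL o\<^sub>L Flin \<theta> p) (k \<theta> x - c (\<theta> 0))"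
    using limit_geometry_branch[OF \<theta>(1) xG, of p] by (simp add: \<theta>(2))
qed

lemma h_branch_base:
  assumes ch: "chain \<theta> p"
  shows "(Der h (branch f \<theta> p (c (\<theta> 0))) o\<^sub>L dbranch f \<theta> p (c (\<theta> 0))) = (AL o\<^sub>L Flin \<theta> p)"
  using h_branch(1)[OF ch c_cantor] ch by (simp add: E_lim_base chain_def)

definition pt :: "'t \<Rightarrow> (nat \<Rightarrow> 'a) \<Rightarrow> nat \<Rightarrow> complex ^ 'd" where
  "pt t \<theta> p = branch (ib (L t)) \<theta> p (base t (\<theta> 0))"

text \<open>A choice, since the derivative is invertible only for \<open>t\<close> far along \<open>F\<close>.\<close>

definition kinv :: "'t \<Rightarrow> complex ^ 'd \<Rightarrow> ((complex ^ 'd) \<Rightarrow>\<^sub>L (complex ^ 'd))" where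
  "kinv t z = (SOME Y. inverse_pair (Der (ko t) z) Y)"

definition jet :: "'t \<Rightarrow> (nat \<Rightarrow> 'a) \<Rightarrow> nat \<Rightarrow> ((complex ^ 'd) \<Rightarrow>\<^sub>L (complex ^ 'd))" where
  "jet t \<theta> p = (Der (ko t) (pt t \<theta> p) o\<^sub>L dbranch (ib (L t)) \<theta> p (base t (\<theta> 0)))"

definition ijet :: "'t \<Rightarrow> (nat \<Rightarrow> 'a) \<Rightarrow> nat \<Rightarrow> ((complex ^ 'd) \<Rightarrow>\<^sub>L (complex ^ 'd))" where
  "ijet t \<theta> p = (ibranch (ib (L t)) (expmap (L t)) \<theta> p (base t (\<theta> 0)) o\<^sub>L kinv t (pt t \<theta> p))"

text \<open>
  The one-jet, at the perturbed base point, of the observable along a branch; it is based at the unperturbed \<open>c (\<theta> 0)\<close>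
  so that all base points are the same as in the affine model.
\<close>

definition J :: "'t \<Rightarrow> (nat \<Rightarrow> 'a) \<Rightarrow> nat \<Rightarrow> 'd aff" where
  "J t \<theta> p = aff_of (jet t \<theta> p) (c (\<theta> 0)) (ko t (pt t \<theta> p))"

text \<open>
  Derivative and values of the observable along a branch, normalised by its own jet: the counterparts of
  the limit of \<open>E\<close> and of the limit geometry \<open>k\<close> of \<open>\<theta>\<close>.
\<close>

definition Ek :: "'t \<Rightarrow> (nat \<Rightarrow> 'a) \<Rightarrow> nat \<Rightarrow> complex ^ 'd \<Rightarrow> ((complex ^ 'd) \<Rightarrow>\<^sub>L (complex ^ 'd))" where
  "Ek t \<theta> p y = (ijet t \<theta> p o\<^sub>L (Der (ko t) (branch (ib (L t)) \<theta> p y) o\<^sub>L dbranch (ib (L t)) \<theta> p y))"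

definition kn :: "'t \<Rightarrow> (nat \<Rightarrow> 'a) \<Rightarrow> nat \<Rightarrow> complex ^ 'd \<Rightarrow> complex ^ 'd" where
  "kn t \<theta> p y = c (\<theta> 0) + blinfun_apply (ijet t \<theta> p) (ko t (branch (ib (L t)) \<theta> p y) - ko t (pt t \<theta> p))"

lemma pt_cantor:
  assumes "perturbed \<alpha> K (L t) (\<epsilon> t) r0 r1 \<Gamma> H (\<phi> t)" "left_seq (adm K) \<theta>"
  shows "pt t \<theta> p \<in> cantor_piece (L t) (\<theta> p)"
proof -
  interpret P: perturbed \<alpha> K "L t" "\<epsilon> t" r0 r1 \<Gamma> H "\<phi> t" by fact
  show ?thesis unfolding pt_def
    by (rule P.L.branch_cantor) (use assms(2) base(1)[OF assms(1)] P.adm_eq in auto)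
qed

lemma pt_D:
  assumes "perturbed \<alpha> K (L t) (\<epsilon> t) r0 r1 \<Gamma> H (\<phi> t)" "left_seq (adm K) \<theta>"
  shows "pt t \<theta> p \<in> D (\<theta> p)"
  unfolding pt_def by (rule perturbed.branch_D[OF assms base(3)[OF assms(1)]])

lemma K_orbit: "left_seq (adm K) \<theta> \<Longrightarrow> branch f \<theta> p (c (\<theta> 0)) \<in> cantor_piece K (\<theta> p)"
  by (rule branch_cantor[OF _ c_cantor])

lemma K_orbit_D: "left_seq (adm K) \<theta> \<Longrightarrow> branch f \<theta> p (c (\<theta> 0)) \<in> D (\<theta> p)"
  using K_orbit cantor_D by blast

lemma jet_GLC:
  "\<forall>\<^sub>F t in F. \<forall>\<theta> p. chain \<theta> p \<longrightarrow> jet t \<theta> p \<in> GLC \<and> Der (ko t) (pt t \<theta> p) \<in> GLC"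
  using perturbed ko_GLC
proof eventually_elim
  case (elim t)
  interpret P: perturbed \<alpha> K "L t" "\<epsilon> t" r0 r1 \<Gamma> H "\<phi> t" by fact
  show ?case
  proof (intro allI impI)
    fix \<theta> p assume ch: "chain \<theta> p"
    then have \<theta>: "left_seq (adm K) \<theta>" by (simp add: chain_def)
    have "Der (ko t) (pt t \<theta> p) \<in> GLC"
      using elim(2) pt_cantor[OF elim(1) \<theta>, of p] chain_end[OF ch] by simp
    moreover have "dbranch (ib (L t)) \<theta> p (base t (\<theta> 0)) \<in> GLC"
      by (rule P.L.dbranch_GLC) (use \<theta> base(1)[OF elim(1)] P.adm_eq in auto)
    ultimately show "jet t \<theta> p \<in> GLC \<and> Der (ko t) (pt t \<theta> p) \<in> GLC"
      by (simp add: jet_def GLC_compose)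
  qed
qed

lemma kinv_pair:
  "\<forall>\<^sub>F t in F. \<forall>\<theta> p. chain \<theta> p \<longrightarrow> inverse_pair (Der (ko t) (pt t \<theta> p)) (kinv t (pt t \<theta> p))"
  using jet_GLC
proof eventually_elim
  case (elim t)
  show ?case
  proof (intro allI impI)
    fix \<theta> p assume "chain \<theta> p"
    then have "\<exists>Y. inverse_pair (Der (ko t) (pt t \<theta> p)) Y" using elim by (intro GLC_inverse_exists) auto
    then show "inverse_pair (Der (ko t) (pt t \<theta> p)) (kinv t (pt t \<theta> p))"
      unfolding kinv_def by (rule someI_ex)
  qed
qed

lemma jet_pair: "\<forall>\<^sub>F t in F. \<forall>\<theta> p. chain \<theta> p \<longrightarrow> inverse_pair (jet t \<theta> p) (ijet t \<theta> p)"
  using kinv_pair perturbed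
proof eventually_elim
  case (elim t)
  interpret P: perturbed \<alpha> K "L t" "\<epsilon> t" r0 r1 \<Gamma> H "\<phi> t" by fact
  show ?case
    unfolding jet_def ijet_def
  proof (intro allI impI inverse_pair_compose)
    fix \<theta> p assume ch: "chain \<theta> p"
    then have \<theta>: "left_seq (adm (L t)) \<theta>" using P.adm_eq by (simp add: chain_def)
    show "inverse_pair (Der (ko t) (pt t \<theta> p)) (kinv t (pt t \<theta> p))" using elim(1) ch by blast
    show "inverse_pair (dbranch (ib (L t)) \<theta> p (base t (\<theta> 0))) (ibranch (ib (L t)) (expmap (L t)) \<theta> p (base t (\<theta> 0)))"
      using base(3)[OF elim(2)] P.D_GstarL by (intro P.L.branch_inverse_pair[OF \<theta>]) auto
  qed
qed

lemma kinv_lim: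
  assumes F': "F' \<le> F" and ch: "\<forall>\<^sub>F t in F'. chain (\<theta> t) (p t)"
    and Y: "\<forall>\<^sub>F t in F'. inverse_pair (Der h (branch f (\<theta> t) (p t) (c (\<theta> t 0)))) (Y t)"
  shows "((\<lambda>t. kinv t (pt t (\<theta> t) (p t)) - Y t) \<longlongrightarrow> 0) F'" "\<forall>\<^sub>F t in F'. norm (Y t) \<le> Zh"
proof -
  have \<theta>: "\<forall>\<^sub>F t in F'. left_seq (adm K) (\<theta> t)" using ch by eventually_elim (simp add: chain_def)
  show Z: "\<forall>\<^sub>F t in F'. norm (Y t) \<le> Zh"
    using ch Y
  proof eventually_elim
    case (elim t)
    have "branch f (\<theta> t) (p t) (c (\<theta> t 0)) \<in> piece K a0"
      using K_orbit[of "\<theta> t" "p t"] chain_end[OF elim(1)] elim(1) by (auto simp: chain_def cantor_piece_def)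
    then show ?case using h_inv inverse_pair_unique[OF elim(2)] by metis
  qed
  show "((\<lambda>t. kinv t (pt t (\<theta> t) (p t)) - Y t) \<longlongrightarrow> 0) F'"
  proof (rule inverse_pair_tendsto[OF _ Y Z])
    show "\<forall>\<^sub>F t in F'. inverse_pair (Der (ko t) (pt t (\<theta> t) (p t))) (kinv t (pt t (\<theta> t) (p t)))"
      using filter_leD[OF F' kinv_pair] ch by eventually_elim blast
    show "((\<lambda>t. Der (ko t) (pt t (\<theta> t) (p t)) - Der h (branch f (\<theta> t) (p t) (c (\<theta> t 0)))) \<longlongrightarrow> 0) F'"
    proof (rule obs_lim(2)[OF F'])
      show "\<forall>\<^sub>F t in F'. pt t (\<theta> t) (p t) \<in> D a0 \<and> branch f (\<theta> t) (p t) (c (\<theta> t 0)) \<in> D a0"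
        using ev[OF F'] ch
      proof eventually_elim
        case (elim t)
        then show ?case
          using pt_D[OF elim(1), of "\<theta> t" "p t"] K_orbit_D[of "\<theta> t" "p t"] chain_end[OF elim(2)]
          by (simp add: chain_def)
      qed
      show "((\<lambda>t. pt t (\<theta> t) (p t) - branch f (\<theta> t) (p t) (c (\<theta> t 0))) \<longlongrightarrow> 0) F'"
        unfolding pt_def by (rule base_orbit_lim[OF F' \<theta>])
    qed
  qed
qed

lemma kinv_bound: "\<forall>\<^sub>F t in F. \<forall>\<theta> p. chain \<theta> p \<longrightarrow> norm (kinv t (pt t \<theta> p)) \<le> Zh + 1"
proof -
  have "\<forall>\<^sub>F t in F. \<forall>s\<in>{(\<theta>, p). chain \<theta> p}. norm (kinv t (pt t (fst s) (snd s))) \<le> Zh + 1"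
  proof (rule eventually_ball_of_choices)
    fix F' and s :: "'t \<Rightarrow> (nat \<Rightarrow> 'a) \<times> nat"
    assume F': "F' \<le> F" and s: "\<forall>\<^sub>F t in F'. s t \<in> {(\<theta>, p). chain \<theta> p}"
    have ch: "\<forall>\<^sub>F t in F'. chain (fst (s t)) (snd (s t))" using s by eventually_elim auto
    define Y where "Y t = (SOME Y. inverse_pair (Der h (branch f (fst (s t)) (snd (s t)) (c (fst (s t) 0)))) Y)" for t
    have Y: "\<forall>\<^sub>F t in F'. inverse_pair (Der h (branch f (fst (s t)) (snd (s t)) (c (fst (s t) 0)))) (Y t)"
      using ch
    proof eventually_elim
      case (elim t)
      have "branch f (fst (s t)) (snd (s t)) (c (fst (s t) 0)) \<in> piece K a0"
        using K_orbit[of "fst (s t)" "snd (s t)"] chain_end[OF elim] elim by (auto simp: chain_def cantor_piece_def)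
      then have "\<exists>Y. inverse_pair (Der h (branch f (fst (s t)) (snd (s t)) (c (fst (s t) 0)))) Y"
        using h_inv by blast
      then show ?case unfolding Y_def by (rule someI_ex)
    qed
    note lim = kinv_lim[OF F' ch Y]
    have "\<forall>\<^sub>F t in F'. norm (kinv t (pt t (fst (s t)) (snd (s t))) - Y t) < 1"
      using tendsto_norm_zero[OF lim(1)] by (rule order_tendstoD) simp
    then show "\<forall>\<^sub>F t in F'. norm (kinv t (pt t (fst (s t)) (snd (s t)))) \<le> Zh + 1"
      using lim(2)
    proof eventually_elim
      case (elim t)
      then show ?case using norm_triangle_sub[of "kinv t (pt t (fst (s t)) (snd (s t)))" "Y t"] by simp
    qed
  qed
  then show ?thesis by eventually_elim auto
qed

text \<open>
  This is \<open>observable_tail\<close> with the constants of \<open>family_bunched\<close>: a word with at least \<open>m\<close> transitions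
  may be replaced by its last \<open>m\<close> ones, while the rest of the word and the
  observable applied after it are forgotten.  The error is independent of the perturbation.
\<close>

lemma long_words:
  obtains C \<kappa>1 where "0 < \<kappa>1" "\<kappa>1 < 1"
    "\<forall>\<^sub>F t in F. \<forall>\<theta> p m y. chain \<theta> p \<and> m \<le> p \<and> y \<in> D (\<theta> 0) \<longrightarrow>
      norm (Ek t \<theta> p y - (ibranch (ib (L t)) (expmap (L t)) \<theta> m (base t (\<theta> 0)) o\<^sub>L dbranch (ib (L t)) \<theta> m y)) \<le> C * \<kappa>1 ^ m \<and>
      norm (kn t \<theta> p y - (c (\<theta> 0) + blinfun_apply (ibranch (ib (L t)) (expmap (L t)) \<theta> m (base t (\<theta> 0)))
        (branch (ib (L t)) \<theta> m y - branch (ib (L t)) \<theta> m (base t (\<theta> 0))))) \<le> C * \<kappa>1 ^ m"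
proof -
  obtain \<mu>1 \<Gamma>1 H1 M1 Q1 \<kappa>1 where bb:
    "\<forall>\<^sub>F t in F. bunched_branches (adm K) D (ib (L t)) (expmap (L t)) \<mu>1 \<Gamma>1 (base t) \<alpha> H1 M1 Q1 \<kappa>1"
    by (rule family_bunched)
  define Bh where "Bh = 2 * (Hh + 1 + 2 * (\<Gamma>h + 1)) * 2 powr \<alpha>"
  define C where "C = (Zh + 1) * Bh * Q1 * exp (H1 * Q1 / (1 - \<kappa>1)) + H1 * Q1 * exp (H1 * Q1 / (1 - \<kappa>1)) / (1 - \<kappa>1)"
  have main: "\<forall>\<^sub>F t in F. (0 < \<kappa>1 \<and> \<kappa>1 < 1) \<and> (\<forall>\<theta> p m y. chain \<theta> p \<and> m \<le> p \<and> y \<in> D (\<theta> 0) \<longrightarrow>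
      norm (Ek t \<theta> p y - (ibranch (ib (L t)) (expmap (L t)) \<theta> m (base t (\<theta> 0)) o\<^sub>L dbranch (ib (L t)) \<theta> m y)) \<le> max C (M1 * C) * \<kappa>1 ^ m \<and>
      norm (kn t \<theta> p y - (c (\<theta> 0) + blinfun_apply (ibranch (ib (L t)) (expmap (L t)) \<theta> m (base t (\<theta> 0)))
        (branch (ib (L t)) \<theta> m y - branch (ib (L t)) \<theta> m (base t (\<theta> 0))))) \<le> max C (M1 * C) * \<kappa>1 ^ m)"
    using bb kinv_bound kinv_pair obs
  proof eventually_elim
    case (elim t)
    interpret PB: bunched_branches "adm K" D "ib (L t)" "expmap (L t)" \<mu>1 \<Gamma>1 "base t" \<alpha> H1 M1 Q1 \<kappa>1 by fact
    interpret NP: near_pair \<alpha> "\<epsilon> t" "2 * r1" r1 \<Gamma>h Hh "piece K a0" "\<psi> t" "ko t" h by fact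
    have C: "C = (Zh + 1) * Bh * Q1 * PB.dist_const + PB.tail_const"
      by (simp add: C_def PB.dist_const_def PB.tail_const_def)
    have Bh: "0 \<le> Bh" using NP.H(1) NP.\<Gamma>(1) by (simp add: Bh_def)
    show ?case
    proof (intro conjI allI impI)
      show "0 < \<kappa>1" "\<kappa>1 < 1" by (fact PB.\<kappa>)+
      fix \<theta> p m y assume *: "chain \<theta> p \<and> m \<le> p \<and> y \<in> D (\<theta> 0)"
      then have ch: "chain \<theta> p" and \<theta>: "left_seq (adm K) \<theta>" and m: "m \<le> p" and y: "y \<in> D (\<theta> 0)"
        by (auto simp: chain_def)
      have last: "\<theta> p = a0" by (rule chain_end[OF ch])
      have holder: "norm (Der (ko t) u - Der (ko t) v) \<le> Bh * dist u v powr \<alpha>" if "u \<in> D (\<theta> p)" "v \<in> D (\<theta> p)" for u v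
        using NP.Dk_holder[of u v] that last by (simp add: Bh_def)
      have der: "(ko t has_derivative blinfun_apply (Der (ko t) u)) (at u)" if "u \<in> D (\<theta> p)" for u
        using NP.near_at(4)[of u] that last by (intro Der_works) simp
      have pair: "inverse_pair (Der (ko t) (branch (ib (L t)) \<theta> p (base t (\<theta> 0)))) (kinv t (pt t \<theta> p))"
        using elim(3) ch unfolding pt_def by blast
      have nrm: "norm (kinv t (pt t \<theta> p)) \<le> Zh + 1" using elim(2) ch by blast
      have "norm (Ek t \<theta> p y - (ibranch (ib (L t)) (expmap (L t)) \<theta> m (base t (\<theta> 0)) o\<^sub>L dbranch (ib (L t)) \<theta> m y)) \<le> C * \<kappa>1 ^ m"
        using PB.observable_tail[OF \<theta> y holder pair nrm Bh m] unfolding Ek_def ijet_def PB.E_def C .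
      also have "\<dots> \<le> max C (M1 * C) * \<kappa>1 ^ m" using PB.\<kappa> by (intro mult_right_mono) auto
      finally show "norm (Ek t \<theta> p y - (ibranch (ib (L t)) (expmap (L t)) \<theta> m (base t (\<theta> 0)) o\<^sub>L dbranch (ib (L t)) \<theta> m y)) \<le> max C (M1 * C) * \<kappa>1 ^ m" .
      have "norm (kn t \<theta> p y - (c (\<theta> 0) + blinfun_apply (ibranch (ib (L t)) (expmap (L t)) \<theta> m (base t (\<theta> 0)))
        (branch (ib (L t)) \<theta> m y - branch (ib (L t)) \<theta> m (base t (\<theta> 0))))) \<le> M1 * (C * \<kappa>1 ^ m)"
        using PB.observable_tail_value[OF \<theta> y holder der pair nrm Bh m]
        unfolding kn_def ijet_def pt_def C by simp
      also have "\<dots> \<le> max C (M1 * C) * \<kappa>1 ^ m" using PB.\<kappa> by (simp add: mult_right_mono flip: mult.assoc)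
      finally show "norm (kn t \<theta> p y - (c (\<theta> 0) + blinfun_apply (ibranch (ib (L t)) (expmap (L t)) \<theta> m (base t (\<theta> 0)))
        (branch (ib (L t)) \<theta> m y - branch (ib (L t)) \<theta> m (base t (\<theta> 0))))) \<le> max C (M1 * C) * \<kappa>1 ^ m" .
    qed
  qed
  show thesis
  proof (cases "F = bot")
    case True
    then show thesis by (intro that[of "1/2" 0]) auto
  next
    case False
    then obtain t where "0 < \<kappa>1 \<and> \<kappa>1 < 1" using eventually_happens'[OF False main] by blast
    then show thesis using main by (intro that[of \<kappa>1 "max C (M1 * C)"]) (auto elim: eventually_mono)
  qed
qed

end

lemma geometric_small:
  fixes C \<kappa> \<eta> :: real
  assumes "0 < \<kappa>" "\<kappa> < 1" "0 < \<eta>" shows "\<forall>\<^sub>F m in sequentially. C * \<kappa> ^ m < \<eta>"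
proof -
  have "(\<lambda>m. C * \<kappa> ^ m) \<longlonglongrightarrow> C * 0" using assms by (intro tendsto_intros LIMSEQ_realpow_zero) auto
  then show ?thesis using assms(3) by (intro order_tendstoD(2)) auto
qed

lemma norm_chain3:
  fixes a b c d :: "'b::real_normed_vector"
  assumes "norm (a - b) \<le> r" "norm (b - c) < s" "norm (d - c) \<le> u"
  shows "norm (a - d) < r + s + u"
proof -
  have "a - d = (a - b) + (b - c) - (d - c)" by simp
  also have "norm \<dots> \<le> norm (a - b) + norm (b - c) + norm (d - c)"
    by (intro order_trans[OF norm_triangle_ineq4] add_right_mono norm_triangle_ineq)
  finally show ?thesis using assms by linarith
qed

context observed_family begin

lemma h_values_bounded: "\<exists>b. \<forall>z\<in>piece K a0. norm (h z) \<le> b"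
proof -
  have "continuous_on (piece K a0) (aff_app A \<circ> k \<theta>0)"
  proof (rule continuous_at_imp_continuous_on, rule ballI)
    fix z assume "z \<in> piece K a0"
    then have "z \<in> Gstar K (\<theta>0 0)" using piece_Gstar \<theta>0(2) by auto
    then have "(aff_app A \<circ> k \<theta>0 has_derivative (\<lambda>v. fst A *v v) \<circ> blinfun_apply (B.E_lim \<theta>0 z)) (at z)"
      by (intro diff_chain_at aff_app_has_derivative limit_geometry_has_derivative \<theta>0(1))
    then show "isCont (aff_app A \<circ> k \<theta>0) z" by (rule has_derivative_continuous)
  qed
  then have "bounded ((aff_app A \<circ> k \<theta>0) ` piece K a0)"
    by (intro compact_imp_bounded compact_continuous_image compact_piece)
  then show ?thesis using agree by (auto simp: bounded_iff agree_on_def)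
qed

text \<open>
  The normalised observable converges to the limit geometry.  Along bounded words this is
  continuity; along long words both sides are close to the same normalised finite branch.
\<close>

lemma Ek_kn_lim:
  assumes F': "F' \<le> F" and ch: "\<forall>\<^sub>F t in F'. chain (\<theta> t) (p t)"
    and e: "\<forall>\<^sub>F t in F'. y t \<in> D (\<theta> t 0) \<and> x t \<in> cantor_piece K (\<theta> t 0)"
    and lim: "((\<lambda>t. y t - x t) \<longlongrightarrow> 0) F'"
  shows "((\<lambda>t. Ek t (\<theta> t) (p t) (y t) - B.E_lim (\<theta> t) (x t)) \<longlongrightarrow> 0) F'"
    and "((\<lambda>t. kn t (\<theta> t) (p t) (y t) - k (\<theta> t) (x t)) \<longlongrightarrow> 0) F'"
proof -
  obtain C \<kappa>1 where \<kappa>1: "0 < \<kappa>1" "\<kappa>1 < 1" and long: "\<forall>\<^sub>F t in F. \<forall>\<theta> p m y. chain \<theta> p \<and> m \<le> p \<and> y \<in> D (\<theta> 0) \<longrightarrow>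
      norm (Ek t \<theta> p y - (ibranch (ib (L t)) (expmap (L t)) \<theta> m (base t (\<theta> 0)) o\<^sub>L dbranch (ib (L t)) \<theta> m y)) \<le> C * \<kappa>1 ^ m \<and>
      norm (kn t \<theta> p y - (c (\<theta> 0) + blinfun_apply (ibranch (ib (L t)) (expmap (L t)) \<theta> m (base t (\<theta> 0)))
        (branch (ib (L t)) \<theta> m y - branch (ib (L t)) \<theta> m (base t (\<theta> 0))))) \<le> C * \<kappa>1 ^ m"
    by (rule long_words)
  have \<theta>: "\<forall>\<^sub>F t in F'. left_seq (adm K) (\<theta> t)" using ch by eventually_elim (simp add: chain_def)
  have xG: "\<forall>\<^sub>F t in F'. x t \<in> Gstar K (\<theta> t 0)"
    using e by eventually_elim (use piece_Gstar in \<open>auto simp: cantor_piece_def\<close>)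
  have e1: "\<forall>\<^sub>F t in F'. left_seq (adm K) (\<theta> t) \<and> y t \<in> D (\<theta> t 0) \<and> x t \<in> D (\<theta> t 0)"
    using \<theta> e by eventually_elim (use cantor_D in blast)
  have e2: "\<forall>\<^sub>F t in F'. left_seq (adm K) (\<theta> t) \<and> base t (\<theta> t 0) \<in> D (\<theta> t 0) \<and> c (\<theta> t 0) \<in> D (\<theta> t 0)"
    using \<theta> ev[OF F'] by eventually_elim (use c_D base(3) in blast)
  note xlim = branch_lim[OF F' e1 lim]
  note clim = branch_lim[OF F' e2 base_lim[OF F']]
  have i_bd: "\<forall>\<^sub>F t in F'. norm (ibranch f g (\<theta> t) m (c (\<theta> t 0))) \<le> \<Gamma> ^ m" for m
    using \<theta> by eventually_elim (rule B.norm_ibranch[OF _ c_Gstar])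
  have d_bd: "\<forall>\<^sub>F t in F'. norm (dbranch f (\<theta> t) m (x t)) \<le> \<mu> ^ m" for m
    using \<theta> xG by eventually_elim (rule B.norm_dbranch)
  let ?a = "\<lambda>m t. ibranch (ib (L t)) (expmap (L t)) (\<theta> t) m (base t (\<theta> t 0)) o\<^sub>L dbranch (ib (L t)) (\<theta> t) m (y t)"
  let ?v = "\<lambda>m t. c (\<theta> t 0) + blinfun_apply (ibranch (ib (L t)) (expmap (L t)) (\<theta> t) m (base t (\<theta> t 0)))
        (branch (ib (L t)) (\<theta> t) m (y t) - branch (ib (L t)) (\<theta> t) m (base t (\<theta> t 0)))"
  have alim: "((\<lambda>t. ?a m t - B.E (\<theta> t) m (x t)) \<longlongrightarrow> 0) F'" for m
    unfolding B.E_def by (rule tendsto_compose_diff[OF clim(3) xlim(2) i_bd d_bd])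
  have vlim: "((\<lambda>t. ?v m t - approx_geometry K c (\<theta> t) m (x t)) \<longlongrightarrow> 0) F'" for m
  proof -
    have "((\<lambda>t. (branch (ib (L t)) (\<theta> t) m (y t) - branch (ib (L t)) (\<theta> t) m (base t (\<theta> t 0)))
       - (branch f (\<theta> t) m (x t) - branch f (\<theta> t) m (c (\<theta> t 0)))) \<longlongrightarrow> 0) F'"
      using tendsto_diff[OF xlim(1)[of m] clim(1)[of m]] by (simp add: algebra_simps)
    moreover have "\<forall>\<^sub>F t in F'. norm (branch f (\<theta> t) m (x t) - branch f (\<theta> t) m (c (\<theta> t 0))) \<le> M * \<mu> ^ m"
      using \<theta> xG
    proof eventually_elim
      case (elim t)
      then show ?case using B.diameter[OF elim(1,2) c_Gstar, of m] by (simp add: dist_norm)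
    qed
    ultimately have "((\<lambda>t. blinfun_apply (ibranch (ib (L t)) (expmap (L t)) (\<theta> t) m (base t (\<theta> t 0)))
        (branch (ib (L t)) (\<theta> t) m (y t) - branch (ib (L t)) (\<theta> t) m (base t (\<theta> t 0)))
      - blinfun_apply (ibranch f g (\<theta> t) m (c (\<theta> t 0))) (branch f (\<theta> t) m (x t) - branch f (\<theta> t) m (c (\<theta> t 0)))) \<longlongrightarrow> 0) F'"
      by (rule tendsto_apply_diff[OF clim(3) _ i_bd])
    then show ?thesis
      by (rule Lim_transform_eventually) (use \<theta> in \<open>eventually_elim, simp add: approx_geometry_eq\<close>)
  qed
  define Y where "Y t = (SOME Y. inverse_pair (Der h (branch f (\<theta> t) (p t) (c (\<theta> t 0)))) Y)" for t
  have Y: "\<forall>\<^sub>F t in F'. inverse_pair (Der h (branch f (\<theta> t) (p t) (c (\<theta> t 0)))) (Y t)"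
    using ch
  proof eventually_elim
    case (elim t)
    have "branch f (\<theta> t) (p t) (c (\<theta> t 0)) \<in> piece K a0"
      using K_orbit[of "\<theta> t" "p t"] chain_end[OF elim] elim by (auto simp: chain_def cantor_piece_def)
    then have "\<exists>Y. inverse_pair (Der h (branch f (\<theta> t) (p t) (c (\<theta> t 0)))) Y" using h_inv by blast
    then show ?case unfolding Y_def by (rule someI_ex)
  qed
  obtain b where b: "\<And>z. z \<in> piece K a0 \<Longrightarrow> norm (h z) \<le> b" using h_values_bounded by blast
  have short: "((\<lambda>t. Ek t (\<theta> t) (p t) (y t) - B.E_lim (\<theta> t) (x t)) \<longlongrightarrow> 0) (inf F' (principal {t. p t = j}))
     \<and> ((\<lambda>t. kn t (\<theta> t) (p t) (y t) - k (\<theta> t) (x t)) \<longlongrightarrow> 0) (inf F' (principal {t. p t = j}))" for j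
  proof -
    define F2 where "F2 = inf F' (principal {t. p t = j})"
    have F2': "F2 \<le> F'" by (simp add: F2_def)
    then have F2: "F2 \<le> F" using F' by (rule order_trans)
    have pj: "\<forall>\<^sub>F t in F2. p t = j" by (simp add: F2_def eventually_inf_principal)
    have chj: "\<forall>\<^sub>F t in F2. chain (\<theta> t) j"
      using filter_leD[OF F2' ch] pj by eventually_elim simp
    have Yj: "\<forall>\<^sub>F t in F2. inverse_pair (Der h (branch f (\<theta> t) j (c (\<theta> t 0)))) (Y t)"
      using filter_leD[OF F2' Y] pj by eventually_elim simp
    note kl = kinv_lim[OF F2 chj Yj]
    note mono = tendsto_mono[OF F2']
    note leD = filter_leD[OF F2']
    let ?I = "\<lambda>t. ibranch f g (\<theta> t) j (c (\<theta> t 0)) o\<^sub>L Y t"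
    have Ilim: "((\<lambda>t. ijet t (\<theta> t) j - ?I t) \<longlongrightarrow> 0) F2"
      unfolding ijet_def by (rule tendsto_compose_diff[OF mono[OF clim(3)] kl(1) leD[OF i_bd] kl(2)])
    have Ibd: "\<forall>\<^sub>F t in F2. norm (?I t) \<le> \<Gamma> ^ j * Zh"
      using leD[OF i_bd[of j]] kl(2) by eventually_elim (rule norm_compose_le)
    have Ipair: "\<forall>\<^sub>F t in F2. inverse_pair (AL o\<^sub>L Flin (\<theta> t) j) (?I t)"
      using chj Yj
    proof eventually_elim
      case (elim t)
      show ?case
        unfolding h_branch_base[OF elim(1), symmetric]
        by (intro inverse_pair_compose elim(2) branch_inverse_pair c_Gstar) (use elim(1) in \<open>simp add: chain_def\<close>)
    qed
    have orb: "\<forall>\<^sub>F t in F2. branch f (\<theta> t) j (x t) \<in> piece K a0 \<and> branch f (\<theta> t) j (c (\<theta> t 0)) \<in> piece K a0"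
      using chj leD[OF e]
    proof eventually_elim
      case (elim t)
      have "left_seq (adm K) (\<theta> t)" using elim by (simp add: chain_def)
      then show ?case
        using branch_cantor[of "\<theta> t" "x t" j] K_orbit[of "\<theta> t" j] elim chain_end[OF elim(1)]
        by (simp add: cantor_piece_def)
    qed
    have oD: "\<forall>\<^sub>F t in F2. branch (ib (L t)) (\<theta> t) j (y t) \<in> D a0 \<and> branch f (\<theta> t) j (x t) \<in> D a0"
      using ev[OF F2] chj leD[OF e1]
    proof eventually_elim
      case (elim t)
      then show ?case
        using perturbed.branch_D[OF elim(1), of "\<theta> t" _ j] chain_end[OF elim(2)] by simp
    qed
    have pD: "\<forall>\<^sub>F t in F2. pt t (\<theta> t) j \<in> D a0 \<and> branch f (\<theta> t) j (c (\<theta> t 0)) \<in> D a0"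
      using ev[OF F2] chj
    proof eventually_elim
      case (elim t)
      then show ?case
        using pt_D[OF elim(1), of "\<theta> t" j] K_orbit_D[of "\<theta> t" j] chain_end[OF elim(2)]
        by (simp add: chain_def)
    qed
    note ol = obs_lim[OF F2 oD mono[OF xlim(1)]]
    have pl: "((\<lambda>t. ko t (pt t (\<theta> t) j) - h (branch f (\<theta> t) j (c (\<theta> t 0)))) \<longlongrightarrow> 0) F2"
      by (rule obs_lim(1)[OF F2 pD]) (use mono[OF clim(1)[of j]] in \<open>simp add: pt_def\<close>)
    have hbd: "\<forall>\<^sub>F t in F2. norm (Der h (branch f (\<theta> t) j (x t))) \<le> \<Gamma>h"
      using orb by eventually_elim (simp add: h_bound)
    have "((\<lambda>t. (Der (ko t) (branch (ib (L t)) (\<theta> t) j (y t)) o\<^sub>L dbranch (ib (L t)) (\<theta> t) j (y t))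
       - (Der h (branch f (\<theta> t) j (x t)) o\<^sub>L dbranch f (\<theta> t) j (x t))) \<longlongrightarrow> 0) F2"
      by (rule tendsto_compose_diff[OF ol(2) mono[OF xlim(2)] hbd leD[OF d_bd]])
    moreover have "\<forall>\<^sub>F t in F2. norm (Der h (branch f (\<theta> t) j (x t)) o\<^sub>L dbranch f (\<theta> t) j (x t)) \<le> \<Gamma>h * \<mu> ^ j"
      using hbd leD[OF d_bd[of j]] by eventually_elim (rule norm_compose_le)
    ultimately have "((\<lambda>t. Ek t (\<theta> t) j (y t) - (?I t o\<^sub>L (Der h (branch f (\<theta> t) j (x t)) o\<^sub>L dbranch f (\<theta> t) j (x t)))) \<longlongrightarrow> 0) F2"
      unfolding Ek_def by (rule tendsto_compose_diff[OF Ilim _ Ibd])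
    moreover have "\<forall>\<^sub>F t in F2. Ek t (\<theta> t) j (y t) - (?I t o\<^sub>L (Der h (branch f (\<theta> t) j (x t)) o\<^sub>L dbranch f (\<theta> t) j (x t)))
        = Ek t (\<theta> t) (p t) (y t) - B.E_lim (\<theta> t) (x t)"
      using chj leD[OF e] Ipair pj
    proof eventually_elim
      case (elim t)
      then have "(?I t o\<^sub>L (Der h (branch f (\<theta> t) j (x t)) o\<^sub>L dbranch f (\<theta> t) j (x t))) = B.E_lim (\<theta> t) (x t)"
        using h_branch(1)[OF elim(1), of "x t"] by (simp add: inverse_pair_def flip: blinfun_compose_assoc)
      then show ?case using elim(4) by simp
    qed
    ultimately have 1: "((\<lambda>t. Ek t (\<theta> t) (p t) (y t) - B.E_lim (\<theta> t) (x t)) \<longlongrightarrow> 0) F2"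
      by (rule Lim_transform_eventually)
    have "((\<lambda>t. (ko t (branch (ib (L t)) (\<theta> t) j (y t)) - ko t (pt t (\<theta> t) j))
       - (h (branch f (\<theta> t) j (x t)) - h (branch f (\<theta> t) j (c (\<theta> t 0))))) \<longlongrightarrow> 0) F2"
      using tendsto_diff[OF ol(1) pl] by (simp add: algebra_simps)
    moreover have "\<forall>\<^sub>F t in F2. norm (h (branch f (\<theta> t) j (x t)) - h (branch f (\<theta> t) j (c (\<theta> t 0)))) \<le> b + b"
      using orb by eventually_elim (meson b norm_triangle_le_diff add_mono)
    ultimately have "((\<lambda>t. blinfun_apply (ijet t (\<theta> t) j) (ko t (branch (ib (L t)) (\<theta> t) j (y t)) - ko t (pt t (\<theta> t) j))
       - blinfun_apply (?I t) (h (branch f (\<theta> t) j (x t)) - h (branch f (\<theta> t) j (c (\<theta> t 0))))) \<longlongrightarrow> 0) F2"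
      by (rule tendsto_apply_diff[OF Ilim _ Ibd])
    moreover have "\<forall>\<^sub>F t in F2. blinfun_apply (ijet t (\<theta> t) j) (ko t (branch (ib (L t)) (\<theta> t) j (y t)) - ko t (pt t (\<theta> t) j))
       - blinfun_apply (?I t) (h (branch f (\<theta> t) j (x t)) - h (branch f (\<theta> t) j (c (\<theta> t 0))))
       = kn t (\<theta> t) (p t) (y t) - k (\<theta> t) (x t)"
      using chj leD[OF e] Ipair pj
    proof eventually_elim
      case (elim t)
      have "blinfun_apply (?I t) (h (branch f (\<theta> t) j (x t)) - h (branch f (\<theta> t) j (c (\<theta> t 0)))) = k (\<theta> t) (x t) - c (\<theta> t 0)"
        using h_branch(3)[OF elim(1), of "x t"] elim(2) inverse_pair_apply(2)[OF elim(3)] by simp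
      then show ?case using elim(4) by (simp add: kn_def)
    qed
    ultimately have "((\<lambda>t. kn t (\<theta> t) (p t) (y t) - k (\<theta> t) (x t)) \<longlongrightarrow> 0) F2"
      by (rule Lim_transform_eventually)
    with 1 show ?thesis by (simp add: F2_def)
  qed
  show "((\<lambda>t. Ek t (\<theta> t) (p t) (y t) - B.E_lim (\<theta> t) (x t)) \<longlongrightarrow> 0) F'"
  proof (rule tendsto_zero_by_cases)
    show "((\<lambda>t. Ek t (\<theta> t) (p t) (y t) - B.E_lim (\<theta> t) (x t)) \<longlongrightarrow> 0) (inf F' (principal {t. p t = j}))" for j
      using short by blast
    fix \<eta> :: real assume \<eta>: "0 < \<eta>"
    then have "0 < \<eta> / 3" by simp
    then have "\<forall>\<^sub>F m in sequentially. C * \<kappa>1 ^ m < \<eta> / 3 \<and> B.tail_const * \<kappa> ^ m < \<eta> / 3"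
      by (intro eventually_conj geometric_small \<kappa>1 B.\<kappa>)
    then obtain m where m: "C * \<kappa>1 ^ m < \<eta> / 3" "B.tail_const * \<kappa> ^ m < \<eta> / 3"
      by (auto simp: eventually_sequentially)
    have "\<forall>\<^sub>F t in F'. norm (?a m t - B.E (\<theta> t) m (x t)) < \<eta> / 3"
      using tendsto_norm_zero[OF alim[of m]] \<open>0 < \<eta> / 3\<close> by (rule order_tendstoD)
    then have "\<forall>\<^sub>F t in F'. m \<le> p t \<longrightarrow> norm (Ek t (\<theta> t) (p t) (y t) - B.E_lim (\<theta> t) (x t)) < \<eta>"
      using filter_leD[OF F' long] ch \<theta> xG e
    proof eventually_elim
      case (elim t)
      show ?case
      proof
      assume "m \<le> p t"
      have 1: "norm (Ek t (\<theta> t) (p t) (y t) - ?a m t) \<le> C * \<kappa>1 ^ m"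
        using elim(2)[rule_format, of "\<theta> t" "p t" m "y t"] elim(3,6) \<open>m \<le> p t\<close> by simp
      have 2: "norm (B.E_lim (\<theta> t) (x t) - B.E (\<theta> t) m (x t)) \<le> B.tail_const * \<kappa> ^ m"
        by (rule B.E_lim(2)) fact+
      show "norm (Ek t (\<theta> t) (p t) (y t) - B.E_lim (\<theta> t) (x t)) < \<eta>"
        using norm_chain3[OF 1 elim(1) 2] m by linarith
      qed
    qed
    then show "\<exists>m. \<forall>\<^sub>F t in F'. m \<le> p t \<longrightarrow> norm (Ek t (\<theta> t) (p t) (y t) - B.E_lim (\<theta> t) (x t)) < \<eta>" by blast
  qed
  show "((\<lambda>t. kn t (\<theta> t) (p t) (y t) - k (\<theta> t) (x t)) \<longlongrightarrow> 0) F'"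
  proof (rule tendsto_zero_by_cases)
    show "((\<lambda>t. kn t (\<theta> t) (p t) (y t) - k (\<theta> t) (x t)) \<longlongrightarrow> 0) (inf F' (principal {t. p t = j}))" for j
      using short by blast
    fix \<eta> :: real assume \<eta>: "0 < \<eta>"
    then have "0 < \<eta> / 3" by simp
    then have "\<forall>\<^sub>F m in sequentially. C * \<kappa>1 ^ m < \<eta> / 3 \<and> M * B.tail_const * \<kappa> ^ m < \<eta> / 3"
      by (intro eventually_conj geometric_small \<kappa>1 B.\<kappa>)
    then obtain m where m: "C * \<kappa>1 ^ m < \<eta> / 3" "M * B.tail_const * \<kappa> ^ m < \<eta> / 3"
      by (auto simp: eventually_sequentially)
    have "\<forall>\<^sub>F t in F'. norm (?v m t - approx_geometry K c (\<theta> t) m (x t)) < \<eta> / 3"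
      using tendsto_norm_zero[OF vlim[of m]] \<open>0 < \<eta> / 3\<close> by (rule order_tendstoD)
    then have "\<forall>\<^sub>F t in F'. m \<le> p t \<longrightarrow> norm (kn t (\<theta> t) (p t) (y t) - k (\<theta> t) (x t)) < \<eta>"
      using filter_leD[OF F' long] ch \<theta> xG e
    proof eventually_elim
      case (elim t)
      show ?case
      proof
      assume "m \<le> p t"
      have 1: "norm (kn t (\<theta> t) (p t) (y t) - ?v m t) \<le> C * \<kappa>1 ^ m"
        using elim(2)[rule_format, of "\<theta> t" "p t" m "y t"] elim(3,6) \<open>m \<le> p t\<close> by simp
      have 2: "norm (k (\<theta> t) (x t) - approx_geometry K c (\<theta> t) m (x t)) \<le> M * B.tail_const * \<kappa> ^ m"
        by (rule limit_geometry_tail(2)) fact+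
      show "norm (kn t (\<theta> t) (p t) (y t) - k (\<theta> t) (x t)) < \<eta>"
        using norm_chain3[OF 1 elim(1) 2] m by linarith
      qed
    qed
    then show "\<exists>m. \<forall>\<^sub>F t in F'. m \<le> p t \<longrightarrow> norm (kn t (\<theta> t) (p t) (y t) - k (\<theta> t) (x t)) < \<eta>" by blast
  qed
qed

lemma chain_extend:
  assumes "chain \<theta> p" "w \<noteq> []" "admissible_word K w" "hd w = \<theta> 0"
  shows "chain (extend \<theta> w) (p + (length w - 1))" "left_seq (adm K) (extend \<theta> w)"
    "shift (length w - 1) (extend \<theta> w) = \<theta>"
proof -
  show 1: "left_seq (adm K) (extend \<theta> w)"
    using assms by (intro extend_left_seq) (auto simp: chain_def admissible_word_def)
  show 2: "shift (length w - 1) (extend \<theta> w) = \<theta>" using assms by (intro extend_shift)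
  have "shift (p + q) \<tau> = shift p (shift q \<tau>)" for q and \<tau> :: "nat \<Rightarrow> 'a"
    by (simp add: shift_def add.assoc)
  then show "chain (extend \<theta> w) (p + (length w - 1))"
    using 1 2 assms(1) by (simp add: chain_def)
qed

text \<open>
  The increment is the one-jet of the normalised observable along the appended word, that is of \<open>kn \<circ> f\<^sub>w\<close>
  at the perturbed base point.  By \<open>Ek_kn_lim\<close> it tends to the one-jet of \<open>k \<circ> f\<^sub>w\<close>, which is \<open>F\<close>.
\<close>

lemma J_step:
  assumes F': "F' \<le> F" and w: "w \<noteq> []" "admissible_word K w"
    and ch: "\<forall>\<^sub>F t in F'. chain (\<theta> t) (p t) \<and> hd w = \<theta> t 0"
  shows "((\<lambda>t. aff_comp (aff_inv (J t (\<theta> t) (p t))) (J t (extend (\<theta> t) w) (p t + (length w - 1)))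
      - Faff K c (\<theta> t) w) \<longlongrightarrow> 0) F'"
proof -
  define q where "q = length w - 1"
  define \<theta>' where "\<theta>' t = extend (\<theta> t) w" for t
  have e: "\<forall>\<^sub>F t in F'. chain (\<theta> t) (p t) \<and> chain (\<theta>' t) (p t + q) \<and> left_seq (adm K) (\<theta>' t)
      \<and> shift q (\<theta>' t) = \<theta> t \<and> left_seq (adm K) (\<theta> t) \<and> \<theta>' t q = \<theta> t 0"
    using ch
  proof eventually_elim
    case (elim t)
    then show ?case
      using chain_extend[of "\<theta> t" "p t" w] w unfolding \<theta>'_def q_def
      by (metis chain_def shift_0(2))
  qed
  have \<theta>'0: "\<theta>' t 0 = last w" for t using extend_0[OF w(1)] by (simp add: \<theta>'_def)
  let ?y = "\<lambda>t. pt t (\<theta>' t) q" and ?x = "\<lambda>t. branch f (\<theta>' t) q (c (\<theta>' t 0))"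
  have ls: "\<forall>\<^sub>F t in F'. left_seq (adm K) (\<theta>' t)" using e by eventually_elim simp
  have e2: "\<forall>\<^sub>F t in F'. ?y t \<in> D (\<theta> t 0) \<and> ?x t \<in> cantor_piece K (\<theta> t 0)"
    using e ev[OF F']
  proof eventually_elim
    case (elim t)
    then show ?case using pt_D[OF elim(2), of "\<theta>' t" q] K_orbit[of "\<theta>' t" q] by simp
  qed
  have e3: "\<forall>\<^sub>F t in F'. left_seq (adm K) (\<theta>' t) \<and> base t (\<theta>' t 0) \<in> D (\<theta>' t 0) \<and> c (\<theta>' t 0) \<in> D (\<theta>' t 0)"
    using ls ev[OF F'] by eventually_elim (use c_D base(3) in blast)
  have "((\<lambda>t. ?y t - ?x t) \<longlongrightarrow> 0) F'"
    unfolding pt_def by (rule base_orbit_lim[OF F' ls])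
  moreover have "\<forall>\<^sub>F t in F'. chain (\<theta> t) (p t)" using ch by eventually_elim simp
  ultimately have lims: "((\<lambda>t. Ek t (\<theta> t) (p t) (?y t) - B.E_lim (\<theta> t) (?x t)) \<longlongrightarrow> 0) F'"
    "((\<lambda>t. kn t (\<theta> t) (p t) (?y t) - k (\<theta> t) (?x t)) \<longlongrightarrow> 0) F'"
    using Ek_kn_lim[where \<theta> = \<theta> and p = p and y = ?y and x = ?x, OF F' _ e2] by blast+
  have bd1: "\<forall>\<^sub>F t in F'. norm (B.E_lim (\<theta> t) (?x t)) \<le> B.dist_const"
    using e e2
  proof eventually_elim
    case (elim t)
    have "?x t \<in> Gstar K (\<theta> t 0)" using elim(2) piece_Gstar by (auto simp: cantor_piece_def)
    then show ?case
      by (intro tendsto_upperbound[OF tendsto_norm[OF B.E_lim(1)]] always_eventually allI B.E_bounds(1))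
        (use elim in auto)
  qed
  have bd2: "\<forall>\<^sub>F t in F'. norm (dbranch f (\<theta>' t) q (c (\<theta>' t 0))) \<le> \<mu> ^ q"
    using ls by eventually_elim (rule B.norm_dbranch[OF _ c_Gstar])
  have lin: "((\<lambda>t. (Ek t (\<theta> t) (p t) (?y t) o\<^sub>L dbranch (ib (L t)) (\<theta>' t) q (base t (\<theta>' t 0)))
     - (B.E_lim (\<theta> t) (?x t) o\<^sub>L dbranch f (\<theta>' t) q (c (\<theta>' t 0)))) \<longlongrightarrow> 0) F'"
    by (rule tendsto_compose_diff[OF lims(1) branch_lim(2)[OF F' e3 base_lim[OF F']] bd1 bd2])
  have bd3: "\<forall>\<^sub>F t in F'. norm (B.E_lim (\<theta> t) (?x t) o\<^sub>L dbranch f (\<theta>' t) q (c (\<theta>' t 0))) \<le> B.dist_const * \<mu> ^ q"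
    using bd1 bd2 by eventually_elim (rule norm_compose_le)
  have "((\<lambda>t. aff_of (Ek t (\<theta> t) (p t) (?y t) o\<^sub>L dbranch (ib (L t)) (\<theta>' t) q (base t (\<theta>' t 0))) (c (last w)) (kn t (\<theta> t) (p t) (?y t))
     - aff_of (B.E_lim (\<theta> t) (?x t) o\<^sub>L dbranch f (\<theta>' t) q (c (\<theta>' t 0))) (c (last w)) (k (\<theta> t) (?x t))) \<longlongrightarrow> 0) F'"
    by (rule aff_of_tendsto[OF lin lims(2) _ bd3, of _ "norm (c (last w))"]) simp
  moreover have "\<forall>\<^sub>F t in F'. aff_of (Ek t (\<theta> t) (p t) (?y t) o\<^sub>L dbranch (ib (L t)) (\<theta>' t) q (base t (\<theta>' t 0))) (c (last w)) (kn t (\<theta> t) (p t) (?y t))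
     - aff_of (B.E_lim (\<theta> t) (?x t) o\<^sub>L dbranch f (\<theta>' t) q (c (\<theta>' t 0))) (c (last w)) (k (\<theta> t) (?x t))
     = aff_comp (aff_inv (J t (\<theta> t) (p t))) (J t (extend (\<theta> t) w) (p t + (length w - 1))) - Faff K c (\<theta> t) w"
    using ch e filter_leD[OF F' jet_GLC] filter_leD[OF F' jet_pair]
  proof eventually_elim
    case (elim t)
    have F: "Faff K c (\<theta> t) w = aff_of (B.E_lim (\<theta> t) (?x t) o\<^sub>L dbranch f (\<theta>' t) q (c (\<theta>' t 0))) (c (last w)) (k (\<theta> t) (?x t))"
      using Faff_eq[of "\<theta> t" w, folded \<theta>'_def q_def] w elim(1,2) \<theta>'0[of t] by (simp add: Flin_def)
    have pt: "pt t (\<theta>' t) (p t + q) = branch (ib (L t)) (\<theta> t) (p t) (?y t)"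
      using elim(2) by (simp add: pt_def branch_add)
    have "aff_comp (aff_inv (J t (\<theta> t) (p t))) (J t (\<theta>' t) (p t + q)) =
        aff_of (ijet t (\<theta> t) (p t) o\<^sub>L jet t (\<theta>' t) (p t + q)) (c (\<theta>' t 0))
          (c (\<theta> t 0) + blinfun_apply (ijet t (\<theta> t) (p t)) (ko t (pt t (\<theta>' t) (p t + q)) - ko t (pt t (\<theta> t) (p t))))"
      unfolding J_def by (rule aff_of_inv_comp) (use elim in auto)
    also have "(ijet t (\<theta> t) (p t) o\<^sub>L jet t (\<theta>' t) (p t + q)) =
        (Ek t (\<theta> t) (p t) (?y t) o\<^sub>L dbranch (ib (L t)) (\<theta>' t) q (base t (\<theta>' t 0)))"
      using elim(2) by (simp add: Ek_def jet_def pt dbranch_add blinfun_compose_assoc) (simp add: pt_def)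
    also have "(c (\<theta> t 0) + blinfun_apply (ijet t (\<theta> t) (p t)) (ko t (pt t (\<theta>' t) (p t + q)) - ko t (pt t (\<theta> t) (p t))))
        = kn t (\<theta> t) (p t) (?y t)"
      by (simp add: kn_def pt)
    finally show ?case using F \<theta>'0[of t] unfolding \<theta>'_def[symmetric] q_def[symmetric] by simp
  qed
  ultimately show ?thesis by (rule Lim_transform_eventually)
qed

lemma J_start: "((\<lambda>t. J t \<theta>0 0) \<longlongrightarrow> A) F"
proof -
  have ch: "chain \<theta>0 0" using \<theta>0 by (simp add: chain_def)
  have F0: "Flin \<theta>0 0 = id_blinfun" using E_lim_base[OF \<theta>0(1)] by (simp add: Flin_def)
  have Dh: "Der h (c a0) = AL" using h_branch_base[OF ch] by (simp add: F0 \<theta>0(2))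
  have hc: "h (c a0) = aff_app A (c a0)"
    using h_branch(2)[OF ch c_cantor] limit_geometry_base[OF \<theta>0(1)] by (simp add: \<theta>0(2))
  have e: "\<forall>\<^sub>F t in F. base t a0 \<in> D a0 \<and> c a0 \<in> D a0"
    using perturbed by eventually_elim (use c_D base(3) in blast)
  note l = obs_lim[OF order_refl e base_lim[OF order_refl]]
  have "((\<lambda>t. aff_of (Der (ko t) (base t a0)) (c a0) (ko t (base t a0)) - aff_of (Der h (c a0)) (c a0) (h (c a0))) \<longlongrightarrow> 0) F"
    by (rule aff_of_tendsto[OF l(2) l(1), of _ "norm (c a0)" "norm (Der h (c a0))"]) simp_all
  moreover have "J t \<theta>0 0 = aff_of (Der (ko t) (base t a0)) (c a0) (ko t (base t a0))" for t
    by (simp add: J_def jet_def pt_def \<theta>0(2))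
  moreover have "aff_of (Der h (c a0)) (c a0) (h (c a0)) = A"
    by (simp add: Dh hc aff_of_def aff_app_def)
  ultimately have "((\<lambda>t. J t \<theta>0 0 - A) \<longlongrightarrow> 0) F" by simp
  then show ?thesis by (rule LIM_zero_cancel)
qed

lemma J_values:
  "\<forall>\<^sub>F t in F. \<forall>\<theta> p. chain \<theta> p \<longrightarrow> J t \<theta> p \<in> Aff \<and> aff_app (J t \<theta> p) (c (\<theta> 0)) \<in> ko t ` cantor_piece (L t) a0"
  using jet_GLC perturbed
proof eventually_elim
  case (elim t)
  show ?case
  proof (intro allI impI)
    fix \<theta> p assume ch: "chain \<theta> p"
    then have \<theta>: "left_seq (adm K) \<theta>" by (simp add: chain_def)
    show "J t \<theta> p \<in> Aff \<and> aff_app (J t \<theta> p) (c (\<theta> 0)) \<in> ko t ` cantor_piece (L t) a0"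
      using elim(1) ch pt_cantor[OF elim(2) \<theta>, of p] chain_end[OF ch]
      by (auto simp: J_def aff_of_Aff aff_of_app)
  qed
qed

lemma J_small:
  obtains C m where "0 < m" "m < 1"
    "\<forall>\<^sub>F t in F. \<forall>\<theta> p v. chain \<theta> p \<longrightarrow> norm (fst (J t \<theta> p) *v v) \<le> C * m ^ p * norm v"
proof -
  obtain \<mu>1 \<Gamma>1 H1 M1 Q1 \<kappa>1 where bb:
    "\<forall>\<^sub>F t in F. bunched_branches (adm K) D (ib (L t)) (expmap (L t)) \<mu>1 \<Gamma>1 (base t) \<alpha> H1 M1 Q1 \<kappa>1"
    by (rule family_bunched)
  have main: "\<forall>\<^sub>F t in F. (0 < \<mu>1 \<and> \<mu>1 < 1) \<and> (\<forall>\<theta> p v. chain \<theta> p \<longrightarrow> norm (fst (J t \<theta> p) *v v) \<le> 2 * (\<Gamma>h + 1) * \<mu>1 ^ p * norm v)"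
    using bb jet_GLC perturbed obs
  proof eventually_elim
    case (elim t)
    interpret PB: bunched_branches "adm K" D "ib (L t)" "expmap (L t)" \<mu>1 \<Gamma>1 "base t" \<alpha> H1 M1 Q1 \<kappa>1 by fact
    interpret NP: near_pair \<alpha> "\<epsilon> t" "2 * r1" r1 \<Gamma>h Hh "piece K a0" "\<psi> t" "ko t" h by fact
    show ?case
    proof (intro conjI allI impI)
      show "0 < \<mu>1" "\<mu>1 < 1" by (fact PB.\<mu>)+
      fix \<theta> p v assume ch: "chain \<theta> p"
      then have \<theta>: "left_seq (adm K) \<theta>" by (simp add: chain_def)
      have "norm (jet t \<theta> p) \<le> 2 * (\<Gamma>h + 1) * \<mu>1 ^ p"
        unfolding jet_def
        by (intro norm_compose_le NP.near_at(3) PB.norm_dbranch \<theta> base(3) elim(3))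
          (use pt_D[OF elim(3) \<theta>, of p] chain_end[OF ch] in simp)
      then have "norm (blinfun_apply (jet t \<theta> p) v) \<le> 2 * (\<Gamma>h + 1) * \<mu>1 ^ p * norm v"
        by (intro order_trans[OF norm_blinfun] mult_right_mono) auto
      then show "norm (fst (J t \<theta> p) *v v) \<le> 2 * (\<Gamma>h + 1) * \<mu>1 ^ p * norm v"
        using elim(2) ch by (simp add: J_def aff_of_def mat_of_apply)
    qed
  qed
  show thesis
  proof (cases "F = bot")
    case True
    then show thesis by (intro that[of "1/2" 0]) auto
  next
    case False
    then have "0 < \<mu>1 \<and> \<mu>1 < 1" using eventually_happens'[OF False main] by blast
    then show thesis using main by (intro that[of \<mu>1 "2 * (\<Gamma>h + 1)"]) (auto elim: eventually_mono)
  qed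
qed

end

section \<open>Existence of jet systems\<close>

context hcantor begin

text \<open>By contraction \<open>G\<^sup>*(b)\<close> lies in the image of a compact subset of the open set \<open>G\<^sup>*(a)\<close>.\<close>

lemma room_exists:
  obtains r0 where "0 < r0" "\<And>a b v. (a, b) \<in> adm K \<Longrightarrow> v \<in> Gstar K b \<Longrightarrow> ball v r0 \<subseteq> g ` Gstar K a"
proof -
  define C where "C a = {x. infdist x (piece K a) \<le> \<mu> * rad K}" for a
  have lt: "\<mu> * rad K < rad K" using \<mu> rad_pos by simp
  have C: "compact (C a)" "C a \<subseteq> Gstar K a" "thicken (\<mu> * rad K) (piece K a) \<subseteq> C a" for a
    using compact_thicken_closed[OF compact_piece piece_ne] lt by (auto simp: C_def Gstar_thicken)
  have "\<exists>r>0. (\<Union>x\<in>g ` C a. ball x r) \<subseteq> g ` Gstar K a" for a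
  proof -
    have d: "C1a \<alpha> g (Gstar K a)" "open (g ` Gstar K a)"
      using g_diffeo[of a] by (auto simp: C1a_diffeo_def C1a_def)
    have "compact (g ` C a)"
      by (rule compact_continuous_image[OF continuous_on_subset[OF C1a_continuous_on[OF d(1)] C(2)] C(1)])
    from compact_subset_open_imp_ball_epsilon_subset[OF this d(2) image_mono[OF C(2)]]
    obtain r where "0 < r" "(\<Union>x\<in>g ` C a. ball x r) \<subseteq> g ` Gstar K a" .
    then show ?thesis by (intro exI[of _ r] conjI)
  qed
  then obtain r where r: "\<And>a. 0 < r a" "\<And>a. (\<Union>x\<in>g ` C a. ball x (r a)) \<subseteq> g ` Gstar K a" by metis
  show thesis
  proof (rule that[of "Min (range r)"])
    show "0 < Min (range r)" using r(1) by simp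
    fix a b v assume R: "(a, b) \<in> adm K" and v: "v \<in> Gstar K b"
    have "f a b v \<in> C a"
      using f_thicken[OF R order_refl, of v] v C(3) by (auto simp: Gstar_thicken)
    then have "v \<in> g ` C a" using g_f[OF R v] by (metis imageI)
    then have "ball v (r a) \<subseteq> g ` Gstar K a" using r(2) by blast
    moreover have "Min (range r) \<le> r a" by simp
    ultimately show "ball v (Min (range r)) \<subseteq> g ` Gstar K a" by (meson subset_ball order_trans)
  qed
qed

lemma limit_geometries_exist:
  assumes c: "\<And>a. c a \<in> cantor_piece K a"
    and \<Gamma>: "1 \<le> \<Gamma>" "\<And>a x. x \<in> Gstar K a \<Longrightarrow> norm (Der g x) \<le> \<Gamma>"
    and H: "0 \<le> H" "\<And>a x y. x \<in> Gstar K a \<Longrightarrow> y \<in> Gstar K a \<Longrightarrow>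
       norm (Der g x - Der g y) \<le> H * dist x y powr \<alpha>"
  shows "\<exists>M Q \<kappa>. limit_geometries \<alpha> K c \<Gamma> H M Q \<kappa>"
proof -
  interpret B: branches "adm K" "Gstar K" f g \<mu> \<Gamma> by (rule branches_Gstar[OF \<Gamma>])
  have "cantor_set K \<noteq> {}" using c by (auto simp: cantor_piece_def)
  then obtain N \<rho> where N: "0 < N" "0 < \<rho>" "\<rho> < 1"
    and blocks: "\<And>\<theta> y. left_seq (adm K) \<theta> \<Longrightarrow> y \<in> cantor_piece K (\<theta> 0) \<Longrightarrow>
      norm (dbranch f \<theta> N y) * norm (ibranch f g \<theta> N y) * (\<mu> ^ N) powr \<alpha> \<le> \<rho>"
    using bunched_blocks by blast
  obtain M where M: "0 < M"
    "\<And>a (\<phi> :: complex ^ 'd \<Rightarrow> complex ^ 'd) \<phi>' B x y.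
       (\<And>x. x \<in> Gstar K a \<Longrightarrow> (\<phi> has_derivative blinfun_apply (\<phi>' x)) (at x)) \<Longrightarrow>
       (\<And>x. x \<in> Gstar K a \<Longrightarrow> norm (\<phi>' x) \<le> B) \<Longrightarrow>
       x \<in> Gstar K a \<Longrightarrow> y \<in> Gstar K a \<Longrightarrow> norm (\<phi> x - \<phi> y) \<le> M * B"
    using inner_diameter_pieces[OF rad_pos, folded Gstar_thicken] by blast
  have cG: "c a \<in> Gstar K a" for a using c piece_Gstar by (auto simp: cantor_piece_def)
  have "limit_geometries \<alpha> K c \<Gamma> H M (M powr \<alpha> * (\<Gamma> ^ N / \<rho>)) (root N \<rho>)"
  proof unfold_locales
    fix a b y y' assume "(a, b) \<in> adm K" "y \<in> Gstar K b" "y' \<in> Gstar K b"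
    then show "norm (Der g (f a b y) - Der g (f a b y')) \<le> H * dist (f a b y) (f a b y') powr \<alpha>"
      by (intro H(2)[of _ a] f_in)
  next
    fix \<theta> n assume \<theta>: "left_seq (adm K) \<theta>"
    have b: "norm (dbranch f \<theta> n (c (\<theta> 0))) * norm (ibranch f g \<theta> n (c (\<theta> 0))) * (\<mu> ^ n) powr \<alpha>
        \<le> \<Gamma> ^ N / \<rho> * root N \<rho> ^ n"
    proof (rule B.bunching_from_blocks[OF \<theta> cG N \<alpha>_pos])
      fix i
      show "norm (dbranch f (shift i \<theta>) N (branch f \<theta> i (c (\<theta> 0))))
        * norm (ibranch f g (shift i \<theta>) N (branch f \<theta> i (c (\<theta> 0)))) * (\<mu> ^ N) powr \<alpha> \<le> \<rho>"
        using branch_cantor[OF \<theta> c, of i] by (intro blocks left_seq_shift \<theta>) simp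
    qed
    have "(M * \<mu> ^ n) powr \<alpha> = M powr \<alpha> * (\<mu> ^ n) powr \<alpha>"
      using M(1) \<mu> by (simp add: powr_mult)
    then show "norm (dbranch f \<theta> n (c (\<theta> 0))) * norm (ibranch f g \<theta> n (c (\<theta> 0))) * (M * \<mu> ^ n) powr \<alpha>
        \<le> M powr \<alpha> * (\<Gamma> ^ N / \<rho>) * root N \<rho> ^ n"
      using mult_left_mono[OF b, of "M powr \<alpha>"] by (simp add: mult_ac)
  next
    show "norm (\<phi> x - \<phi> y) \<le> M * B" if "\<And>x. x \<in> Gstar K a \<Longrightarrow> (\<phi> has_derivative blinfun_apply (\<phi>' x)) (at x)"
      "\<And>x. x \<in> Gstar K a \<Longrightarrow> norm (\<phi>' x) \<le> B" "x \<in> Gstar K a" "y \<in> Gstar K a"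
      for a x y B and \<phi> :: "complex ^ 'd \<Rightarrow> complex ^ 'd" and \<phi>'
      by (rule M(2)[OF that])
  qed (use c cG \<alpha>_pos H(1) M(1) N in auto)
  then show ?thesis by blast
qed

end

lemma hcantor_close:
  assumes "hcantor \<alpha> K" "bunched_holomorphic_cantor \<alpha> L" "cantor_close \<alpha> \<epsilon> K L"
  shows "hcantor \<alpha> L"
proof -
  interpret K: hcantor \<alpha> K by fact
  show ?thesis
  proof
    fix a
    have "C1a_close \<alpha> \<epsilon> (expmap K) (Gstar K a) (expmap L) (Gstar L a)"
      using assms(3) by (simp add: cantor_close_def)
    then obtain \<phi> where "\<phi> ` Gstar K a = Gstar L a" unfolding C1a_close_def by blast
    moreover have "Gstar K a \<noteq> {}" using K.piece_Gstar[of a] K.piece_ne[of a] by blast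
    ultimately have "Gstar L a \<noteq> {}" by blast
    then show "piece L a \<noteq> {}" by (auto simp: Gstar_def)
  qed (use K.\<alpha>_pos assms(2) in auto)
qed

lemma perturbed_exists:
  assumes "hcantor \<alpha> K" "bunched_holomorphic_cantor \<alpha> L" "cantor_close \<alpha> \<epsilon> K L"
    and "\<And>a b v. (a, b) \<in> adm K \<Longrightarrow> v \<in> Gstar K b \<Longrightarrow> ball v r0 \<subseteq> expmap K ` Gstar K a"
    and "1 \<le> \<Gamma>" "\<And>a x. x \<in> Gstar K a \<Longrightarrow> norm (Der (expmap K) x) \<le> \<Gamma>"
    and "0 \<le> H" "\<And>a x y. x \<in> Gstar K a \<Longrightarrow> y \<in> Gstar K a \<Longrightarrow>
       norm (Der (expmap K) x - Der (expmap K) y) \<le> H * dist x y powr \<alpha>"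
    and "0 < r1" "2 * r1 \<le> rad K" "0 < \<epsilon>" "2 * \<epsilon> < r0" "4 * \<epsilon> \<le> 1" "8 * \<epsilon> \<le> (1 - contr K)\<^sup>2 * r1"
  shows "\<exists>\<phi>. perturbed \<alpha> K L \<epsilon> r0 r1 \<Gamma> H \<phi>"
proof -
  have "\<forall>a. \<exists>\<phi>. C1a_diffeo \<alpha> \<phi> (Gstar K a) \<and> \<phi> ` Gstar K a = Gstar L a \<and>
    C1a_near \<alpha> \<epsilon> (Gstar K a) \<phi> (\<lambda>x. x) \<and> C1a_near \<alpha> \<epsilon> (Gstar K a) (expmap L \<circ> \<phi>) (expmap K)"
    using assms(3) unfolding cantor_close_def C1a_close_def by blast
  then obtain \<phi> where \<phi>: "\<And>a. C1a_diffeo \<alpha> (\<phi> a) (Gstar K a) \<and> \<phi> a ` Gstar K a = Gstar L a \<and>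
    C1a_near \<alpha> \<epsilon> (Gstar K a) (\<phi> a) (\<lambda>x. x) \<and> C1a_near \<alpha> \<epsilon> (Gstar K a) (expmap L \<circ> \<phi> a) (expmap K)"
    by metis
  have "adm L = adm K" using assms(3) by (simp add: cantor_close_def)
  then have "perturbed \<alpha> K L \<epsilon> r0 r1 \<Gamma> H \<phi>"
    using \<phi>
    by (intro perturbed.intro perturbed_axioms.intro hcantor_close[OF assms(1-3)])
      (fact assms | erule assms | (rule assms; assumption) | simp)+
  then show ?thesis by (rule exI[of _ \<phi>])
qed

lemma near_pair_exists:
  fixes S :: "'v::euclidean_space set"
  assumes "0 < \<alpha>" "C1a_close \<alpha> \<epsilon> h W k Z" and sub: "thicken (2 * r1) S \<subseteq> W"
    and "1 \<le> \<Gamma>" "\<And>x. x \<in> thicken (2 * r1) S \<Longrightarrow> norm (Der h x) \<le> \<Gamma>"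
    and "0 \<le> H" "\<And>x y. x \<in> thicken (2 * r1) S \<Longrightarrow> y \<in> thicken (2 * r1) S \<Longrightarrow>
       norm (Der h x - Der h y) \<le> H * dist x y powr \<alpha>"
    and "0 < r1" "0 < \<epsilon>" "4 * \<epsilon> \<le> 1" "8 * \<epsilon> \<le> r1"
  shows "\<exists>\<psi>. near_pair \<alpha> \<epsilon> (2 * r1) r1 \<Gamma> H S \<psi> k h"
proof -
  have h: "C1a \<alpha> h W" and k: "C1a \<alpha> k Z" using assms(2) by (auto simp: C1a_close_def C1a_diffeo_def)
  obtain \<psi> where \<psi>: "C1a \<alpha> \<psi> W" "\<psi> ` W = Z" "C1a_near \<alpha> \<epsilon> W \<psi> (\<lambda>x. x)" "C1a_near \<alpha> \<epsilon> W (k \<circ> \<psi>) h"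
    using assms(2) by (auto simp: C1a_close_def C1a_diffeo_def)
  have restrict: "C1a_near \<alpha> \<epsilon> (thicken (2 * r1) S) p q" if "C1a_near \<alpha> \<epsilon> W p q" for p q :: "'v \<Rightarrow> 'v"
    using that sub unfolding C1a_near_def by (meson subsetD)
  have "C1a \<alpha> \<psi> (thicken (2 * r1) S)" using \<psi>(1) sub by (fastforce simp: C1a_def)
  moreover have "k differentiable (at (\<psi> u))" if "u \<in> thicken (2 * r1) S" for u
    using C1a_differentiable[OF k] \<psi>(2) sub that by blast
  moreover have "h differentiable (at u)" if "u \<in> thicken (2 * r1) S" for u
    using C1a_differentiable[OF h] sub that by blast
  ultimately have "near_pair \<alpha> \<epsilon> (2 * r1) r1 \<Gamma> H S \<psi> k h"
    using restrict[OF \<psi>(3)] restrict[OF \<psi>(4)]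
    by (intro near_pair.intro) (fact assms | erule assms | (rule assms; assumption) | simp)+
  then show ?thesis by (rule exI[of _ \<psi>])
qed

text \<open>
  What the renormalization argument uses of a perturbed observable \<open>k\<close> on a perturbed Cantor set:
  affine one-jets \<open>J \<theta> p\<close> at Cantor points, which start near \<open>A\<close>, shrink, and whose increments
  along the finitely many words under consideration are close to those of the affine model.
\<close>

definition jet_system :: "('a::finite, 'd::finite) cantor \<Rightarrow> ('a \<Rightarrow> complex ^ 'd) \<Rightarrow> (nat \<Rightarrow> 'a) \<Rightarrow> 'd aff \<Rightarrow>
    'a list set \<Rightarrow> real \<Rightarrow> (complex ^ 'd) set \<Rightarrow> ((nat \<Rightarrow> 'a) \<Rightarrow> nat \<Rightarrow> 'd aff) \<Rightarrow> bool" where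
  "jet_system K c \<theta>0 A Ws \<eta> S J \<longleftrightarrow> norm (J \<theta>0 0 - A) < \<eta> \<and>
    (\<forall>\<theta> p. left_seq (adm K) \<theta> \<and> shift p \<theta> = \<theta>0 \<longrightarrow>
       J \<theta> p \<in> Aff \<and> aff_app (J \<theta> p) (c (\<theta> 0)) \<in> S \<and>
       (\<forall>w\<in>Ws. hd w = \<theta> 0 \<longrightarrow>
         norm (aff_comp (aff_inv (J \<theta> p)) (J (extend \<theta> w) (p + (length w - 1))) - Faff K c \<theta> w) < \<eta>)) \<and>
    (\<exists>C m. 0 < m \<and> m < 1 \<and> (\<forall>\<theta> p v. left_seq (adm K) \<theta> \<and> shift p \<theta> = \<theta>0 \<longrightarrow>
       norm (fst (J \<theta> p) *v v) \<le> C * m ^ p * norm v))"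

text \<open>
  Otherwise there are counterexamples for \<open>\<epsilon> = 1 / (j + 1)\<close>, \<open>j \<in> \<nat>\<close>.  They form an observed family, and
  the limits along this family contradict their choice.  The constants \<open>r1\<close>, \<open>\<Gamma>\<close>, \<open>H\<close> depend on the
  unperturbed data alone.
\<close>

lemma jet_system_exists:
  fixes K :: "('a::finite, 'd::finite) cantor"
  assumes \<alpha>: "0 < \<alpha>" and K: "bunched_holomorphic_cantor \<alpha> K" and c: "\<And>a. c a \<in> cantor_piece K a"
    and \<theta>0: "left_seq (adm K) \<theta>0" "\<theta>0 0 = a0" and A: "A \<in> Aff"
    and h: "C1a_diffeo \<alpha> h W" and W: "piece K a0 \<subseteq> W"
    and agree: "agree_on (piece K a0) h (aff_app A \<circ> limit_geometry K c \<theta>0)"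
    and Ws: "finite Ws" "\<And>w. w \<in> Ws \<Longrightarrow> w \<noteq> [] \<and> admissible_word K w" and \<eta>: "0 < \<eta>"
  shows "\<exists>\<epsilon>>0. \<forall>L k Z. bunched_holomorphic_cantor \<alpha> L \<and> cantor_close \<alpha> \<epsilon> K L \<and> k \<in> PHol \<alpha> L a0 \<and>
      C1a_close \<alpha> \<epsilon> h W k Z \<longrightarrow> (\<exists>J. jet_system K c \<theta>0 A Ws \<eta> (k ` cantor_piece L a0) J)"
proof (rule ccontr)
  assume neg: "\<not> ?thesis"
  define \<epsilon> where "\<epsilon> j = inverse (real (Suc j))" for j
  have \<epsilon>_pos: "0 < \<epsilon> j" for j by (simp add: \<epsilon>_def)
  have "\<forall>j. \<exists>L k Z. bunched_holomorphic_cantor \<alpha> L \<and> cantor_close \<alpha> (\<epsilon> j) K L \<and> k \<in> PHol \<alpha> L a0 \<and>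
      C1a_close \<alpha> (\<epsilon> j) h W k Z \<and> \<not> (\<exists>J. jet_system K c \<theta>0 A Ws \<eta> (k ` cantor_piece L a0) J)"
    using neg \<epsilon>_pos by meson
  then obtain L k Z where L: "\<And>j. bunched_holomorphic_cantor \<alpha> (L j)" "\<And>j. cantor_close \<alpha> (\<epsilon> j) K (L j)"
    and k: "\<And>j. k j \<in> PHol \<alpha> (L j) a0" "\<And>j. C1a_close \<alpha> (\<epsilon> j) h W (k j) (Z j)"
    and no: "\<And>j. \<not> (\<exists>J. jet_system K c \<theta>0 A Ws \<eta> (k j ` cantor_piece (L j) a0) J)"
    by metis
  have hK: "hcantor \<alpha> K"
    using \<alpha> K c by (intro hcantor.intro) (auto simp: cantor_piece_def)
  interpret K: hcantor \<alpha> K by (rule hK)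
  obtain \<Gamma> where \<Gamma>: "1 \<le> \<Gamma>" "\<And>a x. x \<in> Gstar K a \<Longrightarrow> norm (Der (expmap K) x) \<le> \<Gamma>"
    using K.Der_g_bound by blast
  obtain H where H0: "0 \<le> H" "\<And>a b x y. x \<in> Gstar K a \<Longrightarrow> y \<in> Gstar K b \<Longrightarrow>
      norm (Der (expmap K) x - Der (expmap K) y) \<le> H * dist x y powr \<alpha>"
    using K.Der_g_holder by metis
  have H: "0 \<le> H" "\<And>a x y. x \<in> Gstar K a \<Longrightarrow> y \<in> Gstar K a \<Longrightarrow>
      norm (Der (expmap K) x - Der (expmap K) y) \<le> H * dist x y powr \<alpha>"
    by (rule H0(1)) (erule H0(2))
  obtain M Q \<kappa> where lg: "limit_geometries \<alpha> K c \<Gamma> H M Q \<kappa>"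
    using K.limit_geometries_exist[of c \<Gamma> H] c \<Gamma> H by blast
  obtain r0 where r0: "0 < r0" "\<And>a b v. (a, b) \<in> adm K \<Longrightarrow> v \<in> Gstar K b \<Longrightarrow> ball v r0 \<subseteq> expmap K ` Gstar K a"
    using K.room_exists by metis
  have hC: "C1a \<alpha> h W" "C1a \<alpha> (inv_into W h) (h ` W)" using h by (auto simp: C1a_diffeo_def)
  obtain r where r: "0 < r" "(\<Union>x\<in>piece K a0. ball x r) \<subseteq> W"
    by (rule compact_subset_open_imp_ball_epsilon_subset[OF K.compact_piece C1a_open[OF hC(1)] W])
  define r1 where "r1 = min (r / 2) (rad K / 2)"
  have r1: "0 < r1" "2 * r1 \<le> rad K" "2 * r1 \<le> r" using r(1) K.rad_pos by (auto simp: r1_def)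
  have sub: "thicken (2 * r1) (piece K a0) \<subseteq> W"
    using thicken_mono[OF r1(3), of "piece K a0"] r(2) by (auto simp: thicken_def)
  obtain B where B: "0 \<le> B" "\<And>x. x \<in> thicken (2 * r1) (piece K a0) \<Longrightarrow> norm (Der h x) \<le> B"
    using Der_bounded[OF hC(1) sub bounded_thicken[OF compact_imp_bounded[OF K.compact_piece]] \<alpha>] by blast
  define \<Gamma>h where "\<Gamma>h = max 1 B"
  have \<Gamma>h: "1 \<le> \<Gamma>h" "\<And>x. x \<in> thicken (2 * r1) (piece K a0) \<Longrightarrow> norm (Der h x) \<le> \<Gamma>h"
    using B by (auto simp: \<Gamma>h_def le_max_iff_disj)
  obtain Hh where Hh: "0 \<le> Hh" "\<And>x y. x \<in> W \<Longrightarrow> y \<in> W \<Longrightarrow> norm (Der h x - Der h y) \<le> Hh * dist x y powr \<alpha>"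
    using C1aE[OF hC(1)] by blast
  have "bounded (h ` piece K a0)"
    by (intro compact_imp_bounded compact_continuous_image K.compact_piece
        continuous_on_subset[OF C1a_continuous_on[OF hC(1)] W])
  then obtain Zh where Zh: "\<And>y. y \<in> h ` piece K a0 \<Longrightarrow> norm (Der (inv_into W h) y) \<le> Zh"
    using Der_bounded[OF hC(2) image_mono[OF W] _ \<alpha>] by blast
  have \<epsilon>_lim: "\<epsilon> \<longlonglongrightarrow> 0"
    unfolding \<epsilon>_def by (rule LIMSEQ_inverse_real_of_nat)
  then have ev: "\<forall>\<^sub>F j in sequentially. \<epsilon> j < r0 / 2 \<and> \<epsilon> j < 1 / 4 \<and> \<epsilon> j < (1 - contr K)\<^sup>2 * r1 / 8 \<and> \<epsilon> j < r1 / 8"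
    using r0(1) r1(1) K.\<mu> by (intro eventually_conj order_tendstoD(2)[OF \<epsilon>_lim]) auto
  define \<phi> where "\<phi> j = (SOME \<phi>. perturbed \<alpha> K (L j) (\<epsilon> j) r0 r1 \<Gamma> H \<phi>)" for j
  have pert: "\<forall>\<^sub>F j in sequentially. perturbed \<alpha> K (L j) (\<epsilon> j) r0 r1 \<Gamma> H (\<phi> j)"
    using ev
  proof eventually_elim
    case (elim j)
    have "\<exists>\<phi>. perturbed \<alpha> K (L j) (\<epsilon> j) r0 r1 \<Gamma> H \<phi>"
      by (rule perturbed_exists[OF hK L])
        ((rule r0(2) \<Gamma>(2) H(2); assumption) | (use elim \<Gamma>(1) H(1) r1 \<epsilon>_pos in simp))+
    then show ?case unfolding \<phi>_def by (rule someI_ex)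
  qed
  define \<psi> where "\<psi> j = (SOME \<psi>. near_pair \<alpha> (\<epsilon> j) (2 * r1) r1 \<Gamma>h Hh (piece K a0) \<psi> (k j) h)" for j
  have obs: "\<forall>\<^sub>F j in sequentially. near_pair \<alpha> (\<epsilon> j) (2 * r1) r1 \<Gamma>h Hh (piece K a0) (\<psi> j) (k j) h"
    using ev
  proof eventually_elim
    case (elim j)
    have "\<exists>\<psi>. near_pair \<alpha> (\<epsilon> j) (2 * r1) r1 \<Gamma>h Hh (piece K a0) \<psi> (k j) h"
      by (rule near_pair_exists[OF \<alpha> k(2) sub])
        ((rule \<Gamma>h(2); assumption) | (rule Hh(2); use sub in blast)
          | (use elim \<Gamma>h(1) Hh(1) r1 \<epsilon>_pos in simp))+
    then show ?case unfolding \<psi>_def by (rule someI_ex)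
  qed
  \<comment> \<open>The inverse of the diffeomorphism has bounded derivative on the compact image of the piece.\<close>
  have hinv: "\<exists>Y. inverse_pair (Der h x) Y \<and> norm Y \<le> Zh" if "x \<in> piece K a0" for x
    using inverse_pair_sym[OF C1a_diffeo_inverse_pair[OF h, of x]] W Zh that by blast
  interpret lg: limit_geometries \<alpha> K c \<Gamma> H M Q \<kappa> by (rule lg)
  interpret O: observed_family \<alpha> K c \<Gamma> H M Q \<kappa> r0 r1 sequentially L \<epsilon> \<phi> a0 h k \<psi> \<Gamma>h Hh Zh A \<theta>0
  proof unfold_locales
    show "\<forall>\<^sub>F j in sequentially. \<forall>x\<in>cantor_piece (L j) a0. Der (k j) x \<in> GLC"
      using k(1) by (auto simp: PHol_def)
    show "norm (Der h x) \<le> \<Gamma>h" if "x \<in> piece K a0" for x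
      using \<Gamma>h(2) subset_thicken[of "2 * r1" "piece K a0"] r1(1) that by auto
  qed (use \<epsilon>_lim pert r1(1) obs hinv \<theta>0 A agree in auto)
  obtain C m where Cm: "0 < m" "m < 1"
    "\<forall>\<^sub>F j in sequentially. \<forall>\<theta> p v. O.chain \<theta> p \<longrightarrow> norm (fst (O.J j \<theta> p) *v v) \<le> C * m ^ p * norm v"
    by (rule O.J_small)
  have "\<forall>\<^sub>F j in sequentially. \<forall>w\<in>Ws. \<forall>s\<in>{(\<theta>, p). O.chain \<theta> p \<and> hd w = \<theta> 0}.
     norm (aff_comp (aff_inv (O.J j (fst s) (snd s))) (O.J j (extend (fst s) w) (snd s + (length w - 1))) - Faff K c (fst s) w) < \<eta>"
  proof (rule eventually_ball_finite[OF Ws(1)], rule ballI)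
    fix w assume w: "w \<in> Ws"
    show "\<forall>\<^sub>F j in sequentially. \<forall>s\<in>{(\<theta>, p). O.chain \<theta> p \<and> hd w = \<theta> 0}.
     norm (aff_comp (aff_inv (O.J j (fst s) (snd s))) (O.J j (extend (fst s) w) (snd s + (length w - 1))) - Faff K c (fst s) w) < \<eta>"
    proof (rule eventually_ball_of_choices)
      fix F' and s :: "nat \<Rightarrow> (nat \<Rightarrow> 'a) \<times> nat"
      assume F': "F' \<le> sequentially" and s: "\<forall>\<^sub>F j in F'. s j \<in> {(\<theta>, p). O.chain \<theta> p \<and> hd w = \<theta> 0}"
      have "\<forall>\<^sub>F j in F'. O.chain (fst (s j)) (snd (s j)) \<and> hd w = fst (s j) 0"
        using s by eventually_elim auto
      from O.J_step[OF F' _ _ this] Ws(2)[OF w]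
      have "((\<lambda>j. aff_comp (aff_inv (O.J j (fst (s j)) (snd (s j)))) (O.J j (extend (fst (s j)) w) (snd (s j) + (length w - 1)))
        - Faff K c (fst (s j)) w) \<longlongrightarrow> 0) F'" by blast
      from tendsto_norm_zero[OF this] \<eta>
      show "\<forall>\<^sub>F j in F'. norm (aff_comp (aff_inv (O.J j (fst (s j)) (snd (s j)))) (O.J j (extend (fst (s j)) w) (snd (s j) + (length w - 1)))
        - Faff K c (fst (s j)) w) < \<eta>" by (rule order_tendstoD(2))
    qed
  qed
  moreover have "\<forall>\<^sub>F j in sequentially. norm (O.J j \<theta>0 0 - A) < \<eta>"
    using tendstoD[OF O.J_start \<eta>] by (simp add: dist_norm)
  ultimately have "\<forall>\<^sub>F j in sequentially. jet_system K c \<theta>0 A Ws \<eta> (k j ` cantor_piece (L j) a0) (O.J j)"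
    using O.J_values Cm(3)
  proof eventually_elim
    case (elim j)
    then show ?case
      unfolding jet_system_def O.chain_def[symmetric] using Cm(1,2) by auto
  qed
  then show False using no by (auto simp: eventually_sequentially)
qed

section \<open>The affine group as a topological group\<close>

lemma aff_eqI:
  assumes "\<And>x. aff_app A x = aff_app B x" shows "A = B"
proof -
  have s: "snd A = snd B" using assms[of 0] by (simp add: aff_app_def)
  then have "fst A = fst B"
    using assms by (intro matrix_eq_iff_vec) (simp add: aff_app_def)
  with s show ?thesis by (simp add: prod_eq_iff)
qed

lemma Aff_comp: "A \<in> Aff \<Longrightarrow> B \<in> Aff \<Longrightarrow> aff_comp A B \<in> Aff"
  by (simp add: Aff_def aff_comp_def invertible_mult)

lemma Aff_inv: "A \<in> Aff \<Longrightarrow> aff_inv A \<in> Aff"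
  using matrix_inv_both by (auto simp: Aff_def aff_inv_def invertible_def)

lemma Aff_id: "(mat 1, 0) \<in> Aff"
  by (auto simp: Aff_def invertible_def)

lemma aff_inv_self: "A \<in> Aff \<Longrightarrow> aff_comp (aff_inv A) A = (mat 1, 0)"
  by (rule aff_eqI) (simp add: aff_app_comp aff_app_inv_left, simp add: aff_app_def)

lemma aff_app_inv_comp:
  assumes "A \<in> Aff" "B \<in> Aff"
  shows "aff_app (aff_inv (aff_comp A B)) x = aff_app (aff_inv B) (aff_app (aff_inv A) x)"
proof -
  have "aff_app (aff_comp A B) (aff_app (aff_inv B) (aff_app (aff_inv A) x)) = x"
    using assms by (simp add: aff_app_comp aff_app_inv_right)
  then show ?thesis using aff_app_inv_left[OF Aff_comp[OF assms]] by metis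
qed

lemma aff_inv_inv: "A \<in> Aff \<Longrightarrow> aff_inv (aff_inv A) = A"
  by (rule aff_eqI) (metis Aff_inv aff_app_inv_left)

text \<open>
  The configuration of the new jets \<open>(J1, I1)\<close> arises from that of \<open>(J, I)\<close> by the formula of a
  renormalization operator, with the increments of the jets in place of the maps \<open>F\<close>.
\<close>

lemma aff_telescope:
  assumes "J \<in> Aff" "J1 \<in> Aff" "I \<in> Aff" "I1 \<in> Aff"
  shows "aff_comp (aff_inv (aff_comp (aff_inv J) J1)) (aff_comp (aff_comp (aff_inv J) I) (aff_comp (aff_inv I) I1))
    = aff_comp (aff_inv J1) I1"
  using assms
  by (intro aff_eqI) (simp add: aff_app_comp aff_app_inv_comp aff_app_inv_right aff_inv_inv Aff_inv)

lemma tendsto_matrix_mult: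
  fixes A B :: "'t \<Rightarrow> complex ^ 'd::finite ^ 'd"
  assumes "(A \<longlongrightarrow> a) F" "(B \<longlongrightarrow> b) F" shows "((\<lambda>t. A t ** B t) \<longlongrightarrow> a ** b) F"
  unfolding matrix_matrix_mult_def
  by (intro tendsto_vec_lambda tendsto_sum tendsto_mult tendsto_vec_nth assms)

lemma tendsto_matrix_vector_mult:
  fixes A :: "'t \<Rightarrow> complex ^ 'd::finite ^ 'd"
  assumes "(A \<longlongrightarrow> a) F" "(v \<longlongrightarrow> b) F" shows "((\<lambda>t. A t *v v t) \<longlongrightarrow> a *v b) F"
  unfolding matrix_vector_mult_def
  by (intro tendsto_vec_lambda tendsto_sum tendsto_mult tendsto_vec_nth assms)

lemma norm_blin_of: "norm (blin_of M) \<le> (real CARD('d))^2 * norm (M :: complex ^ 'd::finite ^ 'd)"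
proof (rule norm_blinfun_bound)
  fix v :: "complex ^ 'd"
  have l1: "norm x \<le> (\<Sum>i\<in>UNIV. norm (x $ i))" for x :: "complex ^ 'd"
    by (simp add: norm_vec_def L2_set_le_sum)
  have "norm (M *v v) \<le> (\<Sum>i\<in>UNIV. norm ((M *v v) $ i))" by (rule l1)
  also have "\<dots> \<le> (\<Sum>i\<in>(UNIV::'d set). \<Sum>j\<in>(UNIV::'d set). norm M * norm v)"
  proof (intro sum_mono)
    fix i
    have "norm ((M *v v) $ i) \<le> (\<Sum>j\<in>UNIV. norm (M $ i $ j * v $ j))"
      by (simp add: matrix_vector_mult_def norm_sum)
    also have "\<dots> \<le> (\<Sum>j\<in>(UNIV::'d set). norm M * norm v)"
      unfolding norm_mult
      by (intro sum_mono mult_mono order_trans[OF Finite_Cartesian_Product.norm_nth_le] Finite_Cartesian_Product.norm_nth_le) auto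
    finally show "norm ((M *v v) $ i) \<le> (\<Sum>j\<in>(UNIV::'d set). norm M * norm v)" .
  qed
  finally show "norm (blinfun_apply (blin_of M) v) \<le> (real CARD('d))^2 * norm M * norm v"
    by (simp add: power2_eq_square mult_ac)
qed simp

lemma blin_of_inverse_pair:
  assumes "invertible M" shows "inverse_pair (blin_of M) (blin_of (matrix_inv M))"
  by (auto simp: inverse_pair_def matrix_vector_mul_assoc matrix_inv_both[OF assms] intro!: blinfun_eqI)

lemma tendsto_matrix_inv:
  fixes A :: "'t \<Rightarrow> complex ^ 'd::finite ^ 'd"
  assumes "(A \<longlongrightarrow> a) F" "\<forall>\<^sub>F t in F. invertible (A t)" "invertible a"
  shows "((\<lambda>t. matrix_inv (A t)) \<longlongrightarrow> matrix_inv a) F"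
proof -
  have d: "blin_of M - blin_of N = blin_of (M - N)" for M N :: "complex ^ 'd ^ 'd"
    by (rule blinfun_eqI) (simp add: blinfun.diff_left matrix_vector_mult_diff_rdistrib)
  have "((\<lambda>t. (real CARD('d))^2 * norm (A t - a)) \<longlongrightarrow> (real CARD('d))^2 * 0) F"
    by (intro tendsto_intros tendsto_norm_zero LIM_zero assms(1))
  then have "((\<lambda>t. (real CARD('d))^2 * norm (A t - a)) \<longlongrightarrow> 0) F" by simp
  then have "((\<lambda>t. blin_of (A t) - blin_of a) \<longlongrightarrow> 0) F"
    by (rule Lim_null_comparison[rotated]) (simp add: d norm_blin_of)
  then have lim: "((\<lambda>t. blin_of (A t) - blin_of a) \<longlongrightarrow> 0) F" .
  have "\<forall>\<^sub>F t in F. inverse_pair (blin_of (A t)) (blin_of (matrix_inv (A t)))"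
    using assms(2) by eventually_elim (rule blin_of_inverse_pair)
  then have "((\<lambda>t. blin_of (matrix_inv (A t)) - blin_of (matrix_inv a)) \<longlongrightarrow> 0) F"
    by (rule inverse_pair_tendsto[OF _ always_eventually always_eventually lim])
      (use blin_of_inverse_pair[OF assms(3)] in auto)
  from mat_of_tendsto[OF this] show ?thesis by (simp add: LIM_zero_cancel)
qed

lemma tendsto_aff_comp:
  assumes "(A \<longlongrightarrow> a) F" "(B \<longlongrightarrow> b) F" shows "((\<lambda>t. aff_comp (A t) (B t)) \<longlongrightarrow> aff_comp a b) F"
  unfolding aff_comp_def
  by (intro tendsto_Pair tendsto_add tendsto_matrix_mult tendsto_matrix_vector_mult tendsto_fst tendsto_snd assms)

lemma tendsto_aff_inv:
  assumes "(A \<longlongrightarrow> a) F" "\<forall>\<^sub>F t in F. A t \<in> Aff" "a \<in> Aff"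
  shows "((\<lambda>t. aff_inv (A t)) \<longlongrightarrow> aff_inv a) F"
  unfolding aff_inv_def
  by (intro tendsto_Pair tendsto_minus tendsto_matrix_vector_mult tendsto_matrix_inv tendsto_fst tendsto_snd assms)
    (use assms(2,3) in \<open>auto simp: Aff_def\<close>)

lemma tendsto_aff_app: "(A \<longlongrightarrow> a) F \<Longrightarrow> ((\<lambda>t. aff_app (A t) x) \<longlongrightarrow> aff_app a x) F"
  unfolding aff_app_def by (intro tendsto_add tendsto_matrix_vector_mult tendsto_fst tendsto_snd tendsto_const)

lemma conjugate_continuous:
  assumes "F0 \<in> Aff" "F0' \<in> Aff" "0 < \<rho>"
  shows "\<exists>\<delta>>0. \<forall>F1\<in>Aff. \<forall>B1\<in>Aff. \<forall>F1'\<in>Aff. norm (F1 - F0) < \<delta> \<and> norm (B1 - B0) < \<delta> \<and> norm (F1' - F0') < \<delta> \<longrightarrow>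
    norm (aff_comp (aff_inv F1) (aff_comp B1 F1') - aff_comp (aff_inv F0) (aff_comp B0 F0')) < \<rho>"
proof (rule ccontr)
  assume neg: "\<not> ?thesis"
  have "\<forall>n. \<exists>F1 B1 F1'. F1 \<in> Aff \<and> B1 \<in> Aff \<and> F1' \<in> Aff \<and> norm (F1 - F0) < inverse (real (Suc n)) \<and>
    norm (B1 - B0) < inverse (real (Suc n)) \<and> norm (F1' - F0') < inverse (real (Suc n)) \<and>
    \<not> norm (aff_comp (aff_inv F1) (aff_comp B1 F1') - aff_comp (aff_inv F0) (aff_comp B0 F0')) < \<rho>"
  proof
    fix n :: nat
    have "0 < inverse (real (Suc n))" by simp
    then show "\<exists>F1 B1 F1'. F1 \<in> Aff \<and> B1 \<in> Aff \<and> F1' \<in> Aff \<and> norm (F1 - F0) < inverse (real (Suc n)) \<and>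
      norm (B1 - B0) < inverse (real (Suc n)) \<and> norm (F1' - F0') < inverse (real (Suc n)) \<and>
      \<not> norm (aff_comp (aff_inv F1) (aff_comp B1 F1') - aff_comp (aff_inv F0) (aff_comp B0 F0')) < \<rho>"
      using neg by meson
  qed
  then obtain F1 B1 F1' where s: "\<And>n. F1 n \<in> Aff" "\<And>n. B1 n \<in> Aff" "\<And>n. F1' n \<in> Aff"
    "\<And>n. norm (F1 n - F0) < inverse (real (Suc n))" "\<And>n. norm (B1 n - B0) < inverse (real (Suc n))"
    "\<And>n. norm (F1' n - F0') < inverse (real (Suc n))"
    "\<And>n. \<not> norm (aff_comp (aff_inv (F1 n)) (aff_comp (B1 n) (F1' n)) - aff_comp (aff_inv F0) (aff_comp B0 F0')) < \<rho>"
    by metis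
  have lim: "u \<longlonglongrightarrow> v" if "\<And>n. norm (u n - v) < inverse (real (Suc n))" for u and v :: "'a aff"
    by (rule LIM_zero_cancel, rule Lim_null_comparison[OF _ LIMSEQ_inverse_real_of_nat])
      (use that in \<open>auto intro: always_eventually less_imp_le\<close>)
  have "(\<lambda>n. aff_comp (aff_inv (F1 n)) (aff_comp (B1 n) (F1' n))) \<longlonglongrightarrow> aff_comp (aff_inv F0) (aff_comp B0 F0')"
    by (intro tendsto_aff_comp tendsto_aff_inv lim s assms) (simp add: s)
  from tendstoD[OF this assms(3)] show False using s(7) by (auto simp: dist_norm eventually_sequentially)
qed

lemma aff_app_locally_bounded:
  assumes "B \<in> Aff"
  shows "\<exists>\<delta>>0. \<forall>B1\<in>Aff. norm (B1 - B) < \<delta> \<longrightarrow>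
    norm (aff_app B1 x) < norm (aff_app B x) + 1 \<and> norm (aff_app (aff_inv B1) y) < norm (aff_app (aff_inv B) y) + 1"
proof (rule ccontr)
  assume neg: "\<not> ?thesis"
  have "\<forall>n. \<exists>B1. B1 \<in> Aff \<and> norm (B1 - B) < inverse (real (Suc n)) \<and> \<not> (norm (aff_app B1 x) < norm (aff_app B x) + 1 \<and>
    norm (aff_app (aff_inv B1) y) < norm (aff_app (aff_inv B) y) + 1)"
  proof
    fix n :: nat
    have "0 < inverse (real (Suc n))" by simp
    then show "\<exists>B1. B1 \<in> Aff \<and> norm (B1 - B) < inverse (real (Suc n)) \<and> \<not> (norm (aff_app B1 x) < norm (aff_app B x) + 1 \<and>
      norm (aff_app (aff_inv B1) y) < norm (aff_app (aff_inv B) y) + 1)" using neg by meson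
  qed
  then obtain B1 where s: "\<And>n. B1 n \<in> Aff" "\<And>n. norm (B1 n - B) < inverse (real (Suc n))"
    "\<And>n. \<not> (norm (aff_app (B1 n) x) < norm (aff_app B x) + 1 \<and>
    norm (aff_app (aff_inv (B1 n)) y) < norm (aff_app (aff_inv B) y) + 1)" by metis
  have lim: "B1 \<longlonglongrightarrow> B"
    by (rule LIM_zero_cancel, rule Lim_null_comparison[OF _ LIMSEQ_inverse_real_of_nat])
      (use s in \<open>auto intro: always_eventually less_imp_le\<close>)
  have l1: "(\<lambda>n. norm (aff_app (B1 n) x)) \<longlonglongrightarrow> norm (aff_app B x)"
    by (intro tendsto_norm tendsto_aff_app lim)
  have l2: "(\<lambda>n. norm (aff_app (aff_inv (B1 n)) y)) \<longlonglongrightarrow> norm (aff_app (aff_inv B) y)"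
    by (intro tendsto_norm tendsto_aff_app tendsto_aff_inv lim assms) (simp add: s)
  have "\<forall>\<^sub>F n in sequentially. norm (aff_app (B1 n) x) < norm (aff_app B x) + 1 \<and>
     norm (aff_app (aff_inv (B1 n)) y) < norm (aff_app (aff_inv B) y) + 1"
    by (intro eventually_conj order_tendstoD(2)[OF l1] order_tendstoD(2)[OF l2]) auto
  then show False using s(3) by (auto simp: eventually_sequentially)
qed

section \<open>Relatively compact covers are robust\<close>

lemma topspace_SigmaM: "topspace (SigmaM_top K) = {\<theta>. left_seq (adm K) \<theta>}"
  by (simp add: SigmaM_top_def left_seq_def)

definition cyl :: "('a \<times> 'a) set \<Rightarrow> nat \<Rightarrow> (nat \<Rightarrow> 'a) \<Rightarrow> (nat \<Rightarrow> 'a) set" where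
  "cyl R m \<theta> = {\<theta>'. left_seq R \<theta>' \<and> (\<forall>i\<le>m. \<theta>' i = \<theta> i)}"

lemma openin_cyl: "openin (SigmaM_top K) (cyl (adm K) m \<theta>)"
proof -
  let ?X = "\<lambda>i. if i \<le> m then {\<theta> i} else UNIV"
  have "openin (product_topology (\<lambda>_::nat. discrete_topology (UNIV :: 'a set)) UNIV) (PiE UNIV ?X)"
  proof (rule product_topology_basis)
    have "{i. ?X i \<noteq> topspace (discrete_topology UNIV)} \<subseteq> {..m}" by auto
    then show "finite {i. ?X i \<noteq> topspace (discrete_topology UNIV)}" using finite_subset by blast
  qed auto
  moreover have "PiE UNIV ?X = {\<theta>'. \<forall>i\<le>m. \<theta>' i = \<theta> i}" by (auto simp: PiE_def Pi_def split: if_splits)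
  ultimately have "openin (SigmaM_top K) ({\<theta>'. \<forall>i\<le>m. \<theta>' i = \<theta> i} \<inter> {\<theta>. \<forall>i. (\<theta> (Suc i), \<theta> i) \<in> adm K})"
    unfolding SigmaM_top_def openin_subtopology by auto
  moreover have "{\<theta>'. \<forall>i\<le>m. \<theta>' i = \<theta> i} \<inter> {\<theta>. \<forall>i. (\<theta> (Suc i), \<theta> i) \<in> adm K} = cyl (adm K) m \<theta>"
    by (auto simp: cyl_def left_seq_def)
  ultimately show ?thesis by simp
qed

text \<open>A basic open set of the product topology restricts finitely many letters, hence only letters up to some \<open>m\<close>.\<close>

lemma SigmaM_cyl:
  assumes "openin (SigmaM_top K) V" "\<theta> \<in> V"
  shows "\<exists>m. cyl (adm K) m \<theta> \<subseteq> V"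
proof -
  obtain T where T: "openin (product_topology (\<lambda>_::nat. discrete_topology (UNIV :: 'a set)) UNIV) T"
    "V = T \<inter> {\<theta>. \<forall>i. (\<theta> (Suc i), \<theta> i) \<in> adm K}"
    using assms(1) unfolding SigmaM_top_def openin_subtopology by blast
  obtain X where X: "\<theta> \<in> PiE UNIV X" "finite {i. X i \<noteq> topspace (discrete_topology (UNIV :: 'a set))}" "PiE UNIV X \<subseteq> T"
    using product_topology_open_contains_basis[OF T(1), of \<theta>] assms(2) T(2) by auto
  define m where "m = Max (insert 0 {i. X i \<noteq> UNIV})"
  have "finite {i. X i \<noteq> UNIV}" using X(2) by simp
  then have m: "i \<le> m" if "X i \<noteq> UNIV" for i unfolding m_def using that by (intro Max_ge) auto
  have "cyl (adm K) m \<theta> \<subseteq> V"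
  proof
    fix \<tau> assume \<tau>: "\<tau> \<in> cyl (adm K) m \<theta>"
    have "\<tau> i \<in> X i" for i
      using m[of i] \<tau> X(1) by (cases "X i = UNIV") (auto simp: cyl_def PiE_def Pi_def)
    then have "\<tau> \<in> T" using X(3) by (auto simp: PiE_def)
    then show "\<tau> \<in> V" using \<tau> T(2) by (auto simp: cyl_def left_seq_def)
  qed
  then show ?thesis ..
qed

lemma topspace_QAff:
  "topspace (QAff_top K K') = {(B, \<theta>, \<theta>'). B \<in> Aff \<and> left_seq (adm K) \<theta> \<and> left_seq (adm K') \<theta>'}"
  by (auto simp: QAff_top_def topspace_SigmaM)

definition conf_box :: "('a::finite, 'd::finite) cantor \<Rightarrow> ('b::finite, 'd) cantor \<Rightarrow> real \<Rightarrow> nat \<Rightarrow>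
    ('a, 'b, 'd) affconf \<Rightarrow> ('a, 'b, 'd) affconf set" where
  "conf_box K K' \<rho> m = (\<lambda>(B, \<theta>, \<theta>'). {B1 \<in> Aff. norm (B1 - B) < \<rho>} \<times> cyl (adm K) m \<theta> \<times> cyl (adm K') m \<theta>')"

lemma openin_conf_box: "openin (QAff_top K K') (conf_box K K' \<rho> m x)"
proof -
  obtain B \<theta> \<theta>' where x: "x = (B, \<theta>, \<theta>')" by (cases x) auto
  have "{B1 \<in> Aff. norm (B1 - B) < \<rho>} = Aff \<inter> ball B \<rho>"
    by (auto simp: dist_norm norm_minus_commute)
  then have "openin (subtopology euclidean Aff) {B1 \<in> Aff. norm (B1 - B) < \<rho>}"
    by (metis openin_open open_ball)
  then show ?thesis
    by (simp add: x conf_box_def QAff_top_def openin_prod_Times_iff openin_cyl)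
qed

lemma conf_box_self: "0 < \<rho> \<Longrightarrow> x \<in> topspace (QAff_top K K') \<Longrightarrow> x \<in> conf_box K K' \<rho> m x"
  by (cases x) (auto simp: conf_box_def topspace_QAff cyl_def)

lemma open_contains_conf_box:
  assumes "openin (QAff_top K K') U" "x \<in> U"
  obtains \<rho> m where "0 < \<rho>" "conf_box K K' \<rho> m x \<subseteq> U"
proof -
  obtain B \<theta> \<theta>' where x: "x = (B, \<theta>, \<theta>')" by (cases x) auto
  obtain V1 V2 where V: "openin (subtopology euclidean Aff) V1" "openin (prod_topology (SigmaM_top K) (SigmaM_top K')) V2"
    "B \<in> V1" "(\<theta>, \<theta>') \<in> V2" "V1 \<times> V2 \<subseteq> U"
    using assms(1)[unfolded QAff_top_def openin_prod_topology_alt[of "subtopology euclidean Aff"],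
        rule_format, of B "(\<theta>, \<theta>')"] assms(2) x by auto
  obtain V3 V4 where V': "openin (SigmaM_top K) V3" "openin (SigmaM_top K') V4" "\<theta> \<in> V3" "\<theta>' \<in> V4" "V3 \<times> V4 \<subseteq> V2"
    using V(2)[unfolded openin_prod_topology_alt, rule_format, OF V(4)] by auto
  obtain m3 m4 where m: "cyl (adm K) m3 \<theta> \<subseteq> V3" "cyl (adm K') m4 \<theta>' \<subseteq> V4"
    using SigmaM_cyl[OF V'(1,3)] SigmaM_cyl[OF V'(2,4)] by blast
  obtain \<rho> where \<rho>: "0 < \<rho>" "\<And>B1. B1 \<in> Aff \<Longrightarrow> dist B1 B < \<rho> \<Longrightarrow> B1 \<in> V1"
    using V(1,3) unfolding openin_euclidean_subtopology_iff by meson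
  have cyl: "cyl (adm K) (max m3 m4) \<theta> \<subseteq> V3" "cyl (adm K') (max m3 m4) \<theta>' \<subseteq> V4"
    using m by (auto simp: cyl_def)
  have "conf_box K K' \<rho> (max m3 m4) x \<subseteq> U"
  proof
    fix y assume y: "y \<in> conf_box K K' \<rho> (max m3 m4) x"
    obtain B1 \<tau> \<tau>' where y': "y = (B1, \<tau>, \<tau>')" by (cases y) auto
    have "B1 \<in> V1" using y \<rho>(2) by (simp add: y' x conf_box_def dist_norm)
    moreover have "(\<tau>, \<tau>') \<in> V2" using y cyl V'(5) by (auto simp: y' x conf_box_def)
    ultimately show "y \<in> U" using V(5) y' by blast
  qed
  with \<rho>(1) show thesis by (rule that)
qed

context limit_geometries begin

lemma Faff_Aff:
  assumes "left_seq (adm K) \<theta>" "w \<noteq> [] \<longrightarrow> admissible_word K w \<and> hd w = \<theta> 0"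
  shows "Faff K c \<theta> w \<in> Aff"
proof (cases "w = []")
  case True
  then show ?thesis by (simp add: Faff_def Aff_id)
next
  case False
  then have "left_seq (adm K) (extend \<theta> w)"
    using assms by (intro extend_left_seq) (auto simp: admissible_word_def)
  then show ?thesis using Faff_eq[of \<theta> w] assms False by (simp add: aff_of_Aff Flin_GLC)
qed

text \<open>
  The normalised branches of length \<open>m\<close> only see \<open>m\<close> letters and are \<open>C \<kappa>\<^sup>m\<close>-close to their
  limits; so are the maps \<open>F\<close> computed from these limits.
\<close>

lemma Faff_continuous:
  assumes w: "w \<noteq> [] \<longrightarrow> admissible_word K w" and \<eta>: "0 < \<eta>"
  shows "\<exists>m. \<forall>\<theta> \<tau>. left_seq (adm K) \<theta> \<and> (w \<noteq> [] \<longrightarrow> hd w = \<theta> 0) \<and> \<tau> \<in> cyl (adm K) m \<theta> \<longrightarrow>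
    norm (Faff K c \<tau> w - Faff K c \<theta> w) < \<eta>"
proof (cases "w = []")
  case True
  then show ?thesis using \<eta> by (simp add: Faff_def)
next
  case False
  show ?thesis
  proof (rule ccontr)
    assume "\<not> ?thesis"
    then have "\<forall>m. \<exists>\<theta> \<tau>. left_seq (adm K) \<theta> \<and> hd w = \<theta> 0 \<and> \<tau> \<in> cyl (adm K) m \<theta> \<and>
        \<not> norm (Faff K c \<tau> w - Faff K c \<theta> w) < \<eta>" using False by blast
    then obtain \<theta> \<tau> where s: "\<And>m. left_seq (adm K) (\<theta> m)" "\<And>m. hd w = \<theta> m 0" "\<And>m. \<tau> m \<in> cyl (adm K) m (\<theta> m)"
      "\<And>m. \<not> norm (Faff K c (\<tau> m) w - Faff K c (\<theta> m) w) < \<eta>" by metis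
    define q where "q = length w - 1"
    define \<theta>' where "\<theta>' m = extend (\<theta> m) w" for m
    define \<tau>' where "\<tau>' m = extend (\<tau> m) w" for m
    have \<tau>: "left_seq (adm K) (\<tau> m)" "\<And>i. i \<le> m \<Longrightarrow> \<tau> m i = \<theta> m i" for m
      using s(3)[of m] by (auto simp: cyl_def)
    have \<tau>0: "hd w = \<tau> m 0" for m using s(2)[of m] \<tau>(2)[of 0 m] by simp
    have w': "admissible_word K w" using w False by simp
    have ls: "left_seq (adm K) (\<theta>' m)" "left_seq (adm K) (\<tau>' m)" for m
      unfolding \<theta>'_def \<tau>'_def
      using w' False s(1,2) \<tau>(1) \<tau>0 by (auto intro!: extend_left_seq simp: admissible_word_def)
    have sh: "shift q (\<theta>' m) = \<theta> m" "shift q (\<tau>' m) = \<tau> m" for m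
    proof -
      show "shift q (\<theta>' m) = \<theta> m" unfolding \<theta>'_def q_def by (rule extend_shift[OF False]) (rule s(2))
      show "shift q (\<tau>' m) = \<tau> m" unfolding \<tau>'_def q_def by (rule extend_shift[OF False]) (rule \<tau>0)
    qed
    have eq: "\<tau>' m i = \<theta>' m i" if "i \<le> q" for m i
      unfolding \<theta>'_def \<tau>'_def using that \<tau>(2)[of _ m] by (intro extend_cong[of m]) (auto simp: q_def)
    have l0: "\<theta>' m 0 = last w" "\<tau>' m 0 = last w" for m
      using extend_0[OF False] by (simp_all add: \<theta>'_def \<tau>'_def)
    let ?c = "c (last w)"
    define x where "x m = branch f (\<theta>' m) q ?c" for m
    define d where "d m = dbranch f (\<theta>' m) q ?c" for m
    have x\<tau>: "branch f (\<tau>' m) q ?c = x m" "dbranch f (\<tau>' m) q ?c = d m" for m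
      using branch_cong[of q "\<tau>' m" "\<theta>' m" f] eq by (simp_all add: x_def d_def)
    have F: "Faff K c (\<theta> m) w = aff_of (B.E_lim (\<theta> m) (x m) o\<^sub>L d m) ?c (k (\<theta> m) (x m))"
      "Faff K c (\<tau> m) w = aff_of (B.E_lim (\<tau> m) (x m) o\<^sub>L d m) ?c (k (\<tau> m) (x m))" for m
      using Faff_eq[of "\<theta> m" w, folded \<theta>'_def q_def] Faff_eq[of "\<tau> m" w, folded \<tau>'_def q_def]
        s(1,2) \<tau>(1) \<tau>0 w' False sh x\<tau>
      by (simp_all add: Flin_def l0 x_def d_def)
    have xG: "x m \<in> Gstar K (\<theta> m 0)" "x m \<in> Gstar K (\<tau> m 0)" for m
    proof -
      have "x m \<in> Gstar K (\<theta>' m q)"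
        unfolding x_def by (rule B.branch_in[OF ls(1)]) (use l0 c_Gstar in simp)
      moreover have "\<theta>' m q = \<theta> m 0" "\<theta> m 0 = \<tau> m 0"
        using sh(1)[of m] \<tau>(2)[of 0 m] by (metis shift_0(2), simp)
      ultimately show "x m \<in> Gstar K (\<theta> m 0)" "x m \<in> Gstar K (\<tau> m 0)" by simp_all
    qed
    have E: "B.E (\<tau> m) m (x m) = B.E (\<theta> m) m (x m)"
      "approx_geometry K c (\<tau> m) m (x m) = approx_geometry K c (\<theta> m) m (x m)" for m
      using branch_cong(1,2)[of m "\<tau> m" "\<theta> m" f] branch_cong(3)[of m "\<tau> m" "\<theta> m" f g] \<tau>(2)[of _ m]
      by (simp_all add: B.E_def approx_geometry_eq[OF s(1)] approx_geometry_eq[OF \<tau>(1)])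
    have z: "(\<lambda>m. C * \<kappa> ^ m + C * \<kappa> ^ m) \<longlonglongrightarrow> 0" for C
    proof -
      have "(\<lambda>m. C * \<kappa> ^ m + C * \<kappa> ^ m) \<longlonglongrightarrow> C * 0 + C * 0"
        using B.\<kappa> by (intro tendsto_intros LIMSEQ_realpow_zero) auto
      then show ?thesis by simp
    qed
    have 1: "(\<lambda>m. B.E_lim (\<tau> m) (x m) - B.E_lim (\<theta> m) (x m)) \<longlonglongrightarrow> 0"
    proof (rule Lim_null_comparison[OF always_eventually z], rule allI)
      fix m
      show "norm (B.E_lim (\<tau> m) (x m) - B.E_lim (\<theta> m) (x m)) \<le> B.tail_const * \<kappa> ^ m + B.tail_const * \<kappa> ^ m"
        using dist_triangle2[of "B.E_lim (\<tau> m) (x m)" "B.E_lim (\<theta> m) (x m)" "B.E (\<theta> m) m (x m)"]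
          B.E_lim(2)[OF \<tau>(1) xG(2), of m m] B.E_lim(2)[OF s(1) xG(1), of m m]
        unfolding dist_norm E(1) by linarith
    qed
    have 2: "(\<lambda>m. k (\<tau> m) (x m) - k (\<theta> m) (x m)) \<longlonglongrightarrow> 0"
    proof (rule Lim_null_comparison[OF always_eventually z], rule allI)
      fix m
      show "norm (k (\<tau> m) (x m) - k (\<theta> m) (x m)) \<le> M * B.tail_const * \<kappa> ^ m + M * B.tail_const * \<kappa> ^ m"
        using dist_triangle2[of "k (\<tau> m) (x m)" "k (\<theta> m) (x m)" "approx_geometry K c (\<theta> m) m (x m)"]
          limit_geometry_tail(2)[OF \<tau>(1) xG(2), of m m] limit_geometry_tail(2)[OF s(1) xG(1), of m m]
        unfolding dist_norm E(2) by linarith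
    qed
    have bE: "norm (B.E_lim (\<theta> m) (x m)) \<le> B.dist_const" for m
      by (rule tendsto_upperbound[OF tendsto_norm[OF B.E_lim(1)[OF s(1) xG(1)]]])
        (auto intro!: always_eventually B.E_bounds s xG)
    have bd: "norm (d m) \<le> \<mu> ^ q" for m
      unfolding d_def by (rule B.norm_dbranch[OF ls(1)]) (use l0 c_Gstar in simp)
    have "(\<lambda>m. (B.E_lim (\<tau> m) (x m) o\<^sub>L d m) - (B.E_lim (\<theta> m) (x m) o\<^sub>L d m)) \<longlonglongrightarrow> 0"
      by (rule tendsto_compose_diff[OF 1 _ always_eventually always_eventually]) (use bE bd in auto)
    then have "(\<lambda>m. Faff K c (\<tau> m) w - Faff K c (\<theta> m) w) \<longlonglongrightarrow> 0"
      unfolding F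
      by (rule aff_of_tendsto[OF _ 2, of _ _ _ "norm ?c" "B.dist_const * \<mu> ^ q"])
        (auto intro!: always_eventually norm_compose_le bE bd)
    from order_tendstoD(2)[OF tendsto_norm_zero[OF this] \<eta>] s(4)
    show False by (auto simp: eventually_sequentially)
  qed
qed

end

text \<open>
  The operator given by \<open>w\<close> and \<open>w'\<close> may be applied to the configuration with maps \<open>F1\<close>, \<open>F1'\<close> merely \<open>\<eta>\<close>-close
  to the prescribed ones, and still leads into \<open>U\<close>.  The radius \<open>r\<close> records the boundedness of \<open>U\<close>, in
  the form in which distances are estimated at the end of the argument.
\<close>

definition robust_step :: "('a::finite, 'd::finite) cantor \<Rightarrow> ('a \<Rightarrow> complex ^ 'd) \<Rightarrow>
    ('b::finite, 'd) cantor \<Rightarrow> ('b \<Rightarrow> complex ^ 'd) \<Rightarrow> ('a, 'b, 'd) affconf set \<Rightarrow>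
    real \<Rightarrow> real \<Rightarrow> 'a list \<Rightarrow> 'b list \<Rightarrow> ('a, 'b, 'd) affconf \<Rightarrow> bool" where
  "robust_step K c K' c' U \<eta> r w w' = (\<lambda>(B, \<theta>, \<theta>').
     (w \<noteq> [] \<longrightarrow> hd w = \<theta> 0) \<and> (w' \<noteq> [] \<longrightarrow> hd w' = \<theta>' 0) \<and>
     norm (aff_app B (c' (\<theta>' 0))) \<le> r \<and> norm (aff_app (aff_inv B) (c (\<theta> 0))) \<le> r \<and>
     (\<forall>F1\<in>Aff. \<forall>F1'\<in>Aff. norm (F1 - Faff K c \<theta> w) < \<eta> \<and> norm (F1' - Faff K' c' \<theta>' w') < \<eta> \<longrightarrow>
       (aff_comp (aff_inv F1) (aff_comp B F1'), extend \<theta> w, extend \<theta>' w') \<in> U))"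

lemma robust_step_mono:
  "robust_step K c K' c' U \<eta> r w w' x \<Longrightarrow> \<eta>' \<le> \<eta> \<Longrightarrow> r \<le> r' \<Longrightarrow> robust_step K c K' c' U \<eta>' r' w w' x"
  unfolding robust_step_def by (cases x) force

lemma extend_cyl:
  assumes "\<tau> \<in> cyl (adm K) m \<theta>" "w \<noteq> [] \<longrightarrow> admissible_word K w \<and> hd w = \<theta> 0"
  shows "extend \<tau> w \<in> cyl (adm K) m (extend \<theta> w)"
proof -
  have \<tau>: "left_seq (adm K) \<tau>" "\<And>i. i \<le> m \<Longrightarrow> \<tau> i = \<theta> i" using assms(1) by (auto simp: cyl_def)
  have "left_seq (adm K) (extend \<tau> w)"
  proof (cases "w = []")
    case True
    then have "extend \<tau> w = \<tau>" by (auto simp: extend_def)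
    then show ?thesis using \<tau> by simp
  next
    case False
    then show ?thesis using assms(2) \<tau>(1) \<tau>(2)[of 0]
      by (intro extend_left_seq) (auto simp: admissible_word_def)
  qed
  then show ?thesis using extend_cong[of m \<tau> \<theta> _ w] \<tau>(2) by (simp add: cyl_def)
qed

text \<open>
  The formula of an operator is continuous in \<open>B\<close> and in both maps \<open>F\<close>, and these vary continuously with
  the sequences; as \<open>U\<close> is open, some tolerance is left for all configurations near \<open>x\<close>.
\<close>

lemma local_robust_step:
  assumes lg: "limit_geometries \<alpha> K c \<Gamma> H M Q \<kappa>" and lg': "limit_geometries \<alpha> K' c' \<Gamma>' H' M' Q' \<kappa>'"
    and U: "openin (QAff_top K K') U" and w: "w \<in> renorm_words K" "w' \<in> renorm_words K'"
    and x: "x \<in> renorm_dom K K' w w'" "renorm K c K' c' w w' x \<in> U"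
  shows "\<exists>\<rho> m \<eta> r. 0 < \<rho> \<and> 0 < \<eta> \<and> (\<forall>y\<in>conf_box K K' \<rho> m x. robust_step K c K' c' U \<eta> r w w' y)"
proof -
  interpret A: limit_geometries \<alpha> K c \<Gamma> H M Q \<kappa> by (rule lg)
  interpret A': limit_geometries \<alpha> K' c' \<Gamma>' H' M' Q' \<kappa>' by (rule lg')
  obtain B \<theta> \<theta>' where xe: "x = (B, \<theta>, \<theta>')" by (cases x) auto
  have hd: "w \<noteq> [] \<longrightarrow> admissible_word K w \<and> hd w = \<theta> 0" "w' \<noteq> [] \<longrightarrow> admissible_word K' w' \<and> hd w' = \<theta>' 0"
    using w x(1) by (auto simp: renorm_words_def renorm_dom_def xe)
  have top: "B \<in> Aff" "left_seq (adm K) \<theta>" "left_seq (adm K') \<theta>'"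
    using x(1) by (auto simp: renorm_dom_def xe topspace_QAff)
  let ?F = "Faff K c \<theta> w" and ?F' = "Faff K' c' \<theta>' w'"
  have F: "?F \<in> Aff" "?F' \<in> Aff" using A.Faff_Aff[OF top(2) hd(1)] A'.Faff_Aff[OF top(3) hd(2)] by auto
  obtain \<rho>1 m1 where 1: "0 < \<rho>1" "conf_box K K' \<rho>1 m1 (renorm K c K' c' w w' x) \<subseteq> U"
    by (rule open_contains_conf_box[OF U x(2)])
  obtain \<delta> where \<delta>: "0 < \<delta>" "\<And>F1 B1 F1'. F1 \<in> Aff \<Longrightarrow> B1 \<in> Aff \<Longrightarrow> F1' \<in> Aff \<Longrightarrow> norm (F1 - ?F) < \<delta> \<Longrightarrow>
      norm (B1 - B) < \<delta> \<Longrightarrow> norm (F1' - ?F') < \<delta> \<Longrightarrow>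
      norm (aff_comp (aff_inv F1) (aff_comp B1 F1') - aff_comp (aff_inv ?F) (aff_comp B ?F')) < \<rho>1"
    using conjugate_continuous[OF F 1(1), of B] by blast
  obtain \<delta>2 where \<delta>2: "0 < \<delta>2" "\<And>B1. B1 \<in> Aff \<Longrightarrow> norm (B1 - B) < \<delta>2 \<Longrightarrow>
      norm (aff_app B1 (c' (\<theta>' 0))) < norm (aff_app B (c' (\<theta>' 0))) + 1 \<and>
      norm (aff_app (aff_inv B1) (c (\<theta> 0))) < norm (aff_app (aff_inv B) (c (\<theta> 0))) + 1"
    using aff_app_locally_bounded[OF top(1)] by blast
  obtain n1 where n1: "\<And>\<tau>. \<tau> \<in> cyl (adm K) n1 \<theta> \<Longrightarrow> norm (Faff K c \<tau> w - ?F) < \<delta> / 2"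
    using A.Faff_continuous[of w "\<delta> / 2"] hd(1) \<delta>(1) top(2) by auto
  obtain n2 where n2: "\<And>\<tau>. \<tau> \<in> cyl (adm K') n2 \<theta>' \<Longrightarrow> norm (Faff K' c' \<tau> w' - ?F') < \<delta> / 2"
    using A'.Faff_continuous[of w' "\<delta> / 2"] hd(2) \<delta>(1) top(3) by auto
  define m where "m = max m1 (max n1 n2)"
  define r where "r = max (norm (aff_app B (c' (\<theta>' 0)))) (norm (aff_app (aff_inv B) (c (\<theta> 0)))) + 1"
  have "robust_step K c K' c' U (\<delta> / 2) r w w' y" if y: "y \<in> conf_box K K' (min \<delta> \<delta>2) m x" for y
  proof -
    obtain B1 \<tau> \<tau>' where ye: "y = (B1, \<tau>, \<tau>')" by (cases y) auto
    have B1: "B1 \<in> Aff" "norm (B1 - B) < \<delta>" "norm (B1 - B) < \<delta>2"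
      and c: "\<tau> \<in> cyl (adm K) m \<theta>" "\<tau>' \<in> cyl (adm K') m \<theta>'"
      using y by (auto simp: ye xe conf_box_def)
    have cm: "\<tau> \<in> cyl (adm K) n1 \<theta>" "\<tau> \<in> cyl (adm K) m1 \<theta>" "\<tau>' \<in> cyl (adm K') n2 \<theta>'" "\<tau>' \<in> cyl (adm K') m1 \<theta>'"
      using c by (auto simp: cyl_def m_def)
    have 0: "\<tau> 0 = \<theta> 0" "\<tau>' 0 = \<theta>' 0" using c by (auto simp: cyl_def)
    show ?thesis
      unfolding robust_step_def ye prod.case 0
    proof (intro conjI ballI impI)
      show "w \<noteq> [] \<Longrightarrow> hd w = \<theta> 0" "w' \<noteq> [] \<Longrightarrow> hd w' = \<theta>' 0" using hd by auto
      show "norm (aff_app B1 (c' (\<theta>' 0))) \<le> r" "norm (aff_app (aff_inv B1) (c (\<theta> 0))) \<le> r"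
        using \<delta>2(2)[OF B1(1,3)] by (auto simp: r_def)
      fix F1 F1' assume F1: "F1 \<in> Aff" "F1' \<in> Aff"
        "norm (F1 - Faff K c \<tau> w) < \<delta> / 2 \<and> norm (F1' - Faff K' c' \<tau>' w') < \<delta> / 2"
      have "norm (F1 - ?F) < \<delta>" "norm (F1' - ?F') < \<delta>"
        using F1(3) n1[OF cm(1)] n2[OF cm(3)] norm_triangle_ineq[of "F1 - Faff K c \<tau> w" "Faff K c \<tau> w - ?F"]
          norm_triangle_ineq[of "F1' - Faff K' c' \<tau>' w'" "Faff K' c' \<tau>' w' - ?F'"] by auto
      then have "norm (aff_comp (aff_inv F1) (aff_comp B1 F1') - aff_comp (aff_inv ?F) (aff_comp B ?F')) < \<rho>1"
        using \<delta>(2)[OF F1(1) B1(1) F1(2)] B1(2) by blast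
      moreover have "aff_comp (aff_inv F1) (aff_comp B1 F1') \<in> Aff"
        using F1 B1 by (intro Aff_comp Aff_inv)
      ultimately have "(aff_comp (aff_inv F1) (aff_comp B1 F1'), extend \<tau> w, extend \<tau>' w') \<in> conf_box K K' \<rho>1 m1 (renorm K c K' c' w w' x)"
        using extend_cyl[OF cm(2) hd(1)] extend_cyl[OF cm(4) hd(2)] by (simp add: conf_box_def renorm_def xe)
      then show "(aff_comp (aff_inv F1) (aff_comp B1 F1'), extend \<tau> w, extend \<tau>' w') \<in> U" using 1(2) by blast
    qed
  qed
  then show ?thesis using \<delta>(1) \<delta>2(1) by (intro exI[of _ "min \<delta> \<delta>2"] exI[of _ m] exI[of _ "\<delta> / 2"] exI[of _ r]) auto
qed

text \<open>Finitely many of the neighbourhoods from \<open>local_robust_step\<close> cover the compact closure of \<open>U\<close>.\<close>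

lemma uniform_robust_steps:
  assumes lg: "limit_geometries \<alpha> K c \<Gamma> H M Q \<kappa>" and lg': "limit_geometries \<alpha> K' c' \<Gamma>' H' M' Q' \<kappa>'"
    and U: "openin (QAff_top K K') U" and comp: "compactin (QAff_top K K') (QAff_top K K' closure_of U)"
    and cov: "QAff_top K K' closure_of U \<subseteq> (\<Union>\<Psi>\<in>renorm_ops K c K' c'. partial_preimage \<Psi> U)"
  obtains Ws Ws' \<eta> r where "finite Ws" "Ws \<subseteq> renorm_words K" "finite Ws'" "Ws' \<subseteq> renorm_words K'" "0 < \<eta>"
    "\<And>x. x \<in> U \<Longrightarrow> \<exists>w\<in>Ws. \<exists>w'\<in>Ws'. \<not> (w = [] \<and> w' = []) \<and> robust_step K c K' c' U \<eta> r w w' x"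
proof -
  let ?cl = "QAff_top K K' closure_of U"
  have "\<forall>x\<in>?cl. \<exists>w w' \<rho> m \<eta> r. w \<in> renorm_words K \<and> w' \<in> renorm_words K' \<and> \<not> (w = [] \<and> w' = []) \<and>
     0 < \<rho> \<and> 0 < \<eta> \<and> (\<forall>y\<in>conf_box K K' \<rho> m x. robust_step K c K' c' U \<eta> r w w' y)"
  proof
    fix x assume "x \<in> ?cl"
    then obtain \<Psi> where "\<Psi> \<in> renorm_ops K c K' c'" "x \<in> partial_preimage \<Psi> U" using cov by blast
    then obtain w w' where w: "w \<in> renorm_words K" "w' \<in> renorm_words K'" "\<not> (w = [] \<and> w' = [])"
      "x \<in> renorm_dom K K' w w'" "renorm K c K' c' w w' x \<in> U"
      by (auto simp: renorm_ops_def partial_preimage_def)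
    show "\<exists>w w' \<rho> m \<eta> r. w \<in> renorm_words K \<and> w' \<in> renorm_words K' \<and> \<not> (w = [] \<and> w' = []) \<and>
     0 < \<rho> \<and> 0 < \<eta> \<and> (\<forall>y\<in>conf_box K K' \<rho> m x. robust_step K c K' c' U \<eta> r w w' y)"
      using local_robust_step[OF lg lg' U w(1,2,4,5)] w(1-3) by blast
  qed
  then obtain W W' \<rho> m \<eta> r where P: "\<And>x. x \<in> ?cl \<Longrightarrow> W x \<in> renorm_words K \<and> W' x \<in> renorm_words K' \<and>
     \<not> (W x = [] \<and> W' x = []) \<and> 0 < \<rho> x \<and> 0 < \<eta> x \<and>
     (\<forall>y\<in>conf_box K K' (\<rho> x) (m x) x. robust_step K c K' c' U (\<eta> x) (r x) (W x) (W' x) y)"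
    by metis
  let ?b = "\<lambda>x. conf_box K K' (\<rho> x) (m x) x"
  have cover: "?cl \<subseteq> \<Union> (?b ` ?cl)"
  proof
    fix x assume x: "x \<in> ?cl"
    then have "x \<in> topspace (QAff_top K K')" by (rule subsetD[OF closure_of_subset_topspace])
    then have "x \<in> ?b x" using P[OF x] by (intro conf_box_self) simp
    then show "x \<in> \<Union> (?b ` ?cl)" using x by (rule UN_I[rotated])
  qed
  have "\<exists>\<F>. finite \<F> \<and> \<F> \<subseteq> ?b ` ?cl \<and> ?cl \<subseteq> \<Union>\<F>"
    by (rule compactinD[OF comp _ cover]) (auto intro: openin_conf_box)
  then obtain \<F> where \<F>: "finite \<F>" "\<F> \<subseteq> ?b ` ?cl" "?cl \<subseteq> \<Union>\<F>"
    by (elim exE conjE)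
  obtain C where C: "C \<subseteq> ?cl" "finite C" "\<F> = ?b ` C"
    using finite_subset_image[OF \<F>(1,2)] by (elim exE conjE)
  define \<eta>0 where "\<eta>0 = Min (insert 1 (\<eta> ` C))"
  define r0 where "r0 = Max (insert 0 (r ` C))"
  show thesis
  proof (rule that[of "W ` C" "W' ` C" \<eta>0 r0])
    show "finite (W ` C)" "finite (W' ` C)" using C by auto
    show "W ` C \<subseteq> renorm_words K" "W' ` C \<subseteq> renorm_words K'" using C(1) P by auto
    show "0 < \<eta>0" using C P unfolding \<eta>0_def by (subst Min_gr_iff) auto
    fix x assume "x \<in> U"
    then have "x \<in> ?cl" using closure_of_subset[OF openin_subset[OF U]] by blast
    then obtain z where z: "z \<in> C" "x \<in> ?b z" using \<F>(3) C(3) by auto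
    have "robust_step K c K' c' U (\<eta> z) (r z) (W z) (W' z) x" using P[of z] z C(1) by blast
    moreover have "\<eta>0 \<le> \<eta> z" "r z \<le> r0" using z C(2) by (auto simp: \<eta>0_def r0_def)
    ultimately have "robust_step K c K' c' U \<eta>0 r0 (W z) (W' z) x" by (rule robust_step_mono)
    then show "\<exists>w\<in>W ` C. \<exists>w'\<in>W' ` C. \<not> (w = [] \<and> w' = []) \<and> robust_step K c K' c' U \<eta>0 r0 w w' x"
      using z(1) P[of z] C(1) by blast
  qed
qed

section \<open>The renormalization argument\<close>

text \<open>
  Increments of jets are admissible replacements for the maps \<open>F\<close>.  For the void word, not
  covered by a jet system, both are the identity.
\<close>

lemma jet_system_step:
  assumes J: "jet_system K c \<theta>0 A (Ws - {[]}) \<eta> S J" and Ws: "Ws \<subseteq> renorm_words K" and \<eta>: "0 < \<eta>"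
    and ch: "left_seq (adm K) \<theta>" "shift p \<theta> = \<theta>0" and w: "w \<in> Ws" "w \<noteq> [] \<longrightarrow> hd w = \<theta> 0"
  shows "left_seq (adm K) (extend \<theta> w)" "shift (p + (length w - 1)) (extend \<theta> w) = \<theta>0"
    and "aff_comp (aff_inv (J \<theta> p)) (J (extend \<theta> w) (p + (length w - 1))) \<in> Aff"
    and "norm (aff_comp (aff_inv (J \<theta> p)) (J (extend \<theta> w) (p + (length w - 1))) - Faff K c \<theta> w) < \<eta>"
proof -
  have JA: "J \<tau> q \<in> Aff" if "left_seq (adm K) \<tau>" "shift q \<tau> = \<theta>0" for \<tau> q
    using J that by (auto simp: jet_system_def)
  have "left_seq (adm K) (extend \<theta> w) \<and> shift (p + (length w - 1)) (extend \<theta> w) = \<theta>0 \<and>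
    norm (aff_comp (aff_inv (J \<theta> p)) (J (extend \<theta> w) (p + (length w - 1))) - Faff K c \<theta> w) < \<eta>"
  proof (cases "w = []")
    case True
    then have "extend \<theta> w = \<theta>" by (auto simp: extend_def)
    then show ?thesis using True ch \<eta> aff_inv_self[OF JA[OF ch]] by (simp add: Faff_def)
  next
    case False
    then have adm: "admissible_word K w" using w(1) Ws by (auto simp: renorm_words_def)
    have "left_seq (adm K) (extend \<theta> w)"
      using adm False w(2) ch(1) by (intro extend_left_seq) (auto simp: admissible_word_def)
    moreover have "shift (p + (length w - 1)) (extend \<theta> w) = shift p (shift (length w - 1) (extend \<theta> w))"
      by (simp add: shift_def add.assoc)
    moreover have "norm (aff_comp (aff_inv (J \<theta> p)) (J (extend \<theta> w) (p + (length w - 1))) - Faff K c \<theta> w) < \<eta>"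
      using J ch w False unfolding jet_system_def by auto
    ultimately show ?thesis using extend_shift[of w \<theta>] False w(2) ch(2) by simp
  qed
  then show 1: "left_seq (adm K) (extend \<theta> w)" "shift (p + (length w - 1)) (extend \<theta> w) = \<theta>0"
    and "norm (aff_comp (aff_inv (J \<theta> p)) (J (extend \<theta> w) (p + (length w - 1))) - Faff K c \<theta> w) < \<eta>" by auto
  show "aff_comp (aff_inv (J \<theta> p)) (J (extend \<theta> w) (p + (length w - 1))) \<in> Aff"
    by (intro Aff_comp Aff_inv JA ch 1)
qed

text \<open>
  By \<open>aff_telescope\<close> and robustness the configuration \<open>B = J\<^sup>-\<^sup>1 J'\<close> of the jets can be kept in \<open>U\<close> while the
  total length of the two words increases.  The points \<open>J (c)\<close> of \<open>S\<close> and \<open>J' (c')\<close> of \<open>S'\<close> differ by the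
  linear part of \<open>J\<close> applied to \<open>c - B (c')\<close>, and also by that of \<open>J'\<close> applied to \<open>B\<^sup>-\<^sup>1 (c) - c'\<close>.
  Both vectors are bounded on \<open>U\<close>, and the linear part belonging to the longer word is small.
\<close>

lemma jet_systems_meet:
  fixes K :: "('a::finite, 'd::finite) cantor" and K' :: "('b::finite, 'd) cantor"
  assumes J: "jet_system K c \<theta>0 A (Ws - {[]}) \<eta>1 S J" and J': "jet_system K' c' \<theta>0' A' (Ws' - {[]}) \<eta>1 S' J'"
    and \<eta>: "0 < \<eta>1" "\<eta>1 \<le> \<eta>" and Ws: "Ws \<subseteq> renorm_words K" "Ws' \<subseteq> renorm_words K'"
    and steps: "\<And>x. x \<in> U \<Longrightarrow> \<exists>w\<in>Ws. \<exists>w'\<in>Ws'. \<not> (w = [] \<and> w' = []) \<and> robust_step K c K' c' U \<eta> r w w' x"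
    and \<theta>0: "left_seq (adm K) \<theta>0" "left_seq (adm K') \<theta>0'"
    and start: "(aff_comp (aff_inv (J \<theta>0 0)) (J' \<theta>0' 0), \<theta>0, \<theta>0') \<in> U"
    and S: "compact S" "compact S'"
  shows "S \<inter> S' \<noteq> {}"
proof -
  have JA: "J \<tau> q \<in> Aff" "aff_app (J \<tau> q) (c (\<tau> 0)) \<in> S" if "left_seq (adm K) \<tau>" "shift q \<tau> = \<theta>0" for \<tau> q
    using J that by (auto simp: jet_system_def)
  have JA': "J' \<tau> q \<in> Aff" "aff_app (J' \<tau> q) (c' (\<tau> 0)) \<in> S'" if "left_seq (adm K') \<tau>" "shift q \<tau> = \<theta>0'" for \<tau> q
    using J' that by (auto simp: jet_system_def)
  have orbit: "\<exists>\<theta> p \<theta>' p'. left_seq (adm K) \<theta> \<and> shift p \<theta> = \<theta>0 \<and> left_seq (adm K') \<theta>' \<and> shift p' \<theta>' = \<theta>0' \<and>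
      (aff_comp (aff_inv (J \<theta> p)) (J' \<theta>' p'), \<theta>, \<theta>') \<in> U \<and> n \<le> p + p'" for n
  proof (induction n)
    case 0
    show ?case using \<theta>0 start by (intro exI[of _ \<theta>0] exI[of _ 0] exI[of _ \<theta>0']) auto
  next
    case (Suc n)
    then obtain \<theta> p \<theta>' p' where ch: "left_seq (adm K) \<theta>" "shift p \<theta> = \<theta>0" and ch': "left_seq (adm K') \<theta>'" "shift p' \<theta>' = \<theta>0'"
      and inU: "(aff_comp (aff_inv (J \<theta> p)) (J' \<theta>' p'), \<theta>, \<theta>') \<in> U" and n: "n \<le> p + p'" by blast
    obtain w w' where w: "w \<in> Ws" "w' \<in> Ws'" "\<not> (w = [] \<and> w' = [])"
      and rs: "robust_step K c K' c' U \<eta> r w w' (aff_comp (aff_inv (J \<theta> p)) (J' \<theta>' p'), \<theta>, \<theta>')"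
      using steps[OF inU] by blast
    let ?q = "p + (length w - 1)" and ?q' = "p' + (length w' - 1)"
    have hd: "w \<noteq> [] \<longrightarrow> hd w = \<theta> 0" "w' \<noteq> [] \<longrightarrow> hd w' = \<theta>' 0" using rs by (auto simp: robust_step_def)
    note s = jet_system_step[OF J Ws(1) \<eta>(1) ch w(1) hd(1)] and s' = jet_system_step[OF J' Ws(2) \<eta>(1) ch' w(2) hd(2)]
    let ?F1 = "aff_comp (aff_inv (J \<theta> p)) (J (extend \<theta> w) ?q)"
    let ?F1' = "aff_comp (aff_inv (J' \<theta>' p')) (J' (extend \<theta>' w') ?q')"
    have "(aff_comp (aff_inv ?F1) (aff_comp (aff_comp (aff_inv (J \<theta> p)) (J' \<theta>' p')) ?F1'), extend \<theta> w, extend \<theta>' w') \<in> U"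
      using rs s(3,4) s'(3,4) \<eta>(2) unfolding robust_step_def by auto
    then have "(aff_comp (aff_inv (J (extend \<theta> w) ?q)) (J' (extend \<theta>' w') ?q'), extend \<theta> w, extend \<theta>' w') \<in> U"
      by (simp only: aff_telescope[OF JA(1)[OF ch] JA(1)[OF s(1,2)] JA'(1)[OF ch'] JA'(1)[OF s'(1,2)]])
    moreover have "Suc n \<le> ?q + ?q'"
    proof -
      have "1 \<le> length w - 1 \<or> 1 \<le> length w' - 1" using w Ws by (auto simp: renorm_words_def)
      then show ?thesis using n by linarith
    qed
    ultimately show ?case using s(1,2) s'(1,2) by blast
  qed
  have "\<exists>C m. 0 < m \<and> m < 1 \<and> (\<forall>\<theta> p v. left_seq (adm K) \<theta> \<and> shift p \<theta> = \<theta>0 \<longrightarrow>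
      norm (fst (J \<theta> p) *v v) \<le> C * m ^ p * norm v)"
    using J unfolding jet_system_def by (elim conjE)
  then obtain C m where "0 < m" "m < 1" and "\<forall>\<theta> p v. left_seq (adm K) \<theta> \<and> shift p \<theta> = \<theta>0 \<longrightarrow>
      norm (fst (J \<theta> p) *v v) \<le> C * m ^ p * norm v" by (elim exE conjE)
  then have C: "0 < m" "m < 1" "\<And>\<theta> p v. left_seq (adm K) \<theta> \<Longrightarrow> shift p \<theta> = \<theta>0 \<Longrightarrow>
      norm (fst (J \<theta> p) *v v) \<le> C * m ^ p * norm v" by simp_all
  have "\<exists>C m. 0 < m \<and> m < 1 \<and> (\<forall>\<theta> p v. left_seq (adm K') \<theta> \<and> shift p \<theta> = \<theta>0' \<longrightarrow>
      norm (fst (J' \<theta> p) *v v) \<le> C * m ^ p * norm v)"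
    using J' unfolding jet_system_def by (elim conjE)
  then obtain C' m' where "0 < m'" "m' < 1" and "\<forall>\<theta> p v. left_seq (adm K') \<theta> \<and> shift p \<theta> = \<theta>0' \<longrightarrow>
      norm (fst (J' \<theta> p) *v v) \<le> C' * m' ^ p * norm v" by (elim exE conjE)
  then have C': "0 < m'" "m' < 1" "\<And>\<theta> p v. left_seq (adm K') \<theta> \<Longrightarrow> shift p \<theta> = \<theta>0' \<Longrightarrow>
      norm (fst (J' \<theta> p) *v v) \<le> C' * m' ^ p * norm v" by simp_all
  define b where "b = Max (range (\<lambda>a. norm (c a)) \<union> range (\<lambda>a. norm (c' a)))"
  have b: "norm (c a) \<le> b" "norm (c' a') \<le> b" for a a' unfolding b_def by (intro Max_ge; auto)+
  define m0 where "m0 = max m m'"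
  have m0: "0 < m0" "m0 < 1" using C C' by (auto simp: m0_def)
  have near: "\<exists>x\<in>S. \<exists>y\<in>S'. dist x y \<le> max \<bar>C\<bar> \<bar>C'\<bar> * (b + r) * m0 ^ n" for n
  proof -
    obtain \<theta> p \<theta>' p' where ch: "left_seq (adm K) \<theta>" "shift p \<theta> = \<theta>0" and ch': "left_seq (adm K') \<theta>'" "shift p' \<theta>' = \<theta>0'"
      and inU: "(aff_comp (aff_inv (J \<theta> p)) (J' \<theta>' p'), \<theta>, \<theta>') \<in> U" and n: "2 * n \<le> p + p'" using orbit[of "2 * n"] by blast
    let ?B = "aff_comp (aff_inv (J \<theta> p)) (J' \<theta>' p')"
    let ?x = "aff_app (J \<theta> p) (c (\<theta> 0))" and ?y = "aff_app (J' \<theta>' p') (c' (\<theta>' 0))"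
    have r: "norm (aff_app ?B (c' (\<theta>' 0))) \<le> r" "norm (aff_app (aff_inv ?B) (c (\<theta> 0))) \<le> r"
      using steps[OF inU] by (auto simp: robust_step_def)
    have y: "?y = aff_app (J \<theta> p) (aff_app ?B (c' (\<theta>' 0)))"
      by (simp add: aff_app_comp aff_app_inv_right JA(1)[OF ch])
    have x: "?x = aff_app (J' \<theta>' p') (aff_app (aff_inv ?B) (c (\<theta> 0)))"
      by (simp add: aff_app_inv_comp aff_inv_inv Aff_inv aff_app_inv_right JA(1)[OF ch] JA'(1)[OF ch'])
    have br: "0 \<le> b + r" using b(1)[of "\<theta> 0"] r(1) norm_ge_zero order_trans by (metis add_nonneg_nonneg)
    have fin: "dist ?x ?y \<le> max \<bar>C\<bar> \<bar>C'\<bar> * (b + r) * m0 ^ n"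
      if "dist ?x ?y \<le> G * \<nu> ^ q * (b + r)" "\<bar>G\<bar> \<le> max \<bar>C\<bar> \<bar>C'\<bar>" "0 < \<nu>" "\<nu> \<le> m0" "n \<le> q" for G \<nu> q
    proof -
      have "\<nu> ^ q \<le> m0 ^ q" using that by (intro power_mono) auto
      also have "\<dots> \<le> m0 ^ n" using m0 that by (intro power_decreasing) auto
      finally have p: "\<nu> ^ q \<le> m0 ^ n" .
      have "G * \<nu> ^ q \<le> max \<bar>C\<bar> \<bar>C'\<bar> * m0 ^ n"
        using that p m0 by (intro mult_mono) auto
      then have "G * \<nu> ^ q * (b + r) \<le> max \<bar>C\<bar> \<bar>C'\<bar> * m0 ^ n * (b + r)" using br by (rule mult_right_mono)
      then show ?thesis using that(1) by (simp add: mult_ac)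
    qed
    have "n \<le> p \<or> n \<le> p'" using n by linarith
    then have "dist ?x ?y \<le> max \<bar>C\<bar> \<bar>C'\<bar> * (b + r) * m0 ^ n"
    proof
      assume np: "n \<le> p"
      let ?v = "c (\<theta> 0) - aff_app ?B (c' (\<theta>' 0))"
      have "?x - ?y = fst (J \<theta> p) *v ?v"
        unfolding y by (simp add: aff_app_def matrix_vector_mult_diff_distrib)
      then have "dist ?x ?y \<le> C * m ^ p * norm ?v" using C(3)[OF ch, of ?v] by (simp add: dist_norm)
      also have "\<dots> \<le> \<bar>C\<bar> * m ^ p * (b + r)"
        using C(1) b(1)[of "\<theta> 0"] r(1) norm_triangle_ineq4[of "c (\<theta> 0)" "aff_app ?B (c' (\<theta>' 0))"]
        by (intro mult_mono) auto
      finally show ?thesis by (rule fin) (use np C(1) in \<open>auto simp: m0_def\<close>)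
    next
      assume np: "n \<le> p'"
      let ?v = "aff_app (aff_inv ?B) (c (\<theta> 0)) - c' (\<theta>' 0)"
      have "?x - ?y = fst (J' \<theta>' p') *v ?v"
        unfolding x by (simp add: aff_app_def matrix_vector_mult_diff_distrib)
      then have "dist ?x ?y \<le> C' * m' ^ p' * norm ?v" using C'(3)[OF ch', of ?v] by (simp add: dist_norm)
      also have "\<dots> \<le> \<bar>C'\<bar> * m' ^ p' * (b + r)"
        using C'(1) b(2)[of "\<theta>' 0"] r(2) norm_triangle_ineq4[of "aff_app (aff_inv ?B) (c (\<theta> 0))" "c' (\<theta>' 0)"]
        by (intro mult_mono) auto
      finally show ?thesis by (rule fin) (use np C'(1) in \<open>auto simp: m0_def\<close>)
    qed
    then show ?thesis using JA(2)[OF ch] JA'(2)[OF ch'] by blast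
  qed
  show ?thesis
  proof
    assume "S \<inter> S' = {}"
    then obtain d where d: "0 < d" "\<And>x y. x \<in> S \<Longrightarrow> y \<in> S' \<Longrightarrow> d \<le> dist x y"
      using separate_compact_closed[OF S(1) compact_imp_closed[OF S(2)]] by blast
    obtain n where "max \<bar>C\<bar> \<bar>C'\<bar> * (b + r) * m0 ^ n < d"
      using geometric_small[OF m0 d(1), of "max \<bar>C\<bar> \<bar>C'\<bar> * (b + r)"] by (auto simp: eventually_sequentially)
    then show False using near[of n] d(2) by fastforce
  qed
qed

lemma limit_geometries_of_cantor:
  assumes "0 < \<alpha>" "bunched_holomorphic_cantor \<alpha> K" "\<And>a. c a \<in> cantor_piece K a"
  shows "\<exists>\<Gamma> H M Q \<kappa>. limit_geometries \<alpha> K c \<Gamma> H M Q \<kappa>"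
proof -
  have "hcantor \<alpha> K" using assms by (intro hcantor.intro) (auto simp: cantor_piece_def)
  then interpret K: hcantor \<alpha> K .
  obtain \<Gamma> where \<Gamma>: "1 \<le> \<Gamma>" "\<And>a x. x \<in> Gstar K a \<Longrightarrow> norm (Der (expmap K) x) \<le> \<Gamma>"
    using K.Der_g_bound by blast
  obtain H where H0: "0 \<le> H" "\<And>a b x y. x \<in> Gstar K a \<Longrightarrow> y \<in> Gstar K b \<Longrightarrow>
      norm (Der (expmap K) x - Der (expmap K) y) \<le> H * dist x y powr \<alpha>"
    using K.Der_g_holder by metis
  have H: "0 \<le> H" "\<And>a x y. x \<in> Gstar K a \<Longrightarrow> y \<in> Gstar K a \<Longrightarrow>
      norm (Der (expmap K) x - Der (expmap K) y) \<le> H * dist x y powr \<alpha>"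
    by (rule H0(1)) (erule H0(2))
  show ?thesis using K.limit_geometries_exist[of c \<Gamma> H] assms(3) \<Gamma> H by blast
qed

lemma compact_image_cantor_piece:
  assumes "0 < \<alpha>" "hcantor \<alpha> L" "k \<in> PHol \<alpha> L a"
  shows "compact (k ` cantor_piece L a)"
proof -
  interpret L: hcantor \<alpha> L by (rule assms(2))
  obtain W where "C1a_diffeo \<alpha> k W" "piece L a \<subseteq> W" using assms(3) by (auto simp: PHol_def)
  then have "continuous_on (cantor_piece L a) k"
    using C1a_continuous_on[of \<alpha> k W] by (auto simp: C1a_diffeo_def cantor_piece_def intro: continuous_on_subset)
  then show ?thesis by (intro compact_continuous_image L.compact_cantor_piece)
qed

text \<open>
  The class of \<open>(h, h')\<close> contains \<open>(h, h')\<close> itself, which is therefore in the orbit of the pair of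
  limit geometries.
\<close>

lemma rel_config_affine:
  assumes h: "h \<in> PHol \<alpha> K a" "h' \<in> PHol \<alpha> K' a'"
    and eq: "rel_config \<alpha> K K' (a, h) (a', h') = Phi_q \<alpha> K c K' c' (B, \<theta>, \<theta>')"
  obtains A where "A \<in> Aff" "\<theta> 0 = a" "\<theta>' 0 = a'"
    "agree_on (piece K a) h (aff_app A \<circ> limit_geometry K c \<theta>)"
    "agree_on (piece K' a') h' (aff_app (aff_comp A B) \<circ> limit_geometry K' c' \<theta>')"
proof -
  have id: "aff_app (mat 1, 0) = (\<lambda>x. x)" by (auto simp: aff_app_def)
  have "((a, h), (a', h')) \<in> rel_config \<alpha> K K' (a, h) (a', h')"
    using h Aff_id by (auto simp: rel_config_def orbit_rel_def agree_on_def id o_def intro!: bexI[of _ "(mat 1, 0)"])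
  then have "((a, h), (a', h')) \<in> rel_config \<alpha> K K' (\<theta> 0, limit_geometry K c \<theta>) (\<theta>' 0, aff_app B \<circ> limit_geometry K' c' \<theta>')"
    using eq by (simp add: Phi_q_def)
  then show thesis
    using that by (auto simp: rel_config_def orbit_rel_def aff_app_comp o_assoc)
qed

lemma identity_C1a_diffeo: "C1a_diffeo \<alpha> (\<lambda>x. x) (UNIV :: 'v::euclidean_space set)"
proof -
  have "inv_into UNIV (\<lambda>x. x) = (\<lambda>x::'v. x)" by (rule inv_unique_comp) auto
  then show ?thesis by (auto simp: C1a_diffeo_def C1a_def intro!: exI[of _ 0])
qed

lemma identity_PHol: "(\<lambda>x. x) \<in> PHol \<alpha> K a"
  using identity_C1a_diffeo by (auto simp: PHol_def GLC_id intro!: exI[of _ UNIV])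

lemma identity_C1a_close: "0 < \<epsilon> \<Longrightarrow> C1a_close \<alpha> \<epsilon> (\<lambda>x. x) UNIV (\<lambda>x. x) (UNIV :: 'v::euclidean_space set)"
  unfolding C1a_close_def
  by (intro conjI exI[of _ "\<lambda>x. x"] identity_C1a_diffeo) (auto simp: C1a_near_def o_def)

theorem theorem4:
  fixes \<alpha> :: real
    and K :: "('a::finite, 'd::finite) cantor" and c :: "'a \<Rightarrow> complex ^ 'd"
    and K' :: "('b::finite, 'd) cantor" and c' :: "'b \<Rightarrow> complex ^ 'd"
    and U :: "('a, 'b, 'd) affconf set"
  assumes "0 < \<alpha>" and "\<alpha> < 1"
    and "bunched_holomorphic_cantor \<alpha> K" and "bunched_holomorphic_cantor \<alpha> K'"
    and "\<And>a. c a \<in> cantor_piece K a" and "\<And>a'. c' a' \<in> cantor_piece K' a'"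
    and "openin (QAff_top K K') U"
    and "compactin (QAff_top K K') (QAff_top K K' closure_of U)"
    and "QAff_top K K' closure_of U \<subseteq> (\<Union>\<Psi>\<in>renorm_ops K c K' c'. partial_preimage \<Psi> U)"
  shows "(\<forall>a a'. \<forall>h\<in>PHol \<alpha> K a. \<forall>h'\<in>PHol \<alpha> K' a'.
            rel_config \<alpha> K K' (a, h) (a', h') \<in> Phi_q \<alpha> K c K' c' ` U \<longrightarrow>
            stably_intersecting \<alpha> K K' (a, h) (a', h')) \<and>
         ((\<exists>a a'. rel_config \<alpha> K K' (a, \<lambda>x. x) (a', \<lambda>x. x) \<in> Phi_q \<alpha> K c K' c' ` U) \<longrightarrow>
            stable_intersection \<alpha> K K')"
proof -
  have hK: "hcantor \<alpha> K" "hcantor \<alpha> K'"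
    using assms(1-6) by (auto intro!: hcantor.intro simp: cantor_piece_def)
  obtain \<Gamma> H M Q \<kappa> where lg: "limit_geometries \<alpha> K c \<Gamma> H M Q \<kappa>"
    using limit_geometries_of_cantor[OF assms(1,3,5)] by blast
  obtain \<Gamma>' H' M' Q' \<kappa>' where lg': "limit_geometries \<alpha> K' c' \<Gamma>' H' M' Q' \<kappa>'"
    using limit_geometries_of_cantor[OF assms(1,4,6)] by blast
  obtain Ws Ws' \<eta> r where Ws: "finite Ws" "Ws \<subseteq> renorm_words K" "finite Ws'" "Ws' \<subseteq> renorm_words K'" and \<eta>: "0 < \<eta>"
    and steps: "\<And>x. x \<in> U \<Longrightarrow> \<exists>w\<in>Ws. \<exists>w'\<in>Ws'. \<not> (w = [] \<and> w' = []) \<and> robust_step K c K' c' U \<eta> r w w' x"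
    using uniform_robust_steps[OF lg lg' assms(7,8,9)] by metis
  have words: "w \<noteq> [] \<and> admissible_word K w" if "w \<in> Ws - {[]}" for w
    using that Ws(2) by (auto simp: renorm_words_def)
  have words': "w \<noteq> [] \<and> admissible_word K' w" if "w \<in> Ws' - {[]}" for w
    using that Ws(4) by (auto simp: renorm_words_def)
  have part1: "stably_intersecting \<alpha> K K' (a, h) (a', h')"
    if h: "h \<in> PHol \<alpha> K a" "h' \<in> PHol \<alpha> K' a'"
      and rc: "rel_config \<alpha> K K' (a, h) (a', h') \<in> Phi_q \<alpha> K c K' c' ` U" for a a' h h'
  proof -
    obtain B \<theta> \<theta>' where x: "(B, \<theta>, \<theta>') \<in> U" "rel_config \<alpha> K K' (a, h) (a', h') = Phi_q \<alpha> K c K' c' (B, \<theta>, \<theta>')"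
      using rc by auto
    have top: "B \<in> Aff" "left_seq (adm K) \<theta>" "left_seq (adm K') \<theta>'"
      using x(1) openin_subset[OF assms(7)] by (auto simp: topspace_QAff)
    obtain A where A: "A \<in> Aff" "\<theta> 0 = a" "\<theta>' 0 = a'"
      "agree_on (piece K a) h (aff_app A \<circ> limit_geometry K c \<theta>)"
      "agree_on (piece K' a') h' (aff_app (aff_comp A B) \<circ> limit_geometry K' c' \<theta>')"
      by (rule rel_config_affine[OF h x(2)])
    have AB: "aff_comp A B \<in> Aff" by (rule Aff_comp[OF A(1) top(1)])
    obtain \<rho> m where conf_box: "0 < \<rho>" "conf_box K K' \<rho> m (B, \<theta>, \<theta>') \<subseteq> U"
      by (rule open_contains_conf_box[OF assms(7) x(1)])
    have one: "aff_comp (mat 1, 0) X = X" for X :: "'d aff" by (simp add: aff_comp_def)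
    have B_eq: "aff_comp (aff_inv A) (aff_comp A B) = B"
      by (rule aff_eqI) (simp add: aff_app_comp aff_app_inv_left A(1))
    \<comment> \<open>The initial jets are close to \<open>A\<close> and \<open>A B\<close>, so their configuration is close to \<open>B\<close>.\<close>
    obtain \<delta> where \<delta>: "0 < \<delta>" "\<And>J1 J1'. J1 \<in> Aff \<Longrightarrow> J1' \<in> Aff \<Longrightarrow> norm (J1 - A) < \<delta> \<Longrightarrow>
        norm (J1' - aff_comp A B) < \<delta> \<Longrightarrow> norm (aff_comp (aff_inv J1) J1' - B) < \<rho>"
    proof -
      obtain \<delta> where "0 < \<delta>" "\<forall>F1\<in>Aff. \<forall>B1\<in>Aff. \<forall>F1'\<in>Aff. norm (F1 - A) < \<delta> \<and> norm (B1 - (mat 1, 0)) < \<delta> \<and>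
          norm (F1' - aff_comp A B) < \<delta> \<longrightarrow>
          norm (aff_comp (aff_inv F1) (aff_comp B1 F1') - aff_comp (aff_inv A) (aff_comp (mat 1, 0) (aff_comp A B))) < \<rho>"
        using conjugate_continuous[OF A(1) AB conf_box(1), of "(mat 1, 0)"] by blast
      then show thesis
        using Aff_id by (intro that[of \<delta>]) (fastforce simp: one B_eq)+
    qed
    \<comment> \<open>One tolerance for the start in \<open>U\<close> and for all later steps.\<close>
    define \<eta>1 where "\<eta>1 = min \<eta> \<delta>"
    have \<eta>1: "0 < \<eta>1" "\<eta>1 \<le> \<eta>" "\<eta>1 \<le> \<delta>" using \<eta> \<delta>(1) by (auto simp: \<eta>1_def)
    show ?thesis
      unfolding stably_intersecting_def prod.case
    proof (intro allI impI, elim conjE)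
      fix W W' assume W: "piece K a \<subseteq> W" "C1a_diffeo \<alpha> h W" "piece K' a' \<subseteq> W'" "C1a_diffeo \<alpha> h' W'"
      have fin: "finite (Ws - {[]})" "finite (Ws' - {[]})" using Ws(1,3) by simp_all
      have "\<exists>\<epsilon>>0. \<forall>L k Z. bunched_holomorphic_cantor \<alpha> L \<and> cantor_close \<alpha> \<epsilon> K L \<and> k \<in> PHol \<alpha> L a \<and>
          C1a_close \<alpha> \<epsilon> h W k Z \<longrightarrow> (\<exists>J. jet_system K c \<theta> A (Ws - {[]}) \<eta>1 (k ` cantor_piece L a) J)"
        by (rule jet_system_exists[OF assms(1,3,5) top(2) A(2,1) W(2,1) A(4) fin(1) words \<eta>1(1)])
      then obtain \<epsilon>1 where e1: "0 < \<epsilon>1" "\<And>L k Z. bunched_holomorphic_cantor \<alpha> L \<Longrightarrow> cantor_close \<alpha> \<epsilon>1 K L \<Longrightarrow> k \<in> PHol \<alpha> L a \<Longrightarrow>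
          C1a_close \<alpha> \<epsilon>1 h W k Z \<Longrightarrow> \<exists>J. jet_system K c \<theta> A (Ws - {[]}) \<eta>1 (k ` cantor_piece L a) J"
        by meson
      have "\<exists>\<epsilon>>0. \<forall>L k Z. bunched_holomorphic_cantor \<alpha> L \<and> cantor_close \<alpha> \<epsilon> K' L \<and> k \<in> PHol \<alpha> L a' \<and>
          C1a_close \<alpha> \<epsilon> h' W' k Z \<longrightarrow> (\<exists>J. jet_system K' c' \<theta>' (aff_comp A B) (Ws' - {[]}) \<eta>1 (k ` cantor_piece L a') J)"
        by (rule jet_system_exists[OF assms(1,4,6) top(3) A(3) AB W(4,3) A(5) fin(2) words' \<eta>1(1)])
      then obtain \<epsilon>2 where e2: "0 < \<epsilon>2" "\<And>L k Z. bunched_holomorphic_cantor \<alpha> L \<Longrightarrow> cantor_close \<alpha> \<epsilon>2 K' L \<Longrightarrow> k \<in> PHol \<alpha> L a' \<Longrightarrow>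
          C1a_close \<alpha> \<epsilon>2 h' W' k Z \<Longrightarrow> \<exists>J. jet_system K' c' \<theta>' (aff_comp A B) (Ws' - {[]}) \<eta>1 (k ` cantor_piece L a') J"
        by meson
      have close_mono: "C1a_close \<alpha> e' p X q Y" if "C1a_close \<alpha> e p X q Y" "e \<le> e'"
        for e e' X Y and p q :: "complex ^ 'd \<Rightarrow> complex ^ 'd"
      proof -
        have "C1a_near \<alpha> e' N u v" if "C1a_near \<alpha> e N u v" for N and u v :: "complex ^ 'd \<Rightarrow> complex ^ 'd"
          using that \<open>e \<le> e'\<close> unfolding C1a_near_def by (meson mult_right_mono order_trans powr_ge_zero)
        then show ?thesis using that(1) unfolding C1a_close_def by blast
      qed
      show "\<exists>\<epsilon>>0. \<forall>L L' k k' Z Z'.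
        bunched_holomorphic_cantor \<alpha> L \<and> bunched_holomorphic_cantor \<alpha> L' \<and>
        cantor_close \<alpha> \<epsilon> K L \<and> cantor_close \<alpha> \<epsilon> K' L' \<and>
        k \<in> PHol \<alpha> L a \<and> k' \<in> PHol \<alpha> L' a' \<and>
        C1a_close \<alpha> \<epsilon> h W k Z \<and> C1a_close \<alpha> \<epsilon> h' W' k' Z' \<longrightarrow>
        k ` cantor_piece L a \<inter> k' ` cantor_piece L' a' \<noteq> {}"
      proof (intro exI[of _ "min \<epsilon>1 \<epsilon>2"] conjI allI impI, goal_cases)
        case 1
        then show ?case using e1(1) e2(1) by simp
      next
        case (2 L L' k k' Z Z')
        then have b: "bunched_holomorphic_cantor \<alpha> L" "bunched_holomorphic_cantor \<alpha> L'"
          and cc: "cantor_close \<alpha> (min \<epsilon>1 \<epsilon>2) K L" "cantor_close \<alpha> (min \<epsilon>1 \<epsilon>2) K' L'"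
          and k: "k \<in> PHol \<alpha> L a" "k' \<in> PHol \<alpha> L' a'"
          and ck: "C1a_close \<alpha> (min \<epsilon>1 \<epsilon>2) h W k Z" "C1a_close \<alpha> (min \<epsilon>1 \<epsilon>2) h' W' k' Z'" by auto
        have c1: "cantor_close \<alpha> \<epsilon>1 K L" and c2: "cantor_close \<alpha> \<epsilon>2 K' L'"
          using cc close_mono min.cobounded1 min.cobounded2 unfolding cantor_close_def by blast+
        obtain J where J: "jet_system K c \<theta> A (Ws - {[]}) \<eta>1 (k ` cantor_piece L a) J"
          using e1(2)[OF b(1) c1 k(1) close_mono[OF ck(1)]] by auto
        obtain J' where J': "jet_system K' c' \<theta>' (aff_comp A B) (Ws' - {[]}) \<eta>1 (k' ` cantor_piece L' a') J'"
          using e2(2)[OF b(2) c2 k(2) close_mono[OF ck(2)]] by auto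
        have s: "J \<theta> 0 \<in> Aff" "norm (J \<theta> 0 - A) < \<delta>" using J top(2) \<eta>1(3) by (auto simp: jet_system_def)
        have s': "J' \<theta>' 0 \<in> Aff" "norm (J' \<theta>' 0 - aff_comp A B) < \<delta>" using J' top(3) \<eta>1(3) by (auto simp: jet_system_def)
        have "(aff_comp (aff_inv (J \<theta> 0)) (J' \<theta>' 0), \<theta>, \<theta>') \<in> conf_box K K' \<rho> m (B, \<theta>, \<theta>')"
          using \<delta>(2)[OF s(1) s'(1) s(2) s'(2)] s(1) s'(1) top by (simp add: conf_box_def cyl_def Aff_comp Aff_inv)
        then have start: "(aff_comp (aff_inv (J \<theta> 0)) (J' \<theta>' 0), \<theta>, \<theta>') \<in> U" using conf_box(2) by blast
        show ?case
          by (rule jet_systems_meet[OF J J' \<eta>1(1,2) Ws(2,4) steps top(2,3) start])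
            (use compact_image_cantor_piece[OF assms(1)] hcantor_close[OF hK(1) b(1) cc(1)]
              hcantor_close[OF hK(2) b(2) cc(2)] k in auto)
      qed
    qed
  qed
  have part2: "stable_intersection \<alpha> K K'"
    if rc: "rel_config \<alpha> K K' (a, \<lambda>x. x) (a', \<lambda>x. x) \<in> Phi_q \<alpha> K c K' c' ` U" for a a'
  proof -
    have "stably_intersecting \<alpha> K K' (a, \<lambda>x. x) (a', \<lambda>x. x)"
      by (rule part1[OF identity_PHol identity_PHol rc])
    then obtain \<epsilon> where \<epsilon>: "0 < \<epsilon>" "\<And>L L' k k' Z Z'.
        bunched_holomorphic_cantor \<alpha> L \<and> bunched_holomorphic_cantor \<alpha> L' \<and>
        cantor_close \<alpha> \<epsilon> K L \<and> cantor_close \<alpha> \<epsilon> K' L' \<and>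
        k \<in> PHol \<alpha> L a \<and> k' \<in> PHol \<alpha> L' a' \<and>
        C1a_close \<alpha> \<epsilon> (\<lambda>x. x) UNIV k Z \<and> C1a_close \<alpha> \<epsilon> (\<lambda>x. x) UNIV k' Z' \<Longrightarrow>
        k ` cantor_piece L a \<inter> k' ` cantor_piece L' a' \<noteq> {}"
      unfolding stably_intersecting_def prod.case using identity_C1a_diffeo subset_UNIV by metis
    show ?thesis
      unfolding stable_intersection_def
    proof (intro exI[of _ \<epsilon>] conjI \<epsilon>(1) allI impI)
      fix L L' assume *: "bunched_holomorphic_cantor \<alpha> L \<and> bunched_holomorphic_cantor \<alpha> L' \<and>
        cantor_close \<alpha> \<epsilon> K L \<and> cantor_close \<alpha> \<epsilon> K' L'"
      have "(\<lambda>x. x) ` cantor_piece L a \<inter> (\<lambda>x. x) ` cantor_piece L' a' \<noteq> {}"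
        by (rule \<epsilon>(2)[of L L' _ _ UNIV UNIV]) (intro conjI identity_PHol identity_C1a_close \<epsilon>(1); use * in blast)
      then show "cantor_set L \<inter> cantor_set L' \<noteq> {}" by (auto simp: cantor_piece_def)
    qed
  qed
  show ?thesis using part1 part2 by blast
qed

end
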